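(* Let $\Gamma$ be a framed graph. The map $\mathrm{DownBricks}$, sending a maximal clique $\Delta$ to the set of bricks labeling the covering relations $\Delta''\lessdot\Delta$ in the framing lattice $\mathcal L_\Gamma$, is a bijection from the set of maximal cliques of routes of $\Gamma$ to the set of brick cliques of $\Gamma$. The map $\mathrm{UpBricks}$, sending $\Delta$ to the set of bricks labeling the covering relations $\Delta\lessdot\Delta''$, is also a bijection from maximal cliques of routes to brick cliques.
   Context: A flow graph $G$ is a finite directed acyclic graph with vertex set $[n]$ and a finite multiset of edges, each directed from a smaller to a larger vertex. Sources (resp. sinks) have no incoming (resp. outgoing) edge; other vertices are internal. A route is a directed path from a source to a sink. A framing assigns to every internal vertex $v$ total orders $<_{\mathrm{in}(v)}$ on incoming edges and $<_{\mathrm{out}(v)}$ on outgoing edges of $v$; $\Gamma=(G,F)$ is a framed graph. Routes are compared at a shared internal vertex $v$ by the outgoing preorder $\le^+_v$ (lexicographic comparison of the suffixes from $v$, using the orders $<_{\mathrm{out}}$) and the incoming preorder $\le^-_v$ (lexicographic comparison of the prefixes ending at $v$, read backwards, using the orders $<_{\mathrm{in}}$). $p$ is clockwise to $q$ at $v$ if $p<^-_v q$ and $p>^+_v q$; routes are coherent if neither is clockwise to the other at any shared internal vertex; if incoherent at $v$, their maximal common subpath containing $v$ is a subroute of conflict. A maximal clique is an inclusion-maximal set of pairwise coherent routes. Adjacent maximal cliques share all but one route; for adjacent $\Delta,\Delta'$ with $r\in\Delta\setminus\Delta'$, $r'\in\Delta'\setminus\Delta$ it is known that $r,r'$ have a unique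 subroute of conflict $s$. The framing lattice $\mathcal L_\Gamma$ is the lattice on maximal cliques with cover relations $\Delta\lessdot\Delta'$ for adjacent $\Delta,\Delta'$ with $r$ clockwise to $r'$ at $s$. Corners: a left corner is $c=(c^\bullet,c^\downarrow,c^\uparrow)$ with $c^\bullet$ internal and $c^\downarrow<_{\mathrm{in}(c^\bullet)}c^\uparrow$ consecutive incoming edges of $c^\bullet$; a right corner is the same with consecutive outgoing edges. A generalized path is $\bar s=L(\bar s)\,s\,R(\bar s)$ where $s$ is a directed path (possibly of length $0$) from $v$ to $v'$, $L(\bar s)$ is either $v$ or a left corner with $L(\bar s)^\bullet=v$, and $R(\bar s)$ is either $v'$ or a right corner with $R(\bar s)^\bullet=v'$; it passes through the vertices of $s$. A brick is a generalized path whose $L$ and $R$ are both corners. At each internal vertex $v$, extend $<_{\mathrm{in}(v)}$ to incoming edges and left corners at $v$ by $c^\downarrow<c<c^\uparrow$, and $<_{\mathrm{out}(v)}$ similarly with right corners; this extends $\le^\pm_v$ and "clockwise" to generalized paths through $v$. Two generalized paths are weakly coherent if neither is clockwise to the other at any vertex both pass through, and coherent if moreover they share neither a left corner nor a right corner. A brick clique is a (possibly empty) set of pairwise coherent bricks. Labels: for a covering relation $\Delta\lessdot\Delta'$ with $r\in\Delta\setminus\Delta'$, $r'\in\Delta'\setminus\Delta$, subroute of conflict $s$, $r=r_1sr_2$, $r'=r'_1sr'_2$, the last edges of $r_1,r'_1$ form a left corner $c_1$ and the first edges of $r_2,r'_2$ form a right corner $c_2$; the covering relation is labeled by the brick $c_1\,s\,c_2$.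 *)

theory Defs
  imports "Graph_Theory.Arc_Walk"
begin

section \<open>Framed graphs\<close>

text \<open>Parallel edges are distinct arcs with the same tail and head.\<close>

definition flow_graph :: "nat \<Rightarrow> (nat, 'e) pre_digraph \<Rightarrow> bool" where
  "flow_graph n G \<longleftrightarrow>
     fin_digraph G \<and> verts G = {1..n} \<and> (\<forall>e\<in>arcs G. tail G e < head G e)"

record 'e framed_graph =
  graph :: "(nat, 'e) pre_digraph"
  in_order :: "nat \<Rightarrow> ('e \<times> 'e) set"
  out_order :: "nat \<Rightarrow> ('e \<times> 'e) set"

definition is_source :: "(nat, 'e) pre_digraph \<Rightarrow> nat \<Rightarrow> bool" where
  "is_source G v \<longleftrightarrow> v \<in> verts G \<and> in_arcs G v = {}"

definition is_sink :: "(nat, 'e) pre_digraph \<Rightarrow> nat \<Rightarrow> bool" where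
  "is_sink G v \<longleftrightarrow> v \<in> verts G \<and> out_arcs G v = {}"

definition internal :: "(nat, 'e) pre_digraph \<Rightarrow> nat set" where
  "internal G = {v \<in> verts G. \<not> is_source G v \<and> \<not> is_sink G v}"

text \<open>
  The orders are strict. Their values at vertices that are not internal are never used.
\<close>

definition framed_graph :: "nat \<Rightarrow> 'e framed_graph \<Rightarrow> bool" where
  "framed_graph n \<Gamma> \<longleftrightarrow>
     flow_graph n (graph \<Gamma>) \<and>
     (\<forall>v\<in>internal (graph \<Gamma>).
        in_order \<Gamma> v \<subseteq> in_arcs (graph \<Gamma>) v \<times> in_arcs (graph \<Gamma>) v \<and>
        strict_linear_order_on (in_arcs (graph \<Gamma>) v) (in_order \<Gamma> v) \<and>
        out_order \<Gamma> v \<subseteq> out_arcs (graph \<Gamma>) v \<times> out_arcs (graph \<Gamma>) v \<and>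
        strict_linear_order_on (out_arcs (graph \<Gamma>) v) (out_order \<Gamma> v))"


section \<open>Directed paths and routes\<close>

text \<open>
  The initial vertex is recorded so that paths of length 0 at different vertices differ.
  Since flow graphs are acyclic, every walk is a path.
\<close>

datatype 'e dpath = DPath (start: nat) (path_arcs: "'e list")

definition pverts :: "(nat, 'e) pre_digraph \<Rightarrow> 'e dpath \<Rightarrow> nat set" where
  "pverts G p = set (pre_digraph.awalk_verts G (start p) (path_arcs p))"

definition end_vertex :: "(nat, 'e) pre_digraph \<Rightarrow> 'e dpath \<Rightarrow> nat" where
  "end_vertex G p = pre_digraph.awlast G (start p) (path_arcs p)"

definition is_dpath :: "(nat, 'e) pre_digraph \<Rightarrow> 'e dpath \<Rightarrow> bool" where
  "is_dpath G p \<longleftrightarrow> pre_digraph.awalk G (start p) (path_arcs p) (end_vertex G p)"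

definition route :: "(nat, 'e) pre_digraph \<Rightarrow> 'e dpath \<Rightarrow> bool" where
  "route G p \<longleftrightarrow> is_dpath G p \<and> is_source G (start p) \<and> is_sink G (end_vertex G p)"

text \<open>
  The parts of a path before and after one of its vertices \<open>v\<close>. If \<open>v\<close> is the
  end of the path, no arc leaves it, so the prefix is the whole path and the suffix is empty.
\<close>

definition prefix_to :: "(nat, 'e) pre_digraph \<Rightarrow> nat \<Rightarrow> 'e dpath \<Rightarrow> 'e list" where
  "prefix_to G v p = takeWhile (\<lambda>e. tail G e \<noteq> v) (path_arcs p)"

definition suffix_from :: "(nat, 'e) pre_digraph \<Rightarrow> nat \<Rightarrow> 'e dpath \<Rightarrow> 'e list" where
  "suffix_from G v p = dropWhile (\<lambda>e. tail G e \<noteq> v) (path_arcs p)"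

text \<open>
  Strict lexicographic comparison, decided at the first difference. Unlike in
  \<^const>\<open>lexord\<close>, a proper prefix is not smaller than its extensions.
\<close>

definition lex_less :: "('a \<times> 'a) set \<Rightarrow> 'a list \<Rightarrow> 'a list \<Rightarrow> bool" where
  "lex_less R xs ys \<longleftrightarrow>
     (\<exists>us x y xs' ys'. xs = us @ x # xs' \<and> ys = us @ y # ys' \<and> (x, y) \<in> R)"

text \<open>
  The strict parts of the incoming and outgoing preorders at \<open>v\<close>. Two paths
  through an internal vertex \<open>v\<close> first differ at arcs sharing an internal vertex, so that
  taking the union of the orders just selects the order at the vertex of divergence.
\<close>

definition route_in_less :: "'e framed_graph \<Rightarrow> nat \<Rightarrow> 'e dpath \<Rightarrow> 'e dpath \<Rightarrow> bool" where
  "route_in_less \<Gamma> v p q \<longleftrightarrow>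
     lex_less (\<Union>w\<in>internal (graph \<Gamma>). in_order \<Gamma> w)
       (rev (prefix_to (graph \<Gamma>) v p)) (rev (prefix_to (graph \<Gamma>) v q))"

definition route_out_less :: "'e framed_graph \<Rightarrow> nat \<Rightarrow> 'e dpath \<Rightarrow> 'e dpath \<Rightarrow> bool" where
  "route_out_less \<Gamma> v p q \<longleftrightarrow>
     lex_less (\<Union>w\<in>internal (graph \<Gamma>). out_order \<Gamma> w)
       (suffix_from (graph \<Gamma>) v p) (suffix_from (graph \<Gamma>) v q)"

definition route_clockwise :: "'e framed_graph \<Rightarrow> nat \<Rightarrow> 'e dpath \<Rightarrow> 'e dpath \<Rightarrow> bool" where
  "route_clockwise \<Gamma> v p q \<longleftrightarrow> route_in_less \<Gamma> v p q \<and> route_out_less \<Gamma> v q p"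

definition incoherent_at :: "'e framed_graph \<Rightarrow> nat \<Rightarrow> 'e dpath \<Rightarrow> 'e dpath \<Rightarrow> bool" where
  "incoherent_at \<Gamma> v p q \<longleftrightarrow>
     v \<in> internal (graph \<Gamma>) \<and> v \<in> pverts (graph \<Gamma>) p \<and> v \<in> pverts (graph \<Gamma>) q \<and>
     (route_clockwise \<Gamma> v p q \<or> route_clockwise \<Gamma> v q p)"

definition routes_coherent :: "'e framed_graph \<Rightarrow> 'e dpath \<Rightarrow> 'e dpath \<Rightarrow> bool" where
  "routes_coherent \<Gamma> p q \<longleftrightarrow> (\<nexists>v. incoherent_at \<Gamma> v p q)"

definition clique :: "'e framed_graph \<Rightarrow> 'e dpath set \<Rightarrow> bool" where
  "clique \<Gamma> \<Delta> \<longleftrightarrow>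
     (\<forall>p\<in>\<Delta>. route (graph \<Gamma>) p) \<and> pairwise (routes_coherent \<Gamma>) \<Delta>"

definition max_cliques :: "'e framed_graph \<Rightarrow> 'e dpath set set" where
  "max_cliques \<Gamma> = {\<Delta>. clique \<Gamma> \<Delta> \<and> (\<forall>\<Delta>'. clique \<Gamma> \<Delta>' \<and> \<Delta> \<subseteq> \<Delta>' \<longrightarrow> \<Delta>' = \<Delta>)}"


section \<open>Generalized paths and bricks\<close>

datatype 'e corner = Corner (cvert: nat) (cdown: 'e) (cup: 'e)

definition consecutive :: "('a \<times> 'a) set \<Rightarrow> 'a \<Rightarrow> 'a \<Rightarrow> bool" where
  "consecutive R x y \<longleftrightarrow> (x, y) \<in> R \<and> (\<nexists>z. (x, z) \<in> R \<and> (z, y) \<in> R)"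

definition left_corner :: "'e framed_graph \<Rightarrow> 'e corner \<Rightarrow> bool" where
  "left_corner \<Gamma> c \<longleftrightarrow>
     cvert c \<in> internal (graph \<Gamma>) \<and> consecutive (in_order \<Gamma> (cvert c)) (cdown c) (cup c)"

definition right_corner :: "'e framed_graph \<Rightarrow> 'e corner \<Rightarrow> bool" where
  "right_corner \<Gamma> c \<longleftrightarrow>
     cvert c \<in> internal (graph \<Gamma>) \<and> consecutive (out_order \<Gamma> (cvert c)) (cdown c) (cup c)"

text \<open>\<^const>\<open>None\<close> at an end means that the generalized path has no corner there.\<close>

datatype 'e gpath =
  GPath (lend: "'e corner option") (spine: "'e dpath") (rend: "'e corner option")

definition generalized_path :: "'e framed_graph \<Rightarrow> 'e gpath \<Rightarrow> bool" where
  "generalized_path \<Gamma> s \<longleftrightarrow>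
     is_dpath (graph \<Gamma>) (spine s) \<and>
     (\<forall>c. lend s = Some c \<longrightarrow> left_corner \<Gamma> c \<and> cvert c = start (spine s)) \<and>
     (\<forall>c. rend s = Some c \<longrightarrow> right_corner \<Gamma> c \<and> cvert c = end_vertex (graph \<Gamma>) (spine s))"

definition brick :: "'e framed_graph \<Rightarrow> 'e gpath \<Rightarrow> bool" where
  "brick \<Gamma> b \<longleftrightarrow> generalized_path \<Gamma> b \<and> lend b \<noteq> None \<and> rend b \<noteq> None"

datatype 'e step = EdgeStep 'e | CornerStep "'e corner"

definition ext_in_order :: "'e framed_graph \<Rightarrow> nat \<Rightarrow> ('e step \<times> 'e step) set" where
  "ext_in_order \<Gamma> v =
     ({(EdgeStep e, EdgeStep f) | e f. (e, f) \<in> in_order \<Gamma> v} \<union>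
      {(EdgeStep (cdown c), CornerStep c) | c. left_corner \<Gamma> c \<and> cvert c = v} \<union>
      {(CornerStep c, EdgeStep (cup c)) | c. left_corner \<Gamma> c \<and> cvert c = v})\<^sup>+"

definition ext_out_order :: "'e framed_graph \<Rightarrow> nat \<Rightarrow> ('e step \<times> 'e step) set" where
  "ext_out_order \<Gamma> v =
     ({(EdgeStep e, EdgeStep f) | e f. (e, f) \<in> out_order \<Gamma> v} \<union>
      {(EdgeStep (cdown c), CornerStep c) | c. right_corner \<Gamma> c \<and> cvert c = v} \<union>
      {(CornerStep c, EdgeStep (cup c)) | c. right_corner \<Gamma> c \<and> cvert c = v})\<^sup>+"

definition corner_steps :: "'e corner option \<Rightarrow> 'e step list" where
  "corner_steps x = (case x of None \<Rightarrow> [] | Some c \<Rightarrow> [CornerStep c])"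

definition in_steps :: "(nat, 'e) pre_digraph \<Rightarrow> nat \<Rightarrow> 'e gpath \<Rightarrow> 'e step list" where
  "in_steps G v s = rev (corner_steps (lend s) @ map EdgeStep (prefix_to G v (spine s)))"

definition out_steps :: "(nat, 'e) pre_digraph \<Rightarrow> nat \<Rightarrow> 'e gpath \<Rightarrow> 'e step list" where
  "out_steps G v s = map EdgeStep (suffix_from G v (spine s)) @ corner_steps (rend s)"

definition gp_in_less :: "'e framed_graph \<Rightarrow> nat \<Rightarrow> 'e gpath \<Rightarrow> 'e gpath \<Rightarrow> bool" where
  "gp_in_less \<Gamma> v s t \<longleftrightarrow>
     lex_less (\<Union>w\<in>internal (graph \<Gamma>). ext_in_order \<Gamma> w)
       (in_steps (graph \<Gamma>) v s) (in_steps (graph \<Gamma>) v t)"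

definition gp_out_less :: "'e framed_graph \<Rightarrow> nat \<Rightarrow> 'e gpath \<Rightarrow> 'e gpath \<Rightarrow> bool" where
  "gp_out_less \<Gamma> v s t \<longleftrightarrow>
     lex_less (\<Union>w\<in>internal (graph \<Gamma>). ext_out_order \<Gamma> w)
       (out_steps (graph \<Gamma>) v s) (out_steps (graph \<Gamma>) v t)"

definition gp_clockwise :: "'e framed_graph \<Rightarrow> nat \<Rightarrow> 'e gpath \<Rightarrow> 'e gpath \<Rightarrow> bool" where
  "gp_clockwise \<Gamma> v s t \<longleftrightarrow> gp_in_less \<Gamma> v s t \<and> gp_out_less \<Gamma> v t s"

definition weakly_coherent :: "'e framed_graph \<Rightarrow> 'e gpath \<Rightarrow> 'e gpath \<Rightarrow> bool" where
  "weakly_coherent \<Gamma> s t \<longleftrightarrow>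
     (\<forall>v \<in> pverts (graph \<Gamma>) (spine s) \<inter> pverts (graph \<Gamma>) (spine t).
        \<not> gp_clockwise \<Gamma> v s t \<and> \<not> gp_clockwise \<Gamma> v t s)"

definition gp_coherent :: "'e framed_graph \<Rightarrow> 'e gpath \<Rightarrow> 'e gpath \<Rightarrow> bool" where
  "gp_coherent \<Gamma> s t \<longleftrightarrow>
     weakly_coherent \<Gamma> s t \<and>
     (\<nexists>c. lend s = Some c \<and> lend t = Some c) \<and>
     (\<nexists>c. rend s = Some c \<and> rend t = Some c)"

definition brick_cliques :: "'e framed_graph \<Rightarrow> 'e gpath set set" where
  "brick_cliques \<Gamma> = {B. (\<forall>b\<in>B. brick \<Gamma> b) \<and> pairwise (gp_coherent \<Gamma>) B}"


section \<open>Cover relations of the framing lattice and their labels\<close>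

definition decomposes ::
  "(nat, 'e) pre_digraph \<Rightarrow> 'e dpath \<Rightarrow> 'e list \<Rightarrow> 'e dpath \<Rightarrow> 'e list \<Rightarrow> bool" where
  "decomposes G p p1 s p2 \<longleftrightarrow>
     path_arcs p = p1 @ path_arcs s @ p2 \<and> pre_digraph.awalk G (start p) p1 (start s)"

definition subpath :: "(nat, 'e) pre_digraph \<Rightarrow> 'e dpath \<Rightarrow> 'e dpath \<Rightarrow> bool" where
  "subpath G s p \<longleftrightarrow> (\<exists>p1 p2. decomposes G p p1 s p2)"

definition max_common_subpath ::
  "(nat, 'e) pre_digraph \<Rightarrow> nat \<Rightarrow> 'e dpath \<Rightarrow> 'e dpath \<Rightarrow> 'e dpath \<Rightarrow> bool" where
  "max_common_subpath G v p q s \<longleftrightarrow>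
     subpath G s p \<and> subpath G s q \<and> v \<in> pverts G s \<and>
     (\<forall>t. subpath G t p \<and> subpath G t q \<and> subpath G s t \<longrightarrow> t = s)"

definition subroute_of_conflict ::
  "'e framed_graph \<Rightarrow> 'e dpath \<Rightarrow> 'e dpath \<Rightarrow> 'e dpath \<Rightarrow> bool" where
  "subroute_of_conflict \<Gamma> p q s \<longleftrightarrow>
     (\<exists>v. incoherent_at \<Gamma> v p q \<and> max_common_subpath (graph \<Gamma>) v p q s)"

text \<open>
  \<open>covers_via \<Gamma> \<Delta> \<Delta>' r r' s\<close>: \<open>\<Delta>\<close> is covered by \<open>\<Delta>'\<close> in the framing lattice, by exchanging
  \<open>r\<close> for \<open>r'\<close>, with subroute of conflict \<open>s\<close>.
\<close>

definition covers_via ::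
  "'e framed_graph \<Rightarrow> 'e dpath set \<Rightarrow> 'e dpath set \<Rightarrow> 'e dpath \<Rightarrow> 'e dpath \<Rightarrow> 'e dpath \<Rightarrow> bool" where
  "covers_via \<Gamma> \<Delta> \<Delta>' r r' s \<longleftrightarrow>
     \<Delta> \<in> max_cliques \<Gamma> \<and> \<Delta>' \<in> max_cliques \<Gamma> \<and> \<Delta> - \<Delta>' = {r} \<and> \<Delta>' - \<Delta> = {r'} \<and>
     subroute_of_conflict \<Gamma> r r' s \<and> (\<forall>v\<in>pverts (graph \<Gamma>) s. route_clockwise \<Gamma> v r r')"

text \<open>
  Since \<open>r\<close> is clockwise to \<open>r'\<close>, it enters \<open>s\<close> below \<open>r'\<close> and leaves \<open>s\<close> above \<open>r'\<close>, which
  determines the lower and upper edges of the two corners.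
\<close>

definition cover_label ::
  "'e framed_graph \<Rightarrow> 'e dpath set \<Rightarrow> 'e dpath set \<Rightarrow> 'e gpath \<Rightarrow> bool" where
  "cover_label \<Gamma> \<Delta> \<Delta>' b \<longleftrightarrow>
     (\<exists>r r' s r1 r2 r1' r2'.
        covers_via \<Gamma> \<Delta> \<Delta>' r r' s \<and>
        decomposes (graph \<Gamma>) r r1 s r2 \<and> decomposes (graph \<Gamma>) r' r1' s r2' \<and>
        b = GPath (Some (Corner (start s) (last r1) (last r1'))) s
              (Some (Corner (end_vertex (graph \<Gamma>) s) (hd r2') (hd r2))))"

definition DownBricks :: "'e framed_graph \<Rightarrow> 'e dpath set \<Rightarrow> 'e gpath set" where
  "DownBricks \<Gamma> \<Delta> = {b. \<exists>\<Delta>''. cover_label \<Gamma> \<Delta>'' \<Delta> b}"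

definition UpBricks :: "'e framed_graph \<Rightarrow> 'e dpath set \<Rightarrow> 'e gpath set" where
  "UpBricks \<Gamma> \<Delta> = {b. \<exists>\<Delta>''. cover_label \<Gamma> \<Delta> \<Delta>'' b}"

end

theory Submission
  imports Defs
begin

text \<open>
  Treat every left corner as an additional initial edge and every right corner as an additional
  final edge, placed in the order between the two edges it separates. Generalized paths then become
  maximal paths, and their clockwise relation is the one for routes.

  A maximal clique \<open>D\<close> is encoded by the system of maximal paths with exactly one corner end that are
  weakly coherent with every route of \<open>D\<close>. There is exactly one such path for each corner, these
  paths are pairwise weakly coherent, and \<open>D\<close> consists of the routes weakly coherent with all of
  them. At each vertex the system is a chain, and the bricks below \<open>D\<close> are read off from the
  consecutive pairs formed by a path \<open>s\<close> starting with a left corner and a path \<open>t\<close> ending with a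
  right corner: the brick follows \<open>s\<close> up to the vertex and \<open>t\<close> after it. That crossing such a gap
  really yields an adjacent maximal clique follows from purity: all maximal cliques have the same
  cardinality.

  Conversely, a brick clique \<open>B\<close> determines the system: a path starting with a left corner always
  leaves a vertex along the highest edge that does not cross any brick of \<open>B\<close> lying above the
  path so far, and dually for right corners.

  Reversing all edges and negating all orders each exchange the two sides of the clockwise
  relation. Their composition exchanges left and right in all arguments, and negating alone turns
  the statement on down bricks into the one on up bricks.
\<close>

section \<open>Cornered graphs\<close>

text \<open>Inserting the corners makes edges and corners alternate around every vertex. Two routes
  that separate therefore have a corner between them, and the system path of that corner transmits
  every comparison. Conversely, a starting or final corner can be exchanged for one of its
  neighbouring edges without destroying a strict comparison. This is how a clique and its path
  system determine each other, and it makes systems rigid: two systems that are comparable by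
  inclusion are equal.

  New paths must be coherent with a whole family at once. Each of them is glued from two half paths
  at a vertex, and \<open>wcoh_split\<close> reduces the question to the junction and to the places
  where another path leaves one of the halves. Maximality after an exchange is not tested directly;
  it comes from counting.

  For a given pair of adjacent cliques the key is \<open>resolve\<close>: wherever the exchanged
  routes conflict, both recombinations of their halves belong to both cliques. These common members
  pin down every system path that lies between the exchanged routes, so that the corners of the
  label are forced.\<close>

text \<open>
  A half path is a list of edges leading away from a vertex in the direction \<open>h \<rightarrow> t\<close> until no
  further vertex is recorded. With the roles of head and tail exchanged it describes the part of a
  path after the vertex. Prefixes are therefore listed backwards, and both parts are compared by
  the same lexicographic order \<open>lt\<close>.
\<close>

fun half :: "'x set \<Rightarrow> ('x \<Rightarrow> 'v option) \<Rightarrow> ('x \<Rightarrow> 'v option) \<Rightarrow> 'v \<Rightarrow> 'x list \<Rightarrow> bool" where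
  "half E h t v [] \<longleftrightarrow> False"
| "half E h t v (x # X) \<longleftrightarrow>
     x \<in> E \<and> h x = Some v \<and> (case t x of None \<Rightarrow> X = [] | Some u \<Rightarrow> half E h t u X)"

text \<open>An exhausted list is never less and never greater. This loses nothing, because half
  paths at one vertex are never proper prefixes of each other, and it agrees with
  \<open>lex_less\<close>.\<close>

fun lt :: "('x \<Rightarrow> int) \<Rightarrow> 'x list \<Rightarrow> 'x list \<Rightarrow> bool" where
  "lt k (x # X) (y # Y) \<longleftrightarrow> k x < k y \<or> x = y \<and> lt k X Y"
| "lt k [] Y \<longleftrightarrow> False"
| "lt k X [] \<longleftrightarrow> False"

lemma lt_irrefl [simp]: "\<not> lt k X X"
  by (induction X) auto

lemma lt_trans: "lt k X Y \<Longrightarrow> lt k Y Z \<Longrightarrow> lt k X Z"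
proof (induction X arbitrary: Y Z)
  case (Cons x X)
  then obtain y Y' z Z' where "Y = y # Y'" "Z = z # Z'" by (metis lt.simps(3) list.exhaust)
  with Cons show ?case by auto
qed simp

lemma lt_asym: "lt k X Y \<Longrightarrow> \<not> lt k Y X"
  using lt_trans lt_irrefl by metis

lemma lt_neg [simp]: "lt (\<lambda>x. - k x) X Y \<longleftrightarrow> lt k Y X"
proof (induction X arbitrary: Y)
  case Nil
  then show ?case by (cases Y) auto
next
  case (Cons x X)
  then show ?case by (cases Y) auto
qed

lemma lt_append [simp]: "lt k (A @ X) (A @ Y) \<longleftrightarrow> lt k X Y"
  by (induction A) auto

lemma lt_Nil [simp]: "\<not> lt k X []"
  by (cases X) auto

lemma lt_diverge:
  assumes "lt k X Y"
  obtains A x y X' Y' where "X = A @ x # X'" "Y = A @ y # Y'" "k x < k y"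
proof -
  have "\<exists>A x y X' Y'. X = A @ x # X' \<and> Y = A @ y # Y' \<and> k x < k y" using assms
  proof (induction X arbitrary: Y)
    case (Cons x X)
    then obtain y Y' where Y: "Y = y # Y'" by (cases Y) auto
    show ?case
    proof (cases "k x < k y")
      case True
      then show ?thesis using Y by (intro exI[of _ "[]"]) auto
    next
      case False
      with Cons.prems Y have "x = y" "lt k X Y'" by auto
      then obtain A x1 y1 X1 Y1 where "X = A @ x1 # X1" "Y' = A @ y1 # Y1" "k x1 < k y1"
        using Cons.IH by blast
      then show ?thesis using Y \<open>x = y\<close> by (metis append_Cons)
    qed
  qed simp
  then show ?thesis using that by blast
qed

text \<open>A half path stops exactly where \<open>t\<close> is \<open>None\<close>, so neither list
  can be a proper prefix of the other. The first difference occurs at a common vertex, where the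
  keys are injective.\<close>

lemma half_total:
  assumes "\<And>v. inj_on k {x \<in> E. h x = Some v}" "half E h t v X" "half E h t v Y"
  shows "X = Y \<or> lt k X Y \<or> lt k Y X"
  using assms(2,3)
proof (induction X arbitrary: v Y)
  case (Cons x X)
  then obtain y Y' where Y: "Y = y # Y'" by (cases Y) auto
  show ?case
  proof (cases "k x = k y")
    case True
    then have "x = y" using assms(1)[of v] Cons.prems Y by (auto simp: inj_on_def)
    then show ?thesis using Cons Y by (auto split: option.splits)
  next
    case False
    then show ?thesis using Y by auto
  qed
qed simp

lemma half_set: "half E h t v X \<Longrightarrow> set X \<subseteq> E"
  by (induction X arbitrary: v) (auto split: option.splits)

lemma half_last: "half E h t v X \<Longrightarrow> t (last X) = None"
  by (induction X arbitrary: v) (auto split: option.splits)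

lemma half_ne: "half E h t v X \<Longrightarrow> X \<noteq> []"
  by auto

lemma half_same: "half E h t v X \<Longrightarrow> half E h t u X \<Longrightarrow> u = v"
  by (cases X) auto

lemma finite_half_max:
  assumes "finite A" "A \<noteq> {}" "\<And>v. inj_on k {x \<in> E. h x = Some v}" "\<forall>X \<in> A. half E h t v X"
  obtains m where "m \<in> A" "\<forall>X \<in> A. X = m \<or> lt k X m"
proof -
  have "\<exists>m \<in> A. \<forall>X \<in> A. X = m \<or> lt k X m" using assms(1,2,4)
  proof (induction A rule: finite_ne_induct)
    case (insert x F)
    then obtain m where m: "m \<in> F" "\<forall>X \<in> F. X = m \<or> lt k X m" by auto
    have "half E h t v x" "half E h t v m" using insert.prems m(1) by auto
    from half_total[OF assms(3) this] show ?case
    proof (elim disjE)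
      assume "lt k m x"
      then have "\<forall>X \<in> insert x F. X = x \<or> lt k X x" using m(2) lt_trans[of k _ m x] by auto
      then show ?thesis by blast
    qed (use m in auto)
  qed simp
  then show ?thesis using that by auto
qed

text \<open>
  \<open>hv x\<close> and \<open>tv x\<close> are \<open>None\<close> if the head or tail of \<open>x\<close> is not internal; \<open>ki\<close> and \<open>ko\<close> encode the
  framing. The function \<open>rk\<close> witnesses acyclicity. Its bound \<open>N\<close> only serves to express the
  acyclicity of the reversed graph by another function into the natural numbers.
\<close>

locale cornered =
  fixes E :: "'x set" and hv tv :: "'x \<Rightarrow> 'v option" and ki ko :: "'x \<Rightarrow> int"
    and LC RC :: "'x set" and rk :: "'v \<Rightarrow> nat" and N :: nat
  assumes finE: "finite E"
    and LCE: "LC \<subseteq> E" and RCE: "RC \<subseteq> E" and LRC: "LC \<inter> RC = {}"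
    and LC_tv: "c \<in> LC \<Longrightarrow> tv c = None" and LC_hv: "c \<in> LC \<Longrightarrow> hv c \<noteq> None"
    and RC_hv: "c \<in> RC \<Longrightarrow> hv c = None" and RC_tv: "c \<in> RC \<Longrightarrow> tv c \<noteq> None"
    and inji: "inj_on ki {x \<in> E. hv x = Some v}" and injo: "inj_on ko {x \<in> E. tv x = Some v}"
    and rk: "x \<in> E \<Longrightarrow> tv x = Some u \<Longrightarrow> hv x = Some v \<Longrightarrow> rk u < rk v"
    and rk_hv: "x \<in> E \<Longrightarrow> hv x = Some v \<Longrightarrow> rk v \<le> N"
    and rk_tv: "x \<in> E \<Longrightarrow> tv x = Some v \<Longrightarrow> rk v \<le> N"
    and ex_out: "x \<in> E \<Longrightarrow> hv x = Some v \<Longrightarrow> \<exists>y. y \<in> E - RC \<and> tv y = Some v"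
    and ex_in: "x \<in> E \<Longrightarrow> tv x = Some v \<Longrightarrow> \<exists>y. y \<in> E - LC \<and> hv y = Some v"
    and L_nb: "c \<in> LC \<Longrightarrow> hv c = Some v \<Longrightarrow>
      \<exists>e f. e \<in> E - LC \<and> f \<in> E - LC \<and> hv e = Some v \<and> hv f = Some v \<and> ki e < ki c \<and> ki c < ki f \<and>
        (\<forall>x \<in> E. hv x = Some v \<longrightarrow> x = c \<or> ki x \<le> ki e \<or> ki f \<le> ki x)"
    and R_nb: "c \<in> RC \<Longrightarrow> tv c = Some v \<Longrightarrow>
      \<exists>e f. e \<in> E - RC \<and> f \<in> E - RC \<and> tv e = Some v \<and> tv f = Some v \<and> ko e < ko c \<and> ko c < ko f \<and>
        (\<forall>x \<in> E. tv x = Some v \<longrightarrow> x = c \<or> ko x \<le> ko e \<or> ko f \<le> ko x)"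
    and L_bt: "x \<in> E - LC \<Longrightarrow> y \<in> E - LC \<Longrightarrow> hv x = Some v \<Longrightarrow> hv y = Some v \<Longrightarrow> ki x < ki y \<Longrightarrow>
      \<exists>c. c \<in> LC \<and> hv c = Some v \<and> ki x < ki c \<and> ki c < ki y"
    and R_bt: "x \<in> E - RC \<Longrightarrow> y \<in> E - RC \<Longrightarrow> tv x = Some v \<Longrightarrow> tv y = Some v \<Longrightarrow> ko x < ko y \<Longrightarrow>
      \<exists>c. c \<in> RC \<and> tv c = Some v \<and> ko x < ko c \<and> ko c < ko y"
begin

abbreviation lhalf where "lhalf \<equiv> half E hv tv"
abbreviation rhalf where "rhalf \<equiv> half E tv hv"
abbreviation ltI where "ltI \<equiv> lt ki"
abbreviation ltO where "ltO \<equiv> lt ko"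

definition through :: "'x list \<Rightarrow> 'v \<Rightarrow> 'x list \<Rightarrow> 'x list \<Rightarrow> bool" where
  "through p v X Y \<longleftrightarrow> p = rev X @ Y \<and> lhalf v X \<and> rhalf v Y"

text \<open>The first alternative is a path that meets no internal vertex. Such a path has no
  splitting and hence no conflict.\<close>

definition complete :: "'x list \<Rightarrow> bool" where
  "complete p \<longleftrightarrow> (\<exists>x \<in> E. p = [x] \<and> tv x = None \<and> hv x = None) \<or> (\<exists>v X Y. through p v X Y)"

definition clash :: "'x list \<Rightarrow> 'x list \<Rightarrow> bool" where
  "clash p q \<longleftrightarrow> (\<exists>v X Y X' Y'. through p v X Y \<and> through q v X' Y' \<and> ltI X X' \<and> ltO Y' Y)"

definition wcoh :: "'x list \<Rightarrow> 'x list \<Rightarrow> bool" where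
  "wcoh p q \<longleftrightarrow> \<not> clash p q \<and> \<not> clash q p"

text \<open>
  Weak coherence with \<open>t\<close> is decided where two paths separate. \<open>compat_left t X\<close> covers the
  conflicts in which the two paths leave each other before the start vertex of \<open>X\<close>, so that it does
  not depend on how the backward half path \<open>X\<close> is continued.
\<close>

definition compat_left :: "'x list \<Rightarrow> 'x list \<Rightarrow> bool" where
  "compat_left t X \<longleftrightarrow> (\<forall>A x P z T T'. X = A @ x # P \<and> tv x = Some z \<and> through t z T T' \<longrightarrow>
     (ko (hd T') < ko x \<longrightarrow> \<not> ltI P T) \<and> (ko x < ko (hd T') \<longrightarrow> \<not> ltI T P))"

definition compat_right :: "'x list \<Rightarrow> 'x list \<Rightarrow> bool" where
  "compat_right t Y \<longleftrightarrow> (\<forall>A y Q z T T'. Y = A @ y # Q \<and> hv y = Some z \<and> through t z T T' \<longrightarrow>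
     (ki (hd T) < ki y \<longrightarrow> \<not> ltO Q T') \<and> (ki y < ki (hd T) \<longrightarrow> \<not> ltO T' Q))"

definition route :: "'x list \<Rightarrow> bool" where
  "route p \<longleftrightarrow> complete p \<and> hd p \<notin> LC \<and> last p \<notin> RC"

definition one_corner :: "'x list \<Rightarrow> bool" where
  "one_corner p \<longleftrightarrow> complete p \<and> (hd p \<in> LC) \<noteq> (last p \<in> RC)"

definition brick :: "'x list \<Rightarrow> bool" where
  "brick p \<longleftrightarrow> complete p \<and> hd p \<in> LC \<and> last p \<in> RC"

section \<open>Symmetries: reversal and negation\<close>

lemma reversed: "cornered E tv hv ko ki RC LC (\<lambda>v. N - rk v) N"
proof (rule cornered.intro, goal_cases)
  case (11 x u v)
  \<comment> \<open>The bound \<open>N\<close> keeps the truncated subtraction strictly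
    monotone.\<close>
  then show ?case using rk[of x v u] rk_hv[of x u] by linarith
next
  case (16 c v) then show ?case using R_nb by blast
next
  case (17 c v) then show ?case using L_nb by blast
next
  case (18 x y v) then show ?case using R_bt by blast
next
  case (19 x y v) then show ?case using L_bt by blast
qed (use finE LCE RCE LRC LC_tv LC_hv RC_hv RC_tv inji injo ex_out ex_in in auto)

lemma negated: "cornered E hv tv (\<lambda>x. - ki x) (\<lambda>x. - ko x) LC RC rk N"
proof (rule cornered.intro, goal_cases)
  case (9 v) then show ?case using inji[of v] by (auto simp: inj_on_def)
next
  case (10 v) then show ?case using injo[of v] by (auto simp: inj_on_def)
next
  case (16 c v)
  then obtain e f where "e \<in> E - LC" "f \<in> E - LC" "hv e = Some v" "hv f = Some v" "ki e < ki c" "ki c < ki f"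
        "(\<forall>x \<in> E. hv x = Some v \<longrightarrow> x = c \<or> ki x \<le> ki e \<or> ki f \<le> ki x)" using L_nb by blast
  then show ?case by (intro exI[of _ f] exI[of _ e]) auto
next
  case (17 c v)
  then obtain e f where "e \<in> E - RC" "f \<in> E - RC" "tv e = Some v" "tv f = Some v" "ko e < ko c" "ko c < ko f"
        "(\<forall>x \<in> E. tv x = Some v \<longrightarrow> x = c \<or> ko x \<le> ko e \<or> ko f \<le> ko x)" using R_nb by blast
  then show ?case by (intro exI[of _ f] exI[of _ e]) auto
next
  case (18 x y v) then show ?case using L_bt[of y x v] by auto
next
  case (19 x y v) then show ?case using R_bt[of y x v] by auto
qed (use finE LCE RCE LRC LC_tv LC_hv RC_hv RC_tv rk rk_hv rk_tv ex_out ex_in in auto)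

lemma through_rev: "cornered.through E tv hv (rev p) v Y X \<longleftrightarrow> through p v X Y"
proof -
  interpret rv: cornered E tv hv ko ki RC LC "\<lambda>v. N - rk v" N by (rule reversed)
  have "rev p = rev Y @ X \<longleftrightarrow> p = rev X @ Y"
    by (metis rev_append rev_rev_ident)
  then show ?thesis unfolding through_def rv.through_def by auto
qed

lemma through_rev': "cornered.through E tv hv p v Y X \<longleftrightarrow> through (rev p) v X Y"
  using through_rev[of "rev p"] by simp

lemma complete_rev: "cornered.complete E tv hv (rev p) \<longleftrightarrow> complete p"
proof -
  interpret rv: cornered E tv hv ko ki RC LC "\<lambda>v. N - rk v" N by (rule reversed)
  show ?thesis unfolding complete_def rv.complete_def through_rev by auto
qed

lemma clash_rev: "cornered.clash E tv hv ko ki (rev p) (rev q) \<longleftrightarrow> clash q p"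
proof -
  interpret rv: cornered E tv hv ko ki RC LC "\<lambda>v. N - rk v" N by (rule reversed)
  show ?thesis unfolding clash_def rv.clash_def through_rev by blast
qed

lemma wcoh_rev: "cornered.wcoh E tv hv ko ki (rev p) (rev q) \<longleftrightarrow> wcoh p q"
proof -
  interpret rv: cornered E tv hv ko ki RC LC "\<lambda>v. N - rk v" N by (rule reversed)
  show ?thesis unfolding wcoh_def rv.wcoh_def clash_rev by auto
qed

lemma compat_left_rev: "cornered.compat_left E tv hv ko ki (rev t) X \<longleftrightarrow> compat_right t X"
proof -
  interpret rv: cornered E tv hv ko ki RC LC "\<lambda>v. N - rk v" N by (rule reversed)
  show ?thesis unfolding compat_right_def rv.compat_left_def through_rev by auto
qed

lemma complete_ne: "complete p \<Longrightarrow> p \<noteq> []"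
  unfolding complete_def through_def by auto

lemma route_rev: "cornered.route E tv hv RC LC (rev p) \<longleftrightarrow> route p"
proof -
  interpret rv: cornered E tv hv ko ki RC LC "\<lambda>v. N - rk v" N by (rule reversed)
  show ?thesis unfolding route_def rv.route_def complete_rev using complete_ne by (auto simp: hd_rev last_rev)
qed

lemma one_corner_rev: "cornered.one_corner E tv hv RC LC (rev p) \<longleftrightarrow> one_corner p"
proof -
  interpret rv: cornered E tv hv ko ki RC LC "\<lambda>v. N - rk v" N by (rule reversed)
  show ?thesis unfolding one_corner_def rv.one_corner_def complete_rev using complete_ne by (auto simp: hd_rev last_rev)
qed

lemma brick_rev: "cornered.brick E tv hv RC LC (rev p) \<longleftrightarrow> brick p"
proof -
  interpret rv: cornered E tv hv ko ki RC LC "\<lambda>v. N - rk v" N by (rule reversed)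
  show ?thesis unfolding brick_def rv.brick_def complete_rev using complete_ne by (auto simp: hd_rev last_rev)
qed

lemma clash_neg: "cornered.clash E hv tv (\<lambda>x. - ki x) (\<lambda>x. - ko x) p q \<longleftrightarrow> clash q p"
proof -
  interpret ng: cornered E hv tv "\<lambda>x. - ki x" "\<lambda>x. - ko x" LC RC rk N by (rule negated)
  show ?thesis unfolding clash_def ng.clash_def ng.through_def through_def lt_neg by blast
qed

lemma wcoh_neg: "cornered.wcoh E hv tv (\<lambda>x. - ki x) (\<lambda>x. - ko x) p q \<longleftrightarrow> wcoh p q"
proof -
  interpret ng: cornered E hv tv "\<lambda>x. - ki x" "\<lambda>x. - ko x" LC RC rk N by (rule negated)
  show ?thesis unfolding wcoh_def ng.wcoh_def clash_neg by auto
qed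

end

text \<open>Lowering one entry decides the comparison at that entry at the latest, so the tail
  behind it may be changed at will. With \<open>lt_upper\<close> this lets a starting corner be
  replaced by a neighbouring edge followed by any continuation.\<close>

lemma lt_lower: "lt k (A @ c # Z') Q \<Longrightarrow> k e < k c \<Longrightarrow> lt k (A @ e # Z) Q"
proof (induction A arbitrary: Q)
  case Nil
  then show ?case by (cases Q) auto
next
  case (Cons a A)
  then show ?case by (cases Q) auto
qed

lemma lt_upper: "lt k Q (A @ c # Z') \<Longrightarrow> k c < k f \<Longrightarrow> lt k Q (A @ f # Z)"
proof (induction A arbitrary: Q)
  case Nil
  then show ?case by (cases Q) auto
next
  case (Cons a A)
  then show ?case by (cases Q) auto
qed

lemma eq_rev_imageI:
  assumes "\<And>p. p \<in> A \<longleftrightarrow> rev p \<in> B" shows "A = rev ` B"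
proof -
  have "A = rev -` B" using assms by auto
  moreover have "rev -` B = rev ` B" by (auto intro: rev_image_eqI[of "rev _"])
  ultimately show ?thesis by simp
qed

section \<open>Splitting paths at a vertex and gluing half paths\<close>

context cornered begin

lemma thrI: "lhalf v X \<Longrightarrow> rhalf v Y \<Longrightarrow> through (rev X @ Y) v X Y"
  by (simp add: through_def)

lemma through_complete: "through p v X Y \<Longrightarrow> complete p"
  unfolding complete_def by blast

lemma through_ne: "through p v X Y \<Longrightarrow> X \<noteq> [] \<and> Y \<noteq> []"
  unfolding through_def by auto

lemma through_hd: "through p v X Y \<Longrightarrow> hd p = last X"
  unfolding through_def using half_ne by (metis hd_append hd_rev rev_is_Nil_conv)

lemma through_last: "through p v X Y \<Longrightarrow> last p = last Y"
  unfolding through_def using half_ne by (metis last_append)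

lemma through_step: "through p v X (y # Y) \<Longrightarrow> hv y = Some w \<Longrightarrow> through p w (y # X) Y"
  unfolding through_def by auto

lemma through_stepb: "through p w (y # X) Y \<Longrightarrow> tv y = Some v \<Longrightarrow> through p v X (y # Y)"
  unfolding through_def by auto

lemma through_back: "through p v (A @ P) Y \<Longrightarrow> P \<noteq> [] \<Longrightarrow> \<exists>z. through p z P (rev A @ Y)"
proof (induction A arbitrary: v Y)
  case (Cons a A)
  then obtain u where "tv a = Some u" by (auto simp: through_def split: option.splits)
  then have "through p u (A @ P) (a # Y)" using Cons.prems(1) through_stepb by simp
  from Cons.IH[OF this Cons.prems(2)] show ?case by simp
qed auto

lemma through_fwd: "through p v X (A @ Q) \<Longrightarrow> Q \<noteq> [] \<Longrightarrow> \<exists>z. through p z (rev A @ X) Q"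
proof (induction A arbitrary: v X)
  case (Cons a A)
  then obtain u where "hv a = Some u" by (auto simp: through_def split: option.splits)
  then have "through p u (a # X) (A @ Q)" using Cons.prems(1) through_step by simp
  from Cons.IH[OF this Cons.prems(2)] show ?case by simp
qed auto

lemma through_hv: "through p v X Y \<Longrightarrow> hv (hd X) = Some v \<and> hd X \<in> E"
  unfolding through_def by (cases X) auto

lemma through_tv: "through p v X Y \<Longrightarrow> tv (hd Y) = Some v \<and> hd Y \<in> E"
  unfolding through_def by (cases Y) auto

lemma through_vertex: "through p z P Q \<Longrightarrow> through q w P' Q' \<Longrightarrow> hd P = hd P' \<or> hd Q = hd Q' \<Longrightarrow> z = w"
  using through_hv through_tv by (metis option.inject)

lemma rk_append: "lhalf v (A @ X) \<Longrightarrow> lhalf u X \<Longrightarrow> A \<noteq> [] \<Longrightarrow> rk u < rk v"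
proof (induction A arbitrary: v)
  case (Cons a A)
  have X: "X \<noteq> []" using Cons.prems(2) by auto
  then obtain w where w: "tv a = Some w" "hv a = Some v" "a \<in> E" "lhalf w (A @ X)"
    using Cons.prems(1) by (auto split: option.splits)
  then have "rk w < rk v" using rk by blast
  moreover have "A = [] \<Longrightarrow> w = u" using half_same[of E hv tv w X u] w(4) Cons.prems(2) by simp
  moreover have "A \<noteq> [] \<Longrightarrow> rk u < rk w" using Cons.IH[OF w(4) Cons.prems(2)] by blast
  ultimately show ?case by (cases "A = []") auto
qed auto

text \<open>Both splittings cut the same list, so one cut comes at or before the other. Acyclicity,
  in the form of \<open>rk_append\<close>, gives different cuts vertices of different rank.\<close>

lemma through_cases:
  assumes "through p v X Y" "through p z P Q"
  obtains "z = v" "P = X" "Q = Y"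
  | A where "A \<noteq> []" "X = A @ P" "Q = rev A @ Y" "rk z < rk v"
  | A where "A \<noteq> []" "Y = A @ Q" "P = rev A @ X" "rk v < rk z"
proof -
  have "rev X @ Y = rev P @ Q" using assms unfolding through_def by auto
  then obtain us where "rev X = rev P @ us \<and> us @ Y = Q \<or> rev X @ us = rev P \<and> Y = us @ Q"
    by (meson append_eq_append_conv2)
  moreover have "P = rev us @ X" if "rev X @ us = rev P" using that by (metis rev_append rev_rev_ident)
  moreover have "X = rev us @ P" if "rev X = rev P @ us" using that by (metis rev_append rev_rev_ident)
  ultimately have "X = rev us @ P \<and> Q = us @ Y \<or> P = rev us @ X \<and> Y = us @ Q" by blast
  then consider "us = []" "X = P" "Q = Y" | "us \<noteq> []" "X = rev us @ P" "Q = rev (rev us) @ Y"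
    | "us \<noteq> []" "Y = us @ Q" "P = rev us @ X"
    by (cases us) (simp_all, blast, blast)
  then show ?thesis
  proof cases
    case 1
    then show ?thesis using that(1) assms through_hv by (metis option.inject)
  next
    case 2
    then have "rk z < rk v" using rk_append assms unfolding through_def by (metis rev_is_Nil_conv)
    then show ?thesis using that(2)[of "rev us"] 2 by blast
  next
    case 3
    then have "rk v < rk z" using rk_append assms unfolding through_def by (metis rev_is_Nil_conv)
    then show ?thesis using that(3)[of "us"] 3 by blast
  qed
qed

lemma through_unique: "through p v X Y \<Longrightarrow> through p v P Q \<Longrightarrow> P = X \<and> Q = Y"
  by (erule (1) through_cases) auto

lemma through_eq: "through p v X Y \<Longrightarrow> through q v X Y \<Longrightarrow> p = q"
  unfolding through_def by auto

lemma wcoh_sym: "wcoh p q \<Longrightarrow> wcoh q p"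
  unfolding wcoh_def by auto

lemma wcoh_refl: "wcoh p p"
  unfolding wcoh_def clash_def using through_unique lt_irrefl by metis

lemma I_total: "through p v X Y \<Longrightarrow> through q v X' Y' \<Longrightarrow> X = X' \<or> ltI X X' \<or> ltI X' X"
  using half_total[OF inji] unfolding through_def by blast

lemma O_total: "through p v X Y \<Longrightarrow> through q v X' Y' \<Longrightarrow> Y = Y' \<or> ltO Y Y' \<or> ltO Y' Y"
  using half_total[OF injo] unfolding through_def by blast

lemma wcD: "wcoh p q \<Longrightarrow> through p v X Y \<Longrightarrow> through q v X' Y' \<Longrightarrow> ltI X X' \<Longrightarrow> \<not> ltO Y' Y"
  unfolding wcoh_def clash_def by blast

lemma wcD': "wcoh p q \<Longrightarrow> through p v X Y \<Longrightarrow> through q v X' Y' \<Longrightarrow> ltI X' X \<Longrightarrow> \<not> ltO Y Y'"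
  unfolding wcoh_def clash_def by blast

lemma wcI_O: "wcoh p q \<Longrightarrow> through p v X Y \<Longrightarrow> through q v X' Y' \<Longrightarrow> ltI X X' \<Longrightarrow> Y = Y' \<or> ltO Y Y'"
  using wcD[of p q v X Y X' Y'] O_total[of p v X Y q X' Y'] by blast

lemma wcO_I: "wcoh p q \<Longrightarrow> through p v X Y \<Longrightarrow> through q v X' Y' \<Longrightarrow> ltO Y Y' \<Longrightarrow> X = X' \<or> ltI X X'"
  using wcD'[of p q v X Y X' Y'] I_total[of p v X Y q X' Y'] by blast

text \<open>Follow the half path forwards from \<open>z\<close> towards \<open>v\<close>. As long as
  \<open>t\<close> takes the same edges, a conflict at \<open>z\<close> is carried to the next
  vertex. Where \<open>t\<close> first leaves, \<open>compat_left\<close> excludes the conflict; if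
  it never leaves, the hypothesis at \<open>v\<close> does.\<close>

lemma split_left:
  assumes "through p v X Y" "compat_left t X" "X = A @ P" "through p z P Q" "through t z T T'"
    and "\<And>T T'. through t v T T' \<Longrightarrow> \<not> (ltI X T \<and> ltO T' Y) \<and> \<not> (ltI T X \<and> ltO Y T')"
  shows "\<not> (ltI P T \<and> ltO T' Q) \<and> \<not> (ltI T P \<and> ltO Q T')"
  using assms(3-5)
proof (induction A arbitrary: P Q z T T' rule: rev_induct)
  case Nil
  then have P: "P = X" by simp
  then have "z = v" using through_vertex[OF Nil(2) assms(1)] by simp
  then have "Q = Y" using through_unique[OF assms(1)] Nil(2) by blast
  then show ?case using Nil(3) \<open>z = v\<close> P assms(6) by blast
next
  case (snoc x A)
  have X: "X = A @ x # P" using snoc.prems by simp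
  then obtain w where w: "through p w (x # P) (rev A @ Y)" using through_back assms(1) by blast
  then obtain z' where z': "tv x = Some z'" "lhalf z' P"
    using snoc.prems through_ne unfolding through_def by (auto split: option.splits)
  then have zz: "z' = z" using snoc.prems(2) half_same[of E hv tv z' P z] unfolding through_def by blast
  then have "through p z P (x # rev A @ Y)" using w z' through_stepb by auto
  then have Q: "Q = x # rev A @ Y" using snoc.prems(2) through_unique by auto
  have g: "ko (hd T') < ko x \<longrightarrow> \<not> ltI P T" "ko x < ko (hd T') \<longrightarrow> \<not> ltI T P"
    using assms(2) X z'(1) snoc.prems(3) unfolding zz compat_left_def by auto
  obtain y T'' where T': "T' = y # T''" using snoc.prems(3) through_ne by (metis list.exhaust)
  show ?case
  proof (cases "y = x")
    case True
    have "hv x = Some w" using w through_hv by fastforce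
    then have "through t w (x # T) T''" using snoc.prems(3) T' True through_step by auto
    from snoc.IH[OF X w this] show ?thesis using T' True Q by auto
  next
    case False
    then show ?thesis using g T' Q by auto
  qed
qed

lemma split_right:
  assumes "through p v X Y" "compat_right t Y" "Y = A @ Q" "through p z P Q" "through t z T T'"
    and "\<And>T T'. through t v T T' \<Longrightarrow> \<not> (ltI X T \<and> ltO T' Y) \<and> \<not> (ltI T X \<and> ltO Y T')"
  shows "\<not> (ltI P T \<and> ltO T' Q) \<and> \<not> (ltI T P \<and> ltO Q T')"
proof -
  interpret rv: cornered E tv hv ko ki RC LC "\<lambda>v. N - rk v" N by (rule reversed)
  have "\<not> (ltO Q T' \<and> ltI T P) \<and> \<not> (ltO T' Q \<and> ltI P T)"
    by (rule rv.split_left[of "rev p" v Y X "rev t" A Q z P T' T])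
      (use assms in \<open>auto simp: through_rev through_rev' compat_left_rev\<close>)
  then show ?thesis by blast
qed

text \<open>The gluing principle. The halves of \<open>p\<close> may come from different paths; a
  conflict with \<open>t\<close> must show up at the junction \<open>v\<close> or where
  \<open>t\<close> separates from one of the halves.\<close>

lemma wcoh_split:
  assumes p: "through p v X Y" and "compat_left t X" "compat_right t Y"
    and coh: "\<And>T T'. through t v T T' \<Longrightarrow> \<not> (ltI X T \<and> ltO T' Y) \<and> \<not> (ltI T X \<and> ltO Y T')"
  shows "wcoh p t"
proof -
  have "\<not> (ltI P T \<and> ltO T' Q) \<and> \<not> (ltI T P \<and> ltO Q T')"
    if pz: "through p z P Q" and tz: "through t z T T'" for z P Q T T'
    using p pz
  proof (cases rule: through_cases)
    case 1
    then show ?thesis using coh tz by auto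
  next
    case (2 A)
    then show ?thesis using split_left[OF p assms(2) _ pz tz coh] by auto
  next
    case (3 A)
    then show ?thesis using split_right[OF p assms(3) _ pz tz coh] by auto
  qed
  then show ?thesis unfolding wcoh_def clash_def by blast
qed

text \<open>Where \<open>g\<close> and \<open>t\<close> leave \<open>z\<close> by different edges,
  the comparison of their suffixes is decided by these edges and does not see the end of
  \<open>g\<close>. So a half inherited from a coherent path is compatible.\<close>

lemma compat_left_wcoh:
  assumes "through g v X Z" "wcoh g t" shows "compat_left t X"
  unfolding compat_left_def
proof (intro allI impI, elim conjE)
  fix A x P z T T'
  assume X: "X = A @ x # P" and z: "tv x = Some z" and t: "through t z T T'"
  obtain w where "through g w (x # P) (rev A @ Z)" using through_back assms(1) X by blast
  then have g: "through g z P (x # rev A @ Z)" using z through_stepb by auto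
  obtain y T'' where T': "T' = y # T''" using t through_ne by (metis list.exhaust)
  show "(ko (hd T') < ko x \<longrightarrow> \<not> ltI P T) \<and> (ko x < ko (hd T') \<longrightarrow> \<not> ltI T P)"
    using wcD[OF assms(2) g t] wcD'[OF assms(2) g t] T' by auto
qed

lemma compat_right_wcoh:
  assumes "through g v Z Y" "wcoh g t" shows "compat_right t Y"
proof -
  interpret rv: cornered E tv hv ko ki RC LC "\<lambda>v. N - rk v" N by (rule reversed)
  show ?thesis using rv.compat_left_wcoh[of "rev g" v Y Z "rev t"] assms by (simp add: through_rev wcoh_rev compat_left_rev)
qed

lemma compat_left_Cons:
  assumes "compat_left t X"
    and "\<And>z T T'. tv x = Some z \<Longrightarrow> through t z T T' \<Longrightarrow>
      (ko (hd T') < ko x \<longrightarrow> \<not> ltI X T) \<and> (ko x < ko (hd T') \<longrightarrow> \<not> ltI T X)"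
  shows "compat_left t (x # X)"
  unfolding compat_left_def
proof (intro allI impI, elim conjE)
  fix A y P z T T'
  assume *: "x # X = A @ y # P" "tv y = Some z" "through t z T T'"
  show "(ko (hd T') < ko y \<longrightarrow> \<not> ltI P T) \<and> (ko y < ko (hd T') \<longrightarrow> \<not> ltI T P)"
  proof (cases A)
    case Nil
    then show ?thesis using * assms(2) by auto
  next
    case (Cons a A')
    then show ?thesis using * assms(1) unfolding compat_left_def by auto
  qed
qed

lemma compat_left_Nil: "compat_left t []"
  unfolding compat_left_def by auto

lemma compat_left_None: "tv x = None \<Longrightarrow> compat_left t [x]"
  using compat_left_Cons[OF compat_left_Nil] by auto

lemma LC_through:
  assumes "complete t" "hd t \<in> LC"
  obtains v C where "hv (hd t) = Some v" "through t v [hd t] C" "t = hd t # C"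
proof -
  have "\<exists>v X Y. through t v X Y" using assms LC_hv[of "hd t"] unfolding complete_def by auto
  then obtain v X Y where t: "through t v X Y" by blast
  then have X: "X = butlast X @ [hd t]" using through_hd through_ne by (metis append_butlast_last_id)
  then obtain z where z: "through t z [hd t] (rev (butlast X) @ Y)"
    using through_back[of t v "butlast X" "[hd t]" Y] t by auto
  then show ?thesis using that[of z] through_hv[OF z] unfolding through_def by auto
qed

lemma RC_through:
  assumes "complete t" "last t \<in> RC"
  obtains v C where "tv (last t) = Some v" "through t v C [last t]" "t = rev C @ [last t]"
proof -
  interpret rv: cornered E tv hv ko ki RC LC "\<lambda>v. N - rk v" N by (rule reversed)
  have hd: "hd (rev t) = last t" using complete_ne[OF assms(1)] by (simp add: hd_rev)
  then have "rv.complete (rev t)" "hd (rev t) \<in> RC" using assms by (auto simp: complete_rev)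
  from rv.LC_through[OF this] obtain v C where
    *: "tv (hd (rev t)) = Some v" "rv.through (rev t) v [hd (rev t)] C" "rev t = hd (rev t) # C" .
  then have "through t v C [last t]" unfolding hd through_rev by blast
  moreover have "t = rev C @ [last t]" using *(3) hd by (metis rev.simps(2) rev_rev_ident)
  ultimately show ?thesis using that *(1) hd by auto
qed

text \<open>Half paths that do not end in a left corner first differ in two ordinary edges entering
  a common vertex, and \<open>L_bt\<close> puts a left corner between these.\<close>

lemma corner_between:
  assumes "through p v P Y" "through q v Q Z" "ltI P Q" "hd p \<notin> LC" "hd q \<notin> LC"
  obtains A x P' y Q' c z where "P = A @ x # P'" "Q = A @ y # Q'" "c \<in> LC" "hv c = Some z"
    "ki x < ki c" "ki c < ki y" "through p z (x # P') (rev A @ Y)" "through q z (y # Q') (rev A @ Z)"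
    "x \<in> E - LC" "y \<in> E - LC" "hv x = Some z" "hv y = Some z"
proof -
  obtain A x y P' Q' where d: "P = A @ x # P'" "Q = A @ y # Q'" "ki x < ki y"
    using lt_diverge[OF assms(3)] by metis
  obtain z where z: "through p z (x # P') (rev A @ Y)" using through_back assms(1) d by blast
  obtain z' where z': "through q z' (y # Q') (rev A @ Z)" using through_back assms(2) d by blast
  have "z' = z"
  proof (cases A rule: rev_cases)
    case Nil
    then have "hd (rev A @ Y) = hd Y" "hd (rev A @ Z) = hd Z" by auto
    moreover have "tv (hd Y) = tv (hd Z)" using assms(1,2) through_tv by metis
    ultimately show ?thesis using z z' through_tv by (metis option.inject)
  next
    case (snoc B b)
    then show ?thesis using through_vertex[OF z' z] by simp
  qed
  have "x \<notin> LC"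
  proof
    assume "x \<in> LC"
    then have "P' = []" using LC_tv z unfolding through_def by auto
    then show False using through_hd[OF z] assms \<open>x \<in> LC\<close> by auto
  qed
  moreover have "y \<notin> LC"
  proof
    assume "y \<in> LC"
    then have "Q' = []" using LC_tv z' unfolding through_def by auto
    then show False using through_hd[OF z'] assms \<open>y \<in> LC\<close> by auto
  qed
  moreover have "x \<in> E" "y \<in> E" "hv x = Some z" "hv y = Some z"
    using z z' \<open>z' = z\<close> through_hv by fastforce+
  moreover from calculation obtain c where "c \<in> LC" "hv c = Some z" "ki x < ki c" "ki c < ki y"
    using L_bt[of x y z] d(3) by auto
  ultimately show ?thesis using that d z z' \<open>z' = z\<close> by auto
qed

section \<open>Path systems and maximal cliques\<close>

definition path_system :: "'x list set \<Rightarrow> bool" where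
  "path_system S \<longleftrightarrow> (\<forall>t \<in> S. one_corner t) \<and> (\<forall>c \<in> LC. \<exists>!t. t \<in> S \<and> hd t = c) \<and>
     (\<forall>d \<in> RC. \<exists>!t. t \<in> S \<and> last t = d) \<and> (\<forall>s \<in> S. \<forall>t \<in> S. wcoh s t)"

definition routes_of :: "'x list set \<Rightarrow> 'x list set" where
  "routes_of S = {p. route p \<and> (\<forall>t \<in> S. wcoh p t)}"

definition system_of :: "'x list set \<Rightarrow> 'x list set" where
  "system_of D = {t. one_corner t \<and> (\<forall>p \<in> D. wcoh t p)}"

lemma one_corner_ne: "one_corner t \<Longrightarrow> t \<noteq> []"
  unfolding one_corner_def using complete_ne by auto

lemma path_system_rev: "cornered.path_system E tv hv ko ki RC LC (rev ` S) \<longleftrightarrow> path_system S"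
proof -
  interpret rv: cornered E tv hv ko ki RC LC "\<lambda>v. N - rk v" N by (rule reversed)
  have hl: "one_corner t \<Longrightarrow> hd (rev t) = last t \<and> last (rev t) = hd t" for t
    using one_corner_ne by (auto simp: hd_rev last_rev)
  have ex: "(\<exists>!t. t \<in> rev ` S \<and> P t) \<longleftrightarrow> (\<exists>!t. t \<in> S \<and> P (rev t))" for P
  proof
    assume "\<exists>!t. t \<in> rev ` S \<and> P t"
    then show "\<exists>!t. t \<in> S \<and> P (rev t)" by (metis image_iff rev_rev_ident)
  next
    assume "\<exists>!t. t \<in> S \<and> P (rev t)"
    then show "\<exists>!t. t \<in> rev ` S \<and> P t" by (metis (no_types, lifting) image_iff)
  qed
  show ?thesis
  proof (cases "\<forall>t \<in> S. one_corner t")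
    case True
    then have e1: "(\<exists>!t. t \<in> rev ` S \<and> hd t = c) \<longleftrightarrow> (\<exists>!t. t \<in> S \<and> last t = c)"
      and e2: "(\<exists>!t. t \<in> rev ` S \<and> last t = c) \<longleftrightarrow> (\<exists>!t. t \<in> S \<and> hd t = c)" for c
      unfolding ex using hl by metis+
    show ?thesis unfolding path_system_def rv.path_system_def e1 e2 by (auto simp: one_corner_rev wcoh_rev)
  next
    case False
    then show ?thesis unfolding path_system_def rv.path_system_def by (auto simp: one_corner_rev)
  qed
qed

lemma path_system_neg: "cornered.path_system E hv tv (\<lambda>x. - ki x) (\<lambda>x. - ko x) LC RC S \<longleftrightarrow> path_system S"
proof -
  interpret ng: cornered E hv tv "\<lambda>x. - ki x" "\<lambda>x. - ko x" LC RC rk N by (rule negated)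
  show ?thesis unfolding path_system_def ng.path_system_def wcoh_neg ..
qed

lemma routes_of_rev: "cornered.routes_of E tv hv ko ki RC LC (rev ` S) = rev ` routes_of S"
proof -
  interpret rv: cornered E tv hv ko ki RC LC "\<lambda>v. N - rk v" N by (rule reversed)
  have "p \<in> rv.routes_of (rev ` S) \<longleftrightarrow> rev p \<in> routes_of S" for p
    unfolding routes_of_def rv.routes_of_def using route_rev[of "rev p"] wcoh_rev[of "rev p"] by auto
  then show ?thesis by (rule eq_rev_imageI)
qed

lemma routes_of_neg: "cornered.routes_of E hv tv (\<lambda>x. - ki x) (\<lambda>x. - ko x) LC RC S = routes_of S"
proof -
  interpret ng: cornered E hv tv "\<lambda>x. - ki x" "\<lambda>x. - ko x" LC RC rk N by (rule negated)
  show ?thesis unfolding routes_of_def ng.routes_of_def wcoh_neg ..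
qed

lemma system_of_rev: "cornered.system_of E tv hv ko ki RC LC (rev ` D) = rev ` system_of D"
proof -
  interpret rv: cornered E tv hv ko ki RC LC "\<lambda>v. N - rk v" N by (rule reversed)
  have "p \<in> rv.system_of (rev ` D) \<longleftrightarrow> rev p \<in> system_of D" for p
    unfolding system_of_def rv.system_of_def using one_corner_rev[of "rev p"] wcoh_rev[of "rev p"] by auto
  then show ?thesis by (rule eq_rev_imageI)
qed

lemma system_of_neg: "cornered.system_of E hv tv (\<lambda>x. - ki x) (\<lambda>x. - ko x) LC RC S = system_of S"
proof -
  interpret ng: cornered E hv tv "\<lambda>x. - ki x" "\<lambda>x. - ko x" LC RC rk N by (rule negated)
  show ?thesis unfolding system_of_def ng.system_of_def wcoh_neg ..
qed

lemma path_systemD: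
  assumes "path_system S"
  shows "t \<in> S \<Longrightarrow> one_corner t" "c \<in> LC \<Longrightarrow> \<exists>t. t \<in> S \<and> hd t = c" "d \<in> RC \<Longrightarrow> \<exists>t. t \<in> S \<and> last t = d"
    "s \<in> S \<Longrightarrow> t \<in> S \<Longrightarrow> wcoh s t" "s \<in> S \<Longrightarrow> t \<in> S \<Longrightarrow> hd s = hd t \<Longrightarrow> hd t \<in> LC \<Longrightarrow> s = t"
    "s \<in> S \<Longrightarrow> t \<in> S \<Longrightarrow> last s = last t \<Longrightarrow> last t \<in> RC \<Longrightarrow> s = t"
  using assms unfolding path_system_def by (blast, blast, blast, blast, metis, metis)

lemma path_system_corner:
  assumes "path_system S" "c \<in> LC" "hv c = Some v"
  obtains t C where "t \<in> S" "through t v [c] C" "t = c # C" "last t \<notin> RC" "hd t = c"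
proof -
  obtain t where t: "t \<in> S" "hd t = c" using path_systemD(2)[OF assms(1,2)] by auto
  then have "one_corner t" using path_systemD(1) assms(1) by auto
  then have "complete t" "last t \<notin> RC" using t assms(2) unfolding one_corner_def by auto
  then show ?thesis using LC_through[of t] t assms that by (metis option.inject)
qed

text \<open>In a conflict, the system path of a left corner separating the prefixes would need a
  suffix that is at least that of \<open>p\<close> and at most that of \<open>q\<close>, although
  the suffix of \<open>q\<close> is the smaller one.\<close>

lemma routes_of_clique:
  assumes "path_system S" "p \<in> routes_of S" "q \<in> routes_of S" shows "wcoh p q"
proof -
  have "\<not> clash p q" if "p \<in> routes_of S" "q \<in> routes_of S" for p q
  proof
    assume "clash p q"
    then obtain v P Y Q Z where *: "through p v P Y" "through q v Q Z" "ltI P Q" "ltO Z Y"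
      unfolding clash_def by auto
    have "hd p \<notin> LC" "hd q \<notin> LC" using that unfolding routes_of_def route_def by auto
    from corner_between[OF *(1-3) this] obtain A x P' y Q' c z where
      d: "c \<in> LC" "hv c = Some z" "ki x < ki c" "ki c < ki y"
      "through p z (x # P') (rev A @ Y)" "through q z (y # Q') (rev A @ Z)" by metis
    obtain t C where t: "t \<in> S" "through t z [c] C" using path_system_corner[OF assms(1) d(1,2)] by metis
    have "\<not> ltO C (rev A @ Y)" using wcD[of p t, OF _ d(5) t(2)] that t d unfolding routes_of_def by auto
    moreover have "\<not> ltO (rev A @ Z) C" using wcD'[of q t, OF _ d(6) t(2)] that t d unfolding routes_of_def by auto
    moreover have "ltO (rev A @ Z) (rev A @ Y)" using * by simp
    ultimately show False using O_total[OF d(5) t(2)] O_total[OF d(6) t(2)] lt_trans by metis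
  qed
  then show ?thesis using assms unfolding wcoh_def by blast
qed

section \<open>Extensions without conflict, and the clique of a path system\<close>

definition start_of :: "'x \<Rightarrow> 'x list \<Rightarrow> bool" where
  "start_of f X \<longleftrightarrow> tv f = None \<and> X = [] \<or> (\<exists>u. tv f = Some u \<and> lhalf u X)"

text \<open>The minimum is attained at an ordinary edge because every left corner has an edge below
  it.\<close>

lemma lowest_in:
  assumes "x \<in> E" "tv x = Some u"
  obtains f where "f \<in> E - LC" "hv f = Some u" "\<forall>y \<in> E. hv y = Some u \<longrightarrow> y = f \<or> ki f < ki y"
proof -
  let ?F = "{x \<in> E - LC. hv x = Some u}"
  have "finite (ki ` ?F)" "ki ` ?F \<noteq> {}" using finE ex_in assms by auto
  then obtain f where f: "f \<in> ?F" "ki f = Min (ki ` ?F)" by (metis (no_types, lifting) Min_in imageE)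
  then have le: "ki f \<le> ki y" if "y \<in> ?F" for y using that finE by auto
  have "y = f \<or> ki f < ki y" if y: "y \<in> E" "hv y = Some u" for y
  proof (cases "y \<in> LC")
    case True
    then obtain e where "e \<in> ?F" "ki e < ki y" using L_nb[of y u] y by auto
    then show ?thesis using le by fastforce
  next
    case False
    then have "ki f \<le> ki y" using y le by auto
    then show ?thesis using inji[of u] f y by (auto simp: inj_on_def)
  qed
  then show ?thesis using that f by auto
qed

text \<open>
  Extending backwards along the lowest admissible half path never creates a conflict. Hypothesis
  \<open>H\<close> says that, among the paths leaving \<open>u\<close> below \<open>f\<close>, the one with the highest prefix does not
  start with a left corner; its prefix is the one to take.
\<close>

lemma lowest_prefix:
  assumes W: "\<forall>s \<in> W. \<forall>t \<in> W. wcoh s t"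
    and H: "\<And>f u s T T'. f \<in> E - LC - RC \<Longrightarrow> tv f = Some u \<Longrightarrow> s \<in> W \<Longrightarrow> through s u T T' \<Longrightarrow> ko (hd T') < ko f \<Longrightarrow>
      \<exists>X t T'. t \<in> W \<and> through t u X T' \<and> ko (hd T') < ko f \<and> last X \<notin> LC \<and>
         (\<forall>t \<in> W. \<forall>T T'. through t u T T' \<and> ko (hd T') < ko f \<longrightarrow> \<not> ltI X T)"
    and "f \<in> E - LC - RC"
  shows "\<exists>X. start_of f X \<and> (X \<noteq> [] \<longrightarrow> last X \<notin> LC) \<and> (\<forall>t \<in> W. compat_left t (f # X)) \<and>
    (\<forall>t \<in> W. \<forall>u T T'. tv f = Some u \<and> through t u T (f # T') \<longrightarrow> \<not> ltI T X)"
  using assms(3)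
proof (induction "case tv f of None \<Rightarrow> 0 | Some u \<Rightarrow> Suc (rk u)" arbitrary: f rule: less_induct)
  case less
  show ?case
  proof (cases "tv f")
    case None
    then show ?thesis using compat_left_None by (intro exI[of _ "[]"]) (auto simp: start_of_def)
  next
    case (Some u)
    show ?thesis
    proof (cases "\<exists>s T T'. s \<in> W \<and> through s u T T' \<and> ko (hd T') < ko f")
      case True
      \<comment> \<open>Paths leaving \<open>u\<close> below \<open>f\<close> force the new prefix
        to be at least theirs, so the highest of their prefixes is the lowest admissible one. Paths
        leaving at \<open>f\<close> or higher are then not below it, by coherence with
        \<open>t0\<close>.\<close>
      then obtain X t0 T0 where X: "t0 \<in> W" "through t0 u X T0" "ko (hd T0) < ko f" "last X \<notin> LC"
        "\<forall>t \<in> W. \<forall>T T'. through t u T T' \<and> ko (hd T') < ko f \<longrightarrow> \<not> ltI X T"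
        using H[OF less.prems Some] by metis
      have up: "\<not> ltI T X" if t: "t \<in> W" "through t u T T'" "ko f \<le> ko (hd T')" for t T T'
      proof -
        obtain a A b B where "T' = a # A" "T0 = b # B" using t X through_ne by (metis list.exhaust)
        then have "ltO T0 T'" using t X(3) by auto
        then show ?thesis using wcD'[OF _ X(2) t(2)] W X(1) t(1) by blast
      qed
      have "compat_left t (f # X)" if "t \<in> W" for t
      proof (rule compat_left_Cons)
        show "compat_left t X" using compat_left_wcoh[OF X(2)] W X(1) that by blast
      qed (use that X(5) up Some in auto)
      then show ?thesis using X up Some by (intro exI[of _ X]) (auto simp: start_of_def through_def)
    next
      case False
      \<comment> \<open>Nothing leaves \<open>u\<close> below \<open>f\<close>, so the path may
        enter \<open>u\<close> along the lowest edge; the construction continues from that edge,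
        whose tail has smaller rank.\<close>
      obtain f' where f': "f' \<in> E - LC" "hv f' = Some u" "\<forall>y \<in> E. hv y = Some u \<longrightarrow> y = f' \<or> ki f' < ki y"
        using lowest_in[of f u] less.prems Some by auto
      have "f' \<notin> RC" using f' RC_hv by fastforce
      moreover have "(case tv f' of None \<Rightarrow> 0 | Some u \<Rightarrow> Suc (rk u)) < (case tv f of None \<Rightarrow> 0 | Some u \<Rightarrow> Suc (rk u))"
        using rk[of f' _ u] f' Some by (auto split: option.splits)
      ultimately obtain X where X: "start_of f' X" "X \<noteq> [] \<longrightarrow> last X \<notin> LC" "\<forall>t \<in> W. compat_left t (f' # X)"
        "\<forall>t \<in> W. \<forall>u T T'. tv f' = Some u \<and> through t u T (f' # T') \<longrightarrow> \<not> ltI T X"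
        using less.hyps[of f'] f'(1) by blast
      have lhX: "lhalf u (f' # X)" using f' X(1) by (auto simp: start_of_def)
      have up: "\<not> ltI T (f' # X)" if t: "t \<in> W" "through t u T T'" for t T T'
      proof -
        obtain a A where T: "T = a # A" using t through_ne by (metis list.exhaust)
        have a: "a \<in> E" "hv a = Some u" using t(2) T through_hv by fastforce+
        show ?thesis
        proof (cases "a = f'")
          case True
          show ?thesis
          proof (cases "tv f'")
            case None
            then show ?thesis using X(1) T True by (auto simp: start_of_def)
          next
            case (Some w)
            then have "through t w A (f' # T')" using t(2) T True through_stepb by auto
            then show ?thesis using X(4) Some t T True by auto
          qed
        next
          case False
          then show ?thesis using f'(3) a T by auto
        qed
      qed
      have "compat_left t (f # f' # X)" if "t \<in> W" for t
        by (rule compat_left_Cons) (use X(3) that False up Some in auto)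
      then show ?thesis using lhX X f'(1) up Some by (intro exI[of _ "f' # X"]) (auto simp: start_of_def)
    qed
  qed
qed

definition coherent_set :: "'x list set \<Rightarrow> bool" where
  "coherent_set D \<longleftrightarrow> (\<forall>p \<in> D. route p) \<and> (\<forall>p \<in> D. \<forall>q \<in> D. wcoh p q)"

text \<open>Maximality is phrased as absorption of coherent routes, which is the form used in all
  constructions; \<open>max_cliques_iff\<close> relates it to inclusion.\<close>

definition max_clique :: "'x list set \<Rightarrow> bool" where
  "max_clique D \<longleftrightarrow> coherent_set D \<and> (\<forall>q. route q \<and> (\<forall>p \<in> D. wcoh q p) \<longrightarrow> q \<in> D)"

lemma coherent_set_rev: "cornered.coherent_set E tv hv ko ki RC LC (rev ` D) \<longleftrightarrow> coherent_set D"
proof -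
  interpret rv: cornered E tv hv ko ki RC LC "\<lambda>v. N - rk v" N by (rule reversed)
  show ?thesis unfolding coherent_set_def rv.coherent_set_def by (simp add: route_rev wcoh_rev)
qed

lemma max_clique_rev: "cornered.max_clique E tv hv ko ki RC LC (rev ` D) \<longleftrightarrow> max_clique D"
proof -
  interpret rv: cornered E tv hv ko ki RC LC "\<lambda>v. N - rk v" N by (rule reversed)
  have "(\<forall>q. P q) \<longleftrightarrow> (\<forall>q. P (rev q))" for P :: "'x list \<Rightarrow> bool" by (metis rev_rev_ident)
  note * = this[of "\<lambda>q. rv.route q \<and> (\<forall>p \<in> rev ` D. rv.wcoh q p) \<longrightarrow> q \<in> rev ` D"]
  show ?thesis unfolding max_clique_def rv.max_clique_def * coherent_set_rev by (auto simp: route_rev wcoh_rev)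
qed

lemma coherent_set_neg: "cornered.coherent_set E hv tv (\<lambda>x. - ki x) (\<lambda>x. - ko x) LC RC S \<longleftrightarrow> coherent_set S"
proof -
  interpret ng: cornered E hv tv "\<lambda>x. - ki x" "\<lambda>x. - ko x" LC RC rk N by (rule negated)
  show ?thesis unfolding coherent_set_def ng.coherent_set_def wcoh_neg ..
qed

lemma max_clique_neg: "cornered.max_clique E hv tv (\<lambda>x. - ki x) (\<lambda>x. - ko x) LC RC S \<longleftrightarrow> max_clique S"
proof -
  interpret ng: cornered E hv tv "\<lambda>x. - ki x" "\<lambda>x. - ko x" LC RC rk N by (rule negated)
  show ?thesis unfolding max_clique_def ng.max_clique_def wcoh_neg coherent_set_neg ..
qed

text \<open>A corner lies between any two edges, so the highest right corner below \<open>f\<close>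
  is the immediate predecessor of \<open>f\<close> among all steps leaving \<open>u\<close>.\<close>

lemma R_pred:
  assumes "f \<in> E - RC" "tv f = Some u" "y \<in> E" "tv y = Some u" "ko y < ko f"
  obtains d where "d \<in> RC" "tv d = Some u" "ko d < ko f"
    "\<forall>x \<in> E. tv x = Some u \<longrightarrow> x = d \<or> ko x < ko d \<or> ko f \<le> ko x"
proof -
  let ?F = "{d \<in> RC. tv d = Some u \<and> ko d < ko f}"
  have "?F \<noteq> {}"
  proof (cases "y \<in> RC")
    case False
    then show ?thesis using R_bt[of y f u] assms by auto
  qed (use assms in auto)
  moreover have "finite ?F" by (rule finite_subset[OF _ finE]) (use RCE in auto)
  ultimately have fin: "finite (ko ` ?F)" "ko ` ?F \<noteq> {}" by auto
  obtain d where d: "d \<in> ?F" "Max (ko ` ?F) = ko d" using Max_in[OF fin] by blast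
  have le: "ko x \<le> ko d" if "x \<in> ?F" for x
    using Max_ge[OF fin(1)] that unfolding d(2)[symmetric] by blast
  have "x = d \<or> ko x < ko d \<or> ko f \<le> ko x" if x: "x \<in> E" "tv x = Some u" for x
  proof (rule ccontr)
    assume *: "\<not> ?thesis"
    have "ko x \<noteq> ko d" using injo[of u] d(1) RCE x * by (auto simp: inj_on_def)
    then have xf: "ko d < ko x" "ko x < ko f" using * by auto
    show False
    proof (cases "x \<in> RC")
      case True
      then show False using le[of x] x xf by auto
    next
      case False
      then obtain c where "c \<in> RC" "tv c = Some u" "ko x < ko c" "ko c < ko f"
        using R_bt[of x f u] x xf assms by auto
      then show False using le[of c] xf by auto
    qed
  qed
  then show ?thesis using that d by auto
qed

lemma path_system_corner_R:
  assumes "path_system S" "d \<in> RC" "tv d = Some v"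
  obtains t C where "t \<in> S" "through t v C [d]" "t = rev C @ [d]" "hd t \<notin> LC" "last t = d"
proof -
  obtain t where t: "t \<in> S" "last t = d" using path_systemD(3)[OF assms(1,2)] by auto
  then have "one_corner t" using path_systemD(1) assms(1) by auto
  then have "complete t" "hd t \<notin> LC" using t assms(2) unfolding one_corner_def by auto
  then show ?thesis using RC_through[of t] t assms that by (metis option.inject)
qed

lemma through_fwd':
  assumes "through p z X (rev A @ Y)" "through t v T Y" shows "through p v (A @ X) Y"
proof -
  obtain v' where v': "through p v' (A @ X) Y" using through_fwd[OF assms(1)] through_ne[OF assms(2)] by auto
  then show ?thesis using through_vertex[OF v' assms(2)] by auto
qed

lemma RC_final: "through t v T (d # T') \<Longrightarrow> d \<in> RC \<Longrightarrow> T' = []"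
  unfolding through_def using RC_hv by auto

lemma LC_initial: "through t v (c # T) T' \<Longrightarrow> c \<in> LC \<Longrightarrow> T = []"
  unfolding through_def using LC_tv by auto

text \<open>Hypothesis \<open>H\<close> is provided by the system path ending in the right corner
  \<open>d\<close> directly below \<open>f\<close>. Every other path leaving below \<open>f\<close>
  leaves below \<open>d\<close>, so coherence bounds its prefix; and the path of \<open>d\<close>
  has no second corner.\<close>

lemma lowest_prefix_system:
  assumes "path_system S" "f \<in> E - LC - RC"
  shows "\<exists>X. start_of f X \<and> (X \<noteq> [] \<longrightarrow> last X \<notin> LC) \<and> (\<forall>t \<in> S. compat_left t (f # X)) \<and>
    (\<forall>t \<in> S. \<forall>u T T'. tv f = Some u \<and> through t u T (f # T') \<longrightarrow> \<not> ltI T X)"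
proof (rule lowest_prefix[OF _ _ assms(2)])
  show "\<forall>s \<in> S. \<forall>t \<in> S. wcoh s t" using path_systemD(4) assms(1) by auto
next
  fix f u s T T'
  assume f: "f \<in> E - LC - RC" "tv f = Some u" and s: "s \<in> S" "through s u T T'" "ko (hd T') < ko f"
  obtain d where d: "d \<in> RC" "tv d = Some u" "ko d < ko f"
    "\<forall>x \<in> E. tv x = Some u \<longrightarrow> x = d \<or> ko x < ko d \<or> ko f \<le> ko x"
    using R_pred[of f u "hd T'"] f s through_tv[OF s(2)] by blast
  obtain t X where t: "t \<in> S" "through t u X [d]" "hd t \<notin> LC" "last t = d"
    using path_system_corner_R[OF assms(1) d(1,2)] by metis
  have "\<not> ltI X T1" if t1: "t1 \<in> S" "through t1 u T1 T1'" "ko (hd T1') < ko f" for t1 T1 T1'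
  proof -
    obtain y T2 where T1': "T1' = y # T2" using through_ne[OF t1(2)] by (cases T1') auto
    have y: "y \<in> E" "tv y = Some u" using through_tv[OF t1(2)] T1' by auto
    then have "y = d \<or> ko y < ko d" using d(4) t1(3) T1' by auto
    then show ?thesis
    proof
      assume "y = d"
      then have "last t1 = d" using RC_final[OF _ d(1)] t1(2) T1' through_last[OF t1(2)] by auto
      then have "t1 = t" using path_systemD(6)[OF assms(1)] t t1 d(1) by auto
      then show ?thesis using through_unique[OF t(2)] t1(2) by auto
    next
      assume "ko y < ko d"
      then have "ltO T1' [d]" using T1' by auto
      then show ?thesis using wcD[OF _ t(2) t1(2)] path_systemD(4)[OF assms(1) t(1) t1(1)] by blast
    qed
  qed
  then show "\<exists>X t T'. t \<in> S \<and> through t u X T' \<and> ko (hd T') < ko f \<and> last X \<notin> LC \<and>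
         (\<forall>t \<in> S. \<forall>T T'. through t u T T' \<and> ko (hd T') < ko f \<longrightarrow> \<not> ltI X T)"
    using t d(3) through_hd[OF t(2)] by (intro exI[of _ X] exI[of _ t] exI[of _ "[d]"]) auto
qed

text \<open>Trade the corner for the edge directly above it, keep the suffix, and continue backwards
  along the lowest admissible prefix. With its mirror image this makes the system path of a corner
  visible to the clique: it is enclosed by two routes with the same suffix.\<close>

lemma resolve_L_up:
  assumes "path_system S" "c \<in> LC" "t \<in> S" "through t v [c] C"
  obtains p f X where "p \<in> routes_of S" "through p v (f # X) C" "ki c < ki f"
proof -
  have hvc: "hv c = Some v" using through_hv[OF assms(4)] by simp
  obtain f where f: "f \<in> E - LC" "hv f = Some v" "ki c < ki f"
     "\<forall>x \<in> E. hv x = Some v \<longrightarrow> x = c \<or> ki x < ki c \<or> ki f \<le> ki x"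
    using L_nb[OF assms(2) hvc] by force
  then have f': "f \<in> E - LC - RC" using RC_hv by fastforce
  obtain X where X: "start_of f X" "X \<noteq> [] \<longrightarrow> last X \<notin> LC" "\<forall>t \<in> S. compat_left t (f # X)"
    "\<forall>t \<in> S. \<forall>u T T'. tv f = Some u \<and> through t u T (f # T') \<longrightarrow> \<not> ltI T X"
    using lowest_prefix_system[OF assms(1) f'] by blast
  define p where "p = rev (f # X) @ C"
  have "lhalf v (f # X)" using f X(1) by (auto simp: start_of_def)
  then have p: "through p v (f # X) C" using assms(4) unfolding p_def by (simp add: through_def)
  have "wcoh p s" if s: "s \<in> S" for s
  proof (rule wcoh_split[OF p])
    have ts: "wcoh t s" using path_systemD(4)[OF assms(1,3) s] .
    show "compat_left s (f # X)" using X(3) s by blast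
    show "compat_right s C" using compat_right_wcoh[OF assms(4) ts] .
    fix T T' assume T: "through s v T T'"
    obtain a A where TA: "T = a # A" using through_ne[OF T] by (cases T) auto
    have a: "a \<in> E" "hv a = Some v" using through_hv[OF T] TA by auto
    have "\<not> (ltI (f # X) T \<and> ltO T' C)"
    proof
      assume *: "ltI (f # X) T \<and> ltO T' C"
      then have "ki c < ki a" using TA f(3) by auto
      then have "ltI [c] T" using TA by auto
      then show False using wcD[OF ts assms(4) T] * by blast
    qed
    moreover have "\<not> (ltI T (f # X) \<and> ltO C T')"
    proof
      assume *: "ltI T (f # X) \<and> ltO C T'"
      \<comment> \<open>No step lies strictly between \<open>c\<close> and \<open>f\<close>, so
        whatever is at most \<open>f\<close> is \<open>f\<close>, the corner, or below the
        corner.\<close>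
      consider "a = f" | "a = c" | "ki a < ki c" using f(4) a TA * by fastforce
      then show False
      proof cases
        case 1
        then show ?thesis
        proof (cases "tv f")
          case None
          then show ?thesis using X(1) * TA 1 by (auto simp: start_of_def)
        next
          case (Some u)
          then have "through s u A (f # T')" using T TA 1 through_stepb by auto
          then show ?thesis using X(4) s Some * TA 1 by auto
        qed
      next
        case 2
        then have "hd s = c" using LC_initial[OF _ assms(2)] T TA through_hd[OF T] by auto
        moreover have "hd t = c" using through_hd[OF assms(4)] by simp
        ultimately have "s = t" using path_systemD(5)[OF assms(1) s assms(3)] assms(2) by auto
        then show ?thesis using through_unique[OF assms(4)] T * lt_irrefl by blast
      next
        case 3
        then have "ltI T [c]" using TA by auto
        then show ?thesis using wcD'[OF ts assms(4) T] * by blast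
      qed
    qed
    ultimately show "\<not> (ltI (f # X) T \<and> ltO T' C) \<and> \<not> (ltI T (f # X) \<and> ltO C T')" by blast
  qed
  moreover have "hd p \<notin> LC" using through_hd[OF p] X(2) f(1) by auto
  moreover have "last p \<notin> RC"
  proof -
    have "one_corner t" using path_systemD(1) assms by auto
    moreover have "hd t = c" using through_hd[OF assms(4)] by simp
    ultimately have "last t \<notin> RC" using assms(2) unfolding one_corner_def by auto
    then show ?thesis using through_last[OF p] through_last[OF assms(4)] by simp
  qed
  ultimately have "p \<in> routes_of S" unfolding routes_of_def route_def using through_complete[OF p] by auto
  then show ?thesis using that p f(3) by auto
qed

lemma resolve_L_down:
  assumes "path_system S" "c \<in> LC" "t \<in> S" "through t v [c] C"
  obtains p f X where "p \<in> routes_of S" "through p v (f # X) C" "ki f < ki c"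
proof -
  interpret ng: cornered E hv tv "\<lambda>x. - ki x" "\<lambda>x. - ko x" LC RC rk N by (rule negated)
  show ?thesis using ng.resolve_L_up[of S c t v C] assms that
    unfolding path_system_neg routes_of_neg neg_less_iff_less by blast
qed

text \<open>A conflict of \<open>q\<close> with \<open>t\<close> survives when the starting corner
  of \<open>t\<close> is replaced by the edge above or below it, according to the side on which
  \<open>q\<close> lies. The replaced path is a route of the clique.\<close>

lemma routes_of_wcoh_L:
  assumes "path_system S" "hd q \<notin> LC" "\<forall>p \<in> routes_of S. wcoh q p" "t \<in> S" "hd t \<in> LC"
  shows "wcoh q t"
proof -
  obtain v C where t: "through t v [hd t] C" using LC_through[of t] assms path_systemD(1) unfolding one_corner_def by metis
  obtain p f X where p: "p \<in> routes_of S" "through p v (f # X) C" "ki (hd t) < ki f"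
    using resolve_L_up[OF assms(1,5,4) t] by metis
  obtain p' e X' where p': "p' \<in> routes_of S" "through p' v (e # X') C" "ki e < ki (hd t)"
    using resolve_L_down[OF assms(1,5,4) t] by metis
  \<comment> \<open>Every prefix of \<open>t\<close> ends in its corner, so every suffix of
    \<open>t\<close> is a tail of \<open>C\<close>, and a route that shares \<open>C\<close> can be
    followed to the same vertex.\<close>
  have A: "\<exists>A. P = A @ [hd t] \<and> C = rev A @ Y" if P: "through t w P Y" for w P Y
  proof -
    have "P = butlast P @ [hd t]" using through_hd[OF P] through_ne[OF P] by simp
    moreover from this obtain z where "through t z [hd t] (rev (butlast P) @ Y)" using through_back P by (metis not_Cons_self2)
    then have "C = rev (butlast P) @ Y" using through_vertex[OF t] through_unique[OF t] by fastforce
    ultimately show ?thesis by blast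
  qed
  have "\<not> clash q t"
  proof
    assume "clash q t"
    then obtain w Q Z P Y where *: "through q w Q Z" "through t w P Y" "ltI Q P" "ltO Y Z"
      unfolding clash_def by blast
    then obtain A where A: "P = A @ [hd t]" "C = rev A @ Y" using A by blast
    then have "through p w (A @ f # X) Y" using through_fwd' p(2) *(2) by blast
    moreover have "ltI Q (A @ f # X)" using lt_upper[OF *(3)[unfolded A(1)] p(3)] .
    ultimately show False using wcD[of q p, OF _ *(1)] assms(3) p(1) *(4) by blast
  qed
  moreover have "\<not> clash t q"
  proof
    assume "clash t q"
    then obtain w Q Z P Y where *: "through q w Q Z" "through t w P Y" "ltI P Q" "ltO Z Y"
      unfolding clash_def by blast
    then obtain A where A: "P = A @ [hd t]" "C = rev A @ Y" using A by blast
    then have "through p' w (A @ e # X') Y" using through_fwd' p'(2) *(2) by blast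
    moreover have "ltI (A @ e # X') Q" using lt_lower[OF *(3)[unfolded A(1)] p'(3)] .
    ultimately show False using wcD'[of q p', OF _ *(1)] assms(3) p'(1) *(4) by blast
  qed
  ultimately show ?thesis unfolding wcoh_def by blast
qed

lemma routes_of_wcoh_R:
  assumes "path_system S" "route q" "\<forall>p \<in> routes_of S. wcoh q p" "t \<in> S" "last t \<in> RC"
  shows "wcoh q t"
proof -
  interpret rv: cornered E tv hv ko ki RC LC "\<lambda>v. N - rk v" N by (rule reversed)
  have "q \<noteq> []" "t \<noteq> []" using assms path_systemD(1) one_corner_ne complete_ne unfolding route_def by auto
  then have "rv.wcoh (rev q) (rev t)"
    by (intro rv.routes_of_wcoh_L[of "rev ` S" "rev q" "rev t"])
      (use assms in \<open>auto simp: path_system_rev routes_of_rev wcoh_rev hd_rev route_def\<close>)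
  then show ?thesis by (simp add: wcoh_rev)
qed

lemma max_clique_routes_of:
  assumes "path_system S" shows "max_clique (routes_of S)"
proof -
  have "q \<in> routes_of S" if q: "route q" "\<forall>p \<in> routes_of S. wcoh q p" for q
  proof -
    have "wcoh q t" if "t \<in> S" for t
    proof (cases "hd t \<in> LC")
      case True
      then show ?thesis using routes_of_wcoh_L[OF assms] that q unfolding route_def by blast
    next
      case False
      then have "last t \<in> RC" using path_systemD(1)[OF assms] that unfolding one_corner_def by blast
      then show ?thesis using routes_of_wcoh_R[OF assms q] that by blast
    qed
    then show ?thesis using q unfolding routes_of_def by blast
  qed
  moreover have "coherent_set (routes_of S)" unfolding coherent_set_def using routes_of_clique[OF assms] by (auto simp: routes_of_def)
  ultimately show ?thesis unfolding max_clique_def by blast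
qed

section \<open>Finiteness, and the path system of a maximal clique\<close>

lemma through_lhalf: "through p v X Y \<Longrightarrow> lhalf v X" and through_rhalf: "through p v X Y \<Longrightarrow> rhalf v Y"
  unfolding through_def by auto

lemma finite_lhalf: "finite {X. lhalf v X}"
proof (induction "rk v" arbitrary: v rule: less_induct)
  case less
  have "{X. lhalf v X} \<subseteq> (\<Union>x \<in> E. case tv x of None \<Rightarrow> {[x]} |
     Some u \<Rightarrow> if hv x = Some v then (#) x ` {X. lhalf u X} else {})" (is "_ \<subseteq> ?R")
  proof
    fix X assume "X \<in> {X. lhalf v X}"
    then show "X \<in> ?R" by (cases X) (auto split: option.splits)
  qed
  moreover have "finite ?R" using finE less rk by (auto split: option.splits)
  ultimately show ?case using finite_subset by blast
qed

lemma finite_rhalf: "finite {X. rhalf v X}"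
proof -
  interpret rv: cornered E tv hv ko ki RC LC "\<lambda>v. N - rk v" N by (rule reversed)
  show ?thesis by (rule rv.finite_lhalf)
qed

lemma finite_complete: "finite {p. complete p}"
proof -
  have "{p. complete p} \<subseteq> (\<lambda>x. [x]) ` E \<union>
    (\<Union>x \<in> E. case hv x of None \<Rightarrow> {} | Some v \<Rightarrow> (\<lambda>(X, Y). rev X @ Y) ` ({X. lhalf v X} \<times> {Y. rhalf v Y}))"
    (is "_ \<subseteq> ?R")
  proof
    fix p assume "p \<in> {p. complete p}"
    then consider x where "x \<in> E" "p = [x]" | v X Y where "through p v X Y" unfolding complete_def by blast
    then show "p \<in> ?R"
    proof cases
      case 2
      then show ?thesis using through_hv[OF 2] unfolding through_def
        by (intro UnI2 UN_I[of "hd X"]) auto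
    qed auto
  qed
  moreover have "finite ?R" using finE finite_lhalf finite_rhalf by (auto split: option.splits)
  ultimately show ?thesis using finite_subset by blast
qed

lemma coherent_set_ends: "coherent_set D \<Longrightarrow> p \<in> D \<Longrightarrow> hd p \<notin> LC \<and> last p \<notin> RC"
  unfolding coherent_set_def route_def by blast

lemma coherent_set_finite: "coherent_set D \<Longrightarrow> finite D"
  unfolding coherent_set_def route_def using finite_complete finite_subset[of D "{p. complete p}"] by blast

lemma max_I:
  assumes "\<forall>X \<in> A. lhalf v X" "A \<noteq> {}"
  obtains m where "m \<in> A" "\<forall>X \<in> A. X = m \<or> ltI X m"
proof -
  have "finite A" using finite_subset[OF _ finite_lhalf[of v], of A] assms(1) by auto
  then show ?thesis using finite_half_max[OF _ assms(2) inji assms(1)] that by blast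
qed

lemma max_O:
  assumes "\<forall>X \<in> A. rhalf v X" "A \<noteq> {}"
  obtains m where "m \<in> A" "\<forall>X \<in> A. X = m \<or> ltO X m"
proof -
  have "finite A" using finite_subset[OF _ finite_rhalf[of v], of A] assms(1) by auto
  then show ?thesis using finite_half_max[OF _ assms(2) injo assms(1)] that by blast
qed

lemma min_O:
  assumes "\<forall>X \<in> A. rhalf v X" "A \<noteq> {}"
  obtains m where "m \<in> A" "\<forall>X \<in> A. X = m \<or> ltO m X"
proof -
  interpret ng: cornered E hv tv "\<lambda>x. - ki x" "\<lambda>x. - ko x" LC RC rk N by (rule negated)
  show ?thesis using ng.max_O[OF assms] that unfolding lt_neg by blast
qed

text \<open>For a clique, \<open>H\<close> comes from finiteness: among the prefixes that leave
  below \<open>f\<close> there is a highest one, and no route starts with a corner.\<close>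

lemma lowest_prefix_clique:
  assumes "coherent_set D" "f \<in> E - LC - RC"
  shows "\<exists>X. start_of f X \<and> (X \<noteq> [] \<longrightarrow> last X \<notin> LC) \<and> (\<forall>t \<in> D. compat_left t (f # X)) \<and>
    (\<forall>t \<in> D. \<forall>u T T'. tv f = Some u \<and> through t u T (f # T') \<longrightarrow> \<not> ltI T X)"
proof (rule lowest_prefix[OF _ _ assms(2)])
  show "\<forall>s \<in> D. \<forall>t \<in> D. wcoh s t" using assms(1) unfolding coherent_set_def by auto
next
  fix f u s T T'
  assume f: "f \<in> E - LC - RC" "tv f = Some u" and s: "s \<in> D" "through s u T T'" "ko (hd T') < ko f"
  let ?A = "{T. \<exists>t \<in> D. \<exists>T'. through t u T T' \<and> ko (hd T') < ko f}"
  have A: "\<forall>X \<in> ?A. lhalf u X" "?A \<noteq> {}" using s through_lhalf by blast+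
  obtain X where X: "X \<in> ?A" "\<forall>T \<in> ?A. T = X \<or> ltI T X" by (rule max_I[OF A])
  then obtain t T' where t: "t \<in> D" "through t u X T'" "ko (hd T') < ko f" by blast
  have "last X \<notin> LC" using through_hd[OF t(2)] coherent_set_ends[OF assms(1) t(1)] by simp
  moreover have "\<forall>t \<in> D. \<forall>T T'. through t u T T' \<and> ko (hd T') < ko f \<longrightarrow> \<not> ltI X T"
  proof (intro ballI allI impI)
    fix t T T' assume "t \<in> D" "through t u T T' \<and> ko (hd T') < ko f"
    then have "T \<in> ?A" by blast
    then have "T = X \<or> ltI T X" using X(2) by blast
    then show "\<not> ltI X T" using lt_asym[of ki T X] by auto
  qed
  ultimately show "\<exists>X t T'. t \<in> D \<and> through t u X T' \<and> ko (hd T') < ko f \<and> last X \<notin> LC \<and>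
         (\<forall>t \<in> D. \<forall>T T'. through t u T T' \<and> ko (hd T') < ko f \<longrightarrow> \<not> ltI X T)"
    using t by blast
qed

lemma start_of_rev: "cornered.start_of E tv hv f Y \<longleftrightarrow> hv f = None \<and> Y = [] \<or> (\<exists>u. hv f = Some u \<and> rhalf u Y)"
proof -
  interpret rv: cornered E tv hv ko ki RC LC "\<lambda>v. N - rk v" N by (rule reversed)
  show ?thesis unfolding rv.start_of_def ..
qed

text \<open>If no member of \<open>D\<close> used \<open>f\<close>, the two halves around
  \<open>f\<close> could be extended independently, one in the graph and one in its reversal. As no
  member traverses \<open>f\<close>, every meeting at the junction is a separation there, which
  compatibility controls, and the glued route would belong to \<open>D\<close>.\<close>

lemma edge_covered:
  assumes "max_clique D" "f \<in> E - LC" "hv f = Some v"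
  shows "\<exists>p \<in> D. \<exists>X Y. through p v (f # X) Y"
proof (rule ccontr)
  interpret rv: cornered E tv hv ko ki RC LC "\<lambda>v. N - rk v" N by (rule reversed)
  assume no: "\<not> ?thesis"
  have coherent_set: "coherent_set D" using assms(1) unfolding max_clique_def by auto
  have f: "f \<in> E - LC - RC" using assms RC_hv by fastforce
  obtain X where X: "start_of f X" "X \<noteq> [] \<longrightarrow> last X \<notin> LC" "\<forall>t \<in> D. compat_left t (f # X)"
    using lowest_prefix_clique[OF coherent_set f] by blast
  obtain Y where Y: "rv.start_of f Y" "Y \<noteq> [] \<longrightarrow> last Y \<notin> RC" "\<forall>t \<in> rev ` D. rv.compat_left t (f # Y)"
    using rv.lowest_prefix_clique[of "rev ` D" f] coherent_set f by (auto simp: coherent_set_rev)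
  have rY: "rhalf v Y" using Y(1) assms(3) unfolding start_of_rev by auto
  have gY: "compat_right t (f # Y)" if "t \<in> D" for t using Y(3) that by (auto simp: compat_left_rev)
  have lX: "lhalf v (f # X)" using X(1) f assms by (auto simp: start_of_def)
  define p where "p = rev (f # X) @ Y"
  have p: "through p v (f # X) Y" using lX rY unfolding p_def by (simp add: through_def)
  have "wcoh p t" if t: "t \<in> D" for t
  proof (rule wcoh_split[OF p])
    show "compat_left t (f # X)" using X(3) t by blast
    show "compat_right t Y" using gY[OF t] unfolding compat_right_def by (metis append_Cons)
    fix T T' assume T: "through t v T T'"
    obtain a A where TA: "T = a # A" using through_ne[OF T] by (cases T) auto
    have "a \<noteq> f" using no T t TA by blast
    then have "ltI (f # X) T \<Longrightarrow> ki f < ki (hd T)" "ltI T (f # X) \<Longrightarrow> ki (hd T) < ki f" using TA by auto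
    moreover have "(ki (hd T) < ki f \<longrightarrow> \<not> ltO Y T') \<and> (ki f < ki (hd T) \<longrightarrow> \<not> ltO T' Y)"
      using gY[OF t] assms(3) T unfolding compat_right_def by blast
    ultimately show "\<not> (ltI (f # X) T \<and> ltO T' Y) \<and> \<not> (ltI T (f # X) \<and> ltO Y T')" by blast
  qed
  moreover have "route p" unfolding route_def
    using through_complete[OF p] through_hd[OF p] through_last[OF p] X(2) Y(2) through_ne[OF p] f by auto
  ultimately have "p \<in> D" using assms(1) unfolding max_clique_def by blast
  then show False using no p by blast
qed

text \<open>Let \<open>Ye\<close> be the highest suffix in \<open>D\<close> after the edge
  \<open>e\<close> below the corner and \<open>Yf\<close> the lowest after the edge \<open>f\<close>
  above it. If they differed, the highest prefix through \<open>e\<close> joined to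
  \<open>Yf\<close> would be coherent with \<open>D\<close>, hence a member, against the choice of
  \<open>Ye\<close>. The common value continues the corner.\<close>

lemma system_of_corner:
  assumes D: "max_clique D" and c: "c \<in> LC" "hv c = Some v"
  obtains C e f p q Z Z' where "c # C \<in> system_of D" "through (c # C) v [c] C"
    "p \<in> D" "through p v (e # Z) C" "q \<in> D" "through q v (f # Z') C" "ki e < ki c" "ki c < ki f"
    "e \<in> E - LC" "f \<in> E - LC" "hv e = Some v" "hv f = Some v"
    "\<forall>x \<in> E. hv x = Some v \<longrightarrow> x = c \<or> ki x \<le> ki e \<or> ki f \<le> ki x"
proof -
  obtain e f where ef: "e \<in> E - LC" "f \<in> E - LC" "hv e = Some v" "hv f = Some v"
    "ki e < ki c" "ki c < ki f" "\<forall>x \<in> E. hv x = Some v \<longrightarrow> x = c \<or> ki x \<le> ki e \<or> ki f \<le> ki x"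
    using L_nb[OF c] by blast
  have wcD2: "wcoh s t" if "s \<in> D" "t \<in> D" for s t using D that unfolding max_clique_def coherent_set_def by blast
  have rt: "route s" if "s \<in> D" for s using D that unfolding max_clique_def coherent_set_def by blast
  let ?E = "{Y. \<exists>t \<in> D. \<exists>T. through t v (e # T) Y}" and ?F = "{Y. \<exists>t \<in> D. \<exists>T. through t v (f # T) Y}"
  have Ene: "\<forall>X \<in> ?E. rhalf v X" "?E \<noteq> {}" using through_rhalf edge_covered[OF D ef(1,3)] by blast+
  have Fne: "\<forall>X \<in> ?F. rhalf v X" "?F \<noteq> {}" using through_rhalf edge_covered[OF D ef(2,4)] by blast+
  obtain Ye where Ye: "Ye \<in> ?E" "\<forall>Y \<in> ?E. Y = Ye \<or> ltO Y Ye" by (rule max_O[OF Ene])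
  obtain Yf where Yf: "Yf \<in> ?F" "\<forall>Y \<in> ?F. Y = Yf \<or> ltO Yf Y" by (rule min_O[OF Fne])
  obtain p Z where p: "p \<in> D" "through p v (e # Z) Ye" using Ye by blast
  obtain q Z' where q: "q \<in> D" "through q v (f # Z') Yf" using Yf by blast
  have atv: "(ki a < ki e \<or> a = e) \<or> (ki f < ki a \<or> a = f)" if "a \<in> E" "hv a = Some v" "a \<noteq> c" for a
  proof -
    have "ki a = ki e \<Longrightarrow> a = e" "ki a = ki f \<Longrightarrow> a = f" using inji[of v] that ef by (auto simp: inj_on_def)
    then show ?thesis using ef(7) that by force
  qed
  \<comment> \<open>Coherence with \<open>p\<close> extends the bound from the edge \<open>e\<close>
    to all edges below it; \<open>above\<close> does the same for \<open>q\<close> and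
    \<open>f\<close>.\<close>
  have below: "T' = Ye \<or> ltO T' Ye" if "t \<in> D" "through t v (a # T) T'" "ki a < ki e \<or> a = e" for t a T T'
  proof (cases "a = e")
    case False
    then show ?thesis using wcI_O[OF wcD2[OF that(1) p(1)] that(2) p(2)] that(3) by auto
  qed (use Ye that in blast)
  have above: "T' = Yf \<or> ltO Yf T'" if "t \<in> D" "through t v (a # T) T'" "ki f < ki a \<or> a = f" for t a T T'
  proof (cases "a = f")
    case False
    then show ?thesis using wcI_O[OF wcD2[OF q(1) that(1)] q(2) that(2)] that(3) by auto
  qed (use Yf that in blast)
  have noc: "a \<noteq> c" if "t \<in> D" "through t v (a # T) T'" for t a T T'
    using LC_initial[OF that(2)] through_hd[OF that(2)] rt[OF that(1)] c(1) unfolding route_def by auto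
  have eq: "Yf = Ye"
  proof (rule ccontr)
    assume "Yf \<noteq> Ye"
    moreover have "ltI (e # Z) (f # Z')" using ef by auto
    ultimately have lo: "ltO Ye Yf" using wcI_O[OF wcD2[OF p(1) q(1)] p(2) q(2)] by auto
    let ?I = "{X. hd X = e \<and> (\<exists>t \<in> D. \<exists>Y. through t v X Y)}"
    have "e # Z \<in> ?I" using p by auto
    then have Ine: "\<forall>X \<in> ?I. lhalf v X" "?I \<noteq> {}" using through_lhalf by blast+
    obtain X where X: "X \<in> ?I" "\<forall>T \<in> ?I. T = X \<or> ltI T X" by (rule max_I[OF Ine])
    then obtain m Ym where m: "m \<in> D" "through m v X Ym" "hd X = e" by blast
    define r where "r = rev X @ Yf"
    have r: "through r v X Yf" unfolding r_def using m(2) q(2) by (simp add: through_def)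
    have "wcoh r t" if t: "t \<in> D" for t
    proof (rule wcoh_split[OF r])
      show "compat_left t X" using compat_left_wcoh[OF m(2) wcD2[OF m(1) t]] .
      show "compat_right t Yf" using compat_right_wcoh[OF q(2) wcD2[OF q(1) t]] .
      fix T T' assume T: "through t v T T'"
      obtain a A where TA: "T = a # A" using through_ne[OF T] by (cases T) auto
      obtain XX where XX: "X = e # XX" using m through_ne[OF m(2)] by (cases X) auto
      have a: "a \<in> E" "hv a = Some v" "a \<noteq> c" using through_hv[OF T] TA noc t T by auto
      have "\<not> (ltI X T \<and> ltO T' Yf)"
      proof
        assume *: "ltI X T \<and> ltO T' Yf"
        then have "a \<noteq> e" using X(2) TA t T lt_asym lt_irrefl by fastforce
        moreover have "\<not> ki a < ki e" using * TA XX by auto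
        ultimately have "T' = Yf \<or> ltO Yf T'" using above t T TA atv[OF a] by blast
        then show False using * lt_asym by auto
      qed
      moreover have "\<not> (ltI T X \<and> ltO Yf T')"
      proof
        assume *: "ltI T X \<and> ltO Yf T'"
        then have "ki a < ki e \<or> a = e" using TA XX by auto
        then have "T' = Ye \<or> ltO T' Ye" using below t T TA by blast
        then show False using * lo lt_asym lt_trans by metis
      qed
      ultimately show "\<not> (ltI X T \<and> ltO T' Yf) \<and> \<not> (ltI T X \<and> ltO Yf T')" by blast
    qed
    moreover have "route r" unfolding route_def
      using through_complete[OF r] through_hd[OF r] through_last[OF r] through_hd[OF m(2)] through_last[OF q(2)] rt[OF m(1)] rt[OF q(1)]
      unfolding route_def by auto
    ultimately have "r \<in> D" using D unfolding max_clique_def by blast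
    moreover obtain XX where "X = e # XX" using m through_ne[OF m(2)] by (cases X) auto
    ultimately have "Yf = Ye \<or> ltO Yf Ye" using below r by blast
    then show False using lo lt_asym by auto
  qed
  define t where "t = c # Ye"
  have "lhalf v [c]" using c LCE LC_tv by auto
  then have t: "through t v [c] Ye" unfolding t_def using p(2) by (simp add: through_def)
  have "wcoh t s" if s: "s \<in> D" for s
  proof (rule wcoh_split[OF t])
    show "compat_left s [c]" using compat_left_None LC_tv c by blast
    show "compat_right s Ye" using compat_right_wcoh[OF p(2) wcD2[OF p(1) s]] .
    fix T T' assume T: "through s v T T'"
    obtain a A where TA: "T = a # A" using through_ne[OF T] by (cases T) auto
    have a: "a \<in> E" "hv a = Some v" "a \<noteq> c" using through_hv[OF T] TA noc s T by auto
    have "\<not> (ltI [c] T \<and> ltO T' Ye)"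
    proof
      assume *: "ltI [c] T \<and> ltO T' Ye"
      then have "ki f < ki a \<or> a = f" using atv[OF a] TA ef(5) by auto
      then show False using above s T TA * eq lt_asym lt_irrefl by metis
    qed
    moreover have "\<not> (ltI T [c] \<and> ltO Ye T')"
    proof
      assume *: "ltI T [c] \<and> ltO Ye T'"
      then have "ki a < ki e \<or> a = e" using atv[OF a] TA ef(6) by auto
      then show False using below s T TA * lt_asym lt_irrefl by metis
    qed
    ultimately show "\<not> (ltI [c] T \<and> ltO T' Ye) \<and> \<not> (ltI T [c] \<and> ltO Ye T')" by blast
  qed
  moreover have "one_corner t" unfolding one_corner_def
    using through_complete[OF t] through_hd[OF t] through_last[OF t] through_last[OF p(2)] rt[OF p(1)] c unfolding route_def by auto
  ultimately have "t \<in> system_of D" unfolding system_of_def by blast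
  then show ?thesis using that[of Ye p e Z q f Z'] t p q eq ef unfolding t_def by blast
qed

lemma system_of_complete: "t \<in> system_of D \<Longrightarrow> complete t"
  unfolding system_of_def one_corner_def by blast

text \<open>The members \<open>p\<close> and \<open>q\<close> on the two sides of the corner have
  the same suffix \<open>Y\<close>, so they bound the suffix of any coherent path starting there
  from both sides.\<close>

lemma system_of_unique:
  assumes D: "max_clique D" and "s \<in> system_of D" "t \<in> system_of D" "hd s = hd t" "hd t \<in> LC"
  shows "s = t"
proof -
  have wcD2: "wcoh a b" if "a \<in> system_of D" "b \<in> D" for a b using that unfolding system_of_def by blast
  obtain v C where t: "hv (hd t) = Some v" "through t v [hd t] C"
    using LC_through[OF system_of_complete[OF assms(3)] assms(5)] by blast
  have "hd s \<in> LC" using assms by simp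
  then obtain w C' where "hv (hd s) = Some w" "through s w [hd s] C'"
    using LC_through[OF system_of_complete[OF assms(2)]] by blast
  then have s: "through s v [hd t] C'" using t assms(4) by auto
  obtain p q e f Z Z' Y where *: "p \<in> D" "q \<in> D" "through p v (e # Z) Y" "through q v (f # Z') Y"
    "ki e < ki (hd t)" "ki (hd t) < ki f" using system_of_corner[OF D assms(5) t(1)] by metis
  have "C1 = Y" if r: "r \<in> system_of D" "through r v [hd t] C1" for r C1
  proof -
    have "\<not> ltO C1 Y" using wcD'[OF wcD2[OF r(1) *(1)] r(2) *(3)] *(5) by auto
    moreover have "\<not> ltO Y C1" using wcD[OF wcD2[OF r(1) *(2)] r(2) *(4)] *(6) by auto
    ultimately show ?thesis using O_total[OF r(2) *(3)] by auto
  qed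
  then have "C' = C" using s t(2) assms(2,3) by metis
  then show ?thesis using through_eq[OF _ t(2)] s by blast
qed

text \<open>The starting corner is exchanged for the edge below it. A conflict in which
  \<open>s\<close> has the lower prefix thereby passes to a member of \<open>D\<close>.\<close>

lemma system_of_repl:
  assumes D: "max_clique D" and s: "s \<in> system_of D" "hd s \<in> LC" "through s v P Y"
  obtains p P' where "p \<in> D" "through p v P' Y" "\<forall>Q. ltI P Q \<longrightarrow> ltI P' Q"
proof -
  obtain w C where w: "hv (hd s) = Some w" "through s w [hd s] C"
    using LC_through[OF system_of_complete[OF s(1)] s(2)] by blast
  obtain C' p e Z where p: "hd s # C' \<in> system_of D" "through (hd s # C') w [hd s] C'" "p \<in> D"
    "through p w (e # Z) C'" "ki e < ki (hd s)" using system_of_corner[OF D s(2) w(1)] by metis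
  have "hd s # C' = s" using system_of_unique[OF D p(1) s(1)] s(2) by auto
  then have C: "C' = C" using p(2) w(2) through_unique by auto
  have P: "P = butlast P @ [hd s]" using through_hd[OF s(3)] through_ne[OF s(3)] by simp
  obtain z where z: "through s z [hd s] (rev (butlast P) @ Y)"
    using through_back[of s v "butlast P" "[hd s]" Y] P s(3) by auto
  then have "z = w" using through_vertex[OF z w(2)] by simp
  then have "C = rev (butlast P) @ Y" using through_unique[OF w(2)] z by blast
  then have "through p v (butlast P @ e # Z) Y" using through_fwd'[OF _ s(3)] p(4) C by auto
  moreover have "\<forall>Q. ltI P Q \<longrightarrow> ltI (butlast P @ e # Z) Q" using lt_lower P p(5) by metis
  ultimately show ?thesis using that p(3) by blast
qed

text \<open>Reversal alone would lower the suffix. Reversal together with negation raises it, which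
  keeps \<open>s\<close> on the same side of a conflict as in \<open>system_of_repl\<close>.\<close>

lemma system_of_repl_R:
  assumes D: "max_clique D" and s: "s \<in> system_of D" "last s \<in> RC" "through s v P Y"
  obtains p Y' where "p \<in> D" "through p v P Y'" "\<forall>Q. ltO Q Y \<longrightarrow> ltO Q Y'"
proof -
  interpret rn: cornered E tv hv "\<lambda>x. - ko x" "\<lambda>x. - ki x" RC LC "\<lambda>v. N - rk v" N
    by (rule cornered.negated[OF reversed])
  interpret rv: cornered E tv hv ko ki RC LC "\<lambda>v. N - rk v" N by (rule reversed)
  have ne: "s \<noteq> []" using s(1) one_corner_ne unfolding system_of_def by auto
  have 1: "rn.max_clique (rev ` D)" using D by (simp add: rv.max_clique_neg max_clique_rev)
  have 2: "rev s \<in> rn.system_of (rev ` D)" using s by (simp add: rv.system_of_neg system_of_rev)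
  have 3: "hd (rev s) \<in> RC" using s ne by (simp add: hd_rev)
  have 4: "rn.through (rev s) v Y P" using s by (simp add: through_rev)
  obtain p Y' where "p \<in> rev ` D" "rn.through p v Y' P" "\<forall>Q. rn.ltI Y Q \<longrightarrow> rn.ltI Y' Q"
    using rn.system_of_repl[OF 1 2 3 4] .
  then show ?thesis using that by (auto simp: through_rev)
qed

lemma path_system_system_of:
  assumes D: "max_clique D" shows "path_system (system_of D)"
  unfolding path_system_def
proof (intro conjI ballI)
  fix t assume "t \<in> system_of D" then show "one_corner t" unfolding system_of_def by blast
next
  fix c assume c: "c \<in> LC"
  then obtain v where "hv c = Some v" using LC_hv by fastforce
  then obtain C where "c # C \<in> system_of D" using system_of_corner[OF D c] by metis
  then show "\<exists>!t. t \<in> system_of D \<and> hd t = c" using system_of_unique[OF D] c by (metis list.sel(1))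
next
  interpret rv: cornered E tv hv ko ki RC LC "\<lambda>v. N - rk v" N by (rule reversed)
  have D': "rv.max_clique (rev ` D)" using D by (simp add: max_clique_rev)
  fix d assume d: "d \<in> RC"
  then obtain v where "tv d = Some v" using RC_tv by fastforce
  then obtain C where "d # C \<in> rev ` system_of D" using rv.system_of_corner[OF D' d] by (metis system_of_rev)
  then have "rev C @ [d] \<in> system_of D" by (metis imageE rev.simps(2) rev_rev_ident)
  moreover have "s = t" if "s \<in> system_of D" "t \<in> system_of D" "last s = d" "last t = d" for s t
  proof -
    have "s \<noteq> []" "t \<noteq> []" using that one_corner_ne unfolding system_of_def by auto
    then have "rev s = rev t" using rv.system_of_unique[OF D', of "rev s" "rev t"] that d
      by (simp add: system_of_rev hd_rev)
    then show ?thesis by simp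
  qed
  ultimately show "\<exists>!t. t \<in> system_of D \<and> last t = d" by (metis last_snoc)
next
  \<comment> \<open>The conflict is moved from \<open>s\<close> to a member of \<open>D\<close>, by
    lowering the left corner or raising the right corner, whichever \<open>s\<close> has. But
    \<open>t\<close> is coherent with all members.\<close>
  have "\<not> clash s t" if st: "s \<in> system_of D" "t \<in> system_of D" for s t
  proof
    assume "clash s t"
    then obtain v P Y Q Z where *: "through s v P Y" "through t v Q Z" "ltI P Q" "ltO Z Y"
      unfolding clash_def by blast
    have "\<exists>p \<in> D. \<exists>P' Y'. through p v P' Y' \<and> ltI P' Q \<and> ltO Z Y'"
    proof (cases "hd s \<in> LC")
      case True
      then show ?thesis using system_of_repl[OF D st(1) True *(1)] *(3,4) by metis
    next
      case False
      then have "last s \<in> RC" using st(1) unfolding system_of_def one_corner_def by blast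
      then show ?thesis using system_of_repl_R[OF D st(1) _ *(1)] *(3,4) by metis
    qed
    then show False using wcD'[of t, OF _ *(2)] st(2) unfolding system_of_def by blast
  qed
  then show "wcoh s t" if "s \<in> system_of D" "t \<in> system_of D" for s t using that unfolding wcoh_def by blast
qed

text \<open>One inclusion is immediate from the definitions. It is an equality because both sides
  contain exactly one path per corner.\<close>

lemma system_of_routes_of:
  assumes "path_system S" shows "system_of (routes_of S) = S"
proof
  show "S \<subseteq> system_of (routes_of S)"
    using path_systemD(1)[OF assms] wcoh_sym unfolding system_of_def routes_of_def by blast
  then show "system_of (routes_of S) \<subseteq> S"
  proof (intro subsetI)
    fix t assume sub: "S \<subseteq> system_of (routes_of S)" and t: "t \<in> system_of (routes_of S)"
    have s: "path_system (system_of (routes_of S))" using path_system_system_of max_clique_routes_of assms by blast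
    have "one_corner t" using t unfolding system_of_def by blast
    then consider "hd t \<in> LC" | "last t \<in> RC" unfolding one_corner_def by blast
    then show "t \<in> S"
    proof cases
      case 1
      then obtain t' where "t' \<in> S" "hd t' = hd t" using path_systemD(2)[OF assms] by blast
      then show ?thesis using path_systemD(5)[OF s] 1 t sub by (metis subsetD)
    next
      case 2
      then obtain t' where "t' \<in> S" "last t' = last t" using path_systemD(3)[OF assms] by blast
      then show ?thesis using path_systemD(6)[OF s] 2 t sub by (metis subsetD)
    qed
  qed
qed

lemma routes_of_system_of:
  assumes "max_clique D" shows "routes_of (system_of D) = D"
proof
  show *: "D \<subseteq> routes_of (system_of D)"
    using assms wcoh_sym unfolding system_of_def routes_of_def max_clique_def coherent_set_def by blast
  show "routes_of (system_of D) \<subseteq> D"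
  proof
    fix q assume q: "q \<in> routes_of (system_of D)"
    then have "\<forall>p \<in> D. wcoh q p" using * routes_of_clique[OF path_system_system_of[OF assms]] by blast
    then show "q \<in> D" using q assms unfolding max_clique_def routes_of_def by blast
  qed
qed

end

text \<open>Separates comparisons decided behind \<open>A\<close> from those decided within
  \<open>A\<close>, which do not see what follows.\<close>

lemma lt_append_cases:
  "lt k X (A @ Z) \<Longrightarrow> (\<exists>X'. X = A @ X' \<and> lt k X' Z) \<or> (\<forall>W. lt k X (A @ W))"
proof (induction A arbitrary: X)
  case (Cons a A)
  then obtain x X1 where X: "X = x # X1" by (cases X) auto
  show ?case
  proof (cases "k x < k a")
    case False
    then have "x = a" "lt k X1 (A @ Z)" using Cons.prems X by auto
    then show ?thesis using Cons.IH[of X1] X by auto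
  qed (use X in auto)
qed auto

section \<open>Neighbours of a system path in its clique\<close>

context cornered begin

text \<open>The vertex reached behind \<open>A\<close> depends only on \<open>A\<close> and
  \<open>w\<close>, not on the path.\<close>

lemma through_back2:
  assumes "through s w (A @ X) Y'" "through t w (A @ P) Y" "through t v P C" "X \<noteq> []"
  shows "through s v X (rev A @ Y')"
proof -
  obtain z where z: "through s z X (rev A @ Y')" using through_back assms(1,4) by blast
  obtain z' where z': "through t z' P (rev A @ Y)" using through_back assms(2) through_ne[OF assms(3)] by blast
  have "z' = v" using through_vertex[OF z' assms(3)] by simp
  moreover have "z = z'"
  proof (cases A rule: rev_cases)
    case Nil
    then have "through s z X Y'" "through s w X Y'" "through t z' P Y" "through t w P Y" using assms z z' by auto
    then show ?thesis using through_vertex[of s z X Y' s w X Y'] through_vertex[of t z' P Y t w P Y] by simp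
  next
    case (snoc B b)
    then show ?thesis using through_vertex[OF z z'] by simp
  qed
  ultimately show ?thesis using z by simp
qed

lemma system_of_LC_through:
  assumes "complete t" "hd t \<in> LC" "through t w P Y"
  obtains A v where "P = A @ [hd t]" "hv (hd t) = Some v" "through t v [hd t] (rev A @ Y)"
proof -
  have P: "P = butlast P @ [hd t]" using through_hd[OF assms(3)] through_ne[OF assms(3)] by simp
  obtain v C where v: "hv (hd t) = Some v" "through t v [hd t] C" using LC_through[OF assms(1,2)] by blast
  have "through t v [hd t] (rev (butlast P) @ Y)"
    by (rule through_back2[where s = t and t = t and w = w and Y = Y, OF _ _ v(2)]) (use P assms(3) in auto)
  then show ?thesis using that[of "butlast P" v] P v(1) by blast
qed

text \<open>The neighbour of \<open>t\<close> from below. The highest prefix of \<open>D\<close>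
  under that of \<open>t\<close> enters through the edge directly below the corner, and its suffix
  equals that of \<open>t\<close> because it is enclosed between \<open>t\<close> and a lower member
  with this suffix.\<close>

lemma system_of_pred:
  assumes D: "max_clique D" and t: "t \<in> system_of D" "hd t \<in> LC" "through t w P Y"
  obtains p A e Z where "p \<in> D" "P = A @ [hd t]" "through p w (A @ e # Z) Y" "ki e < ki (hd t)"
    "e \<in> E - LC" "hv e = hv (hd t)"
    "\<forall>x \<in> E. hv x = hv (hd t) \<longrightarrow> x = hd t \<or> ki x \<le> ki e \<or> ki (hd t) < ki x"
    "\<forall>s \<in> D. \<forall>X Y'. through s w X Y' \<longrightarrow> ltI X P \<longrightarrow> X = A @ e # Z \<or> ltI X (A @ e # Z)"
proof -
  have tw: "wcoh t s" if "s \<in> D" for s using t(1) that unfolding system_of_def by blast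
  obtain A v where v: "P = A @ [hd t]" "hv (hd t) = Some v" "through t v [hd t] (rev A @ Y)"
    using system_of_LC_through[OF system_of_complete[OF t(1)] t(2,3)] by blast
  obtain C e f p0 q Z0 Z' where *: "hd t # C \<in> system_of D" "through (hd t # C) v [hd t] C"
    "p0 \<in> D" "through p0 v (e # Z0) C" "ki e < ki (hd t)" "ki (hd t) < ki f"
    "e \<in> E - LC" "hv e = Some v"
    "\<forall>x \<in> E. hv x = Some v \<longrightarrow> x = hd t \<or> ki x \<le> ki e \<or> ki f \<le> ki x"
    using system_of_corner[OF D t(2) v(2)] by metis
  have "hd t # C = t" using system_of_unique[OF D *(1) t(1)] t(2) by simp
  then have C: "C = rev A @ Y" using through_unique[OF v(3)] *(2) by simp
  let ?I = "{X. ltI X [hd t] \<and> (\<exists>s \<in> D. \<exists>Y. through s v X Y)}"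
  have "e # Z0 \<in> ?I" using *(3-5) by auto
  then have I: "\<forall>X \<in> ?I. lhalf v X" "?I \<noteq> {}" using through_lhalf by blast+
  obtain X where X: "X \<in> ?I" "\<forall>T \<in> ?I. T = X \<or> ltI T X" by (rule max_I[OF I])
  obtain m Ym where m: "m \<in> D" "through m v X Ym" "ltI X [hd t]" using X(1) by blast
  have eX: "e # Z0 = X \<or> ltI (e # Z0) X" using X(2) \<open>e # Z0 \<in> ?I\<close> by blast
  obtain a Z where XZ: "X = a # Z" using through_ne[OF m(2)] by (cases X) auto
  have a: "a \<in> E" "hv a = Some v" "ki a < ki (hd t)" using through_hv[OF m(2)] m(3) XZ by auto
  then have "ki a \<le> ki e" using *(9) *(6) by force
  moreover have "ki e \<le> ki a" using eX XZ by auto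
  ultimately have ae: "a = e" using inji[of v] a *(7,8) by (auto simp: inj_on_def)
  \<comment> \<open>The member \<open>m\<close> lies above \<open>p0\<close>, which gives one
    inequality of suffixes, and below \<open>t\<close>, which gives the other.\<close>
  have "Ym = C" if "ltI (e # Z0) X"
  proof -
    have "wcoh p0 m" using D *(3) m(1) unfolding max_clique_def coherent_set_def by blast
    then have "\<not> ltO Ym C" using wcD[OF _ *(4) m(2)] that by blast
    moreover have "\<not> ltO C Ym" using wcD'[OF tw[OF m(1)] v(3) m(2)] m(3) C by blast
    ultimately show ?thesis using O_total[OF m(2) *(4)] by blast
  qed
  then obtain p where p: "p \<in> D" "through p v X C" using eX m *(3,4) by blast
  have pw: "through p w (A @ e # Z) Y" using through_fwd'[OF _ t(3)] p(2) C XZ ae by auto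
  have "X' = A @ e # Z \<or> ltI X' (A @ e # Z)" if s: "s \<in> D" "through s w X' Y'" "ltI X' P" for s X' Y'
  proof -
    \<comment> \<open>A prefix that branches off within \<open>A\<close> compares in the same way
      with every continuation of \<open>A\<close>; the others reach the vertex \<open>v\<close> and
      are covered by the maximality of \<open>X\<close>.\<close>
    consider X'' where "X' = A @ X''" "ltI X'' [hd t]" | "\<forall>W. ltI X' (A @ W)"
      using lt_append_cases s(3) unfolding v(1) by blast
    then show ?thesis
    proof cases
      case 1
      then have ne: "X'' \<noteq> []" by auto
      have "through s v X'' (rev A @ Y')"
        using through_back2[OF _ _ v(3) ne] s(2) t(3) unfolding 1(1) v(1) by blast
      then have "X'' \<in> ?I" using 1 s(1) by blast
      then have "X'' = X \<or> ltI X'' X" using X(2) by blast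
      then show ?thesis using 1 XZ ae by auto
    qed auto
  qed
  moreover have "\<forall>x \<in> E. hv x = hv (hd t) \<longrightarrow> x = hd t \<or> ki x \<le> ki e \<or> ki (hd t) < ki x"
    using *(6,9) v(2) by force
  ultimately show ?thesis using that[OF p(1) v(1) pw *(5,7)] *(8) v(2) by auto
qed

lemma system_of_succ:
  assumes D: "max_clique D" and t: "t \<in> system_of D" "hd t \<in> LC" "through t w P Y"
  obtains p A e Z where "p \<in> D" "P = A @ [hd t]" "through p w (A @ e # Z) Y" "ki (hd t) < ki e"
    "e \<in> E - LC" "hv e = hv (hd t)"
    "\<forall>x \<in> E. hv x = hv (hd t) \<longrightarrow> x = hd t \<or> ki e \<le> ki x \<or> ki x < ki (hd t)"
    "\<forall>s \<in> D. \<forall>X Y'. through s w X Y' \<longrightarrow> ltI P X \<longrightarrow> X = A @ e # Z \<or> ltI (A @ e # Z) X"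
proof -
  interpret ng: cornered E hv tv "\<lambda>x. - ki x" "\<lambda>x. - ko x" LC RC rk N by (rule negated)
  show ?thesis using ng.system_of_pred[of D t w P Y] assms that
    unfolding max_clique_neg system_of_neg neg_less_iff_less neg_le_iff_le lt_neg by blast
qed

lemma rev_facts:
  assumes D: "max_clique D" and t: "t \<in> system_of D" "last t \<in> RC" "through t w X Q"
  shows "cornered.max_clique E tv hv ko ki RC LC (rev ` D)" "rev t \<in> cornered.system_of E tv hv ko ki RC LC (rev ` D)"
    "hd (rev t) \<in> RC" "cornered.through E tv hv (rev t) w Q X" "hd (rev t) = last t"
proof -
  have "t \<noteq> []" using complete_ne[OF system_of_complete[OF t(1)]] .
  then show "hd (rev t) = last t" by (simp add: hd_rev)
  then show "cornered.max_clique E tv hv ko ki RC LC (rev ` D)" "rev t \<in> cornered.system_of E tv hv ko ki RC LC (rev ` D)"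
    "hd (rev t) \<in> RC" "cornered.through E tv hv (rev t) w Q X"
    using assms by (auto simp: max_clique_rev system_of_rev through_rev)
qed

lemma system_of_pred_R:
  assumes D: "max_clique D" and t: "t \<in> system_of D" "last t \<in> RC" "through t w X Q"
  obtains p A e Z where "p \<in> D" "Q = A @ [last t]" "through p w X (A @ e # Z)" "ko e < ko (last t)"
    "e \<in> E - RC" "tv e = tv (last t)"
    "\<forall>x \<in> E. tv x = tv (last t) \<longrightarrow> x = last t \<or> ko x \<le> ko e \<or> ko (last t) < ko x"
    "\<forall>s \<in> D. \<forall>X' Y. through s w X' Y \<longrightarrow> ltO Y Q \<longrightarrow> Y = A @ e # Z \<or> ltO Y (A @ e # Z)"
proof -
  interpret rv: cornered E tv hv ko ki RC LC "\<lambda>v. N - rk v" N by (rule reversed)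
  note * = rev_facts[OF assms]
  obtain p A e Z where p: "p \<in> rev ` D" "Q = A @ [last t]" "rv.through p w (A @ e # Z) X" "ko e < ko (last t)"
    "e \<in> E - RC" "tv e = tv (last t)"
    "\<forall>x \<in> E. tv x = tv (last t) \<longrightarrow> x = last t \<or> ko x \<le> ko e \<or> ko (last t) < ko x"
    and m: "\<forall>s \<in> rev ` D. \<forall>Y X'. rv.through s w Y X' \<longrightarrow> ltO Y Q \<longrightarrow> Y = A @ e # Z \<or> ltO Y (A @ e # Z)"
    using rv.system_of_pred[OF *(1-4)] unfolding *(5) by metis
  have "\<forall>s \<in> D. \<forall>X' Y. through s w X' Y \<longrightarrow> ltO Y Q \<longrightarrow> Y = A @ e # Z \<or> ltO Y (A @ e # Z)"
    using m unfolding ball_simps through_rev by blast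
  moreover have "rev p \<in> D" "through (rev p) w X (A @ e # Z)" using p(1,3) by (auto simp: through_rev through_rev')
  ultimately show ?thesis using that p(2,4-7) by blast
qed

lemma system_of_succ_R:
  assumes D: "max_clique D" and t: "t \<in> system_of D" "last t \<in> RC" "through t w X Q"
  obtains p A e Z where "p \<in> D" "Q = A @ [last t]" "through p w X (A @ e # Z)" "ko (last t) < ko e"
    "e \<in> E - RC" "tv e = tv (last t)"
    "\<forall>x \<in> E. tv x = tv (last t) \<longrightarrow> x = last t \<or> ko e \<le> ko x \<or> ko x < ko (last t)"
    "\<forall>s \<in> D. \<forall>X' Y. through s w X' Y \<longrightarrow> ltO Q Y \<longrightarrow> Y = A @ e # Z \<or> ltO (A @ e # Z) Y"
proof -
  interpret ng: cornered E hv tv "\<lambda>x. - ki x" "\<lambda>x. - ko x" LC RC rk N by (rule negated)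
  show ?thesis using ng.system_of_pred_R[of D t w X Q] assms that
    unfolding max_clique_neg system_of_neg neg_less_iff_less neg_le_iff_le lt_neg by blast
qed

text \<open>A left corner separates the two prefixes, and coherence with both members forces its
  system path to continue with their common suffix.\<close>

lemma squeeze_L:
  assumes D: "max_clique D" and p: "p \<in> D" "through p v P Y" and q: "q \<in> D" "through q v Q Y" and "ltI P Q"
  obtains t T where "t \<in> system_of D" "hd t \<in> LC" "through t v T Y" "ltI P T" "ltI T Q"
proof -
  have ends: "hd p \<notin> LC" "hd q \<notin> LC" using coherent_set_ends D p(1) q(1) unfolding max_clique_def by blast+
  from corner_between[OF p(2) q(2) assms(6) this] obtain A x P' y Q' c z where
    c: "P = A @ x # P'" "Q = A @ y # Q'" "c \<in> LC" "hv c = Some z" "ki x < ki c" "ki c < ki y"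
    "through p z (x # P') (rev A @ Y)" "through q z (y # Q') (rev A @ Y)" by metis
  obtain C where t: "c # C \<in> system_of D" "through (c # C) z [c] C" using system_of_corner[OF D c(3,4)] by metis
  have wcs: "wcoh (c # C) s" if "s \<in> D" for s using t(1) that unfolding system_of_def by blast
  have "\<not> ltO C (rev A @ Y)" using wcD'[OF wcs[OF p(1)] t(2) c(7)] c(5) by auto
  moreover have "\<not> ltO (rev A @ Y) C" using wcD[OF wcs[OF q(1)] t(2) c(8)] c(6) by auto
  ultimately have "C = rev A @ Y" using O_total[OF t(2) c(7)] by blast
  then have "through (c # C) v (A @ [c]) Y" using through_fwd'[OF _ p(2)] t(2) by auto
  then show ?thesis using that[OF t(1)] c by auto
qed

lemma squeeze_R:
  assumes D: "max_clique D" and p: "p \<in> D" "through p v X P" and q: "q \<in> D" "through q v X Q" and "ltO P Q"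
  obtains t T where "t \<in> system_of D" "last t \<in> RC" "through t v X T" "ltO P T" "ltO T Q"
proof -
  interpret rv: cornered E tv hv ko ki RC LC "\<lambda>v. N - rk v" N by (rule reversed)
  have D': "rv.max_clique (rev ` D)" using D by (simp add: max_clique_rev)
  obtain t T where t: "t \<in> rev ` system_of D" "hd t \<in> RC" "rv.through t v T X" "ltO P T" "ltO T Q"
    using rv.squeeze_L[OF D', of "rev p" v P X "rev q" Q] assms by (auto simp: through_rev system_of_rev)
  then obtain s where s: "s \<in> system_of D" "t = rev s" by blast
  moreover have "s \<noteq> []" using complete_ne[OF system_of_complete[OF s(1)]] .
  ultimately show ?thesis using that[of s T] t by (auto simp: through_rev hd_rev)
qed

text \<open>If \<open>P\<close> branches off from \<open>Q\<close> before the corner of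
  \<open>t\<close>, the member directly below \<open>t\<close> lies in between. Otherwise the member
  directly above \<open>s\<close> does.\<close>

lemma separate_L:
  assumes D: "max_clique D" and s: "s \<in> system_of D" "hd s \<in> LC" "through s w P Y"
    and t: "t \<in> system_of D" "hd t \<in> LC" "through t w Q Z" and "ltI P Q"
  obtains p X X' where "p \<in> D" "through p w X X'" "ltI P X" "ltI X Q"
proof -
  obtain p A e Z1 where p: "p \<in> D" "P = A @ [hd s]" "through p w (A @ e # Z1) Y" "ki (hd s) < ki e"
    "e \<in> E - LC" "hv e = hv (hd s)"
    "\<forall>x \<in> E. hv x = hv (hd s) \<longrightarrow> x = hd s \<or> ki e \<le> ki x \<or> ki x < ki (hd s)"
    using system_of_succ[OF D s] by metis
  obtain q B f Z2 where q: "q \<in> D" "Q = B @ [hd t]" "through q w (B @ f # Z2) Z" "ki f < ki (hd t)"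
    using system_of_pred[OF D t] by metis
  from lt_append_cases[OF assms(8)[unfolded q(2)]] show ?thesis
  proof (elim disjE exE conjE)
    fix X assume X: "P = B @ X" "ltI X [hd t]"
    have "ltI (A @ e # Z1) Q"
    proof (cases X rule: rev_cases)
      case Nil
      then show ?thesis using X by simp
    next
      case (snoc X1 x)
      then have A: "A = B @ X1" "x = hd s" using X(1) p(2) by auto
      show ?thesis
      proof (cases X1)
        case Nil
        then have lt: "ki (hd s) < ki (hd t)" using X snoc A by auto
        have vx: "hv (hd t) = hv (hd s)"
        proof -
          have Ps: "through s w (B @ [hd s]) Y" "through t w (B @ [hd t]) Z" using s t p(2) q(2) A Nil by auto
          obtain v where v: "through t v [hd t] (rev B @ Z)" using system_of_LC_through[OF system_of_complete[OF t(1)] t(2,3)] q(2) by auto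
          from through_back2[OF Ps v] through_hv[OF v] show ?thesis using through_hv by fastforce
        qed
        \<comment> \<open>Both corners sit at the same vertex. The edge directly above the first is
          at most the second, and it is different from it because it is not a corner.\<close>
        have "ki e \<le> ki (hd t)" using p(7) vx lt t(2) LCE by force
        moreover have "hd t \<noteq> e" using p(5) t(2) by blast
        then have "ki e \<noteq> ki (hd t)"
          using inji[of "the (hv e)"] p(5,6) vx t(2) LCE LC_hv[OF t(2)] by (auto simp: inj_on_def)
        ultimately show ?thesis using q(2) A Nil by auto
      next
        case (Cons a X2)
        then show ?thesis using X(2) snoc A q(2) by auto
      qed
    qed
    moreover have "ltI P (A @ e # Z1)" using p(2,4) by auto
    ultimately show ?thesis using that p by blast
  next
    assume "\<forall>W. ltI P (B @ W)"
    then show ?thesis using that[OF q(1,3)] q(2,4) by auto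
  qed
qed

lemma separate_R:
  assumes D: "max_clique D" and s: "s \<in> system_of D" "last s \<in> RC" "through s w Y P"
    and t: "t \<in> system_of D" "last t \<in> RC" "through t w Z Q" and "ltO P Q"
  obtains p X X' where "p \<in> D" "through p w X X'" "ltO P X'" "ltO X' Q"
proof -
  interpret rv: cornered E tv hv ko ki RC LC "\<lambda>v. N - rk v" N by (rule reversed)
  note 1 = rev_facts[OF D s] note 2 = rev_facts[OF D t]
  obtain p X' X where "p \<in> rev ` D" "rv.through p w X' X" "ltO P X'" "ltO X' Q"
    using rv.separate_L[OF 1(1-4) 2(2-4) assms(8)] by blast
  then show ?thesis using that by (auto simp: through_rev)
qed

lemma not_through_single: "\<not> through [x] v X Y"
proof
  assume t: "through [x] v X Y"
  have "0 < length X" "0 < length Y" using through_ne[OF t] by blast+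
  moreover have "length [x] = length X + length Y" using t unfolding through_def by (metis length_append length_rev)
  ultimately show False by (simp only: list.size)
qed

lemma complete_hd:
  assumes "complete p"
  shows "hv (hd p) = None \<and> p = [hd p] \<or> (\<exists>v Y. hv (hd p) = Some v \<and> through p v [hd p] Y \<and> p = hd p # Y)"
proof -
  consider x where "p = [x]" "hv x = None" | v X Y where "through p v X Y" using assms unfolding complete_def by blast
  then show ?thesis
  proof cases
    case (2 v X Y)
    then have "X = butlast X @ [hd p]" using through_hd[OF 2] through_ne[OF 2] by simp
    then obtain z where "through p z [hd p] (rev (butlast X) @ Y)" using through_back 2 by (metis not_Cons_self2)
    then show ?thesis using through_hv unfolding through_def by fastforce
  qed auto
qed

lemma complete_Some:
  assumes "complete p" "hd p = h" "hv h = Some v"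
  obtains Y where "through p v [h] Y" "p = h # Y"
  using complete_hd[OF assms(1), unfolded assms(2)]
proof (elim disjE exE conjE)
  assume "hv h = None"
  then show ?thesis using assms(3) by simp
next
  fix w Y assume *: "hv h = Some w" "through p w [h] Y" "p = h # Y"
  then have "w = v" using assms(3) by simp
  then show ?thesis using that[OF _ *(3)] *(2) by simp
qed

lemma complete_None: "complete p \<Longrightarrow> hd p = h \<Longrightarrow> hv h = None \<Longrightarrow> p = [h]"
proof -
  assume "complete p" "hd p = h" "hv h = None"
  from complete_hd[OF this(1), unfolded this(2)] this(3) show "p = [h]" by (elim disjE exE conjE) simp_all
qed

lemma hd_total:
  assumes "complete p" "complete q" "hd p = h" "hd q = h"
  shows "p = q \<or> ltO p q \<or> ltO q p"
proof (cases "hv h")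
  case None
  then show ?thesis using complete_None assms by blast
next
  case (Some v)
  obtain Y where p: "through p v [h] Y" "p = h # Y" using complete_Some[OF assms(1,3) Some] .
  obtain Z where q: "through q v [h] Z" "q = h # Z" using complete_Some[OF assms(2,4) Some] .
  show ?thesis using O_total[OF p(1) q(1)] unfolding p(2) q(2) by simp
qed

lemma hd_same:
  assumes "complete p" "complete q" "hd p = h" "hd q = h" "ltO p q"
  obtains v Y Z where "through p v [h] Y" "through q v [h] Z" "ltO Y Z" "p = h # Y" "q = h # Z" "hv h = Some v"
proof (cases "hv h")
  case None
  then have "p = q" using complete_None assms by blast
  then show ?thesis using assms(5) by simp
next
  case (Some v)
  obtain Y where p: "through p v [h] Y" "p = h # Y" using complete_Some[OF assms(1,3) Some] .
  obtain Z where q: "through q v [h] Z" "q = h # Z" using complete_Some[OF assms(2,4) Some] .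
  have "ltO Y Z" using assms(5) unfolding p(2) q(2) by simp
  then show ?thesis using that p q Some by blast
qed

section \<open>Purity\<close>

definition Init :: "'x set" where "Init = {x \<in> E - LC. tv x = None}"

text \<open>
  The bijection sends an initial edge to the lowest route of \<open>D\<close> starting with it, and a right
  corner \<open>d\<close> to the lowest route of \<open>D\<close> that starts with the same edge as, and lies above, the path of
  the system ending with \<open>d\<close>.
\<close>

lemma card_max_clique:
  assumes D: "max_clique D" shows "card D = card (Init \<union> RC)"
proof -
  have rt: "route p" "complete p" if "p \<in> D" for p using D that unfolding max_clique_def coherent_set_def route_def by blast+
  define R where "R x p \<longleftrightarrow> (x \<in> Init \<and> hd p = x \<and> (\<forall>s \<in> D. hd s = x \<longrightarrow> s = p \<or> ltO p s)) \<or>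
    (x \<in> RC \<and> (\<exists>t \<in> system_of D. last t = x \<and> hd p = hd t \<and> ltO t p \<and>
       (\<forall>s \<in> D. hd s = hd t \<longrightarrow> ltO t s \<longrightarrow> s = p \<or> ltO p s)))" for x p
  have dj: "x \<notin> RC" if "x \<in> Init" for x using that RC_tv[of x] unfolding Init_def by auto
  have r1: "\<exists>p \<in> D. R x p" if x: "x \<in> Init \<union> RC" for x
  proof (cases "x \<in> Init")
    case True
    show ?thesis
    proof (cases "hv x")
      case None
      have x1: "x \<in> E" "tv x = None" "x \<notin> LC" using True unfolding Init_def by auto
      then have r: "route [x]" using dj[OF True] None unfolding route_def complete_def by auto
      \<comment> \<open>A path without internal vertices has no conflicts, so it lies in every
        maximal clique, and it is the only route with this first edge.\<close>
      have xD: "[x] \<in> D" using D r not_through_single unfolding max_clique_def wcoh_def clash_def by blast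
      have "s = [x]" if "s \<in> D" "hd s = x" for s using complete_None[OF rt(2)[OF that(1)] that(2) None] .
      then have "\<forall>s \<in> D. hd s = x \<longrightarrow> s = [x] \<or> ltO [x] s" by blast
      then have "R x [x]" using True unfolding R_def by simp
      then show ?thesis using xD by blast
    next
      case (Some v)
      have x1: "x \<in> E - LC" "tv x = None" using True unfolding Init_def by auto
      let ?O = "{Y. \<exists>p \<in> D. through p v [x] Y}"
      obtain p X Y where p: "p \<in> D" "through p v (x # X) Y" using edge_covered[OF D x1(1) Some] by blast
      moreover have "X = []" using p(2) x1(2) unfolding through_def by auto
      ultimately have O: "\<forall>Y \<in> ?O. rhalf v Y" "?O \<noteq> {}" using through_rhalf by blast+
      obtain Ym where m: "Ym \<in> ?O" "\<forall>Y \<in> ?O. Y = Ym \<or> ltO Ym Y" by (rule min_O[OF O])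
      then obtain q where q: "q \<in> D" "through q v [x] Ym" by blast
      have q': "q = x # Ym" using q(2) unfolding through_def by auto
      have "s = q \<or> ltO q s" if s: "s \<in> D" "hd s = x" for s
      proof -
        obtain Y where Y: "through s v [x] Y" "s = x # Y" using complete_Some[OF rt(2)[OF s(1)] s(2) Some] .
        then have "Y \<in> ?O" using s(1) by blast
        then have "Y = Ym \<or> ltO Ym Y" using m(2) by blast
        then show ?thesis unfolding Y(2) q' by simp
      qed
      then have "\<forall>s \<in> D. hd s = x \<longrightarrow> s = q \<or> ltO q s" by blast
      then have "R x q" using True q' unfolding R_def by simp
      then show ?thesis using q(1) by blast
    qed
  next
    case False
    then have x1: "x \<in> RC" using x by auto
    obtain t where t: "t \<in> system_of D" "last t = x" using path_systemD(3)[OF path_system_system_of[OF D] x1] by blast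
    have "last t \<in> RC" using t x1 by simp
    have gpt: "complete t" using system_of_complete t(1) by blast
    obtain h where h: "hd t = h" by blast
    \<comment> \<open>Otherwise \<open>t\<close> would consist of one step with no internal tail,
      whereas a right corner has an internal tail.\<close>
    have "\<exists>v. hv h = Some v"
    proof (rule ccontr)
      assume "\<nexists>v. hv h = Some v"
      then have th: "t = [h]" using complete_None[OF gpt h] by simp
      then have "tv h = None" using gpt not_through_single unfolding complete_def by auto
      then show False using RC_tv[OF x1] th t(2) by auto
    qed
    then obtain v Y where v: "through t v [h] Y" "t = h # Y" "hv h = Some v" using complete_Some[OF gpt h] by metis
    obtain q A e Z where q: "q \<in> D" "Y = A @ [last t]" "through q v [h] (A @ e # Z)" "ko (last t) < ko e"
      and mn: "\<forall>s \<in> D. \<forall>X' Y'. through s v X' Y' \<longrightarrow> ltO Y Y' \<longrightarrow> Y' = A @ e # Z \<or> ltO (A @ e # Z) Y'"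
      using system_of_succ_R[OF D t(1) \<open>last t \<in> RC\<close> v(1)] by metis
    have q': "q = h # A @ e # Z" using q(3) unfolding through_def by simp
    have "ltO Y (A @ e # Z)" using q(4) unfolding q(2) by simp
    then have lt: "ltO t q" unfolding v(2) q' by simp
    have "s = q \<or> ltO q s" if s: "s \<in> D" "hd s = h" "ltO t s" for s
    proof -
      obtain Y' where Y': "through s v [h] Y'" "s = h # Y'" using complete_Some[OF rt(2)[OF s(1)] s(2) v(3)] .
      then have "ltO Y Y'" using s(3) unfolding v(2) Y'(2) by simp
      then have "Y' = A @ e # Z \<or> ltO (A @ e # Z) Y'" using mn s(1) Y'(1) by blast
      then show ?thesis unfolding Y'(2) q' by simp
    qed
    moreover have "hd q = h" using q' by simp
    ultimately have "R x q" unfolding R_def using x1 t h lt by (intro disjI2 conjI bexI[of _ t]) simp_all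
    then show ?thesis using q(1) by blast
  qed
  have r2: "x = x'" if x: "R x p" "R x' p" "p \<in> D" for x x' p
  proof -
    \<comment> \<open>The member directly below \<open>t\<close> has the same first edge and lies
      below \<open>p\<close>, so \<open>p\<close> is not the lowest route starting with that
      edge.\<close>
    have mixed: False if m: "y \<in> Init" "R y p" "y' \<in> RC" "R y' p" for y y'
    proof -
      have y: "hd p = y" "\<forall>s \<in> D. hd s = y \<longrightarrow> s = p \<or> ltO p s" using m dj unfolding R_def by auto
      obtain t where t: "t \<in> system_of D" "last t = y'" "hd p = hd t" "ltO t p"
        using m(3,4) dj[of y'] unfolding R_def by blast
      obtain v Y Z where v: "through t v [y] Y" "t = y # Y"
        using hd_same[OF system_of_complete[OF t(1)] rt(2)[OF x(3)] _ y(1) t(4)] t(3) y(1) by metis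
      have "last t \<in> RC" using t(2) m(3) by simp
      obtain q A e W where q: "q \<in> D" "Y = A @ [last t]" "through q v [y] (A @ e # W)" "ko e < ko (last t)"
        using system_of_pred_R[OF D t(1) \<open>last t \<in> RC\<close> v(1)] by metis
      have q': "q = y # A @ e # W" using q(3) unfolding through_def by simp
      have "ltO (A @ e # W) Y" using q(4) unfolding q(2) by simp
      then have "ltO q t" unfolding v(2) q' by simp
      then have "ltO q p" using t(4) lt_trans by blast
      moreover have "hd q = y" using q' by simp
      ultimately show False using y(2) q(1) lt_asym lt_irrefl by blast
    qed
    \<comment> \<open>Between two right-corner paths with the same first edge there is a member of
      \<open>D\<close>, so \<open>p\<close> cannot be the first member above each of them.\<close>
    have both: False if t: "t \<in> system_of D" "last t \<in> RC" "hd p = hd t" "ltO t p"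
        "\<forall>s \<in> D. hd s = hd t \<longrightarrow> ltO t s \<longrightarrow> s = p \<or> ltO p s"
      and t': "t' \<in> system_of D" "last t' \<in> RC" "hd p = hd t'" "ltO t' p" and lt: "ltO t t'" for t t'
    proof -
      obtain h where h: "hd p = h" by blast
      have ht: "hd t = h" "hd t' = h" using t(3) t'(3) h by auto
      obtain v Y Y' where v: "through t v [h] Y" "through t' v [h] Y'" "ltO Y Y'" "t = h # Y" "t' = h # Y'" "hv h = Some v"
        using hd_same[OF system_of_complete[OF t(1)] system_of_complete[OF t'(1)] ht lt] .
      obtain Z where Z: "through p v [h] Z" "p = h # Z" using complete_Some[OF rt(2)[OF x(3)] h v(6)] .
      have YZ: "ltO Y' Z" using t'(4) unfolding v(5) Z(2) by simp
      obtain q X X' where q: "q \<in> D" "through q v X X'" "ltO Y X'" "ltO X' Y'"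
        using separate_R[OF D t(1,2) v(1) t'(1,2) v(2,3)] .
      have wq: "wcoh t q" "wcoh t' q" using t(1) t'(1) q(1) unfolding system_of_def by blast+
      \<comment> \<open>The suffix of \<open>q\<close> lies strictly between those of
        \<open>t\<close> and \<open>t'\<close>. Coherence then encloses its prefix between their
        prefixes, which are both \<open>[h]\<close>.\<close>
      have "X = [h]"
        using wcO_I[OF wq(1) v(1) q(2,3)] wcO_I[OF wcoh_sym[OF wq(2)] q(2) v(2) q(4)] lt_asym by blast
      then have q': "q = h # X'" using q(2) unfolding through_def by simp
      have "ltO t q" using q(3) unfolding q' v(4) by simp
      moreover have "hd q = hd t" using q' ht by simp
      ultimately have "q = p \<or> ltO p q" using t(5) q(1) by blast
      moreover have "ltO X' Z" using q(4) YZ lt_trans by blast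
      then have "ltO q p" unfolding q' Z(2) by simp
      ultimately show False using lt_asym lt_irrefl by blast
    qed
    show ?thesis
    proof (cases "x \<in> Init")
      case True
      then have "x' \<notin> RC" using mixed x by blast
      then show ?thesis using x True dj unfolding R_def by auto
    next
      case False
      then have "x \<in> RC" using x unfolding R_def by auto
      then have "x' \<notin> Init" using mixed x by blast
      then have "x' \<in> RC" using x unfolding R_def by auto
      obtain t where t: "t \<in> system_of D" "last t = x" "hd p = hd t" "ltO t p"
        "\<forall>s \<in> D. hd s = hd t \<longrightarrow> ltO t s \<longrightarrow> s = p \<or> ltO p s" using x(1) False unfolding R_def by blast
      obtain t' where t': "t' \<in> system_of D" "last t' = x'" "hd p = hd t'" "ltO t' p"
        "\<forall>s \<in> D. hd s = hd t' \<longrightarrow> ltO t' s \<longrightarrow> s = p \<or> ltO p s" using x(2) \<open>x' \<notin> Init\<close> unfolding R_def by blast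
      have "hd t = hd t'" using t t' by simp
      then have "t = t' \<or> ltO t t' \<or> ltO t' t" using hd_total[OF system_of_complete[OF t(1)] system_of_complete[OF t'(1)]] by simp
      then show ?thesis using both[OF t(1) _ t(3-5) t'(1) _ t'(3,4)] both[OF t'(1) _ t'(3-5) t(1) _ t(3,4)]
        t(2) t'(2) \<open>x \<in> RC\<close> \<open>x' \<in> RC\<close> by auto
    qed
  qed
  \<comment> \<open>Either \<open>p\<close> is the lowest route with its first edge, or
    \<open>squeeze_R\<close> puts a right corner between \<open>p\<close> and the next lower member
    with that edge.\<close>
  have r3: "\<exists>x \<in> Init \<union> RC. R x p" if p: "p \<in> D" for p
  proof (cases "\<exists>s \<in> D. hd s = hd p \<and> ltO s p")
    case False
    have "hd p \<in> Init"
    proof -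
      have "hd p \<in> E \<and> tv (hd p) = None"
      proof -
        consider x where "x \<in> E" "p = [x]" "tv x = None" | v X Y where "through p v X Y" using rt(2)[OF p] unfolding complete_def by blast
        then show ?thesis
        proof cases
          case (2 v X Y)
          then show ?thesis using through_hd[OF 2] through_ne[OF 2] through_lhalf[OF 2] half_last half_set by (metis last_in_set subsetD)
        qed auto
      qed
      then show ?thesis using rt(1)[OF p] unfolding route_def Init_def by auto
    qed
    moreover have "s = p \<or> ltO p s" if "s \<in> D" "hd s = hd p" for s
      using hd_total[OF rt(2)[OF that(1)] rt(2)[OF p] that(2) refl] False that by blast
    ultimately show ?thesis unfolding R_def by blast
  next
    case True
    then obtain s0 where s0: "s0 \<in> D" "hd s0 = hd p" "ltO s0 p" by blast
    obtain h where h: "hd p = h" by blast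
    have h0: "hd s0 = h" using s0(2) h by simp
    obtain v Y0 Yp where v: "through s0 v [h] Y0" "through p v [h] Yp" "ltO Y0 Yp" "s0 = h # Y0" "p = h # Yp" "hv h = Some v"
      using hd_same[OF rt(2)[OF s0(1)] rt(2)[OF p] h0 h s0(3)] .
    let ?O = "{Y. ltO Y Yp \<and> (\<exists>s \<in> D. through s v [h] Y)}"
    have "Y0 \<in> ?O" using v s0 by blast
    then have O: "\<forall>Y \<in> ?O. rhalf v Y" "?O \<noteq> {}" using through_rhalf by blast+
    obtain Ym where m: "Ym \<in> ?O" "\<forall>Y \<in> ?O. Y = Ym \<or> ltO Y Ym" by (rule max_O[OF O])
    then obtain q where q: "q \<in> D" "through q v [h] Ym" "ltO Ym Yp" by blast
    obtain t T where t: "t \<in> system_of D" "last t \<in> RC" "through t v [h] T" "ltO Ym T" "ltO T Yp"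
      using squeeze_R[OF D q(1,2) p v(2) q(3)] .
    have t': "t = h # T" using t(3) unfolding through_def by simp
    have "s = p \<or> ltO p s" if s: "s \<in> D" "hd s = hd t" "ltO t s" for s
    proof (rule ccontr)
      assume no: "\<not> ?thesis"
      have hs: "hd s = h" using s(2) t' by simp
      then have sp: "ltO s p" using no hd_total[OF rt(2)[OF s(1)] rt(2)[OF p] hs h] by blast
      obtain Ys where s': "through s v [h] Ys" "s = h # Ys" using complete_Some[OF rt(2)[OF s(1)] hs v(6)] .
      have "ltO Ys Yp" using sp unfolding s'(2) v(5) by simp
      then have "Ys \<in> ?O" using s' s(1) by blast
      then have "Ys = Ym \<or> ltO Ys Ym" using m(2) by blast
      moreover have "ltO T Ys" using s(3) unfolding t' s'(2) by simp
      ultimately show False using t(4) lt_trans lt_irrefl by metis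
    qed
    moreover have "ltO t p" using t(5) unfolding t' v(5) by simp
    moreover have "hd p = hd t" using h t' by simp
    ultimately have "R (last t) p" unfolding R_def using t(1,2) by blast
    then show ?thesis using t(2) by blast
  qed
  have r4: "p = p'" if r: "R x p" "R x p'" "p \<in> D" "p' \<in> D" for x p p'
  proof (cases "x \<in> Init")
    case True
    then have "p = p' \<or> ltO p p'" "p = p' \<or> ltO p' p" using r dj unfolding R_def by blast+
    then show ?thesis using lt_asym by blast
  next
    case False
    obtain t where t: "t \<in> system_of D" "last t = x" "hd p = hd t" "ltO t p"
      "\<forall>s \<in> D. hd s = hd t \<longrightarrow> ltO t s \<longrightarrow> s = p \<or> ltO p s" using r(1) False unfolding R_def by blast
    obtain t' where t': "t' \<in> system_of D" "last t' = x" "hd p' = hd t'" "ltO t' p'"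
      "\<forall>s \<in> D. hd s = hd t' \<longrightarrow> ltO t' s \<longrightarrow> s = p' \<or> ltO p' s" using r(2) False unfolding R_def by blast
    have "x \<in> RC" using r(1) False unfolding R_def by blast
    then have "t = t'" using path_systemD(6)[OF path_system_system_of[OF D] t(1) t'(1)] t(2) t'(2) by simp
    then have "p' = p \<or> ltO p p'" "p = p' \<or> ltO p' p" using t t' r by auto
    then show ?thesis using lt_asym by blast
  qed
  define h where "h p = (SOME x. x \<in> Init \<union> RC \<and> R x p)" for p
  have h: "h p \<in> Init \<union> RC \<and> R (h p) p" if "p \<in> D" for p
  proof -
    have "\<exists>x. x \<in> Init \<union> RC \<and> R x p" using r3[OF that] by (simp only: Bex_def)
    then show ?thesis unfolding h_def by (rule someI_ex)
  qed
  have "bij_betw h D (Init \<union> RC)"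
  proof (rule bij_betw_imageI)
    show "inj_on h D"
    proof (rule inj_onI)
      fix p q assume pq: "p \<in> D" "q \<in> D" "h p = h q"
      have "R (h p) p" "R (h p) q" using h[OF pq(1)] h[OF pq(2)] pq(3) by simp_all
      then show "p = q" using r4 pq by blast
    qed
    show "h ` D = Init \<union> RC"
    proof
      show "h ` D \<subseteq> Init \<union> RC" using h by blast
      show "Init \<union> RC \<subseteq> h ` D"
      proof
        fix x assume "x \<in> Init \<union> RC"
        then obtain p where p: "p \<in> D" "R x p" using r1 by blast
        then have "h p = x" using h r2 by blast
        then show "x \<in> h ` D" using p(1) by blast
      qed
    qed
  qed
  then show ?thesis by (rule bij_betw_same_card)
qed

end

lemma lt_le_trans: "lt k a b \<Longrightarrow> b = c \<or> lt k b c \<Longrightarrow> lt k a c"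
  using lt_trans by blast

lemma le_lt_trans: "a = b \<or> lt k a b \<Longrightarrow> lt k b c \<Longrightarrow> lt k a c"
  using lt_trans by blast

lemma lt_append_cases':
  assumes "lt k (A @ Z) X"
  shows "(\<exists>X'. X = A @ X' \<and> lt k Z X') \<or> (\<forall>W. lt k (A @ W) X)"
  using lt_append_cases[of "\<lambda>x. - k x" X A Z] assms by simp

section \<open>Down bricks of a maximal clique\<close>

context cornered begin

lemma revneg: "cornered E tv hv (\<lambda>x. - ko x) (\<lambda>x. - ki x) RC LC (\<lambda>v. N - rk v) N"
  by (rule cornered.negated[OF reversed])

text \<open>On pairwise coherent paths through \<open>v\<close> this is a strict linear order:
  coherence prevents the two comparisons from pointing in opposite directions, and paths that agree
  in both are equal.\<close>

definition before :: "'v \<Rightarrow> 'x list \<Rightarrow> 'x list \<Rightarrow> bool" where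
  "before v s u \<longleftrightarrow> (\<exists>P Y T T'. through s v P Y \<and> through u v T T' \<and> (ltI P T \<or> ltO Y T'))"

definition gap :: "'x list set \<Rightarrow> 'v \<Rightarrow> 'x list \<Rightarrow> 'x list \<Rightarrow> bool" where
  "gap S v s t \<longleftrightarrow> s \<in> S \<and> t \<in> S \<and> hd s \<in> LC \<and> last t \<in> RC \<and> before v s t \<and>
     \<not> (\<exists>u \<in> S. before v s u \<and> before v u t)"

text \<open>The choice of \<open>v\<close> is harmless: by \<open>gap_along\<close> the gap is
  present at every vertex of the brick.\<close>

definition adj_bricks :: "'x list set \<Rightarrow> 'x list set" where
  "adj_bricks S = {b. \<exists>v s t P Q Y X. gap S v s t \<and> through s v P Y \<and> through t v X Q \<and> b = rev P @ Q}"

lemma before_revneg: "cornered.before E tv hv (\<lambda>x. - ko x) (\<lambda>x. - ki x) v (rev t) (rev s) \<longleftrightarrow> before v s t"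
proof -
  interpret rn: cornered E tv hv "\<lambda>x. - ko x" "\<lambda>x. - ki x" RC LC "\<lambda>v. N - rk v" N by (rule revneg)
  show ?thesis unfolding before_def rn.before_def through_rev lt_neg by blast
qed

lemma path_system_revneg: "cornered.path_system E tv hv (\<lambda>x. - ko x) (\<lambda>x. - ki x) RC LC (rev ` S) \<longleftrightarrow> path_system S"
proof -
  interpret rv: cornered E tv hv ko ki RC LC "\<lambda>v. N - rk v" N by (rule reversed)
  show ?thesis by (simp add: rv.path_system_neg path_system_rev)
qed

lemma system_of_revneg: "cornered.system_of E tv hv (\<lambda>x. - ko x) (\<lambda>x. - ki x) RC LC (rev ` S) = rev ` system_of S"
proof -
  interpret rv: cornered E tv hv ko ki RC LC "\<lambda>v. N - rk v" N by (rule reversed)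
  show ?thesis by (simp add: rv.system_of_neg system_of_rev)
qed

lemma max_clique_revneg: "cornered.max_clique E tv hv (\<lambda>x. - ko x) (\<lambda>x. - ki x) RC LC (rev ` S) \<longleftrightarrow> max_clique S"
proof -
  interpret rv: cornered E tv hv ko ki RC LC "\<lambda>v. N - rk v" N by (rule reversed)
  show ?thesis by (simp add: rv.max_clique_neg max_clique_rev)
qed

lemma wcoh_revneg: "cornered.wcoh E tv hv (\<lambda>x. - ko x) (\<lambda>x. - ki x) (rev p) (rev q) \<longleftrightarrow> wcoh p q"
proof -
  interpret rv: cornered E tv hv ko ki RC LC "\<lambda>v. N - rk v" N by (rule reversed)
  show ?thesis by (simp add: rv.wcoh_neg wcoh_rev)
qed

lemma path_system_ends:
  assumes "path_system S" "t \<in> S"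
  shows "t \<noteq> []" "complete t" "hd (rev t) = last t" "last (rev t) = hd t"
    "hd t \<in> LC \<Longrightarrow> last t \<notin> RC" "last t \<in> RC \<Longrightarrow> hd t \<notin> LC" "hd t \<notin> LC \<Longrightarrow> last t \<in> RC"
proof -
  have c: "one_corner t" using path_systemD(1)[OF assms] .
  then show "t \<noteq> []" by (rule one_corner_ne)
  then show "hd (rev t) = last t" "last (rev t) = hd t" by (auto simp: hd_rev last_rev)
  show "complete t" "hd t \<in> LC \<Longrightarrow> last t \<notin> RC" "last t \<in> RC \<Longrightarrow> hd t \<notin> LC" "hd t \<notin> LC \<Longrightarrow> last t \<in> RC"
    using c unfolding one_corner_def by blast+
qed

lemma gap_revneg:
  assumes "path_system S" "s \<in> S" "t \<in> S"
  shows "cornered.gap E tv hv (\<lambda>x. - ko x) (\<lambda>x. - ki x) RC LC (rev ` S) v (rev t) (rev s) \<longleftrightarrow> gap S v s t"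
proof -
  interpret rn: cornered E tv hv "\<lambda>x. - ko x" "\<lambda>x. - ki x" RC LC "\<lambda>v. N - rk v" N by (rule revneg)
  have ex: "(\<exists>u \<in> rev ` S. rn.before v (rev t) u \<and> rn.before v u (rev s)) \<longleftrightarrow> (\<exists>u \<in> S. before v s u \<and> before v u t)"
    unfolding bex_simps before_revneg by blast
  have e: "hd (rev t) = last t" "last (rev s) = hd s"
    using path_system_ends(4)[OF assms(1,2)] path_system_ends(3)[OF assms(1,3)] by blast+
  have m: "rev s \<in> rev ` S" "rev t \<in> rev ` S" using assms by blast+
  show ?thesis unfolding gap_def rn.gap_def before_revneg ex e using assms m by blast
qed

lemma beforeI: "through s v P Y \<Longrightarrow> through u v T T' \<Longrightarrow> ltI P T \<or> ltO Y T' \<Longrightarrow> before v s u"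
  unfolding before_def by blast

lemma beforeE: "before v s u \<Longrightarrow> through s v P Y \<Longrightarrow> through u v T T' \<Longrightarrow> ltI P T \<or> ltO Y T'"
  unfolding before_def using through_unique by blast

lemma before_le:
  assumes "wcoh s u" "before v s u" "through s v P Y" "through u v T T'"
  shows "P = T \<or> ltI P T" "Y = T' \<or> ltO Y T'"
  using beforeE[OF assms(2-4)] wcI_O[OF assms(1,3,4)] wcO_I[OF assms(1,3,4)] by blast+

lemma before_irrefl: "\<not> before v s s"
  unfolding before_def using through_unique lt_irrefl by blast

lemma not_before:
  assumes "wcoh s u" "\<not> before v s u" "through s v P Y" "through u v T T'"
  shows "T = P \<or> ltI T P" "T' = Y \<or> ltO T' Y"
  using assms(2) I_total[OF assms(3,4)] O_total[OF assms(3,4)] beforeI[OF assms(3,4)] by blast+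

lemma before_trans:
  assumes "wcoh s u" "wcoh u t" "wcoh s t" "before v s u" "before v u t"
  shows "before v s t"
proof -
  obtain P Y T T' where t: "through s v P Y" "through u v T T'" using assms(4) unfolding before_def by blast
  obtain X Q where x: "through t v X Q" using assms(5) unfolding before_def by blast
  show ?thesis
  proof (rule beforeI[OF t(1) x])
    show "ltI P X \<or> ltO Y Q"
      using beforeE[OF assms(4) t] before_le[OF assms(2,5) t(2) x] lt_le_trans by blast
  qed
qed

text \<open>Both comparisons are strict: the prefixes differ because only \<open>s\<close> starts
  with a corner, the suffixes because only \<open>t\<close> ends with one.\<close>

lemma gap_through:
  assumes "path_system S" "gap S v s t"
  obtains P Y X Q where "through s v P Y" "through t v X Q" "ltI P X" "ltO Y Q"
proof -
  have g: "s \<in> S" "t \<in> S" "hd s \<in> LC" "last t \<in> RC" "before v s t" using assms(2) unfolding gap_def by blast+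
  obtain P Y X Q where t: "through s v P Y" "through t v X Q" using g(5) unfolding before_def by blast
  have w: "wcoh s t" using path_systemD(4)[OF assms(1) g(1,2)] .
  have "P \<noteq> X" using through_hd[OF t(1)] through_hd[OF t(2)] g path_system_ends(6)[OF assms(1) g(2)] by auto
  moreover have "Y \<noteq> Q" using through_last[OF t(1)] through_last[OF t(2)] g path_system_ends(5)[OF assms(1) g(1)] by auto
  ultimately show ?thesis using that t before_le[OF w g(5) t] by blast
qed

text \<open>If \<open>s\<close> left \<open>v\<close> by another edge than \<open>y\<close>, a right
  corner between the two edges would give a system path between \<open>s\<close> and
  \<open>t\<close>. So they share \<open>y\<close>. A path between them at \<open>w\<close> must
  then enter through \<open>y\<close> too, and would already lie between them at
  \<open>v\<close>.\<close>

lemma gap_step: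
  assumes S: "path_system S" and g: "gap S v s t" and s: "through s v P Y" and t: "through t v X (y # Q)" and y: "hv y = Some w"
  obtains Y' where "Y = y # Y'" "gap S w s t" "through s w (y # P) Y'" "through t w (y # X) Q"
proof -
  have gg: "s \<in> S" "t \<in> S" "hd s \<in> LC" "last t \<in> RC" "before v s t"
    and no: "\<And>u. u \<in> S \<Longrightarrow> before v s u \<Longrightarrow> \<not> before v u t" using g unfolding gap_def by blast+
  have lt: "ltO Y (y # Q)" using gap_through[OF S g] through_unique[OF s] through_unique[OF t] by metis
  obtain a Y' where Y: "Y = a # Y'" using through_ne[OF s] by (cases Y) auto
  have "a = y"
  proof (rule ccontr)
    assume "a \<noteq> y"
    then have ko: "ko a < ko y" using lt Y by auto
    have "a \<notin> RC"
    proof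
      assume "a \<in> RC"
      then have "last s \<in> RC" using RC_final[of s v P a Y'] s Y through_last[OF s] by auto
      then show False using path_system_ends(5)[OF S gg(1)] gg(3) by blast
    qed
    moreover have "y \<notin> RC" using y RC_hv[of y] by auto
    moreover have "a \<in> E" "tv a = Some v" "y \<in> E" "tv y = Some v" using through_tv[OF s] through_tv[OF t] Y by auto
    ultimately obtain d where d: "d \<in> RC" "tv d = Some v" "ko a < ko d" "ko d < ko y"
      using R_bt[of a y v] ko by auto
    obtain u C where u: "u \<in> S" "through u v C [d]" using path_system_corner_R[OF S d(1,2)] by metis
    have "before v s u" by (rule beforeI[OF s u(2)]) (use d Y in auto)
    moreover have "before v u t" by (rule beforeI[OF u(2) t]) (use d in auto)
    ultimately show False using no u(1) by blast
  qed
  have sw: "through s w (y # P) Y'" using s Y \<open>a = y\<close> y through_step by blast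
  have tw: "through t w (y # X) Q" using t y through_step by blast
  have "gap S w s t"
    unfolding gap_def
  proof (intro conjI)
    show "before w s t" by (rule beforeI[OF sw tw]) (use lt Y \<open>a = y\<close> in auto)
    show "\<not> (\<exists>u \<in> S. before w s u \<and> before w u t)"
    proof
      assume "\<exists>u \<in> S. before w s u \<and> before w u t"
      then obtain u where u: "u \<in> S" "before w s u" "before w u t" by blast
      then obtain U U' where U: "through u w U U'" unfolding before_def by blast
      have l: "y # P = U \<or> ltI (y # P) U" "U = y # X \<or> ltI U (y # X)"
        using before_le(1)[OF path_systemD(4)[OF S gg(1) u(1)] u(2) sw U] before_le(1)[OF path_systemD(4)[OF S u(1) gg(2)] u(3) U tw] .
      obtain b U0 where Ub: "U = b # U0" using through_ne[OF U] by (cases U) auto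
      have b: "b = y"
      proof -
        have "b = y \<or> ki b < ki y" using l(2) Ub by auto
        moreover have "b = y \<or> ki y < ki b" using l(1) Ub by auto
        ultimately show ?thesis by auto
      qed
      have "tv y = Some v" using through_tv[OF t] by simp
      then have Uv: "through u v U0 (y # U')" using through_stepb U Ub b by blast
      have "before v s u" by (rule beforeI[OF s Uv]) (use beforeE[OF u(2) sw U] Ub b Y \<open>a = y\<close> in auto)
      moreover have "before v u t" by (rule beforeI[OF Uv t]) (use beforeE[OF u(3) U tw] Ub b in auto)
      ultimately show False using no u(1) by blast
    qed
  qed (use gg in auto)
  then show ?thesis using that sw tw Y \<open>a = y\<close> by blast
qed

lemma gap_fwd:
  assumes S: "path_system S"
  shows "gap S v s t \<Longrightarrow> through s v P Y \<Longrightarrow> through t v X (A @ Q) \<Longrightarrow> Q \<noteq> [] \<Longrightarrow>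
    \<exists>w Y'. Y = A @ Y' \<and> gap S w s t \<and> through s w (rev A @ P) Y' \<and> through t w (rev A @ X) Q"
proof (induction A arbitrary: v P Y X)
  case Nil
  then show ?case by auto
next
  case (Cons y A)
  have t: "through t v X (y # (A @ Q))" using Cons.prems(3) by simp
  then obtain w where w: "hv y = Some w" using Cons.prems(4) unfolding through_def by (auto split: option.splits)
  obtain Y' where *: "Y = y # Y'" "gap S w s t" "through s w (y # P) Y'" "through t w (y # X) (A @ Q)"
    using gap_step[OF S Cons.prems(1,2) t w] .
  from Cons.IH[OF *(2-4) Cons.prems(4)] show ?case using *(1) by simp
qed

lemma gap_bwd:
  assumes S: "path_system S" and g: "gap S v s t" and s: "through s v (A @ P) Y" and t: "through t v X Q" and ne: "P \<noteq> []"
  shows "\<exists>w X'. X = A @ X' \<and> gap S w s t \<and> through s w P (rev A @ Y) \<and> through t w X' (rev A @ Q)"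
proof -
  interpret rn: cornered E tv hv "\<lambda>x. - ko x" "\<lambda>x. - ki x" RC LC "\<lambda>v. N - rk v" N by (rule revneg)
  have st: "s \<in> S" "t \<in> S" using g unfolding gap_def by blast+
  have "\<exists>w X'. X = A @ X' \<and> rn.gap (rev ` S) w (rev t) (rev s) \<and> rn.through (rev t) w (rev A @ Q) X' \<and> rn.through (rev s) w (rev A @ Y) P"
    by (rule rn.gap_fwd) (use assms st in \<open>simp_all add: path_system_revneg gap_revneg through_rev\<close>)
  then show ?thesis unfolding through_rev gap_revneg[OF S st] by blast
qed

text \<open>The brick runs along the common part of \<open>s\<close> and \<open>t\<close>, and the
  gap persists along all of it in both directions.\<close>

lemma gap_along:
  assumes S: "path_system S" and g: "gap S v s t" and s: "through s v P Y" and t: "through t v X Q"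
    and b: "through (rev P @ Q) w P' Q'"
  shows "gap S w s t \<and> (\<exists>Y'. through s w P' Y') \<and> (\<exists>X'. through t w X' Q')"
proof -
  have bv: "through (rev P @ Q) v P Q" using thrI[OF through_lhalf[OF s] through_rhalf[OF t]] .
  show ?thesis using bv b
  proof (cases rule: through_cases)
    case 1
    then show ?thesis using g s t by auto
  next
    case (2 A)
    have "through s v (A @ P') Y" "P' \<noteq> []" using s 2(2) through_ne[OF b] by simp_all
    then obtain z X' where z: "gap S z s t" "through s z P' (rev A @ Y)" "through t z X' (rev A @ Q)"
      using gap_bwd[OF S g _ t] by blast
    then have "z = w" using through_vertex[OF z(2) b] by simp
    then show ?thesis using z 2(3) by blast
  next
    case (3 A)
    have "through t v X (A @ Q')" "Q' \<noteq> []" using t 3(2) through_ne[OF b] by simp_all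
    then obtain z Y' where z: "gap S z s t" "through s z (rev A @ P) Y'" "through t z (rev A @ X) Q'"
      using gap_fwd[OF S g s] by blast
    then have "z = w" using through_vertex[OF z(3) b] by simp
    then show ?thesis using z 3(3) by blast
  qed
qed

text \<open>Following the gap back to the starting corner of \<open>s\<close> shows that
  \<open>t\<close> comes in there by a step above this corner. This gives one half of the label of
  the exchange.\<close>

lemma gap_between:
  assumes S: "path_system S" and g: "gap S v s t" and s: "through s v P Y" and t: "through t v X Q"
  obtains A x Z where "P = A @ [hd s]" "X = A @ x # Z" "ki (hd s) < ki x"
proof -
  have P: "P = butlast P @ [hd s]" using through_hd[OF s] through_ne[OF s] by simp
  obtain w X' where w: "X = butlast P @ X'" "gap S w s t" "through s w [hd s] (rev (butlast P) @ Y)"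
    "through t w X' (rev (butlast P) @ Q)"
  proof -
    have "through s v (butlast P @ [hd s]) Y" using s P by metis
    from gap_bwd[OF S g this t] show ?thesis using that by blast
  qed
  have lt: "ltI [hd s] X'" using gap_through[OF S w(2)] through_unique[OF w(3)] through_unique[OF w(4)] by metis
  obtain x Z where X': "X' = x # Z" using through_ne[OF w(4)] by (cases X') auto
  then show ?thesis using that[OF P] w(1) lt by auto
qed

lemma gap_between_R:
  assumes S: "path_system S" and g: "gap S v s t" and s: "through s v P Y" and t: "through t v X Q"
  obtains A x Z where "Q = A @ [last t]" "Y = A @ x # Z" "ko x < ko (last t)"
proof -
  interpret rn: cornered E tv hv "\<lambda>x. - ko x" "\<lambda>x. - ki x" RC LC "\<lambda>v. N - rk v" N by (rule revneg)
  have st: "s \<in> S" "t \<in> S" using g unfolding gap_def by blast+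
  have 1: "rn.path_system (rev ` S)" "rn.gap (rev ` S) v (rev t) (rev s)" "rn.through (rev t) v Q X" "rn.through (rev s) v Y P"
    using assms st by (simp_all add: path_system_revneg gap_revneg through_rev)
  show ?thesis using rn.gap_between[OF 1] that path_system_ends(3)[OF S st(2)] by auto
qed

section \<open>Exchanging a route at a gap\<close>

lemma coherent_set_extend:
  assumes "coherent_set D" obtains D' where "D \<subseteq> D'" "max_clique D'"
proof -
  let ?F = "{D'. coherent_set D' \<and> D \<subseteq> D'}"
  have "?F \<subseteq> Pow {p. complete p}" unfolding coherent_set_def route_def by blast
  then have "finite ?F" using finite_complete finite_subset by (metis finite_Pow_iff)
  moreover have "?F \<noteq> {}" using assms by blast
  ultimately obtain M where M: "M \<in> ?F" "\<forall>D' \<in> ?F. M \<subseteq> D' \<longrightarrow> M = D'"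
    using finite_has_maximal[of ?F] by blast
  have "q \<in> M" if q: "route q" "\<forall>p \<in> M. wcoh q p" for q
  proof -
    have "coherent_set (insert q M)" using q M(1) wcoh_sym wcoh_refl unfolding coherent_set_def by blast
    then have "insert q M \<in> ?F" using M(1) by blast
    then show ?thesis using M(2) by blast
  qed
  then have "max_clique M" using M(1) unfolding max_clique_def by blast
  then show ?thesis using that M(1) by blast
qed

text \<open>The corner \<open>c\<close> only has to separate the first differing entries. That these
  are its two neighbours is a theorem for adjacent cliques, see
  \<open>cover_L_between\<close>.\<close>

definition between :: "('x \<Rightarrow> int) \<Rightarrow> 'x list \<Rightarrow> 'x list \<Rightarrow> 'x list \<Rightarrow> bool" where
  "between k X P X' \<longleftrightarrow> (\<exists>A x c x' Z Z'. X = A @ x # Z \<and> P = A @ [c] \<and> X' = A @ x' # Z' \<and> k x < k c \<and> k c < k x')"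

definition labels :: "'x list \<Rightarrow> 'x list \<Rightarrow> 'x list \<Rightarrow> bool" where
  "labels r r' b \<longleftrightarrow> brick b \<and> (\<exists>v X Y X' Y' P Q. through r v X Y \<and> through r' v X' Y' \<and> through b v P Q \<and>
     between ki X P X' \<and> between ko Y' Q Y)"

definition cover :: "'x list set \<Rightarrow> 'x list set \<Rightarrow> 'x list \<Rightarrow> 'x list \<Rightarrow> bool" where
  "cover D0 D r r' \<longleftrightarrow> max_clique D0 \<and> max_clique D \<and> D0 - D = {r} \<and> D - D0 = {r'}"

definition Down :: "'x list set \<Rightarrow> 'x list set" where
  "Down D = {b. \<exists>D0 r r'. cover D0 D r r' \<and> labels r r' b}"

text \<open>The prefix of \<open>t\<close> joined to the suffix of \<open>s\<close> gives the single
  member \<open>r'\<close> of \<open>D\<close> inside the gap. The prefix directly below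
  \<open>s\<close> joined to the suffix directly above \<open>t\<close> gives a route
  \<open>r\<close> that is clockwise to \<open>r'\<close> and coherent with all other members. The
  exchange keeps the cardinality, so purity makes the result maximal.\<close>

lemma adj_bricks_Down:
  assumes D: "max_clique D" shows "adj_bricks (system_of D) \<subseteq> Down D"
proof
  let ?S = "system_of D"
  have S: "path_system ?S" using path_system_system_of[OF D] .
  have cl: "coherent_set D" using D unfolding max_clique_def by blast
  fix b assume "b \<in> adj_bricks ?S"
  then obtain v s t P Q Y X where g: "gap ?S v s t" and s: "through s v P Y" and t: "through t v X Q" and b: "b = rev P @ Q"
    unfolding adj_bricks_def by blast
  have gg: "s \<in> ?S" "t \<in> ?S" "hd s \<in> LC" "last t \<in> RC"
    and no: "\<And>u. u \<in> ?S \<Longrightarrow> before v s u \<Longrightarrow> \<not> before v u t" using g unfolding gap_def by blast+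
  have lt: "ltI P X" "ltO Y Q" using gap_through[OF S g] through_unique[OF s] through_unique[OF t] by metis+
  have wcS: "wcoh a c" if "a \<in> ?S" "c \<in> D" for a c using that unfolding system_of_def by blast
  define r' where "r' = rev X @ Y"
  have r': "through r' v X Y" unfolding r'_def using thrI[OF through_lhalf[OF t] through_rhalf[OF s]] .
  have "wcoh r' u" if u: "u \<in> ?S" for u
  proof (rule wcoh_split[OF r'])
    have w: "wcoh s u" "wcoh u t" "wcoh t u" using path_systemD(4)[OF S] gg u by blast+
    show "compat_left u X" using compat_left_wcoh[OF t w(3)] .
    show "compat_right u Y" using compat_right_wcoh[OF s w(1)] .
    fix T T' assume T: "through u v T T'"
    \<comment> \<open>No system path lies inside the gap, so \<open>u\<close> is weakly below
      \<open>s\<close> or weakly above \<open>t\<close>.\<close>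
    consider "\<not> before v s u" | "\<not> before v u t" using no u by blast
    then show "\<not> (ltI X T \<and> ltO T' Y) \<and> \<not> (ltI T X \<and> ltO Y T')"
    proof cases
      case 1
      have "ltI T X" "T' = Y \<or> ltO T' Y" using not_before[OF w(1) 1 s T] le_lt_trans lt(1) by blast+
      then show ?thesis using lt_asym by (metis lt_irrefl)
    next
      case 2
      have "X = T \<or> ltI X T" "ltO Y T'" using not_before[OF w(2) 2 T t] lt_le_trans[OF lt(2), of T'] by blast+
      then show ?thesis using lt_asym by (metis lt_irrefl)
    qed
  qed
  moreover have rr': "route r'" unfolding route_def
    using through_complete[OF r'] through_hd[OF r'] through_hd[OF t] through_last[OF r'] through_last[OF s]
      path_system_ends(6)[OF S gg(2,4)] path_system_ends(5)[OF S gg(1,3)] by simp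
  ultimately have r'D: "r' \<in> D" using routes_of_system_of[OF D] unfolding routes_of_def by blast
  obtain p A e Z where p: "p \<in> D" "P = A @ [hd s]" "through p v (A @ e # Z) Y" "ki e < ki (hd s)"
    and pmax: "\<forall>u \<in> D. \<forall>T T'. through u v T T' \<longrightarrow> ltI T P \<longrightarrow> T = A @ e # Z \<or> ltI T (A @ e # Z)"
    using system_of_pred[OF D gg(1,3) s] by metis
  obtain q B f W where q: "q \<in> D" "Q = B @ [last t]" "through q v X (B @ f # W)" "ko (last t) < ko f"
    and qmin: "\<forall>u \<in> D. \<forall>T T'. through u v T T' \<longrightarrow> ltO Q T' \<longrightarrow> T' = B @ f # W \<or> ltO (B @ f # W) T'"
    using system_of_succ_R[OF D gg(2,4) t] by metis
  define Ir where "Ir = A @ e # Z"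
  define Or where "Or = B @ f # W"
  define r where "r = rev Ir @ Or"
  have r: "through r v Ir Or" unfolding r_def using thrI through_lhalf[OF p(3)] through_rhalf[OF q(3)] unfolding Ir_def Or_def by blast
  have IP: "ltI Ir P" unfolding Ir_def p(2) using p(4) by simp
  have QO: "ltO Q Or" unfolding Or_def q(2) using q(4) by simp
  have wr: "wcoh r u" if u: "u \<in> D" "u \<noteq> r'" for u
  proof (rule wcoh_split[OF r])
    have w: "wcoh p u" "wcoh q u" "wcoh u r'" using cl p(1) q(1) u r'D unfolding coherent_set_def by blast+
    have ws: "wcoh s u" "wcoh t u" using wcS gg u by blast+
    show "compat_left u Ir" using compat_left_wcoh[OF p(3) w(1)] unfolding Ir_def .
    show "compat_right u Or" using compat_right_wcoh[OF q(3) w(2)] unfolding Or_def .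
    fix T T' assume T: "through u v T T'"
    have "T \<noteq> P" using through_hd[OF T] through_hd[OF s] gg(3) coherent_set_ends[OF cl u(1)] by auto
    moreover have "T' \<noteq> Q" using through_last[OF T] through_last[OF t] gg(4) coherent_set_ends[OF cl u(1)] by auto
    \<comment> \<open>In the first two cases \<open>u\<close> lies outside the gap and is bounded by
      the neighbours chosen for \<open>r\<close>. In the third it lies inside, and if it were not
      \<open>r'\<close>, a system path separating it from \<open>r'\<close> would lie inside as
      well.\<close>
    ultimately consider "ltI T P" | "ltI P T" "ltO Q T'" | "ltI P T" "ltO T' Q"
      using I_total[OF T s] O_total[OF T t] by blast
    then show "\<not> (ltI Ir T \<and> ltO T' Or) \<and> \<not> (ltI T Ir \<and> ltO Or T')"
    proof cases
      case 1
      have a: "T = Ir \<or> ltI T Ir" using pmax u(1) T 1 unfolding Ir_def by blast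
      have "\<not> ltO Y T'" using wcD'[OF ws(1) s T 1] .
      then have "T' = Y \<or> ltO T' Y" using O_total[OF T s] by blast
      then have "ltO T' Or" using le_lt_trans lt(2) QO lt_trans by blast
      then show ?thesis using a lt_asym lt_irrefl by blast
    next
      case 2
      have a: "T' = Or \<or> ltO Or T'" using qmin u(1) T 2(2) unfolding Or_def by blast
      have "ltI Ir T" using IP 2(1) lt_trans by blast
      then show ?thesis using a lt_asym lt_irrefl by blast
    next
      case 3
      have YT: "Y = T' \<or> ltO Y T'" using wcI_O[OF ws(1) s T 3(1)] .
      have TX: "T = X \<or> ltI T X" using wcO_I[OF wcoh_sym[OF ws(2)] T t 3(2)] .
      show ?thesis
      proof (cases "T = X")
        case False
        then have TX: "ltI T X" using TX by blast
        then have "T' = Y" using wcD[OF w(3) T r' TX] YT by blast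
        then have "through u v T Y" using T by blast
        obtain t1 T1 where t1: "t1 \<in> ?S" "through t1 v T1 Y" "ltI T T1" "ltI T1 X"
          using squeeze_L[OF D u(1) \<open>through u v T Y\<close> r'D r' TX] .
        have "before v s t1" by (rule beforeI[OF s t1(2)]) (use 3(1) t1(3) lt_trans in blast)
        moreover have "before v t1 t" by (rule beforeI[OF t1(2) t]) (use t1(4) in blast)
        ultimately show ?thesis using no t1(1) by blast
      next
        case True
        then have "T' \<noteq> Y" using through_eq r' T u(2) by blast
        then have lt1: "ltO Y T'" using YT by blast
        have TX: "through u v X T'" using T True by blast
        obtain t1 T1 where t1: "t1 \<in> ?S" "through t1 v X T1" "ltO Y T1" "ltO T1 T'"
          using squeeze_R[OF D r'D r' u(1) TX lt1] .
        have "before v s t1" by (rule beforeI[OF s t1(2)]) (use t1(3) in blast)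
        moreover have "before v t1 t" by (rule beforeI[OF t1(2) t]) (use t1(4) 3(2) lt_trans in blast)
        ultimately show ?thesis using no t1(1) by blast
      qed
    qed
  qed
  have "clash r r'" unfolding clash_def
    using r r' lt_trans[OF IP lt(1)] lt_trans[OF lt(2) QO] by blast
  then have rD: "r \<notin> D" using r'D cl unfolding coherent_set_def wcoh_def by blast
  have "route r" unfolding route_def
    using through_complete[OF r] through_hd[OF r] through_last[OF r] through_hd[OF p(3)] through_last[OF q(3)]
      coherent_set_ends[OF cl p(1)] coherent_set_ends[OF cl q(1)] unfolding Ir_def Or_def by simp
  define D0 where "D0 = insert r (D - {r'})"
  have cl0: "coherent_set D0" unfolding D0_def coherent_set_def
    using \<open>route r\<close> cl wr wcoh_sym wcoh_refl unfolding coherent_set_def by blast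
  \<comment> \<open>Any maximal extension has as many elements as \<open>D\<close>, hence as
    \<open>D0\<close>, and so is \<open>D0\<close>.\<close>
  obtain D' where D': "D0 \<subseteq> D'" "max_clique D'" using coherent_set_extend[OF cl0] .
  have "card D' = card D" using card_max_clique D D'(2) by simp
  moreover have "card D0 = card D"
  proof -
    have "finite D" using coherent_set_finite[OF cl] .
    then have "card D0 = Suc (card (D - {r'}))" unfolding D0_def using rD by simp
    then show ?thesis using card_Suc_Diff1[OF \<open>finite D\<close> r'D] by simp
  qed
  moreover have "finite D'" using coherent_set_finite D'(2) unfolding max_clique_def by blast
  ultimately have "D0 = D'" using D'(1) card_subset_eq by metis
  then have mc0: "max_clique D0" using D'(2) by simp
  have "r \<noteq> r'" using rD r'D by blast
  then have cov: "cover D0 D r r'" unfolding cover_def using mc0 D rD r'D unfolding D0_def by blast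
  have bt: "through b v P Q" unfolding b using thrI[OF through_lhalf[OF s] through_rhalf[OF t]] .
  obtain A' x' Z' where x': "P = A' @ [hd s]" "X = A' @ x' # Z'" "ki (hd s) < ki x'"
    using gap_between[OF S g s t] .
  obtain B' y' W' where y': "Q = B' @ [last t]" "Y = B' @ y' # W'" "ko y' < ko (last t)"
    using gap_between_R[OF S g s t] .
  have "A' = A" using x'(1) p(2) by simp
  then have "between ki Ir P X" unfolding between_def Ir_def using x' p(4) by blast
  moreover have "B' = B" using y'(1) q(2) by simp
  then have "between ko Y Q Or" unfolding between_def Or_def using y' q(4) by blast
  moreover have "brick b" unfolding brick_def
    using through_complete[OF bt] through_hd[OF bt] through_hd[OF s] through_last[OF bt] through_last[OF t] gg by simp
  ultimately have "labels r r' b" unfolding labels_def using r r' bt by blast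
  then show "b \<in> Down D" unfolding Down_def using cov by blast
qed

end

text \<open>The place of the first difference depends on the two lists only; this identifies corners
  found in different ways.\<close>

lemma first_diff:
  assumes "A @ e # Z = B @ x # W" "A @ f # Z' = B @ y # W'" "e \<noteq> f" "x \<noteq> y"
  shows "A = B \<and> e = x \<and> f = y"
  using assms
proof (induction A arbitrary: B)
  case Nil
  then show ?case by (cases B) auto
next
  case (Cons a A)
  then show ?case by (cases B) auto
qed

section \<open>Routes exchanged between adjacent maximal cliques\<close>

context cornered begin

lemma cover_swap: "cover D0 D r r' \<longleftrightarrow> cover D D0 r' r"
  unfolding cover_def by blast

lemma cover_D:
  assumes "cover D0 D r r'"
  shows "max_clique D0" "max_clique D" "coherent_set D0" "coherent_set D" "r \<in> D0" "r' \<in> D" "r \<notin> D" "r' \<notin> D0"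
    "u \<in> D \<Longrightarrow> u = r' \<or> u \<in> D0" "u \<in> D0 \<Longrightarrow> u = r \<or> u \<in> D"
  using assms unfolding cover_def max_clique_def by blast+

lemma resolve:
  assumes c: "cover D0 D r r'"
    and "through r v X Y" "through r' v X' Y'" "(ltI X X' \<and> ltO Y' Y) \<or> (ltI X' X \<and> ltO Y Y')"
  shows "rev X @ Y' \<in> D \<and> rev X @ Y' \<in> D0"
  using assms(2-4)
proof (induction "rk v" arbitrary: v X Y X' Y' rule: less_induct)
  case less
  note r = less.prems(1) and r' = less.prems(2) and cf = less.prems(3)
  note cD = cover_D[OF c]
  define p where "p = rev X @ Y'"
  have p: "through p v X Y'" unfolding p_def using thrI[OF through_lhalf[OF r] through_rhalf[OF r']] .
  have "compat_left r' X" unfolding compat_left_def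
  proof (intro allI impI, elim conjE)
    fix A x P z T T' assume X: "X = A @ x # P" and z: "tv x = Some z" and t: "through r' z T T'"
    have rz: "through r z P (x # rev A @ Y)"
    proof -
      obtain w where "through r w (x # P) (rev A @ Y)" using through_back r X by blast
      then show ?thesis using z through_stepb by auto
    qed
    obtain y T'' where T': "T' = y # T''" using through_ne[OF t] by (cases T') auto
    have "False" if clash: "(ltI P T \<and> ltO T' (x # rev A @ Y)) \<or> (ltI T P \<and> ltO (x # rev A @ Y) T')" and ne: "y \<noteq> x"
    proof -
      have "lhalf v ((A @ [x]) @ P)" using through_lhalf[OF r] X by simp
      then have rk: "rk z < rk v" using rk_append[of v "A @ [x]" P z] through_lhalf[OF rz] by simp
      have pz: "rev P @ T' \<in> D" "rev P @ T' \<in> D0" using less.hyps[OF rk rz t clash] by blast+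
      have pzz: "through (rev P @ T') z P T'" using thrI[OF through_lhalf[OF rz] through_rhalf[OF t]] .
      obtain A' where A': "A' \<noteq> []" "T' = A' @ Y'" "X' = rev A' @ T"
        using through_cases[OF t r'] rk by (metis less_asym less_irrefl)
      have pzv: "through (rev P @ T') v (rev A' @ P) Y'" using through_fwd'[OF _ r'] pzz A'(2) by simp
      have w: "wcoh (rev P @ T') r" using cD(3,5) pz(2) unfolding coherent_set_def by blast
      \<comment> \<open>\<open>r\<close> cannot reach \<open>v\<close> along the part
        \<open>A'\<close> of \<open>r'\<close>, as it leaves \<open>z\<close> by a different edge.
        The comparison of \<open>r\<close> and \<open>r'\<close> before \<open>v\<close> is
        therefore decided within \<open>A'\<close>, where the recombination made at \<open>z\<close>
        agrees with \<open>r'\<close>.\<close>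
      have no: False if "X = rev A' @ W" "W \<noteq> []" for W
      proof -
        have "through r v (rev A' @ W) Y" using r that by simp
        moreover have "through r' v (rev A' @ T) Y'" using r' A'(3) by simp
        ultimately have "through r z W (rev (rev A') @ Y)" using through_back2 t that(2) by blast
        then have "rev (rev A') @ Y = x # rev A @ Y" using through_unique[OF rz] by blast
        then have "hd A' = x" using A'(1) by (cases A') auto
        moreover have "hd A' = y" using A'(1,2) T' by (cases A') auto
        ultimately show False using ne by simp
      qed
      from cf show False
      proof
        assume *: "ltI X X' \<and> ltO Y' Y"
        then have "ltI X (rev A' @ T)" using A'(3) by simp
        from lt_append_cases[OF this] have "ltI X (rev A' @ P)" using no by (metis lt.simps(2))
        then show False using wcD'[OF w pzv r] * by blast
      next
        assume *: "ltI X' X \<and> ltO Y Y'"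
        then have "ltI (rev A' @ T) X" using A'(3) by simp
        from lt_append_cases'[OF this] have "ltI (rev A' @ P) X" using no by (metis lt_Nil)
        then show False using wcD[OF w pzv r] * by blast
      qed
    qed
    then show "(ko (hd T') < ko x \<longrightarrow> \<not> ltI P T) \<and> (ko x < ko (hd T') \<longrightarrow> \<not> ltI T P)"
      using T' by auto
  qed
  moreover have "compat_right r' Y'" using compat_right_wcoh[OF r' wcoh_refl] .
  ultimately have pr': "wcoh p r'"
    by (rule wcoh_split[OF p]) (use through_unique[OF r'] lt_irrefl in blast)
  have pu: "wcoh p u" if u: "u \<in> D" "u \<in> D0" for u
  proof (rule wcoh_split[OF p])
    have w: "wcoh r u" "wcoh r' u" using cD u unfolding coherent_set_def by blast+
    show "compat_left u X" using compat_left_wcoh[OF r w(1)] .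
    show "compat_right u Y'" using compat_right_wcoh[OF r' w(2)] .
    fix T T' assume T: "through u v T T'"
    from cf show "\<not> (ltI X T \<and> ltO T' Y') \<and> \<not> (ltI T X \<and> ltO Y' T')"
    proof
      assume "ltI X X' \<and> ltO Y' Y"
      then show ?thesis
        using wcD[OF w(1) r T] wcD'[OF w(2) r' T] lt_trans[of ki T X X'] lt_trans[of ko T' Y' Y] by blast
    next
      assume "ltI X' X \<and> ltO Y Y'"
      then show ?thesis
        using wcD'[OF w(1) r T] wcD[OF w(2) r' T] lt_trans[of ki X' X T] lt_trans[of ko Y Y' T'] by blast
    qed
  qed
  have "wcoh p u" if "u \<in> D" for u using pr' pu cD(9) that by blast
  moreover have "route p" unfolding route_def
    using through_complete[OF p] through_hd[OF p] through_hd[OF r] through_last[OF p] through_last[OF r']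
      coherent_set_ends[OF cD(3,5)] coherent_set_ends[OF cD(4,6)] by simp
  ultimately have pD: "p \<in> D" using cD(2) unfolding max_clique_def by blast
  have "X \<noteq> X'" using cf lt_irrefl by auto
  then have "p \<noteq> r'" using through_unique[OF p] r' by blast
  then show ?case using pD cD(9) unfolding p_def by blast
qed

lemma resolve':
  assumes c: "cover D0 D r r'" and "through r v X Y" "through r' v X' Y'" "ltI X X'" "ltO Y' Y"
  shows "rev X @ Y' \<in> D" "rev X @ Y' \<in> D0" "rev X' @ Y \<in> D" "rev X' @ Y \<in> D0"
    "through (rev X @ Y') v X Y'" "through (rev X' @ Y) v X' Y"
proof -
  show "rev X @ Y' \<in> D" "rev X @ Y' \<in> D0" using resolve[OF c assms(2,3)] assms(4,5) by blast+
  have "cover D D0 r' r" using c cover_swap by blast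
  then show "rev X' @ Y \<in> D" "rev X' @ Y \<in> D0" using resolve[OF _ assms(3,2)] assms(4,5) by blast+
  show "through (rev X @ Y') v X Y'" "through (rev X' @ Y) v X' Y" using thrI through_lhalf through_rhalf assms(2,3) by blast+
qed

text \<open>The member of \<open>D\<close> directly above \<open>u\<close> conflicts with
  \<open>r\<close>, so it is \<open>r'\<close>. The member directly below is common to both cliques;
  coherence with \<open>r\<close> makes its prefix at most \<open>X\<close>, and the recombination
  with prefix \<open>X\<close> makes it at least \<open>X\<close>. So the corner of \<open>u\<close>
  sits exactly where \<open>r\<close> and \<open>r'\<close> part.\<close>

lemma cover_L:
  assumes c: "cover D0 D r r'" and r: "through r v X Y" and r': "through r' v X' Y'" and lt: "ltI X X'" "ltO Y' Y"
    and u: "u \<in> system_of D" "through u v U U'" "ltI X U" "ltI U X'"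
  obtains A e f Z Z' where "U' = Y'" "X = A @ e # Z" "X' = A @ f # Z'" "U = A @ [hd u]" "hd u \<in> LC"
    "ki e < ki (hd u)" "ki (hd u) < ki f" "hv e = hv (hd u)"
    "\<forall>x \<in> E. hv x = hv (hd u) \<longrightarrow> x = hd u \<or> ki x \<le> ki e \<or> ki f \<le> ki x"
proof -
  note cD = cover_D[OF c]
  note R = resolve'[OF c r r' lt]
  have S: "path_system (system_of D)" using path_system_system_of cD(2) by blast
  have w: "wcoh u m" if "m \<in> D" for m using u(1) that unfolding system_of_def by blast
  have U': "U' = Y'"
    using wcD'[OF w[OF R(1)] u(2) R(5) u(3)] wcD[OF w[OF cD(6)] u(2) r' u(4)] O_total[OF u(2) r'] by blast
  have "last u \<notin> RC" using through_last[OF u(2)] through_last[OF r'] U' coherent_set_ends[OF cD(4,6)] by simp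
  then have L: "hd u \<in> LC" using path_system_ends(7)[OF S u(1)] by blast
  have wr: "wcoh m r" if "m \<in> D0" for m using cD(3,5) that unfolding coherent_set_def by blast
  obtain m A f Z1 where m: "m \<in> D" "U = A @ [hd u]" "through m v (A @ f # Z1) U'" "ki (hd u) < ki f"
    "\<forall>x \<in> E. hv x = hv (hd u) \<longrightarrow> x = hd u \<or> ki f \<le> ki x \<or> ki x < ki (hd u)"
    using system_of_succ[OF cD(2) u(1) L u(2)] by metis
  obtain m' A' e Z2 where m': "m' \<in> D" "U = A' @ [hd u]" "through m' v (A' @ e # Z2) U'" "ki e < ki (hd u)"
    "hv e = hv (hd u)" "\<forall>x \<in> E. hv x = hv (hd u) \<longrightarrow> x = hd u \<or> ki x \<le> ki e \<or> ki (hd u) < ki x"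
    and mx: "\<forall>s \<in> D. \<forall>T Y'. through s v T Y' \<longrightarrow> ltI T U \<longrightarrow> T = A' @ e # Z2 \<or> ltI T (A' @ e # Z2)"
    using system_of_pred[OF cD(2) u(1) L u(2)] by metis
  have "A' = A" using m(2) m'(2) by simp
  have "ltI U (A @ f # Z1)" unfolding m(2) using m(4) by simp
  then have "ltI X (A @ f # Z1)" using u(3) lt_trans by blast
  then have "m \<notin> D0" using wcD'[OF wr m(3) r] lt(2) U' by blast
  then have "m = r'" using cD(9) m(1) by blast
  then have X': "X' = A @ f # Z1" using through_unique[OF r'] m(3) by blast
  have "ltI (A @ e # Z2) U" unfolding m(2) using m'(4) by simp
  then have "ltI (A @ e # Z2) X'" using u(4) lt_trans by blast
  then have "A @ e # Z2 \<noteq> X'" by auto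
  then have "m' \<noteq> r'" using through_unique[OF r'] m'(3) \<open>A' = A\<close> by blast
  then have "m' \<in> D0" using cD(9) m'(1) by blast
  then have "\<not> ltI X (A @ e # Z2)" using wcD'[OF wr m'(3) r] lt(2) U' \<open>A' = A\<close> by blast
  moreover have "X = A @ e # Z2 \<or> ltI X (A @ e # Z2)" using mx R(1,5) u(3) \<open>A' = A\<close> by blast
  ultimately have X: "X = A @ e # Z2" by blast
  have "\<forall>x \<in> E. hv x = hv (hd u) \<longrightarrow> x = hd u \<or> ki x \<le> ki e \<or> ki f \<le> ki x"
    using m(5) m'(6) by fastforce
  then show ?thesis using that[OF U' X X' m(2) L m'(4) m(4) m'(5)] by blast
qed

text \<open>Converse of \<open>cover_L\<close>: the system path of a corner between the first
  differing edges is enclosed between \<open>r'\<close> and the recombination, both with suffix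
  \<open>Y'\<close>, and follows them. Then \<open>cover_L\<close> shows that these edges are the
  neighbours of the corner.\<close>

lemma cover_L_between:
  assumes c: "cover D0 D r r'" and r: "through r v X Y" and r': "through r' v X' Y'" and lt: "ltI X X'" "ltO Y' Y"
    and d: "X = A @ x # Z" "X' = A @ x' # Z'" "c \<in> LC" "hv c = hv x" "ki x < ki c" "ki c < ki x'"
  obtains u where "u \<in> system_of D" "hd u = c" "through u v (A @ [c]) Y'"
    "\<forall>y \<in> E. hv y = hv c \<longrightarrow> y = c \<or> ki y \<le> ki x \<or> ki x' \<le> ki y"
proof -
  note cD = cover_D[OF c]
  note R = resolve'[OF c r r' lt]
  have S: "path_system (system_of D)" using path_system_system_of cD(2) by blast
  have "through (rev X @ Y') v (A @ x # Z) Y'" using R(5) d(1) by metis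
  then obtain z where z: "through (rev X @ Y') z (x # Z) (rev A @ Y')" using through_back by blast
  have r'z: "through r' z (x' # Z') (rev A @ Y')"
  proof (rule through_back2)
    show "through r' v (A @ x' # Z') Y'" using r' d by simp
    show "through (rev X @ Y') v (A @ x # Z) Y'" using R(5) d by simp
  qed (use z in auto)
  have hvc: "hv c = Some z" using through_hv[OF z] d(4) by simp
  obtain u C where u: "u \<in> system_of D" "through u z [c] C" "hd u = c" using path_system_corner[OF S d(3) hvc] by metis
  have w: "wcoh u m" if "m \<in> D" for m using u(1) that unfolding system_of_def by blast
  have "C = rev A @ Y'"
    using wcD'[OF w[OF R(1)] u(2) z] wcD[OF w[OF cD(6)] u(2) r'z] O_total[OF u(2) r'z] d(5,6) by auto
  then have uv: "through u v (A @ [c]) Y'" using through_fwd'[OF _ r'] u(2) by blast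
  have between: "ltI X (A @ [c])" "ltI (A @ [c]) X'" using d by auto
  obtain A1 e f Z1 Z2 where a: "X = A1 @ e # Z1" "X' = A1 @ f # Z2" "A @ [c] = A1 @ [hd u]"
    "\<forall>y \<in> E. hv y = hv (hd u) \<longrightarrow> y = hd u \<or> ki y \<le> ki e \<or> ki f \<le> ki y"
    using cover_L[OF c r r' lt u(1) uv between] by metis
  have "A1 = A" using a(3) by simp
  then have "e = x" "f = x'" using a(1,2) d(1,2) by auto
  then show ?thesis using that[OF u(1,3) uv] a(4) u(3) by simp
qed

lemma cover_corner:
  assumes c: "cover D0 D r r'" and r: "through r v X Y" and r': "through r' v X' Y'" and lt: "ltI X X'" "ltO Y' Y"
  obtains A x Z x' Z' c where "X = A @ x # Z" "X' = A @ x' # Z'" "c \<in> LC" "hv c = hv x" "hv x' = hv x"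
    "ki x < ki c" "ki c < ki x'" "x \<in> E - LC" "x' \<in> E - LC"
    "\<forall>y \<in> E. hv y = hv c \<longrightarrow> y = c \<or> ki y \<le> ki x \<or> ki x' \<le> ki y"
proof -
  note cD = cover_D[OF c]
  have "hd r \<notin> LC" "hd r' \<notin> LC" using coherent_set_ends cD by blast+
  from corner_between[OF r r' lt(1) this] obtain A x Z x' Z' c z where
    d: "X = A @ x # Z" "X' = A @ x' # Z'" "c \<in> LC" "hv c = Some z" "ki x < ki c" "ki c < ki x'"
    "x \<in> E - LC" "x' \<in> E - LC" "hv x = Some z" "hv x' = Some z" by metis
  then have "hv c = hv x" by simp
  from cover_L_between[OF c r r' lt d(1-3) this d(5,6)] show ?thesis using that d by metis
qed

lemma cover_revneg: "cornered.cover E tv hv (\<lambda>x. - ko x) (\<lambda>x. - ki x) RC LC (rev ` D0) (rev ` D) (rev r) (rev r')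
  \<longleftrightarrow> cover D0 D r r'"
proof -
  interpret rn: cornered E tv hv "\<lambda>x. - ko x" "\<lambda>x. - ki x" RC LC "\<lambda>v. N - rk v" N by (rule revneg)
  have i: "inj (rev :: 'x list \<Rightarrow> 'x list)" by (simp add: inj_def)
  have "rev ` A - rev ` B = {rev a} \<longleftrightarrow> A - B = {a}" for A B and a :: "'x list"
    using image_set_diff[OF i, of A B] inj_image_eq_iff[OF i, of "A - B" "{a}"] by simp
  then show ?thesis unfolding cover_def rn.cover_def max_clique_revneg by simp
qed

lemma cover_R_between:
  assumes c: "cover D0 D r r'" and r: "through r v X Y" and r': "through r' v X' Y'" and lt: "ltI X X'" "ltO Y' Y"
    and d: "Y = A @ x # Z" "Y' = A @ x' # Z'" "c \<in> RC" "tv c = tv x" "ko x' < ko c" "ko c < ko x"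
  obtains u where "u \<in> system_of D" "last u = c" "through u v X' (A @ [c])"
    "\<forall>y \<in> E. tv y = tv c \<longrightarrow> y = c \<or> ko y \<le> ko x' \<or> ko x \<le> ko y"
proof -
  interpret rn: cornered E tv hv "\<lambda>x. - ko x" "\<lambda>x. - ki x" RC LC "\<lambda>v. N - rk v" N by (rule revneg)
  have c': "rn.cover (rev ` D0) (rev ` D) (rev r) (rev r')" using c cover_revneg by blast
  have S: "path_system (system_of D)" using path_system_system_of cover_D(2)[OF c] by blast
  have 1: "rn.through (rev r) v Y X" "rn.through (rev r') v Y' X'" "rn.ltI Y Y'" "rn.ltO X' X"
    "- ko x < - ko c" "- ko c < - ko x'"
    using assms by (simp_all add: through_rev)
  obtain u where u: "u \<in> rn.system_of (rev ` D)" "hd u = c" "rn.through u v (A @ [c]) X'"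
    and nb: "\<forall>y \<in> E. tv y = tv c \<longrightarrow> y = c \<or> - ko y \<le> - ko x \<or> - ko x' \<le> - ko y"
    using rn.cover_L_between[OF c' 1(1-4) d(1-4) 1(5,6)] .
  have nb': "\<forall>y \<in> E. tv y = tv c \<longrightarrow> y = c \<or> ko y \<le> ko x' \<or> ko x \<le> ko y" using nb by fastforce
  obtain w where w: "u = rev w" "w \<in> system_of D" using u(1) unfolding system_of_revneg by blast
  then show ?thesis using that[OF w(2) _ _ nb'] u path_system_ends(3)[OF S w(2)] by (simp add: through_rev)
qed

lemma cover_R:
  assumes c: "cover D0 D r r'" and r: "through r v X Y" and r': "through r' v X' Y'" and lt: "ltI X X'" "ltO Y' Y"
    and u: "u \<in> system_of D" "through u v U U'" "ltO Y' U'" "ltO U' Y"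
  obtains A e f Z Z' where "Y = A @ e # Z" "Y' = A @ f # Z'" "U' = A @ [last u]" "last u \<in> RC"
    "ko f < ko (last u)" "ko (last u) < ko e" "tv e = tv (last u)"
    "\<forall>x \<in> E. tv x = tv (last u) \<longrightarrow> x = last u \<or> ko x \<le> ko f \<or> ko e \<le> ko x"
proof -
  interpret rn: cornered E tv hv "\<lambda>x. - ko x" "\<lambda>x. - ki x" RC LC "\<lambda>v. N - rk v" N by (rule revneg)
  have c': "rn.cover (rev ` D0) (rev ` D) (rev r) (rev r')" using c cover_revneg by blast
  have S: "path_system (system_of D)" using path_system_system_of cover_D(2)[OF c] by blast
  have e: "hd (rev u) = last u" using path_system_ends(3)[OF S u(1)] .
  have 1: "rn.through (rev r) v Y X" "rn.through (rev r') v Y' X'" "rev u \<in> rn.system_of (rev ` D)" "rn.through (rev u) v U' U"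
    "rn.ltI Y Y'" "rn.ltO X' X" "rn.ltI Y U'" "rn.ltI U' Y'"
    using assms by (simp_all add: through_rev system_of_revneg)
  obtain A e f Z Z' where *: "Y = A @ e # Z" "Y' = A @ f # Z'" "U' = A @ [last u]" "last u \<in> RC"
    "- ko e < - ko (last u)" "- ko (last u) < - ko f" "tv e = tv (last u)"
    "\<forall>x \<in> E. tv x = tv (last u) \<longrightarrow> x = last u \<or> - ko x \<le> - ko e \<or> - ko f \<le> - ko x"
    using rn.cover_L[OF c' 1(1,2,5,6,3,4,7,8)] unfolding e by metis
  have "\<forall>x \<in> E. tv x = tv (last u) \<longrightarrow> x = last u \<or> ko x \<le> ko f \<or> ko e \<le> ko x"
    using *(8) by fastforce
  then show ?thesis using that[OF *(1-4)] *(5-7) by simp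
qed

lemma cover_corner_R:
  assumes c: "cover D0 D r r'" and r: "through r v X Y" and r': "through r' v X' Y'" and lt: "ltI X X'" "ltO Y' Y"
  obtains A x Z x' Z' c where "Y = A @ x # Z" "Y' = A @ x' # Z'" "c \<in> RC" "tv c = tv x" "tv x' = tv x"
    "ko x' < ko c" "ko c < ko x" "x \<in> E - RC" "x' \<in> E - RC"
    "\<forall>y \<in> E. tv y = tv c \<longrightarrow> y = c \<or> ko y \<le> ko x' \<or> ko x \<le> ko y"
proof -
  interpret rn: cornered E tv hv "\<lambda>x. - ko x" "\<lambda>x. - ki x" RC LC "\<lambda>v. N - rk v" N by (rule revneg)
  have c': "rn.cover (rev ` D0) (rev ` D) (rev r) (rev r')" using c cover_revneg by blast
  have 1: "rn.through (rev r) v Y X" "rn.through (rev r') v Y' X'" "rn.ltI Y Y'" "rn.ltO X' X"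
    using assms by (simp_all add: through_rev)
  obtain A x Z x' Z' c where *: "Y = A @ x # Z" "Y' = A @ x' # Z'" "c \<in> RC" "tv c = tv x" "tv x' = tv x"
    "- ko x < - ko c" "- ko c < - ko x'" "x \<in> E - RC" "x' \<in> E - RC"
    "\<forall>y \<in> E. tv y = tv c \<longrightarrow> y = c \<or> - ko y \<le> - ko x \<or> - ko x' \<le> - ko y"
    using rn.cover_corner[OF c' 1] by metis
  have "\<forall>y \<in> E. tv y = tv c \<longrightarrow> y = c \<or> ko y \<le> ko x' \<or> ko x \<le> ko y"
    using *(10) by fastforce
  then show ?thesis using that[OF *(1-5) _ _ *(8,9)] *(6,7) by simp
qed

text \<open>The corners of the label belong to system paths \<open>s\<close> and \<open>t\<close>. A
  system path between these lies strictly between \<open>r\<close> and \<open>r'\<close> either in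
  its prefix or, with the prefix of \<open>r'\<close>, in its suffix; \<open>cover_L\<close> and
  \<open>cover_R\<close> then identify it with \<open>s\<close> or \<open>t\<close>.\<close>

lemma Down_adj_bricks:
  assumes "b \<in> Down D" shows "b \<in> adj_bricks (system_of D)"
proof -
  obtain D0 r r' where c: "cover D0 D r r'" and l: "labels r r' b" using assms unfolding Down_def by blast
  obtain v X Y X' Y' P Q where r: "through r v X Y" and r': "through r' v X' Y'" and b: "through b v P Q"
    and bi: "between ki X P X'" and bo: "between ko Y' Q Y" and bk: "hd b \<in> LC" "last b \<in> RC"
    using l unfolding labels_def brick_def by blast
  note cD = cover_D[OF c]
  have S: "path_system (system_of D)" using path_system_system_of cD(2) by blast
  obtain A x h x' Z Z' where i: "X = A @ x # Z" "P = A @ [h]" "X' = A @ x' # Z'" "ki x < ki h" "ki h < ki x'"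
    using bi unfolding between_def by blast
  obtain B y k y' W W' where o: "Y' = B @ y' # W'" "Q = B @ [k]" "Y = B @ y # W" "ko y' < ko k" "ko k < ko y"
    using bo unfolding between_def by blast
  have h: "h \<in> LC" using through_hd[OF b] bk i(2) by simp
  have k: "k \<in> RC" using through_last[OF b] bk o(2) by simp
  have lt: "ltI X X'" "ltO Y' Y" using i o by auto
  obtain z where z: "through b z [h] (rev A @ Q)" using through_back b i(2) by blast
  have rz: "through r z (x # Z) (rev A @ Y)"
  proof (rule through_back2)
    show "through r v (A @ x # Z) Y" using r i by simp
    show "through b v (A @ [h]) Q" using b i by simp
  qed (use z in auto)
  have hh: "hv h = hv x" using through_hv[OF rz] through_hv[OF z] by simp
  obtain s where s: "s \<in> system_of D" "hd s = h" "through s v (A @ [h]) Y'"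
    using cover_L_between[OF c r r' lt i(1,3) h hh i(4,5)] by metis
  have kk: "tv k = tv y"
  proof -
    interpret rv: cornered E tv hv ko ki RC LC "\<lambda>v. N - rk v" N by (rule reversed)
    have 1: "rv.through (rev b) v (B @ [k]) P" "rv.through (rev r) v (B @ y # W) X"
      using b r o by (simp_all add: through_rev)
    obtain z where z: "rv.through (rev b) z [k] (rev B @ P)" using rv.through_back 1(1) by blast
    have "rv.through (rev r) z (y # W) (rev B @ X)" using rv.through_back2[OF 1(2,1) z] by simp
    then show ?thesis using rv.through_hv[OF z] rv.through_hv by (metis list.sel(1))
  qed
  obtain t where t: "t \<in> system_of D" "last t = k" "through t v X' (B @ [k])"
    using cover_R_between[OF c r r' lt o(3,1) k kk o(4,5)] by metis
  have sP: "through s v P Y'" and tQ: "through t v X' Q" using s t i o by simp_all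
  have PX: "ltI X P" "ltI P X'" and QY: "ltO Y' Q" "ltO Q Y" using i o by auto
  have "gap (system_of D) v s t" unfolding gap_def
  proof (intro conjI)
    show "before v s t" using beforeI[OF sP tQ] PX by blast
    show "\<not> (\<exists>u \<in> system_of D. before v s u \<and> before v u t)"
    proof
      assume "\<exists>u \<in> system_of D. before v s u \<and> before v u t"
      then obtain u where u: "u \<in> system_of D" "before v s u" "before v u t" by blast
      obtain U U' where U: "through u v U U'" using u(2) unfolding before_def by blast
      have w: "wcoh s u" "wcoh u t" using path_systemD(4)[OF S] s t u by blast+
      have l1: "P = U \<or> ltI P U" "Y' = U' \<or> ltO Y' U'" using before_le[OF w(1) u(2) sP U] .
      have l2: "U = X' \<or> ltI U X'" "U' = Q \<or> ltO U' Q" using before_le[OF w(2) u(3) U tQ] .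
      have XU: "ltI X U" using lt_le_trans[OF PX(1)] l1(1) by blast
      have UY: "ltO U' Y" using le_lt_trans[OF l2(2) QY(2)] .
      show False
      proof (cases "U = X'")
        case False
        then have "ltI U X'" using l2 by blast
        then obtain A1 e f Z1 Z2 where *: "X = A1 @ e # Z1" "X' = A1 @ f # Z2" "U = A1 @ [hd u]" "hd u \<in> LC"
          "ki e < ki (hd u)" "ki (hd u) < ki f" "hv e = hv (hd u)"
          "\<forall>x \<in> E. hv x = hv (hd u) \<longrightarrow> x = hd u \<or> ki x \<le> ki e \<or> ki f \<le> ki x"
          using cover_L[OF c r r' lt u(1) U XU] by metis
        have "A1 = A \<and> e = x \<and> f = x'"
        proof (rule first_diff)
          show "A1 @ e # Z1 = A @ x # Z" "A1 @ f # Z2 = A @ x' # Z'" using *(1,2) i(1,3) by simp_all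
          show "e \<noteq> f" "x \<noteq> x'" using *(5,6) i(4,5) by auto
        qed
        then have "h = hd u \<or> ki h \<le> ki x \<or> ki x' \<le> ki h" using *(7,8) hh h LCE by auto
        then have "hd u = h" using i(4,5) by auto
        then have "u = s" using path_systemD(5)[OF S u(1) s(1)] s(2) h by simp
        then show False using u(2) before_irrefl by blast
      next
        case True
        \<comment> \<open>Otherwise \<open>u\<close> would be the route \<open>r'\<close>, which has
          no corner.\<close>
        have "U' \<noteq> Y'"
        proof
          assume "U' = Y'"
          then have "u = r'" using through_eq U r' True by blast
          then show False using u(1) coherent_set_ends[OF cD(4,6)] path_system_ends(7)[OF S u(1)] by blast
        qed
        then have "ltO Y' U'" using l1 by blast
        then obtain A1 e f Z1 Z2 where *: "Y = A1 @ e # Z1" "Y' = A1 @ f # Z2" "U' = A1 @ [last u]" "last u \<in> RC"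
          "ko f < ko (last u)" "ko (last u) < ko e" "tv e = tv (last u)"
          "\<forall>x \<in> E. tv x = tv (last u) \<longrightarrow> x = last u \<or> ko x \<le> ko f \<or> ko e \<le> ko x"
          using cover_R[OF c r r' lt u(1) U _ UY] by metis
        have "A1 = B \<and> e = y \<and> f = y'"
        proof (rule first_diff)
          show "A1 @ e # Z1 = B @ y # W" "A1 @ f # Z2 = B @ y' # W'" using *(1,2) o(1,3) by simp_all
          show "e \<noteq> f" "y \<noteq> y'" using *(5,6) o(4,5) by auto
        qed
        then have "k = last u \<or> ko k \<le> ko y' \<or> ko y \<le> ko k" using *(7,8) kk k RCE by auto
        then have "last u = k" using o(4,5) by auto
        then have "u = t" using path_systemD(6)[OF S u(1) t(1)] t(2) k by simp
        then show False using u(3) before_irrefl by blast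
      qed
    qed
  qed (use s t h k in auto)
  moreover have "b = rev P @ Q" using b unfolding through_def by blast
  ultimately show ?thesis unfolding adj_bricks_def using sP tQ by blast
qed

theorem Down_eq: "max_clique D \<Longrightarrow> Down D = adj_bricks (system_of D)"
  using adj_bricks_Down Down_adj_bricks by blast

end

lemma in_rev_image: "t \<in> rev ` A \<longleftrightarrow> rev t \<in> A"
proof
  assume "rev t \<in> A"
  then have "rev (rev t) \<in> rev ` A" by (rule imageI)
  then show "t \<in> rev ` A" by simp
qed auto

section \<open>The path system of a brick clique\<close>

context cornered begin

abbreviation leI where "leI X P \<equiv> X = P \<or> ltI X P"
abbreviation leO where "leO X P \<equiv> X = P \<or> ltO X P"

text \<open>The last clause says that every higher edge is blocked by a brick. Equality
  \<open>X = P\<close> counts as lying above, because a path has to follow the brick that shares its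
  starting corner. A brick that ends at \<open>v\<close> blocks by its right corner, which is itself
  never chosen.\<close>

definition next_step :: "'x list set \<Rightarrow> 'v \<Rightarrow> 'x list \<Rightarrow> 'x \<Rightarrow> bool" where
  "next_step B v X y \<longleftrightarrow> y \<in> E - RC \<and> tv y = Some v \<and>
     (\<forall>b \<in> B. \<forall>P Q. through b v P Q \<longrightarrow> leI X P \<longrightarrow> ko y \<le> ko (hd Q)) \<and>
     (\<forall>y' \<in> E - RC. tv y' = Some v \<longrightarrow> ko y < ko y' \<longrightarrow>
        (\<exists>b \<in> B. \<exists>P Q. through b v P Q \<and> leI X P \<and> ko (hd Q) < ko y'))"

fun follows :: "'x list set \<Rightarrow> 'x list \<Rightarrow> 'x list \<Rightarrow> bool" where
  "follows B X [] \<longleftrightarrow> True"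
| "follows B X (y # Y) \<longleftrightarrow> (\<exists>v. hv (hd X) = Some v \<and> next_step B v X y) \<and> follows B (y # X) Y"

definition left_paths :: "'x list set \<Rightarrow> 'x list set" where
  "left_paths B = {t. complete t \<and> hd t \<in> LC \<and> (\<forall>v X Y. through t v X Y \<longrightarrow> follows B X Y)}"

text \<open>The test for the order of a left path with prefix \<open>X\<close> and a right path with
  suffix \<open>Q\<close>: by \<open>left_right_cases\<close> the left path comes first exactly when
  some brick fits between them.\<close>

definition spanned :: "'x list set \<Rightarrow> 'v \<Rightarrow> 'x list \<Rightarrow> 'x list \<Rightarrow> bool" where
  "spanned B v X Q \<longleftrightarrow> (\<exists>b \<in> B. \<exists>P' Q'. through b v P' Q' \<and> leI X P' \<and> leO Q' Q)"

lemma spanned_revneg: "cornered.spanned E tv hv (\<lambda>x. - ko x) (\<lambda>x. - ki x) (rev ` B) v Q X \<longleftrightarrow> spanned B v X Q"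
proof -
  interpret rn: cornered E tv hv "\<lambda>x. - ko x" "\<lambda>x. - ki x" RC LC "\<lambda>v. N - rk v" N by (rule revneg)
  show ?thesis unfolding spanned_def rn.spanned_def bex_simps through_rev lt_neg by blast
qed

lemma lowest_out:
  assumes "x \<in> E" "hv x = Some u"
  obtains f where "f \<in> E - RC" "tv f = Some u" "\<forall>y \<in> E. tv y = Some u \<longrightarrow> y = f \<or> ko f < ko y"
proof -
  interpret rv: cornered E tv hv ko ki RC LC "\<lambda>v. N - rk v" N by (rule reversed)
  show ?thesis using rv.lowest_in[OF assms] that .
qed

text \<open>The lowest edge out of \<open>v\<close> is never blocked, so the finite set of
  admissible edges has a maximum.\<close>

lemma next_step_exists:
  assumes "lhalf v X" shows "\<exists>y. next_step B v X y"
proof -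
  obtain x X' where X: "X = x # X'" using assms by (cases X) auto
  then have "x \<in> E" "hv x = Some v" using assms by auto
  then obtain f where f: "f \<in> E - RC" "tv f = Some v" "\<forall>y \<in> E. tv y = Some v \<longrightarrow> y = f \<or> ko f < ko y"
    using lowest_out by blast
  let ?F = "{y \<in> E - RC. tv y = Some v \<and> (\<forall>b \<in> B. \<forall>P Q. through b v P Q \<longrightarrow> leI X P \<longrightarrow> ko y \<le> ko (hd Q))}"
  have "ko f \<le> ko (hd Q)" if "through b v P Q" for b P Q
    using through_tv[OF that] f(3) by fastforce
  then have "f \<in> ?F" using f by blast
  then have fin: "finite (ko ` ?F)" "ko ` ?F \<noteq> {}" using finE by auto
  obtain y where y: "y \<in> ?F" "Max (ko ` ?F) = ko y" using Max_in[OF fin] by blast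
  have "\<exists>b \<in> B. \<exists>P Q. through b v P Q \<and> leI X P \<and> ko (hd Q) < ko y'"
    if y': "y' \<in> E - RC" "tv y' = Some v" "ko y < ko y'" for y'
  proof (rule ccontr)
    assume no: "\<not> ?thesis"
    then have "\<forall>b \<in> B. \<forall>P Q. through b v P Q \<longrightarrow> leI X P \<longrightarrow> ko y' \<le> ko (hd Q)" by (meson not_le)
    then have "y' \<in> ?F" using y' by blast
    then have "ko y' \<le> ko y" using Max_ge[OF fin(1)] y(2) by (metis (no_types, lifting) imageI)
    then show False using y'(3) by simp
  qed
  then have "next_step B v X y" unfolding next_step_def using y(1) by blast
  then show ?thesis by blast
qed

lemma next_step_le: "next_step B v X y \<Longrightarrow> b \<in> B \<Longrightarrow> through b v P Q \<Longrightarrow> leI X P \<Longrightarrow> ko y \<le> ko (hd Q)"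
  unfolding next_step_def by blast

lemma next_step_unique: "next_step B v X y \<Longrightarrow> next_step B v X z \<Longrightarrow> y = z"
proof -
  have "\<not> ko y < ko z" if "next_step B v X y" "next_step B v X z" for y z
    using that unfolding next_step_def by (meson not_le)
  note le = this
  assume s: "next_step B v X y" "next_step B v X z"
  have "ko y = ko z" using le[OF s] le[OF s(2,1)] by simp
  moreover have "y \<in> {x \<in> E. tv x = Some v}" "z \<in> {x \<in> E. tv x = Some v}" using s unfolding next_step_def by blast+
  ultimately show "y = z" using inj_onD[OF injo] by blast
qed

lemma follows_exists:
  assumes "lhalf v X" shows "\<exists>Y. rhalf v Y \<and> follows B X Y \<and> last Y \<notin> RC"
  using assms
proof (induction "N - rk v" arbitrary: v X rule: less_induct)
  case less
  obtain y where y: "next_step B v X y" using next_step_exists less.prems by blast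
  have hX: "hv (hd X) = Some v" using less.prems by (cases X) auto
  have ye: "y \<in> E" "y \<notin> RC" "tv y = Some v" using y unfolding next_step_def by blast+
  show ?case
  proof (cases "hv y")
    case None
    then show ?thesis using ye y hX by (intro exI[of _ "[y]"]) auto
  next
    case (Some w)
    have "rk v < rk w" "rk w \<le> N" using rk[OF ye(1,3) Some] rk_hv[OF ye(1) Some] .
    then have "N - rk w < N - rk v" by linarith
    moreover have "lhalf w (y # X)" using less.prems ye Some by simp
    ultimately obtain Y where Y: "rhalf w Y" "follows B (y # X) Y" "last Y \<notin> RC" using less.hyps by blast
    then have "Y \<noteq> []" by auto
    then show ?thesis using Y ye Some hX y by (intro exI[of _ "y # Y"]) auto
  qed
qed

lemma follows_unique:
  assumes "follows B X Y" "follows B X Y'" "lhalf v X" "rhalf v Y" "rhalf v Y'" shows "Y = Y'"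
  using assms
proof (induction Y arbitrary: v X Y')
  case (Cons y Y)
  obtain z Z where Y': "Y' = z # Z" using Cons.prems(5) by (cases Y') auto
  have z: "z = y" using Cons.prems(1,2) Y' next_step_unique by (metis follows.simps(2) option.inject)
  show ?case
  proof (cases "hv y")
    case None
    then show ?thesis using Cons.prems Y' z by auto
  next
    case (Some w)
    then have "Y = Z" using Cons.IH[of "y # X" Z w] Cons.prems Y' z by auto
    then show ?thesis using Y' z by simp
  qed
qed simp

lemma follows_append: "follows B X (A @ Y) \<Longrightarrow> follows B (rev A @ X) Y"
  by (induction A arbitrary: X) auto

lemma follows_all:
  assumes "through t v [c] C" "follows B [c] C" "through t w X Y" "c \<in> LC"
  shows "follows B X Y"
proof -
  have hd: "hd t = c" using through_hd[OF assms(1)] by simp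
  obtain A u where A: "X = A @ [c]" "through t u [c] (rev A @ Y)"
    using system_of_LC_through[OF through_complete[OF assms(1)] _ assms(3)] hd assms(4) by metis
  have "u = v" using through_vertex[OF A(2) assms(1)] by simp
  then have "C = rev A @ Y" using A(2) through_unique[OF assms(1)] by blast
  then show ?thesis using follows_append[of B "[c]" "rev A" Y] assms(2) A(1) by simp
qed

lemma left_paths_exists:
  assumes "c \<in> LC" obtains t where "t \<in> left_paths B" "hd t = c"
proof -
  obtain v where v: "hv c = Some v" using LC_hv[OF assms] by auto
  have lc: "lhalf v [c]" using assms LCE LC_tv v by auto
  obtain C where C: "rhalf v C" "follows B [c] C" using follows_exists[OF lc] by blast
  have t: "through (c # C) v [c] C" using thrI[OF lc C(1)] by simp
  have "c # C \<in> left_paths B" unfolding left_paths_def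
    using through_complete[OF t] assms follows_all[OF t C(2) _ assms] by auto
  then show ?thesis using that by simp
qed

lemma left_paths_unique:
  assumes "s \<in> left_paths B" "t \<in> left_paths B" "hd s = hd t" shows "s = t"
proof -
  have g: "complete s" "complete t" "hd s \<in> LC" "hd t \<in> LC" using assms unfolding left_paths_def by blast+
  obtain v C where s: "hv (hd s) = Some v" "through s v [hd s] C" using LC_through[OF g(1,3)] by blast
  obtain w C' where t: "hv (hd t) = Some w" "through t w [hd t] C'" using LC_through[OF g(2,4)] by blast
  have "w = v" using s t assms(3) by simp
  then have t': "through t v [hd s] C'" using t assms(3) by simp
  have "follows B [hd s] C" "follows B [hd s] C'" using assms(1,2) s(2) t' unfolding left_paths_def by blast+
  then have "C = C'" using follows_unique through_lhalf[OF s(2)] through_rhalf[OF s(2)] through_rhalf[OF t'] by blast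
  then show ?thesis using through_eq[OF s(2)] t' by blast
qed

lemma follows_last: "follows B X Y \<Longrightarrow> Y \<noteq> [] \<Longrightarrow> last Y \<notin> RC"
  by (induction Y arbitrary: X) (auto simp: next_step_def)

lemma left_paths_one_corner: "t \<in> left_paths B \<Longrightarrow> one_corner t"
proof -
  assume t: "t \<in> left_paths B"
  then have g: "complete t" "hd t \<in> LC" unfolding left_paths_def by blast+
  obtain v C where s: "through t v [hd t] C" using LC_through[OF g] by blast
  then have "follows B [hd t] C" using t unfolding left_paths_def by blast
  then have "last t \<notin> RC" using follows_last through_ne[OF s] through_last[OF s] by auto
  then show ?thesis using g unfolding one_corner_def by blast
qed

text \<open>A higher prefix is restricted by fewer bricks, so its greedy continuation cannot be
  lower.\<close>

lemma follows_mono: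
  assumes "follows B X Y" "follows B X' Y'" "lhalf v X" "lhalf v X'" "rhalf v Y" "rhalf v Y'" "ltI X X'"
  shows "\<not> ltO Y' Y"
  using assms
proof (induction Y arbitrary: v X X' Y')
  case (Cons y Y)
  obtain z Z where Y': "Y' = z # Z" using Cons.prems(6) by (cases Y') auto
  have hX: "hv (hd X) = Some v" "hv (hd X') = Some v" using Cons.prems(3,4) by (cases X; cases X'; auto)+
  then have st: "next_step B v X y" "next_step B v X' z" using Cons.prems(1,2) Y' by auto
  have "\<not> ko z < ko y"
  proof
    assume lt: "ko z < ko y"
    have "y \<in> E - RC" "tv y = Some v" using st(1) unfolding next_step_def by blast+
    then obtain b P Q where b: "b \<in> B" "through b v P Q" "leI X' P" "ko (hd Q) < ko y"
      using st(2) lt unfolding next_step_def by blast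
    have "leI X P" using lt_le_trans[OF Cons.prems(7)] b(3) by blast
    then show False using next_step_le[OF st(1) b(1,2)] b(4) by simp
  qed
  moreover have "\<not> ltO Z Y" if "z = y"
  proof (cases "hv y")
    case None
    then show ?thesis using Cons.prems(5) by auto
  next
    case (Some w)
    have "y \<in> E" "tv y = Some v" using st(1) unfolding next_step_def by blast+
    then show ?thesis
      using Cons.IH[of "y # X" "y # X'" Z w] Cons.prems Y' that Some by auto
  qed
  ultimately show ?case using Y' by auto
qed simp

lemma left_paths_wcoh: "s \<in> left_paths B \<Longrightarrow> t \<in> left_paths B \<Longrightarrow> wcoh s t"
proof -
  have "\<not> clash s t" if "s \<in> left_paths B" "t \<in> left_paths B" for s t
  proof
    assume "clash s t"
    then obtain v X Y X' Y' where *: "through s v X Y" "through t v X' Y'" "ltI X X'" "ltO Y' Y"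
      unfolding clash_def by blast
    then have "follows B X Y" "follows B X' Y'" using that unfolding left_paths_def by blast+
    then show False using follows_mono * through_lhalf through_rhalf by metis
  qed
  then show "s \<in> left_paths B \<Longrightarrow> t \<in> left_paths B \<Longrightarrow> wcoh s t" unfolding wcoh_def by blast
qed

text \<open>The greedy edge does not rise above the brick, and the brick does not rise above
  \<open>y # Q\<close>. Both edges being \<open>y\<close>, the brick has to take \<open>y\<close> as
  well.\<close>

lemma spanned_fwd:
  assumes "spanned B v X (y # Q)" "next_step B v X y" "hv y = Some w"
  shows "spanned B w (y # X) Q"
proof -
  obtain b P' Q' where b: "b \<in> B" "through b v P' Q'" "leI X P'" "leO Q' (y # Q)"
    using assms(1) unfolding spanned_def by blast
  obtain z Q'' where Q': "Q' = z # Q''" using through_ne[OF b(2)] by (cases Q') auto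
  have "ko y \<le> ko z" using next_step_le[OF assms(2) b(1-3)] Q' by simp
  then have z: "z = y" "leO Q'' Q" using b(4) Q' by auto
  then have "through b w (y # P') Q''" using through_step b(2) Q' assms(3) by blast
  then show ?thesis unfolding spanned_def using b z by (metis lt.simps(1))
qed

lemma spanned_bwd:
  assumes "spanned B w (y # X) Q" "cornered.next_step E tv hv (\<lambda>x. - ko x) (\<lambda>x. - ki x) LC (rev ` B) w Q y" "tv y = Some v"
  shows "spanned B v X (y # Q)"
proof -
  interpret rn: cornered E tv hv "\<lambda>x. - ko x" "\<lambda>x. - ki x" RC LC "\<lambda>v. N - rk v" N by (rule revneg)
  show ?thesis using rn.spanned_fwd[of "rev ` B" w Q y X v] assms unfolding spanned_revneg by blast
qed

text \<open>The greedy edge is at most that of the brick, which is at most that of \<open>Q\<close>.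
  Equality carries the brick along to the next vertex. This cannot go on to the end, since the brick
  ends in a right corner and the greedy path does not.\<close>

lemma spanned_lt:
  assumes "\<forall>b \<in> B. last b \<in> RC" "spanned B v X Q" "follows B X Y" "lhalf v X" "rhalf v Y" "rhalf v Q"
  shows "ltO Y Q"
  using assms(2-)
proof (induction Y arbitrary: v X Q)
  case (Cons y Y)
  obtain q Q0 where Q: "Q = q # Q0" using Cons.prems(5) by (cases Q) auto
  have hX: "hv (hd X) = Some v" using Cons.prems(3) by (cases X) auto
  then have st: "next_step B v X y" using Cons.prems(2) by auto
  have ye: "y \<in> E" "y \<notin> RC" "tv y = Some v" using st unfolding next_step_def by blast+
  obtain b P' Q' where b: "b \<in> B" "through b v P' Q'" "leI X P'" "leO Q' Q"
    using Cons.prems(1) unfolding spanned_def by blast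
  obtain z Q'' where Q': "Q' = z # Q''" using through_ne[OF b(2)] by (cases Q') auto
  have yz: "ko y \<le> ko z" using next_step_le[OF st b(1-3)] Q' by simp
  have zq: "z = q \<or> ko z < ko q" using b(4) Q' Q by auto
  show ?case
  proof (cases "ko y < ko q")
    case True
    then show ?thesis using Q by simp
  next
    case False
    then have "z = q" "ko y = ko q" using yz zq by auto
    moreover have "q \<in> E" "tv q = Some v" using Cons.prems(5) Q by auto
    ultimately have q: "q = y" "z = y" using ye injo[of v] by (auto simp: inj_on_def)
    show ?thesis
    proof (cases "hv y")
      case None
      then have "Q'' = []" using through_rhalf[OF b(2)] Q' q by auto
      then have "last b = y" using through_last[OF b(2)] Q' q by simp
      then show ?thesis using assms(1) b(1) ye(2) by blast
    next
      case (Some w)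
      have "spanned B w (y # X) Q0" using spanned_fwd[of B v X y Q0 w] Cons.prems(1) Q q st Some by simp
      then have "ltO Y Q0" using Cons.IH[of w "y # X" Q0] Cons.prems Q q Some ye by auto
      then show ?thesis using Q q by simp
    qed
  qed
qed simp

text \<open>If the left path left below \<open>t\<close>, the brick blocking the edge of
  \<open>t\<close> would span. On a shared edge the absence of a spanning brick passes to the next
  vertex, by \<open>spanned_bwd\<close>, because \<open>t\<close> is greedy in the reversed and
  negated graph.\<close>

lemma not_spanned_gt:
  assumes t: "\<And>v P Q. through t v P Q \<Longrightarrow> cornered.follows E tv hv (\<lambda>x. - ko x) (\<lambda>x. - ki x) LC (rev ` B) Q P"
      "last t \<in> RC"
    and "\<not> spanned B v X Q" "follows B X Y" "lhalf v X" "rhalf v Y" "through t v P Q"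
  shows "ltO Q Y"
  using assms(3-)
proof (induction Y arbitrary: v X P Q)
  case (Cons y Y)
  interpret rn: cornered E tv hv "\<lambda>x. - ko x" "\<lambda>x. - ki x" RC LC "\<lambda>v. N - rk v" N by (rule revneg)
  obtain q Q0 where Q: "Q = q # Q0" using through_ne[OF Cons.prems(5)] by (cases Q) auto
  have hX: "hv (hd X) = Some v" using Cons.prems(3) by (cases X) auto
  then have st: "next_step B v X y" using Cons.prems(2) by auto
  have ye: "y \<in> E" "y \<notin> RC" "tv y = Some v" using st unfolding next_step_def by blast+
  have qe: "q \<in> E" "tv q = Some v" using through_tv[OF Cons.prems(5)] Q by auto
  have no: "\<not> leO Q' Q" if "b \<in> B" "through b v P' Q'" "leI X P'" for b P' Q'
    using Cons.prems(1) that unfolding spanned_def by blast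
  have "\<not> ko y < ko q"
  proof
    assume lt: "ko y < ko q"
    show False
    proof (cases "q \<in> RC")
      case False
      then obtain b P' Q' where b: "b \<in> B" "through b v P' Q'" "leI X P'" "ko (hd Q') < ko q"
        using st qe lt unfolding next_step_def by blast
      then have "ltO Q' Q" using Q through_ne[OF b(2)] by (cases Q') auto
      then show False using no b by blast
    next
      case True
      \<comment> \<open>The corner \<open>q\<close> is not a candidate for a greedy step, so
        maximality is applied to the edge \<open>f\<close> directly above it. A brick leaving below
        \<open>f\<close> leaves at \<open>q\<close> or lower.\<close>
      obtain e f where ef: "f \<in> E - RC" "tv f = Some v" "ko e < ko q" "ko q < ko f"
        "\<forall>x \<in> E. tv x = Some v \<longrightarrow> x = q \<or> ko x \<le> ko e \<or> ko f \<le> ko x" using R_nb[OF True qe(2)] by blast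
      then obtain b P' Q' where b: "b \<in> B" "through b v P' Q'" "leI X P'" "ko (hd Q') < ko f"
        using st lt unfolding next_step_def by (meson order.strict_trans)
      obtain z Q1 where Q': "Q' = z # Q1" using through_ne[OF b(2)] by (cases Q') auto
      have "z \<in> E" "tv z = Some v" using through_tv[OF b(2)] Q' by auto
      then have "z = q \<or> ko z < ko q" using ef(3,5) b(4) Q' by force
      moreover have "Q1 = []" if "z = q" using RC_final[of b v P' z Q1] b(2) Q' that True by simp
      moreover have "Q0 = []" using RC_final[of t v P q Q0] Cons.prems(5) Q True by simp
      ultimately have "leO Q' Q" using Q Q' by auto
      then show False using no b by blast
    qed
  qed
  then consider "ko q < ko y" | "ko y = ko q" by linarith
  then show ?case
  proof cases
    case 1
    then show ?thesis using Q by simp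
  next
    case eq: 2
  have "ltO Q0 Y"
  proof -
    have q: "q = y" using eq ye qe injo[of v] by (auto simp: inj_on_def)
    show ?thesis
    proof (cases "hv y")
      case None
      then have "Q0 = []" using through_rhalf[OF Cons.prems(5)] Q q by auto
      then have "last t = y" using through_last[OF Cons.prems(5)] Q q by simp
      then show ?thesis using t(2) ye(2) by blast
    next
      case (Some w)
      then have tw: "through t w (y # P) Q0" using through_step Cons.prems(5) Q q by blast
      have "rn.follows (rev ` B) Q0 (y # P)" using t(1)[OF tw] .
      then have "rn.next_step (rev ` B) w Q0 y" using through_tv[OF tw] by auto
      then have "\<not> spanned B w (y # X) Q0" using spanned_bwd Cons.prems(1) Q q ye(3) by blast
      then show ?thesis using Cons.IH[OF _ _ _ _ tw] Cons.prems Some ye by auto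
    qed
  qed
  moreover have "q = y" using eq ye qe injo[of v] by (auto simp: inj_on_def)
  ultimately show ?thesis using Q by simp
  qed
qed simp

section \<open>Right paths, the combined system, and its gaps\<close>

definition right_paths :: "'x list set \<Rightarrow> 'x list set" where
  "right_paths B = rev ` cornered.left_paths E tv hv (\<lambda>x. - ko x) (\<lambda>x. - ki x) RC LC (rev ` B)"

lemma right_paths_iff: "t \<in> right_paths B \<longleftrightarrow> complete t \<and> last t \<in> RC \<and>
  (\<forall>v P Q. through t v P Q \<longrightarrow> cornered.follows E tv hv (\<lambda>x. - ko x) (\<lambda>x. - ki x) LC (rev ` B) Q P)"
proof -
  interpret rn: cornered E tv hv "\<lambda>x. - ko x" "\<lambda>x. - ki x" RC LC "\<lambda>v. N - rk v" N by (rule revneg)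
  have "t \<in> right_paths B \<longleftrightarrow> rev t \<in> rn.left_paths (rev ` B)" unfolding right_paths_def by (rule in_rev_image)
  also have "\<dots> \<longleftrightarrow> complete t \<and> hd (rev t) \<in> RC \<and> (\<forall>v P Q. through t v P Q \<longrightarrow> rn.follows (rev ` B) Q P)"
    unfolding rn.left_paths_def mem_Collect_eq complete_rev through_rev by blast
  also have "\<dots> \<longleftrightarrow> complete t \<and> last t \<in> RC \<and> (\<forall>v P Q. through t v P Q \<longrightarrow> rn.follows (rev ` B) Q P)"
  proof -
    have "hd (rev t) = last t" if "complete t" using complete_ne[OF that] by (simp only: hd_rev)
    then show ?thesis by metis
  qed
  finally show ?thesis .
qed

lemma revneg_revneg: "cornered.follows E hv tv (\<lambda>x. - (- ki x)) (\<lambda>x. - (- ko x)) RC (rev ` rev ` B) = follows B"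
proof -
  have 1: "(\<lambda>x. - (- ki x)) = ki" "(\<lambda>x. - (- ko x)) = ko" by auto
  have 2: "rev ` rev ` B = B" by (auto simp: image_iff)
  show ?thesis unfolding 1 2 ..
qed

text \<open>Suffixes are compared by the preceding lemmas directly, prefixes by the same lemmas in
  the reversed and negated graph. That spanning is invariant under this symmetry makes the two
  answers agree, which is the coherence of left with right paths.\<close>

lemma left_right_cases:
  assumes B: "\<forall>b \<in> B. brick b" and s: "s \<in> left_paths B" "through s v X Y" and t: "t \<in> right_paths B" "through t v P Q"
  shows "spanned B v X Q \<Longrightarrow> ltI X P \<and> ltO Y Q" "\<not> spanned B v X Q \<Longrightarrow> ltI P X \<and> ltO Q Y"
proof -
  interpret rn: cornered E tv hv "\<lambda>x. - ko x" "\<lambda>x. - ki x" RC LC "\<lambda>v. N - rk v" N by (rule revneg)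
  have h: "through s w X' Y' \<Longrightarrow> follows B X' Y'" for w X' Y' using s(1) unfolding left_paths_def by blast
  have hs: "hd s \<in> LC" "complete s" using s(1) unfolding left_paths_def by blast+
  have ls: "last (rev s) \<in> LC" using hs complete_ne[OF hs(2)] by (simp add: last_rev)
  have t': "\<And>w P Q. through t w P Q \<Longrightarrow> rn.follows (rev ` B) Q P" "last t \<in> RC" using t(1) unfolding right_paths_iff by blast+
  have lb: "\<forall>b \<in> B. last b \<in> RC" using B unfolding brick_def by blast
  have hb: "\<forall>b \<in> rev ` B. last b \<in> LC" using B complete_ne unfolding brick_def by (auto simp: last_rev)
  note T = through_lhalf[OF s(2)] through_rhalf[OF s(2)] through_lhalf[OF t(2)] through_rhalf[OF t(2)]
  show "ltI X P \<and> ltO Y Q" if R_trans: "spanned B v X Q"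
  proof
    show "ltO Y Q" using spanned_lt[OF lb R_trans h[OF s(2)] T(1,2,4)] .
    have "lt (\<lambda>x. - ki x) P X"
      using rn.spanned_lt[OF hb, of v Q X P] R_trans t'(1)[OF t(2)] T unfolding spanned_revneg by blast
    then show "ltI X P" by simp
  qed
  show "ltI P X \<and> ltO Q Y" if R_trans: "\<not> spanned B v X Q"
  proof
    show "ltO Q Y" using not_spanned_gt[OF t' R_trans h[OF s(2)] T(1,2) t(2)] .
    have "lt (\<lambda>x. - ki x) X P"
    proof (rule rn.not_spanned_gt[of "rev s" "rev ` B" v Q X P Y])
      show "cornered.follows E hv tv (\<lambda>x. - (- ki x)) (\<lambda>x. - (- ko x)) RC (rev ` rev ` B) Q' P'"
        if "rn.through (rev s) w P' Q'" for w P' Q'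
        using h that unfolding revneg_revneg through_rev .
      show "\<not> rn.spanned (rev ` B) v Q X" using R_trans unfolding spanned_revneg .
      show "rn.through (rev s) v Y X" using s(2) unfolding through_rev .
    qed (use ls t'(1)[OF t(2)] T in auto)
    then show "ltI P X" by simp
  qed
qed

definition brick_system :: "'x list set \<Rightarrow> 'x list set" where "brick_system B = left_paths B \<union> right_paths B"

lemma right_paths_one_corner: "t \<in> right_paths B \<Longrightarrow> one_corner t"
proof -
  interpret rn: cornered E tv hv "\<lambda>x. - ko x" "\<lambda>x. - ki x" RC LC "\<lambda>v. N - rk v" N by (rule revneg)
  assume "t \<in> right_paths B"
  then obtain u where "u \<in> rn.left_paths (rev ` B)" "t = rev u" unfolding right_paths_def by blast
  then have "rn.one_corner (rev t)" using rn.left_paths_one_corner by simp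
  then show ?thesis unfolding one_corner_rev .
qed

lemma right_paths_wcoh: "s \<in> right_paths B \<Longrightarrow> t \<in> right_paths B \<Longrightarrow> wcoh s t"
proof -
  interpret rn: cornered E tv hv "\<lambda>x. - ko x" "\<lambda>x. - ki x" RC LC "\<lambda>v. N - rk v" N by (rule revneg)
  assume "s \<in> right_paths B" "t \<in> right_paths B"
  then obtain u w where "u \<in> rn.left_paths (rev ` B)" "s = rev u" "w \<in> rn.left_paths (rev ` B)" "t = rev w"
    unfolding right_paths_def by blast
  then have "rn.wcoh (rev s) (rev t)" using rn.left_paths_wcoh by simp
  then show ?thesis unfolding wcoh_revneg .
qed

lemma left_right_wcoh:
  assumes B: "\<forall>b \<in> B. brick b" and "s \<in> left_paths B" "t \<in> right_paths B" shows "wcoh s t"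
proof -
  have "\<not> (ltI X P \<and> ltO Q Y) \<and> \<not> (ltI P X \<and> ltO Y Q)" if "through s v X Y" "through t v P Q" for v X Y P Q
    using left_right_cases[OF B assms(2) that(1) assms(3) that(2)] lt_asym by blast
  then show ?thesis unfolding wcoh_def clash_def by blast
qed

lemma right_paths_exists:
  assumes "d \<in> RC" obtains t where "t \<in> right_paths B" "last t = d"
proof -
  interpret rn: cornered E tv hv "\<lambda>x. - ko x" "\<lambda>x. - ki x" RC LC "\<lambda>v. N - rk v" N by (rule revneg)
  obtain u where u: "u \<in> rn.left_paths (rev ` B)" "hd u = d" using rn.left_paths_exists[OF assms] .
  then have "u \<noteq> []" unfolding rn.left_paths_def using rn.complete_ne by blast
  then show ?thesis using that[of "rev u"] u unfolding right_paths_def by (simp add: last_rev)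
qed

lemma right_paths_unique:
  assumes "s \<in> right_paths B" "t \<in> right_paths B" "last s = last t" shows "s = t"
proof -
  interpret rn: cornered E tv hv "\<lambda>x. - ko x" "\<lambda>x. - ki x" RC LC "\<lambda>v. N - rk v" N by (rule revneg)
  obtain u w where u: "u \<in> rn.left_paths (rev ` B)" "s = rev u" and w: "w \<in> rn.left_paths (rev ` B)" "t = rev w"
    using assms unfolding right_paths_def by blast
  have "u \<noteq> []" "w \<noteq> []" using u w rn.complete_ne unfolding rn.left_paths_def by blast+
  then have "hd u = hd w" using assms(3) u w by (simp add: last_rev)
  then show ?thesis using rn.left_paths_unique u w by blast
qed

lemma path_system_brick_system:
  assumes B: "\<forall>b \<in> B. brick b" shows "path_system (brick_system B)"
  unfolding path_system_def
proof (intro conjI ballI)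
  fix t assume "t \<in> brick_system B" then show "one_corner t" unfolding brick_system_def using left_paths_one_corner right_paths_one_corner by blast
next
  fix c assume c: "c \<in> LC"
  obtain t where t: "t \<in> left_paths B" "hd t = c" using left_paths_exists[OF c] .
  have "s = t" if "s \<in> brick_system B" "hd s = c" for s
  proof -
    have "s \<notin> right_paths B"
    proof
      assume "s \<in> right_paths B"
      then have "one_corner s" "last s \<in> RC" using right_paths_one_corner right_paths_iff by blast+
      then show False using that c unfolding one_corner_def by blast
    qed
    then show ?thesis using that t left_paths_unique unfolding brick_system_def by blast
  qed
  then show "\<exists>!t. t \<in> brick_system B \<and> hd t = c" using t unfolding brick_system_def by blast
next
  fix d assume d: "d \<in> RC"
  obtain t where t: "t \<in> right_paths B" "last t = d" using right_paths_exists[OF d] .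
  have "s = t" if "s \<in> brick_system B" "last s = d" for s
  proof -
    have "s \<notin> left_paths B"
    proof
      assume "s \<in> left_paths B"
      then have "one_corner s" "hd s \<in> LC" using left_paths_one_corner unfolding left_paths_def by blast+
      then show False using that d unfolding one_corner_def by blast
    qed
    then show ?thesis using that t right_paths_unique unfolding brick_system_def by blast
  qed
  then show "\<exists>!t. t \<in> brick_system B \<and> last t = d" using t unfolding brick_system_def by blast
next
  fix s t assume "s \<in> brick_system B" "t \<in> brick_system B"
  then show "wcoh s t" unfolding brick_system_def using left_paths_wcoh right_paths_wcoh left_right_wcoh[OF B] wcoh_sym by blast
qed

definition brick_clique :: "'x list set \<Rightarrow> bool" where
  "brick_clique B \<longleftrightarrow> (\<forall>b \<in> B. brick b) \<and>
     (\<forall>b \<in> B. \<forall>b' \<in> B. b \<noteq> b' \<longrightarrow> wcoh b b' \<and> hd b \<noteq> hd b' \<and> last b \<noteq> last b')"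

lemma brick_cliqueD: "brick_clique B \<Longrightarrow> b \<in> B \<Longrightarrow> b' \<in> B \<Longrightarrow> b \<noteq> b' \<Longrightarrow> wcoh b b' \<and> hd b \<noteq> hd b' \<and> last b \<noteq> last b'"
  unfolding brick_clique_def by simp

text \<open>The greedy edge is at most that of \<open>b\<close>, since \<open>b\<close> itself
  restricts it. Were it lower, another brick with prefix at least that of \<open>b\<close> would
  leave below \<open>b\<close>; as left corners are not shared, the prefixes differ, and the two
  bricks would conflict.\<close>

lemma left_paths_follows:
  assumes B: "brick_clique B" and b: "b \<in> B" and s: "s \<in> left_paths B" "hd s = hd b"
  shows "through b v P Q \<Longrightarrow> \<exists>Y. through s v P Y"
proof (induction P arbitrary: v Q)
  case Nil
  then show ?case using through_ne by blast
next
  case (Cons x P)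
  show ?case
  proof (cases "P = []")
    case True
    have g: "complete s" "hd s \<in> LC" using s unfolding left_paths_def by blast+
    obtain w C where w: "hv (hd s) = Some w" "through s w [hd s] C" using LC_through[OF g] by blast
    have "x = hd s" using through_hd[OF Cons.prems] True s(2) by simp
    then have "w = v" "through s w [x] C" using w through_hv[OF Cons.prems] by auto
    then show ?thesis using True by blast
  next
    case False
    have "\<exists>u. tv x = Some u" using through_lhalf[OF Cons.prems] False by (auto split: option.splits)
    then obtain u where u: "tv x = Some u" "through b u P (x # Q)" using through_stepb[OF Cons.prems] by blast
    have hvx: "hv x = Some v" using through_hv[OF Cons.prems] by simp
    then have xe: "x \<in> E - RC" using through_hv[OF Cons.prems] RC_hv[of x] by auto
    obtain Y where Y: "through s u P Y" using Cons.IH[OF u(2)] by blast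
    obtain y Y' where Yy: "Y = y # Y'" using through_ne[OF Y] by (cases Y) auto
    have "follows B P Y" using s(1) Y unfolding left_paths_def by blast
    then have st: "next_step B u P y" using Yy through_hv[OF Y] by auto
    have "y = x"
    proof (rule ccontr)
      assume "y \<noteq> x"
      moreover have "ko y \<le> ko x" using next_step_le[OF st b u(2)] by simp
      moreover have "y \<in> E" "tv y = Some u" using st unfolding next_step_def by blast+
      moreover have "ko y = ko x \<Longrightarrow> y = x" using injo[of u] xe u(1) calculation(3,4) by (auto simp: inj_on_def)
      ultimately have "ko y < ko x" by force
      then obtain b' P' Q' where b': "b' \<in> B" "through b' u P' Q'" "leI P P'" "ko (hd Q') < ko x"
        using st xe u(1) unfolding next_step_def by blast
      have "b' \<noteq> b"
      proof
        assume "b' = b"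
        then have "Q' = x # Q" using through_unique[OF u(2)] b'(2) by blast
        then show False using b'(4) by simp
      qed
      then have w: "wcoh b b'" "hd b \<noteq> hd b'" using brick_cliqueD[OF B b b'(1)] by simp_all
      then have "P \<noteq> P'" using through_hd[OF u(2)] through_hd[OF b'(2)] by auto
      then have "ltI P P'" using b'(3) by blast
      moreover have "ltO Q' (x # Q)" using b'(4) through_ne[OF b'(2)] by (cases Q') auto
      ultimately show False using wcD[OF w(1) u(2) b'(2)] by blast
    qed
    then show ?thesis using through_step Y Yy hvx by blast
  qed
qed

lemma brick_clique_revneg: "cornered.brick_clique E tv hv (\<lambda>x. - ko x) (\<lambda>x. - ki x) RC LC (rev ` B) \<longleftrightarrow> brick_clique B"
proof -
  interpret rn: cornered E tv hv "\<lambda>x. - ko x" "\<lambda>x. - ki x" RC LC "\<lambda>v. N - rk v" N by (rule revneg)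
  have br: "rn.brick (rev b) \<longleftrightarrow> brick b" for b by (rule brick_rev)
  show ?thesis
  proof (cases "\<forall>b \<in> B. brick b")
    case True
    then have e: "hd (rev b) = last b \<and> last (rev b) = hd b" if "b \<in> B" for b
      using that complete_ne unfolding brick_def by (simp add: hd_rev last_rev)
    have "(rev b \<noteq> rev b' \<longrightarrow> rn.wcoh (rev b) (rev b') \<and> hd (rev b) \<noteq> hd (rev b') \<and> last (rev b) \<noteq> last (rev b'))
       \<longleftrightarrow> (b \<noteq> b' \<longrightarrow> wcoh b b' \<and> hd b \<noteq> hd b' \<and> last b \<noteq> last b')" if "b \<in> B" "b' \<in> B" for b b'
      using e[OF that(1)] e[OF that(2)] wcoh_revneg by auto
    then show ?thesis unfolding brick_clique_def rn.brick_clique_def ball_simps br by (intro conj_cong ball_cong refl)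
  next
    case False
    then show ?thesis unfolding brick_clique_def rn.brick_clique_def ball_simps br by blast
  qed
qed

lemma right_paths_follows:
  assumes B: "brick_clique B" and b: "b \<in> B" and s: "s \<in> right_paths B" "last s = last b" and t: "through b v P Q"
  shows "\<exists>X. through s v X Q"
proof -
  interpret rn: cornered E tv hv "\<lambda>x. - ko x" "\<lambda>x. - ki x" RC LC "\<lambda>v. N - rk v" N by (rule revneg)
  obtain u where u: "u \<in> rn.left_paths (rev ` B)" "s = rev u" using s(1) unfolding right_paths_def by blast
  have ne: "u \<noteq> []" "b \<noteq> []" using u rn.complete_ne b B complete_ne unfolding rn.left_paths_def brick_clique_def brick_def by blast+
  have "\<exists>Y. rn.through u v Q Y"
    by (rule rn.left_paths_follows[of "rev ` B" "rev b"]) (use B b u s(2) t ne in \<open>auto simp: brick_clique_revneg through_rev hd_rev last_rev\<close>)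
  then show ?thesis using through_rev[of s] u(2) by simp
qed

text \<open>A left path between \<open>s\<close> and \<open>t\<close> is spanned with
  \<open>t\<close> by some brick. Coherence of the bricks forces its prefix to be that of
  \<open>b\<close>, so the path starts with the corner of \<open>b\<close> and is \<open>s\<close>.
  Right paths are symmetric.\<close>

lemma adj_bricks_brick_system_sup:
  assumes B: "brick_clique B" and b: "b \<in> B" and bv: "through b v P Q"
  obtains s t X Y where "gap (brick_system B) v s t" "s \<in> left_paths B" "t \<in> right_paths B" "through s v P Y" "through t v X Q"
proof -
  have Bb: "\<forall>b \<in> B. brick b" using B unfolding brick_clique_def by blast
  have S: "path_system (brick_system B)" using path_system_brick_system[OF Bb] .
  have bb: "hd b \<in> LC" "last b \<in> RC" using Bb b unfolding brick_def by blast+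
  obtain s where s: "s \<in> left_paths B" "hd s = hd b" using left_paths_exists[OF bb(1)] .
  obtain t where t: "t \<in> right_paths B" "last t = last b" using right_paths_exists[OF bb(2)] .
  obtain Y where sv: "through s v P Y" using left_paths_follows[OF B b s bv] by blast
  obtain X where tv': "through t v X Q" using right_paths_follows[OF B b t bv] by blast
  have bne: "wcoh b b'" "hd b \<noteq> hd b'" "last b \<noteq> last b'" if "b' \<in> B" "b' \<noteq> b" for b'
    using brick_cliqueD[OF B b that(1)] that(2) by simp_all
  \<comment> \<open>A brick different from \<open>b\<close> shares no corner with it, so both
    comparisons would be strict and in conflict.\<close>
  have up: "P = P' \<and> Q = Q'" if b': "b' \<in> B" "through b' v P' Q'" "leI P P'" "leO Q' Q" for b' P' Q'
  proof (cases "b' = b")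
    case True
    then show ?thesis using through_unique[OF bv] b'(2) by blast
  next
    case False
    have "P \<noteq> P'" using bne(2)[OF b'(1) False] through_hd[OF bv] through_hd[OF b'(2)] by auto
    moreover have "Q \<noteq> Q'" using bne(3)[OF b'(1) False] through_last[OF bv] through_last[OF b'(2)] by auto
    ultimately show ?thesis using wcD[OF bne(1)[OF b'(1) False] bv b'(2)] b'(3,4) by blast
  qed
  have "spanned B v P Q" unfolding spanned_def using b bv by blast
  then have lt: "ltI P X" using left_right_cases(1)[OF Bb s(1) sv t(1) tv'] by blast
  have "gap (brick_system B) v s t" unfolding gap_def
  proof (intro conjI)
    show "before v s t" using beforeI[OF sv tv'] lt by blast
    show "\<not> (\<exists>u \<in> brick_system B. before v s u \<and> before v u t)"
    proof
      assume "\<exists>u \<in> brick_system B. before v s u \<and> before v u t"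
      then obtain u where u: "u \<in> brick_system B" "before v s u" "before v u t" by blast
      obtain U U' where U: "through u v U U'" using u(2) unfolding before_def by blast
      have inS: "s \<in> brick_system B" "t \<in> brick_system B" using s t unfolding brick_system_def by blast+
      note l1 = before_le[OF path_systemD(4)[OF S inS(1) u(1)] u(2) sv U]
      note l2 = before_le[OF path_systemD(4)[OF S u(1) inS(2)] u(3) U tv']
      from u(1) consider "u \<in> left_paths B" | "u \<in> right_paths B" unfolding brick_system_def by blast
      then show False
      proof cases
        case 1
        have "spanned B v U Q"
        proof (rule ccontr)
          assume "\<not> spanned B v U Q"
          then have "ltI X U" using left_right_cases(2)[OF Bb 1 U t(1) tv'] by blast
          then show False using l2(1) lt_asym lt_irrefl by blast
        qed
        then obtain b' P' Q' where b': "b' \<in> B" "through b' v P' Q'" "leI U P'" "leO Q' Q" unfolding spanned_def by blast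
        then have "leI P P'" using l1(1) lt_trans by blast
        then have "P = P'" using up b' by blast
        then have "U = P" using l1(1) b'(3) lt_asym by blast
        then have "hd u = hd s" using through_hd[OF U] through_hd[OF sv] by simp
        then have "u = s" using left_paths_unique 1 s(1) by blast
        then show False using u(2) before_irrefl by blast
      next
        case 2
        have "spanned B v P U'"
        proof (rule ccontr)
          assume "\<not> spanned B v P U'"
          then have "ltI U P" using left_right_cases(2)[OF Bb s(1) sv 2 U] by blast
          then show False using l1(1) lt_asym lt_irrefl by blast
        qed
        then obtain b' P' Q' where b': "b' \<in> B" "through b' v P' Q'" "leI P P'" "leO Q' U'" unfolding spanned_def by blast
        then have "leO Q' Q" using l2(2) lt_trans by blast
        then have "Q = Q'" using up b' by blast
        then have "U' = Q" using l2(2) b'(4) lt_asym by blast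
        then have "last u = last t" using through_last[OF U] through_last[OF tv'] by simp
        then have "u = t" using right_paths_unique 2 t(1) by blast
        then show False using u(3) before_irrefl by blast
      qed
    qed
  qed (use s t bb in \<open>auto simp: brick_system_def\<close>)
  then show ?thesis using that s t sv tv' by blast
qed

lemma adj_bricks_brick_system:
  assumes B: "brick_clique B" shows "adj_bricks (brick_system B) = B"
proof
  have Bb: "\<forall>b \<in> B. brick b" using B unfolding brick_clique_def by blast
  have S: "path_system (brick_system B)" using path_system_brick_system[OF Bb] .
  show "B \<subseteq> adj_bricks (brick_system B)"
  proof
    fix b assume b: "b \<in> B"
    have "complete b" "hd b \<in> LC" using Bb b unfolding brick_def by blast+
    then obtain v C where v: "through b v [hd b] C" using LC_through by metis
    obtain s t X Y where *: "gap (brick_system B) v s t" "through s v [hd b] Y" "through t v X C" using adj_bricks_brick_system_sup[OF B b v] by metis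
    have "b = rev [hd b] @ C" using v unfolding through_def by blast
    then show "b \<in> adj_bricks (brick_system B)" unfolding adj_bricks_def using * by blast
  qed
  show "adj_bricks (brick_system B) \<subseteq> B"
  proof
    fix b assume "b \<in> adj_bricks (brick_system B)"
    then obtain v s t P Q Y X where g: "gap (brick_system B) v s t" and sv: "through s v P Y" and tv': "through t v X Q"
      and b: "b = rev P @ Q" unfolding adj_bricks_def by blast
    have gg: "s \<in> brick_system B" "t \<in> brick_system B" "hd s \<in> LC" "last t \<in> RC"
      and no: "\<And>u. u \<in> brick_system B \<Longrightarrow> before v s u \<Longrightarrow> \<not> before v u t" using g unfolding gap_def by blast+
    have s: "s \<in> left_paths B" using gg(1,3) path_system_ends(5)[OF S gg(1)] right_paths_iff unfolding brick_system_def by blast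
    have t: "t \<in> right_paths B" using gg(2,4) path_system_ends(6)[OF S gg(2)] unfolding brick_system_def left_paths_def by blast
    have lt: "ltI P X" using gap_through[OF S g] through_unique[OF sv] through_unique[OF tv'] by metis
    have "spanned B v P Q"
    proof (rule ccontr)
      assume "\<not> spanned B v P Q"
      then show False using left_right_cases(2)[OF Bb s sv t tv'] lt lt_asym by blast
    qed
    then obtain b' P' Q' where b': "b' \<in> B" "through b' v P' Q'" "leI P P'" "leO Q' Q" unfolding spanned_def by blast
    \<comment> \<open>The spanning brick has its own pair of paths. If it differed from
      \<open>b\<close> in a half, \<open>s'\<close> or \<open>t'\<close> would lie strictly inside
      the gap.\<close>
    obtain s' t' X' Y' where *: "s' \<in> left_paths B" "t' \<in> right_paths B" "through s' v P' Y'" "through t' v X' Q'"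
      using adj_bricks_brick_system_sup[OF B b'(1,2)] by metis
    have "P = P'"
    proof (rule ccontr)
      assume "P \<noteq> P'"
      then have "before v s s'" using beforeI[OF sv *(3)] b'(3) by blast
      moreover have "spanned B v P' Q" unfolding spanned_def using b' by blast
      then have "ltI P' X" using left_right_cases(1)[OF Bb *(1,3) t tv'] by blast
      then have "before v s' t" using beforeI[OF *(3) tv'] by blast
      moreover have "s' \<in> brick_system B" using *(1) unfolding brick_system_def by blast
      ultimately show False using no by blast
    qed
    moreover have "Q' = Q"
    proof (rule ccontr)
      assume "Q' \<noteq> Q"
      then have "before v t' t" using beforeI[OF *(4) tv'] b'(4) by blast
      moreover have "spanned B v P Q'" unfolding spanned_def using b' by blast
      then have "ltI P X'" using left_right_cases(1)[OF Bb s sv *(2,4)] by blast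
      then have "before v s t'" using beforeI[OF sv *(4)] by blast
      moreover have "t' \<in> brick_system B" using *(2) unfolding brick_system_def by blast
      ultimately show False using no by blast
    qed
    ultimately have "b = b'" using b b'(2) unfolding through_def by blast
    then show "b \<in> B" using b'(1) by blast
  qed
qed

section \<open>Recovering a path system from its bricks\<close>

lemma gap_unique:
  assumes S: "path_system S" and "gap S v s t" "gap S v s' t'"
  shows "s = s' \<Longrightarrow> t = t'" "t = t' \<Longrightarrow> s = s'"
proof -
  have g: "s \<in> S" "t \<in> S" "before v s t" "\<And>u. u \<in> S \<Longrightarrow> before v s u \<Longrightarrow> \<not> before v u t"
    "s' \<in> S" "t' \<in> S" "before v s' t'" "\<And>u. u \<in> S \<Longrightarrow> before v s' u \<Longrightarrow> \<not> before v u t'"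
    using assms(2,3) unfolding gap_def by blast+
  have eq: "a = c" if "a \<in> S" "c \<in> S" "\<not> before v a c" "\<not> before v c a" "through a v P Y" "through c v P' Y'" for a c P Y P' Y'
  proof -
    have w: "wcoh a c" "wcoh c a" using path_systemD(4)[OF S] that by blast+
    have "P = P' \<and> Y = Y'"
      using not_before[OF w(1) that(3,5,6)] not_before[OF w(2) that(4,6,5)] lt_asym by blast
    then show ?thesis using through_eq that by blast
  qed
  obtain P Y X Q where t: "through s v P Y" "through t v X Q" using gap_through[OF S assms(2)] by metis
  obtain P' Y' X' Q' where t': "through s' v P' Y'" "through t' v X' Q'" using gap_through[OF S assms(3)] by metis
  show "t = t'" if "s = s'" using eq[OF g(2,6) _ _ t(2) t'(2)] g that by blast
  show "s = s'" if "t = t'" using eq[OF g(1,5) _ _ t(1) t'(1)] g that by blast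
qed

lemma adj_bricks_gap:
  assumes S: "path_system S" and b: "b \<in> adj_bricks S"
  obtains s t where "hd s = hd b" "last t = last b" "brick b" "s \<in> S" "t \<in> S"
    "\<And>v P Q. through b v P Q \<Longrightarrow> gap S v s t \<and> (\<exists>Y. through s v P Y) \<and> (\<exists>X. through t v X Q)"
proof -
  obtain v s t P Q Y X where g: "gap S v s t" and sv: "through s v P Y" and tv': "through t v X Q"
      and b: "b = rev P @ Q" using b unfolding adj_bricks_def by blast
  have bv: "through b v P Q" unfolding b using thrI[OF through_lhalf[OF sv] through_rhalf[OF tv']] .
  have gg: "s \<in> S" "t \<in> S" "hd s \<in> LC" "last t \<in> RC" using g unfolding gap_def by blast+
  have e: "hd s = hd b" "last t = last b" using through_hd through_last bv sv tv' by metis+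
  have "brick b" unfolding brick_def using through_complete[OF bv] gg e by auto
  then show ?thesis using that[OF e _ gg(1,2)] gap_along[OF S g sv tv'] unfolding b by blast
qed

text \<open>Gaps at a common vertex are pairs of neighbours in a chain, so they do not interlock:
  one ends at or before the start of the other, or they have the same left path. A shared corner
  means a shared system path, hence the same gap and the same brick.\<close>

lemma adj_bricks_brick_clique:
  assumes S: "path_system S" shows "brick_clique (adj_bricks S)"
proof -
  have "wcoh b b' \<and> hd b \<noteq> hd b' \<and> last b \<noteq> last b'" if b: "b \<in> adj_bricks S" "b' \<in> adj_bricks S" "b \<noteq> b'" for b b'
  proof -
    obtain s t where s: "hd s = hd b" "last t = last b" "brick b" "s \<in> S" "t \<in> S"
      and g: "\<And>v P Q. through b v P Q \<Longrightarrow> gap S v s t \<and> (\<exists>Y. through s v P Y) \<and> (\<exists>X. through t v X Q)"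
      using adj_bricks_gap[OF S b(1)] by blast
    obtain s' t' where s': "hd s' = hd b'" "last t' = last b'" "brick b'" "s' \<in> S" "t' \<in> S"
      and g': "\<And>v P Q. through b' v P Q \<Longrightarrow> gap S v s' t' \<and> (\<exists>Y. through s' v P Y) \<and> (\<exists>X. through t' v X Q)"
      using adj_bricks_gap[OF S b(2)] by blast
    have bk: "complete b" "hd b \<in> LC" "last b \<in> RC" "complete b'" "hd b' \<in> LC" "last b' \<in> RC"
      using s(3) s'(3) unfolding brick_def by blast+
    have eqs: False if e: "through b v P Q" "through b' v P' Q'" "s = s' \<or> t = t'" for v P Q P' Q'
    proof -
      have gv: "gap S v s t" "gap S v s' t'" using g g' e by blast+
      have "s = s' \<and> t = t'" using gap_unique[OF S gv] e(3) by blast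
      moreover obtain Y X Y' X' where "through s v P Y" "through t v X Q" "through s' v P' Y'" "through t' v X' Q'"
        using g[OF e(1)] g'[OF e(2)] by blast
      ultimately have "P = P' \<and> Q = Q'" using through_unique by blast
      then show False using through_eq e(1,2) b(3) by blast
    qed
    have "hd b \<noteq> hd b'"
    proof
      assume h: "hd b = hd b'"
      then have "s = s'" using path_systemD(5)[OF S s(4) s'(4)] s(1) s'(1) bk(5) by simp
      obtain v C where v: "hv (hd b) = Some v" "through b v [hd b] C" using LC_through[OF bk(1,2)] by blast
      obtain v' C' where v': "hv (hd b') = Some v'" "through b' v' [hd b'] C'" using LC_through[OF bk(4,5)] by blast
      have "v' = v" using v v' h by simp
      then show False using eqs[OF v(2)] v'(2) \<open>s = s'\<close> by blast
    qed
    moreover have "last b \<noteq> last b'"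
    proof
      assume h: "last b = last b'"
      then have "t = t'" using path_systemD(6)[OF S s(5) s'(5)] s(2) s'(2) bk(6) by simp
      obtain v C where v: "tv (last b) = Some v" "through b v C [last b]" using RC_through[OF bk(1,3)] by blast
      obtain v' C' where v': "tv (last b') = Some v'" "through b' v' C' [last b']" using RC_through[OF bk(4,6)] by blast
      have "v' = v" using v v' h by simp
      then show False using eqs[OF v(2)] v'(2) \<open>t = t'\<close> by blast
    qed
    moreover have "\<not> (ltI P P' \<and> ltO Q' Q) \<and> \<not> (ltI P' P \<and> ltO Q Q')"
      if bv: "through b v P Q" "through b' v P' Q'" for v P Q P' Q'
    proof -
      have gv: "gap S v s t" "gap S v s' t'" using g g' bv by blast+
      obtain Y X Y' X' where t: "through s v P Y" "through t v X Q" "through s' v P' Y'" "through t' v X' Q'"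
        using g[OF bv(1)] g'[OF bv(2)] by blast
      have lt: "ltI P X" "ltO Y Q" using gap_through[OF S gv(1)] through_unique[OF t(1)] through_unique[OF t(2)] by metis+
      have lt': "ltI P' X'" "ltO Y' Q'" using gap_through[OF S gv(2)] through_unique[OF t(3)] through_unique[OF t(4)] by metis+
      have no: "\<not> (before v s s' \<and> before v s' t)" "\<not> (before v s' s \<and> before v s t')"
        using gv s(4) s'(4) unfolding gap_def by blast+
      have w: "wcoh s' t" "wcoh s t'" "wcoh s s'" "wcoh s' s" using path_systemD(4)[OF S] s s' by blast+
      consider "\<not> before v s' t" | "\<not> before v s t'" | "\<not> before v s s'" "\<not> before v s' s" using no by blast
      then show ?thesis
      proof cases
        case 1
        have "ltI P P'" "ltO Q Q'"
          using lt_le_trans[OF lt(1), of P'] le_lt_trans[OF _ lt'(2), of Q] not_before[OF w(1) 1 t(3,2)] by blast+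
        then show ?thesis using lt_asym by blast
      next
        case 2
        have "ltI P' P" "ltO Q' Q"
          using lt_le_trans[OF lt'(1), of P] le_lt_trans[OF _ lt(2), of Q'] not_before[OF w(2) 2 t(1,4)] by blast+
        then show ?thesis using lt_asym by blast
      next
        case 3
        have "P = P'" using not_before(1)[OF w(3) 3(1) t(1,3)] not_before(1)[OF w(4) 3(2) t(3,1)] lt_asym by blast
        then show ?thesis by simp
      qed
    qed
    then have "wcoh b b'" unfolding wcoh_def clash_def by blast
    ultimately show ?thesis by blast
  qed
  moreover have "brick b" if "b \<in> adj_bricks S" for b using adj_bricks_gap[OF S that] by blast
  ultimately show ?thesis unfolding brick_clique_def by blast
qed

lemma path_system_finite: "path_system S \<Longrightarrow> finite S"
  using finite_subset[OF _ finite_complete, of S] path_systemD(1) unfolding one_corner_def by blast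

text \<open>A finite chain that begins with a left-corner path and ends with a right-corner path has
  consecutive members of these two kinds, in this order. The induction cuts the interval at any path
  inside it.\<close>

lemma exists_gap:
  assumes S: "path_system S" and "s \<in> S" "t \<in> S" "hd s \<in> LC" "last t \<in> RC" "before v s t"
  shows "\<exists>s1 t1. gap S v s1 t1 \<and> (s1 = s \<or> before v s s1) \<and> (t1 = t \<or> before v t1 t)"
  using assms(2-)
proof (induction "card {u \<in> S. before v s u \<and> before v u t}" arbitrary: s t rule: less_induct)
  case less
  note st = less.prems
  have R_trans: "before v a c" if "before v a b" "before v b c" "a \<in> S" "b \<in> S" "c \<in> S" for a b c
    using before_trans[of a b c v] path_systemD(4)[OF S] that by blast
  show ?case
  proof (cases "\<exists>u \<in> S. before v s u \<and> before v u t")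
    case False
    then show ?thesis using st unfolding gap_def by blast
  next
    case True
    then obtain u where u: "u \<in> S" "before v s u" "before v u t" by blast
    have fin: "finite {u \<in> S. before v s u \<and> before v u t}" using path_system_finite[OF S] by simp
    show ?thesis
    proof (cases "hd u \<in> LC")
      case True
      have "{w \<in> S. before v u w \<and> before v w t} \<subset> {w \<in> S. before v s w \<and> before v w t}"
        using R_trans[OF u(2) _ st(1) u(1)] u before_irrefl by blast
      then have "card {w \<in> S. before v u w \<and> before v w t} < card {w \<in> S. before v s w \<and> before v w t}"
        by (rule psubset_card_mono[OF fin])
      from less.hyps[OF this u(1) st(2) True st(4) u(3)] obtain s1 t1
        where "gap S v s1 t1" "s1 = u \<or> before v u s1" "t1 = t \<or> before v t1 t" by blast
      moreover from this have "s1 \<in> S" unfolding gap_def by blast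
      ultimately show ?thesis using R_trans[OF u(2) _ st(1) u(1)] u(2) by blast
    next
      case False
      then have ru: "last u \<in> RC" using path_system_ends(7)[OF S u(1)] by blast
      have "{w \<in> S. before v s w \<and> before v w u} \<subset> {w \<in> S. before v s w \<and> before v w t}"
        using R_trans[OF _ u(3) _ u(1) st(2)] u before_irrefl by blast
      then have "card {w \<in> S. before v s w \<and> before v w u} < card {w \<in> S. before v s w \<and> before v w t}"
        by (rule psubset_card_mono[OF fin])
      from less.hyps[OF this st(1) u(1) st(3) ru u(2)] obtain s1 t1
        where "gap S v s1 t1" "s1 = s \<or> before v s s1" "t1 = u \<or> before v t1 u" by blast
      moreover from this have "t1 \<in> S" unfolding gap_def by blast
      ultimately show ?thesis using R_trans[OF _ u(3) _ u(1) st(2)] u(3) by blast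
    qed
  qed
qed

text \<open>Gaps starting at \<open>s\<close> or later have bricks that end above the suffix of
  \<open>s\<close>, so the edge taken by \<open>s\<close> is admissible. Any higher edge is
  separated from it by a right corner, and a gap between \<open>s\<close> and the path of this
  corner provides a brick that blocks the higher edge.\<close>

lemma left_paths_adj_bricks:
  assumes S: "path_system S" and s: "s \<in> S" "hd s \<in> LC" shows "s \<in> left_paths (adj_bricks S)"
proof -
  let ?B = "adj_bricks S"
  have ls: "last s \<notin> RC" using path_system_ends(5)[OF S s] .
  have st: "next_step ?B v X y" if sv: "through s v X (y # Y)" for v X y Y
    unfolding next_step_def
  proof (intro conjI ballI allI impI)
    have "y \<notin> RC" using RC_final[OF sv] through_last[OF sv] ls by auto
    then show ye: "y \<in> E - RC" "tv y = Some v" using through_tv[OF sv] by auto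
    {
      fix b P Q assume b: "b \<in> ?B" "through b v P Q" "leI X P"
      obtain s1 t1 where e: "s1 \<in> S" "gap S v s1 t1" "\<exists>Y. through s1 v P Y" "\<exists>X. through t1 v X Q"
        using adj_bricks_gap[OF S b(1)] b(2) by metis
      then obtain Y1 X1 where t: "through s1 v P Y1" "through t1 v X1 Q" by blast
      have lt: "ltO Y1 Q" using gap_through[OF S e(2)] through_unique[OF t(1)] through_unique[OF t(2)] by metis
      have "leO (y # Y) Y1"
      proof (cases "X = P")
        case True
        then have "hd s = hd s1" using through_hd[OF sv] through_hd[OF t(1)] by simp
        then have "s = s1" using path_systemD(5)[OF S s(1) e(1)] s(2) by simp
        then show ?thesis using through_unique[OF sv] t(1) by blast
      next
        case False
        then show ?thesis using wcI_O[OF path_systemD(4)[OF S s(1) e(1)] sv t(1)] b(3) by blast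
      qed
      then have "ltO (y # Y) Q" using le_lt_trans lt by blast
      then show "ko y \<le> ko (hd Q)" by (cases Q) auto
    }
    fix y' assume y': "y' \<in> E - RC" "tv y' = Some v" "ko y < ko y'"
    obtain d where d: "d \<in> RC" "tv d = Some v" "ko y < ko d" "ko d < ko y'" using R_bt[OF ye(1) y'(1) ye(2) y'(2,3)] by blast
    obtain t C where t: "t \<in> S" "through t v C [d]" "last t = d" using path_system_corner_R[OF S d(1,2)] by metis
    have "before v s t" using beforeI[OF sv t(2)] d(3) by simp
    then obtain s1 t1 where g: "gap S v s1 t1" "s1 = s \<or> before v s s1" "t1 = t \<or> before v t1 t"
      using exists_gap[OF S s(1) t(1) s(2)] t(3) d(1) by blast
    have st: "s1 \<in> S" "t1 \<in> S" using g(1) unfolding gap_def by blast+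
    obtain P Y1 X1 Q where p: "through s1 v P Y1" "through t1 v X1 Q" using gap_through[OF S g(1)] by metis
    have "leI X P" using g(2) before_le(1)[OF path_systemD(4)[OF S s(1) st(1)] _ sv p(1)] through_unique[OF sv] p(1) by blast
    moreover have "leO Q [d]" using g(3) before_le(2)[OF path_systemD(4)[OF S st(2) t(1)] _ p(2) t(2)] through_unique[OF t(2)] p(2) by blast
    then have "ko (hd Q) < ko y'" using d(4) by (cases Q) auto
    moreover have "rev P @ Q \<in> ?B" unfolding adj_bricks_def using g(1) p by blast
    moreover have "through (rev P @ Q) v P Q" using thrI through_lhalf[OF p(1)] through_rhalf[OF p(2)] by blast
    ultimately show "\<exists>b \<in> ?B. \<exists>P Q. through b v P Q \<and> leI X P \<and> ko (hd Q) < ko y'" by blast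
  qed
  have "follows ?B X Y" if "through s v X Y" for v X Y
    using that
  proof (induction Y arbitrary: v X)
    case (Cons y Y)
    have "follows ?B (y # X) Y"
    proof (cases "hv y")
      case None
      then have "Y = []" using through_rhalf[OF Cons.prems] by auto
      then show ?thesis by simp
    next
      case (Some w)
      then show ?thesis using Cons.IH through_step[OF Cons.prems] by blast
    qed
    then show ?case using st[OF Cons.prems] through_hv[OF Cons.prems] by auto
  qed simp
  then show ?thesis unfolding left_paths_def using s path_system_ends(2)[OF S s(1)] by blast
qed

lemma adj_bricks_revneg:
  assumes S: "path_system S"
  shows "cornered.adj_bricks E tv hv (\<lambda>x. - ko x) (\<lambda>x. - ki x) RC LC (rev ` S) = rev ` adj_bricks S"
proof (rule eq_rev_imageI)
  interpret rn: cornered E tv hv "\<lambda>x. - ko x" "\<lambda>x. - ki x" RC LC "\<lambda>v. N - rk v" N by (rule revneg)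
  have mem: "rn.gap (rev ` S) v a c \<Longrightarrow> \<exists>s t. s \<in> S \<and> t \<in> S \<and> a = rev t \<and> c = rev s" for v a c
    unfolding rn.gap_def by blast
  have mem': "gap S v s t \<Longrightarrow> s \<in> S \<and> t \<in> S" for v s t unfolding gap_def by blast
  fix p
  show "p \<in> rn.adj_bricks (rev ` S) \<longleftrightarrow> rev p \<in> adj_bricks S"
  proof
    assume "p \<in> rn.adj_bricks (rev ` S)"
    then obtain v a c P Q Y X where *: "rn.gap (rev ` S) v a c" "rn.through a v P Y" "rn.through c v X Q" "p = rev P @ Q"
      unfolding rn.adj_bricks_def by blast
    obtain s t where st: "s \<in> S" "t \<in> S" "a = rev t" "c = rev s" using mem[OF *(1)] by blast
    have "gap S v s t" "through t v Y P" "through s v Q X" using * st gap_revneg[OF S st(1,2)] by (auto simp: through_rev)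
    moreover have "rev p = rev Q @ P" using *(4) by simp
    ultimately show "rev p \<in> adj_bricks S" unfolding adj_bricks_def by blast
  next
    assume "rev p \<in> adj_bricks S"
    then obtain v s t P Q Y X where *: "gap S v s t" "through s v P Y" "through t v X Q" "rev p = rev P @ Q"
      unfolding adj_bricks_def by blast
    have st: "s \<in> S" "t \<in> S" using mem'[OF *(1)] by blast+
    have "rn.gap (rev ` S) v (rev t) (rev s)" "rn.through (rev t) v Q X" "rn.through (rev s) v Y P"
      using * st gap_revneg[OF S st(1,2)] by (auto simp: through_rev)
    moreover have "p = rev Q @ P" using *(4) by (metis rev_append rev_rev_ident)
    ultimately show "p \<in> rn.adj_bricks (rev ` S)" unfolding rn.adj_bricks_def by blast
  qed
qed

text \<open>Greediness of the members of \<open>S\<close> gives one inclusion; the other follows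
  since both systems have one path per corner.\<close>

lemma brick_system_adj_bricks:
  assumes S: "path_system S" shows "brick_system (adj_bricks S) = S"
proof
  interpret rn: cornered E tv hv "\<lambda>x. - ko x" "\<lambda>x. - ki x" RC LC "\<lambda>v. N - rk v" N by (rule revneg)
  have S': "rn.path_system (rev ` S)" using S path_system_revneg by blast
  have Bb: "\<forall>b \<in> adj_bricks S. brick b" using adj_bricks_brick_clique[OF S] unfolding brick_clique_def by blast
  have T: "path_system (brick_system (adj_bricks S))" using path_system_brick_system[OF Bb] .
  show sub: "S \<subseteq> brick_system (adj_bricks S)"
  proof
    fix s assume s: "s \<in> S"
    show "s \<in> brick_system (adj_bricks S)"
    proof (cases "hd s \<in> LC")
      case True
      then show ?thesis using left_paths_adj_bricks[OF S s] unfolding brick_system_def by blast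
    next
      case False
      then have "hd (rev s) \<in> RC" using path_system_ends(3,7)[OF S s] by simp
      then have "rev s \<in> rn.left_paths (rn.adj_bricks (rev ` S))" using rn.left_paths_adj_bricks[OF S'] s by blast
      then have "rev s \<in> rn.left_paths (rev ` adj_bricks S)" unfolding adj_bricks_revneg[OF S] .
      then have "s \<in> right_paths (adj_bricks S)" unfolding right_paths_def in_rev_image .
      then show ?thesis unfolding brick_system_def by blast
    qed
  qed
  show "brick_system (adj_bricks S) \<subseteq> S"
  proof
    fix t assume t: "t \<in> brick_system (adj_bricks S)"
    show "t \<in> S"
    proof (cases "hd t \<in> LC")
      case True
      then obtain s where "s \<in> S" "hd s = hd t" using path_systemD(2)[OF S] by blast
      then show ?thesis using path_systemD(5)[OF T _ t] sub True by blast
    next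
      case False
      then have l: "last t \<in> RC" using path_system_ends(7)[OF T t] by blast
      then obtain s where "s \<in> S" "last s = last t" using path_systemD(3)[OF S] by blast
      then show ?thesis using path_systemD(6)[OF T _ t] sub l by blast
    qed
  qed
qed

theorem Down_bij: "bij_betw Down {D. max_clique D} {B. brick_clique B}"
proof (rule bij_betw_imageI)
  show "inj_on Down {D. max_clique D}"
  proof (rule inj_onI)
    fix D1 D2 assume D: "D1 \<in> {D. max_clique D}" "D2 \<in> {D. max_clique D}" and eq: "Down D1 = Down D2"
    then have m: "max_clique D1" "max_clique D2" by auto
    have "adj_bricks (system_of D1) = adj_bricks (system_of D2)" using eq Down_eq m by simp
    then have "brick_system (adj_bricks (system_of D1)) = brick_system (adj_bricks (system_of D2))" by (rule arg_cong)
    then have "system_of D1 = system_of D2" unfolding brick_system_adj_bricks[OF path_system_system_of[OF m(1)]] brick_system_adj_bricks[OF path_system_system_of[OF m(2)]] .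
    then have "routes_of (system_of D1) = routes_of (system_of D2)" by (rule arg_cong)
    then show "D1 = D2" unfolding routes_of_system_of[OF m(1)] routes_of_system_of[OF m(2)] .
  qed
  show "Down ` {D. max_clique D} = {B. brick_clique B}"
  proof
    show "Down ` {D. max_clique D} \<subseteq> {B. brick_clique B}"
    proof (intro image_subsetI CollectI)
      fix D assume "D \<in> {D. max_clique D}"
      then have m: "max_clique D" by simp
      show "brick_clique (Down D)" unfolding Down_eq[OF m] by (rule adj_bricks_brick_clique[OF path_system_system_of[OF m]])
    qed
    show "{B. brick_clique B} \<subseteq> Down ` {D. max_clique D}"
    proof
      fix B assume "B \<in> {B. brick_clique B}"
      then have B: "brick_clique B" by simp
      then have S: "path_system (brick_system B)" using path_system_brick_system unfolding brick_clique_def by blast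
      have "Down (routes_of (brick_system B)) = B" unfolding Down_eq[OF max_clique_routes_of[OF S]] system_of_routes_of[OF S] adj_bricks_brick_system[OF B] ..
      then show "B \<in> Down ` {D. max_clique D}" using max_clique_routes_of[OF S] by blast
    qed
  qed
qed

end

section \<open>Framed graphs as cornered graphs\<close>

definition order_rank :: "('a \<times> 'a) set \<Rightarrow> 'a \<Rightarrow> nat" where
  "order_rank R x = card {y. (y, x) \<in> R}"

locale fin_order =
  fixes A :: "'a set" and R :: "('a \<times> 'a) set"
  assumes fin: "finite A" and sub: "R \<subseteq> A \<times> A" and slo: "strict_linear_order_on A R"
begin

lemma R_trans: "(x, y) \<in> R \<Longrightarrow> (y, z) \<in> R \<Longrightarrow> (x, z) \<in> R"
  using slo unfolding strict_linear_order_on_def by (meson transE)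

lemma R_irrefl: "(x, x) \<notin> R"
  using slo unfolding strict_linear_order_on_def by (simp add: irrefl_def)

lemma R_total: "x \<in> A \<Longrightarrow> y \<in> A \<Longrightarrow> x = y \<or> (x, y) \<in> R \<or> (y, x) \<in> R"
  using slo unfolding strict_linear_order_on_def total_on_def by blast

lemma order_rank_less: "(x, y) \<in> R \<Longrightarrow> order_rank R x < order_rank R y"
proof -
  assume xy: "(x, y) \<in> R"
  have "finite {z. (z, y) \<in> R}" using finite_subset[OF _ fin, of "{z. (z, y) \<in> R}"] sub by blast
  moreover have "{z. (z, x) \<in> R} \<subset> {z. (z, y) \<in> R}" using xy R_trans R_irrefl by blast
  ultimately show ?thesis unfolding order_rank_def by (rule psubset_card_mono)
qed

lemma order_rank_iff: "x \<in> A \<Longrightarrow> y \<in> A \<Longrightarrow> order_rank R x < order_rank R y \<longleftrightarrow> (x, y) \<in> R"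
  using order_rank_less R_total by (metis less_asym less_irrefl)

lemma order_rank_inj: "x \<in> A \<Longrightarrow> y \<in> A \<Longrightarrow> order_rank R x = order_rank R y \<Longrightarrow> x = y"
  using order_rank_less R_total by (metis less_irrefl)

lemma consecutive_in: "consecutive R x y \<Longrightarrow> x \<in> A \<and> y \<in> A \<and> (x, y) \<in> R"
  using sub unfolding consecutive_def by blast

lemma consecutive_order_rank: "consecutive R x y \<Longrightarrow> z \<in> A \<Longrightarrow> order_rank R z \<le> order_rank R x \<or> order_rank R y \<le> order_rank R z"
  using consecutive_in order_rank_iff unfolding consecutive_def by (meson not_le)

lemma consecutive_inj: "consecutive R x y \<Longrightarrow> consecutive R x z \<Longrightarrow> y = z"
  using consecutive_in R_total unfolding consecutive_def by metis

lemma consecutive_ex: "(x, y) \<in> R \<Longrightarrow> \<exists>z. consecutive R x z"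
proof (induction "order_rank R y" arbitrary: y rule: less_induct)
  case less
  show ?case
  proof (cases "\<exists>z. (x, z) \<in> R \<and> (z, y) \<in> R")
    case True
    then show ?thesis using less order_rank_less by blast
  next
    case False
    then show ?thesis using less.prems unfolding consecutive_def by blast
  qed
qed

end

text \<open>
  \<open>XI v\<close> stands for the route of length 0 at a vertex that is both a source and a sink. Corners
  receive odd keys and edges even ones.
\<close>

datatype 'e xstep = XE 'e | XL "'e corner" | XR "'e corner" | XI nat

locale framed =
  fixes n :: nat and \<Gamma> :: "'e framed_graph"
  assumes fg: "framed_graph n \<Gamma>"
begin

abbreviation "G \<equiv> graph \<Gamma>"

lemma fin_G: "fin_digraph G"
  using fg unfolding framed_graph_def flow_graph_def by blast

lemma verts_G: "verts G = {1..n}"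
  using fg unfolding framed_graph_def flow_graph_def by blast

lemma tail_head: "e \<in> arcs G \<Longrightarrow> tail G e < head G e"
  using fg unfolding framed_graph_def flow_graph_def by blast

end

sublocale framed \<subseteq> D: fin_digraph "graph \<Gamma>"
  by (rule fin_G)

context framed begin

fun xhv :: "'e xstep \<Rightarrow> nat option" where
  "xhv (XE e) = (if head G e \<in> internal G then Some (head G e) else None)"
| "xhv (XL c) = Some (cvert c)"
| "xhv (XR c) = None"
| "xhv (XI v) = None"

fun xtv :: "'e xstep \<Rightarrow> nat option" where
  "xtv (XE e) = (if tail G e \<in> internal G then Some (tail G e) else None)"
| "xtv (XL c) = None"
| "xtv (XR c) = Some (cvert c)"
| "xtv (XI v) = None"

fun xki :: "'e xstep \<Rightarrow> int" where
  "xki (XE e) = 2 * int (order_rank (in_order \<Gamma> (head G e)) e)"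
| "xki (XL c) = 2 * int (order_rank (in_order \<Gamma> (cvert c)) (cdown c)) + 1"
| "xki _ = 0"

fun xko :: "'e xstep \<Rightarrow> int" where
  "xko (XE e) = 2 * int (order_rank (out_order \<Gamma> (tail G e)) e)"
| "xko (XR c) = 2 * int (order_rank (out_order \<Gamma> (cvert c)) (cdown c)) + 1"
| "xko _ = 0"

definition "xLC = XL ` {c. left_corner \<Gamma> c}"
definition "xRC = XR ` {c. right_corner \<Gamma> c}"
definition "xE = XE ` arcs G \<union> xLC \<union> xRC \<union> XI ` {v. is_source G v \<and> is_sink G v}"

lemma in_fin_order: "v \<in> internal G \<Longrightarrow> fin_order (in_arcs G v) (in_order \<Gamma> v)"
  using fg unfolding framed_graph_def by unfold_locales auto

lemma out_fin_order: "v \<in> internal G \<Longrightarrow> fin_order (out_arcs G v) (out_order \<Gamma> v)"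
  using fg unfolding framed_graph_def by unfold_locales auto

lemma internal_verts: "v \<in> internal G \<Longrightarrow> v \<in> verts G"
  unfolding internal_def by blast

lemma left_corner_arcs:
  assumes "left_corner \<Gamma> c"
  shows "cvert c \<in> internal G" "cdown c \<in> arcs G" "cup c \<in> arcs G" "head G (cdown c) = cvert c" "head G (cup c) = cvert c"
proof -
  show i: "cvert c \<in> internal G" using assms unfolding left_corner_def by blast
  have "consecutive (in_order \<Gamma> (cvert c)) (cdown c) (cup c)" using assms unfolding left_corner_def by blast
  then have "cdown c \<in> in_arcs G (cvert c)" "cup c \<in> in_arcs G (cvert c)"
    using fin_order.consecutive_in[OF in_fin_order[OF i]] by blast+
  then show "cdown c \<in> arcs G" "cup c \<in> arcs G" "head G (cdown c) = cvert c" "head G (cup c) = cvert c" by auto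
qed

lemma right_corner_arcs:
  assumes "right_corner \<Gamma> c"
  shows "cvert c \<in> internal G" "cdown c \<in> arcs G" "cup c \<in> arcs G" "tail G (cdown c) = cvert c" "tail G (cup c) = cvert c"
proof -
  show i: "cvert c \<in> internal G" using assms unfolding right_corner_def by blast
  have "consecutive (out_order \<Gamma> (cvert c)) (cdown c) (cup c)" using assms unfolding right_corner_def by blast
  then have "cdown c \<in> out_arcs G (cvert c)" "cup c \<in> out_arcs G (cvert c)"
    using fin_order.consecutive_in[OF out_fin_order[OF i]] by blast+
  then show "cdown c \<in> arcs G" "cup c \<in> arcs G" "tail G (cdown c) = cvert c" "tail G (cup c) = cvert c" by auto
qed

lemma finite_corners: "finite {c. left_corner \<Gamma> c}" "finite {c. right_corner \<Gamma> c}"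
proof -
  let ?f = "\<lambda>(v, e, f). Corner v e f"
  have fin: "finite (?f ` (verts G \<times> arcs G \<times> arcs G))" by simp
  have "c \<in> ?f ` (verts G \<times> arcs G \<times> arcs G)" if "left_corner \<Gamma> c" for c
  proof (rule image_eqI)
    show "c = ?f (cvert c, cdown c, cup c)" by (cases c) simp
    show "(cvert c, cdown c, cup c) \<in> verts G \<times> arcs G \<times> arcs G"
      using left_corner_arcs(1-3)[OF that] internal_verts by blast
  qed
  then have "{c. left_corner \<Gamma> c} \<subseteq> ?f ` (verts G \<times> arcs G \<times> arcs G)" by (rule subsetI) (simp only: mem_Collect_eq)
  then show "finite {c. left_corner \<Gamma> c}" by (rule finite_subset[OF _ fin])
  have "c \<in> ?f ` (verts G \<times> arcs G \<times> arcs G)" if "right_corner \<Gamma> c" for c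
  proof (rule image_eqI)
    show "c = ?f (cvert c, cdown c, cup c)" by (cases c) simp
    show "(cvert c, cdown c, cup c) \<in> verts G \<times> arcs G \<times> arcs G"
      using right_corner_arcs(1-3)[OF that] internal_verts by blast
  qed
  then have "{c. right_corner \<Gamma> c} \<subseteq> ?f ` (verts G \<times> arcs G \<times> arcs G)" by (rule subsetI) (simp only: mem_Collect_eq)
  then show "finite {c. right_corner \<Gamma> c}" by (rule finite_subset[OF _ fin])
qed

lemma corner_eqI: "cvert c = cvert d \<Longrightarrow> cdown c = cdown d \<Longrightarrow> cup c = cup d \<Longrightarrow> c = d"
  by (cases c; cases d) auto

lemma internal_out: "v \<in> internal G \<Longrightarrow> \<exists>e \<in> arcs G. tail G e = v"
  unfolding internal_def is_sink_def by (auto simp: out_arcs_def)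

lemma internal_in: "v \<in> internal G \<Longrightarrow> \<exists>e \<in> arcs G. head G e = v"
  unfolding internal_def is_source_def by (auto simp: in_arcs_def)

lemma xE_hv:
  assumes "x \<in> xE" "xhv x = Some v"
  obtains e where "x = XE e" "e \<in> arcs G" "head G e = v" "v \<in> internal G"
  | c where "x = XL c" "left_corner \<Gamma> c" "cvert c = v" "v \<in> internal G" "x \<in> xLC"
  using assms left_corner_arcs(1) unfolding xE_def xLC_def xRC_def by (auto split: if_splits)

lemma xE_tv:
  assumes "x \<in> xE" "xtv x = Some v"
  obtains e where "x = XE e" "e \<in> arcs G" "tail G e = v" "v \<in> internal G"
  | c where "x = XR c" "right_corner \<Gamma> c" "cvert c = v" "v \<in> internal G" "x \<in> xRC"
  using assms right_corner_arcs(1) unfolding xE_def xLC_def xRC_def by (auto split: if_splits)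

text \<open>Two corners at \<open>v\<close> with the same lower edge coincide, because an edge has
  only one immediate successor. The key of a corner depends on the lower edge only, so this is what
  keeps other corners out of the interval.\<close>

lemma xki_corner:
  assumes c: "left_corner \<Gamma> c" "cvert c = v" and x: "x \<in> xE" "xhv x = Some v"
  shows "x = XL c \<or> xki x \<le> xki (XE (cdown c)) \<or> xki (XE (cup c)) \<le> xki x"
  using x
proof (cases rule: xE_hv)
  have i: "v \<in> internal G" using left_corner_arcs(1)[OF c(1)] c(2) by simp
  interpret fin_order "in_arcs G v" "in_order \<Gamma> v" using in_fin_order[OF i] .
  have cc: "consecutive (in_order \<Gamma> v) (cdown c) (cup c)" using c unfolding left_corner_def by auto
  note h = left_corner_arcs(4,5)[OF c(1)]
  {
    case (1 e)
    then show ?thesis using consecutive_order_rank[OF cc, of e] h c(2) by auto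
  next
    case (2 d)
    have dd: "consecutive (in_order \<Gamma> v) (cdown d) (cup d)" using 2 unfolding left_corner_def by auto
    have m: "cdown d \<in> in_arcs G v" "cdown c \<in> in_arcs G v" using consecutive_in[OF cc] consecutive_in[OF dd] by blast+
    consider "order_rank (in_order \<Gamma> v) (cdown d) < order_rank (in_order \<Gamma> v) (cdown c)"
      | "order_rank (in_order \<Gamma> v) (cdown d) = order_rank (in_order \<Gamma> v) (cdown c)" | "order_rank (in_order \<Gamma> v) (cup c) \<le> order_rank (in_order \<Gamma> v) (cdown d)"
      using consecutive_order_rank[OF cc m(1)] by linarith
    then show ?thesis
    proof cases
      case a: 2
      then have "cdown d = cdown c" using order_rank_inj m by blast
      moreover from this have "cup d = cup c" using consecutive_inj[OF _ cc] dd by metis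
      ultimately have "d = c" using corner_eqI 2 c(2) by metis
      then show ?thesis using 2 by simp
    qed (use 2 h c(2) in auto)
  }
qed

lemma xko_corner:
  assumes c: "right_corner \<Gamma> c" "cvert c = v" and x: "x \<in> xE" "xtv x = Some v"
  shows "x = XR c \<or> xko x \<le> xko (XE (cdown c)) \<or> xko (XE (cup c)) \<le> xko x"
  using x
proof (cases rule: xE_tv)
  have i: "v \<in> internal G" using right_corner_arcs(1)[OF c(1)] c(2) by simp
  interpret fin_order "out_arcs G v" "out_order \<Gamma> v" using out_fin_order[OF i] .
  have cc: "consecutive (out_order \<Gamma> v) (cdown c) (cup c)" using c unfolding right_corner_def by auto
  note h = right_corner_arcs(4,5)[OF c(1)]
  {
    case (1 e)
    then show ?thesis using consecutive_order_rank[OF cc, of e] h c(2) by auto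
  next
    case (2 d)
    have dd: "consecutive (out_order \<Gamma> v) (cdown d) (cup d)" using 2 unfolding right_corner_def by auto
    have m: "cdown d \<in> out_arcs G v" "cdown c \<in> out_arcs G v" using consecutive_in[OF cc] consecutive_in[OF dd] by blast+
    consider "order_rank (out_order \<Gamma> v) (cdown d) < order_rank (out_order \<Gamma> v) (cdown c)"
      | "order_rank (out_order \<Gamma> v) (cdown d) = order_rank (out_order \<Gamma> v) (cdown c)" | "order_rank (out_order \<Gamma> v) (cup c) \<le> order_rank (out_order \<Gamma> v) (cdown d)"
      using consecutive_order_rank[OF cc m(1)] by linarith
    then show ?thesis
    proof cases
      case a: 2
      then have "cdown d = cdown c" using order_rank_inj m by blast
      moreover from this have "cup d = cup c" using consecutive_inj[OF _ cc] dd by metis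
      ultimately have "d = c" using corner_eqI 2 c(2) by metis
      then show ?thesis using 2 by simp
    qed (use 2 h c(2) in auto)
  }
qed

lemma xki_lr:
  assumes "left_corner \<Gamma> c"
  shows "xki (XE (cdown c)) < xki (XL c)" "xki (XL c) < xki (XE (cup c))"
proof -
  have i: "cvert c \<in> internal G" using left_corner_arcs(1)[OF assms] .
  interpret fin_order "in_arcs G (cvert c)" "in_order \<Gamma> (cvert c)" using in_fin_order[OF i] .
  have "order_rank (in_order \<Gamma> (cvert c)) (cdown c) < order_rank (in_order \<Gamma> (cvert c)) (cup c)"
    using assms order_rank_less unfolding left_corner_def consecutive_def by blast
  then show "xki (XE (cdown c)) < xki (XL c)" "xki (XL c) < xki (XE (cup c))"
    using left_corner_arcs(4,5)[OF assms] by auto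
qed

lemma xko_lr:
  assumes "right_corner \<Gamma> c"
  shows "xko (XE (cdown c)) < xko (XR c)" "xko (XR c) < xko (XE (cup c))"
proof -
  have i: "cvert c \<in> internal G" using right_corner_arcs(1)[OF assms] .
  interpret fin_order "out_arcs G (cvert c)" "out_order \<Gamma> (cvert c)" using out_fin_order[OF i] .
  have "order_rank (out_order \<Gamma> (cvert c)) (cdown c) < order_rank (out_order \<Gamma> (cvert c)) (cup c)"
    using assms order_rank_less unfolding right_corner_def consecutive_def by blast
  then show "xko (XE (cdown c)) < xko (XR c)" "xko (XR c) < xko (XE (cup c))"
    using right_corner_arcs(4,5)[OF assms] by auto
qed

lemma xki_E:
  assumes "e \<in> arcs G" "f \<in> arcs G" "head G e = v" "head G f = v" "v \<in> internal G"
  shows "xki (XE e) < xki (XE f) \<longleftrightarrow> (e, f) \<in> in_order \<Gamma> v" "xki (XE e) = xki (XE f) \<longleftrightarrow> e = f"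
proof -
  interpret fin_order "in_arcs G v" "in_order \<Gamma> v" using in_fin_order[OF assms(5)] .
  have m: "e \<in> in_arcs G v" "f \<in> in_arcs G v" using assms by auto
  show "xki (XE e) < xki (XE f) \<longleftrightarrow> (e, f) \<in> in_order \<Gamma> v" using order_rank_iff[OF m] assms by simp
  show "xki (XE e) = xki (XE f) \<longleftrightarrow> e = f" using order_rank_inj[OF m] assms by auto
qed

lemma xko_E:
  assumes "e \<in> arcs G" "f \<in> arcs G" "tail G e = v" "tail G f = v" "v \<in> internal G"
  shows "xko (XE e) < xko (XE f) \<longleftrightarrow> (e, f) \<in> out_order \<Gamma> v" "xko (XE e) = xko (XE f) \<longleftrightarrow> e = f"
proof -
  interpret fin_order "out_arcs G v" "out_order \<Gamma> v" using out_fin_order[OF assms(5)] .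
  have m: "e \<in> out_arcs G v" "f \<in> out_arcs G v" using assms by auto
  show "xko (XE e) < xko (XE f) \<longleftrightarrow> (e, f) \<in> out_order \<Gamma> v" using order_rank_iff[OF m] assms by simp
  show "xko (XE e) = xko (XE f) \<longleftrightarrow> e = f" using order_rank_inj[OF m] assms by auto
qed

lemma XE_parity: "xki (XE e) \<noteq> xki (XL c)" "xko (XE e) \<noteq> xko (XR c)"
  by (auto, presburger+)

text \<open>Edges go from smaller to larger vertices, so the identity serves as rank, and all
  vertices are at most \<open>n\<close>.\<close>

lemma cornered_model: "cornered xE xhv xtv xki xko xLC xRC id n"
proof (rule cornered.intro, goal_cases)
  case 1
  have "{v. is_source G v \<and> is_sink G v} \<subseteq> verts G" unfolding is_source_def by blast
  then have "finite {v. is_source G v \<and> is_sink G v}" using finite_subset D.finite_verts by blast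
  then show ?case unfolding xE_def xLC_def xRC_def using finite_corners by simp
next
  case 9
  show ?case
  proof (rule inj_onI)
    fix v x y assume xy: "x \<in> {x \<in> xE. xhv x = Some v}" "y \<in> {x \<in> xE. xhv x = Some v}" "xki x = xki y"
    then have x: "x \<in> xE" "xhv x = Some v" and y: "y \<in> xE" "xhv y = Some v" by auto
    from x show "x = y"
    proof (cases rule: xE_hv)
      case (1 e)
      from y show ?thesis
      proof (cases rule: xE_hv)
        case (1 f)
        then show ?thesis using \<open>x = XE e\<close> \<open>e \<in> arcs G\<close> \<open>head G e = v\<close> xki_E(2)[of e f v] xy(3) by simp
      next
        case (2 d)
        then show ?thesis using XE_parity(1)[of e d] 1(1) xy(3) by simp
      qed
    next
      case (2 c)
      from y show ?thesis using xki_corner[OF 2(2,3) y] xki_lr[OF 2(2)] 2(1) xy(3) by fastforce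
    qed
  qed
next
  case 10
  show ?case
  proof (rule inj_onI)
    fix v x y assume xy: "x \<in> {x \<in> xE. xtv x = Some v}" "y \<in> {x \<in> xE. xtv x = Some v}" "xko x = xko y"
    then have x: "x \<in> xE" "xtv x = Some v" and y: "y \<in> xE" "xtv y = Some v" by auto
    from x show "x = y"
    proof (cases rule: xE_tv)
      case (1 e)
      from y show ?thesis
      proof (cases rule: xE_tv)
        case (1 f)
        then show ?thesis using \<open>x = XE e\<close> \<open>e \<in> arcs G\<close> \<open>tail G e = v\<close> xko_E(2)[of e f v] xy(3) by simp
      next
        case (2 d)
        then show ?thesis using XE_parity(2)[of e d] 1(1) xy(3) by simp
      qed
    next
      case (2 c)
      from y show ?thesis using xko_corner[OF 2(2,3) y] xko_lr[OF 2(2)] 2(1) xy(3) by fastforce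
    qed
  qed
next
  case (11 x u v)
  then show ?case using tail_head unfolding xE_def xLC_def xRC_def by (auto split: if_splits)
next
  case (12 x v)
  then have "v \<in> internal G" using xE_hv by metis
  then show ?case using internal_verts verts_G by auto
next
  case (13 x v)
  then have "v \<in> internal G" using xE_tv by metis
  then show ?case using internal_verts verts_G by auto
next
  case (14 x v)
  then have v: "v \<in> internal G" using xE_hv by metis
  then obtain e where e: "e \<in> arcs G" "tail G e = v" using internal_out by blast
  then have "XE e \<in> xE - xRC" "xtv (XE e) = Some v" using v unfolding xE_def xRC_def by auto
  then show ?case by blast
next
  case (15 x v)
  then have v: "v \<in> internal G" using xE_tv by metis
  then obtain e where e: "e \<in> arcs G" "head G e = v" using internal_in by blast
  then have "XE e \<in> xE - xLC" "xhv (XE e) = Some v" using v unfolding xE_def xLC_def by auto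
  then show ?case by blast
next
  case (16 c v)
  then obtain d where d: "c = XL d" "left_corner \<Gamma> d" "cvert d = v" unfolding xLC_def by auto
  have m: "XE (cdown d) \<in> xE - xLC" "XE (cup d) \<in> xE - xLC"
    using left_corner_arcs[OF d(2)] unfolding xE_def xLC_def by auto
  have h: "xhv (XE (cdown d)) = Some v" "xhv (XE (cup d)) = Some v"
    using left_corner_arcs[OF d(2)] d(3) by auto
  have lr: "xki (XE (cdown d)) < xki c" "xki c < xki (XE (cup d))" using xki_lr[OF d(2)] unfolding d(1) .
  have nb: "\<forall>x \<in> xE. xhv x = Some v \<longrightarrow> x = c \<or> xki x \<le> xki (XE (cdown d)) \<or> xki (XE (cup d)) \<le> xki x"
    using xki_corner[OF d(2,3)] unfolding d(1) by (intro ballI impI)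
  show ?case
    by (rule exI[of _ "XE (cdown d)"], rule exI[of _ "XE (cup d)"], intro conjI) (fact m h lr nb)+
next
  case (17 c v)
  then obtain d where d: "c = XR d" "right_corner \<Gamma> d" "cvert d = v" unfolding xRC_def by auto
  have m: "XE (cdown d) \<in> xE - xRC" "XE (cup d) \<in> xE - xRC"
    using right_corner_arcs[OF d(2)] unfolding xE_def xRC_def by auto
  have h: "xtv (XE (cdown d)) = Some v" "xtv (XE (cup d)) = Some v"
    using right_corner_arcs[OF d(2)] d(3) by auto
  have lr: "xko (XE (cdown d)) < xko c" "xko c < xko (XE (cup d))" using xko_lr[OF d(2)] unfolding d(1) .
  have nb: "\<forall>x \<in> xE. xtv x = Some v \<longrightarrow> x = c \<or> xko x \<le> xko (XE (cdown d)) \<or> xko (XE (cup d)) \<le> xko x"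
    using xko_corner[OF d(2,3)] unfolding d(1) by (intro ballI impI)
  show ?case
    by (rule exI[of _ "XE (cdown d)"], rule exI[of _ "XE (cup d)"], intro conjI) (fact m h lr nb)+
next
  case (18 x y v)
  obtain e where e: "x = XE e" "e \<in> arcs G" "head G e = v" "v \<in> internal G" using 18 xE_hv[of x v] by blast
  obtain f where f: "y = XE f" "f \<in> arcs G" "head G f = v" using 18 xE_hv[of y v] by blast
  interpret fin_order "in_arcs G v" "in_order \<Gamma> v" using in_fin_order[OF e(4)] .
  have ef: "(e, f) \<in> in_order \<Gamma> v" using xki_E(1) e f 18(5) by blast
  then obtain g where g: "consecutive (in_order \<Gamma> v) e g" using consecutive_ex by blast
  let ?c = "Corner v e g"
  have "left_corner \<Gamma> ?c" unfolding left_corner_def using g e(4) by simp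
  moreover have "xki x < xki (XL ?c)" "xki (XL ?c) < xki y"
    using order_rank_less[OF ef] e f by auto
  ultimately show ?case unfolding xLC_def by (intro exI[of _ "XL ?c"]) auto
next
  case (19 x y v)
  obtain e where e: "x = XE e" "e \<in> arcs G" "tail G e = v" "v \<in> internal G" using 19 xE_tv[of x v] by blast
  obtain f where f: "y = XE f" "f \<in> arcs G" "tail G f = v" using 19 xE_tv[of y v] by blast
  interpret fin_order "out_arcs G v" "out_order \<Gamma> v" using out_fin_order[OF e(4)] .
  have ef: "(e, f) \<in> out_order \<Gamma> v" using xko_E(1) e f 19(5) by blast
  then obtain g where g: "consecutive (out_order \<Gamma> v) e g" using consecutive_ex by blast
  let ?c = "Corner v e g"
  have "right_corner \<Gamma> ?c" unfolding right_corner_def using g e(4) by simp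
  moreover have "xko x < xko (XR ?c)" "xko (XR ?c) < xko y"
    using order_rank_less[OF ef] e f by auto
  ultimately show ?case unfolding xRC_def by (intro exI[of _ "XR ?c"]) auto
qed (auto simp: xE_def xLC_def xRC_def)

end

sublocale framed \<subseteq> M: cornered xE xhv xtv xki xko xLC xRC id n
  by (rule cornered_model)

section \<open>Lexicographic comparison, walks and lists of steps\<close>

lemma lex_less_Nil [simp]: "\<not> lex_less R [] ys" "\<not> lex_less R xs []"
  unfolding lex_less_def by auto

lemma lex_less_Cons: "lex_less R (x # xs) (y # ys) \<longleftrightarrow> (x, y) \<in> R \<or> x = y \<and> lex_less R xs ys"
proof
  assume "lex_less R (x # xs) (y # ys)"
  then obtain us a b xs' ys' where *: "x # xs = us @ a # xs'" "y # ys = us @ b # ys'" "(a, b) \<in> R"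
    unfolding lex_less_def by blast
  show "(x, y) \<in> R \<or> x = y \<and> lex_less R xs ys"
  proof (cases us)
    case Nil
    then show ?thesis using * by simp
  next
    case (Cons u us')
    then show ?thesis using * unfolding lex_less_def by auto
  qed
next
  assume "(x, y) \<in> R \<or> x = y \<and> lex_less R xs ys"
  then show "lex_less R (x # xs) (y # ys)"
  proof
    assume "(x, y) \<in> R"
    then show ?thesis unfolding lex_less_def by (intro exI[of _ "[]"]) auto
  next
    assume "x = y \<and> lex_less R xs ys"
    then show ?thesis unfolding lex_less_def by (metis append_Cons)
  qed
qed

text \<open>\<open>R\<close> will be a union of orders over all vertices. Half paths first differ at
  steps of one common vertex \<open>w\<close>, so agreement of \<open>R\<close> with the keys is
  required for such pairs only.\<close>

lemma lex_less_lt: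
  assumes "half E h t v (map f xs)" "half E h t v (map f ys)" "inj f"
    and R: "\<And>x y w. f x \<in> E \<Longrightarrow> f y \<in> E \<Longrightarrow> h (f x) = Some w \<Longrightarrow> h (f y) = Some w \<Longrightarrow>
      (x, y) \<in> R \<longleftrightarrow> k (f x) < k (f y)"
  shows "lex_less R xs ys \<longleftrightarrow> lt k (map f xs) (map f ys)"
  using assms(1,2)
proof (induction xs arbitrary: v ys)
  case (Cons x xs)
  then obtain y ys' where ys: "ys = y # ys'" by (cases ys) auto
  have h: "f x \<in> E" "f y \<in> E" "h (f x) = Some v" "h (f y) = Some v" using Cons.prems ys by auto
  have "lex_less R xs ys' \<longleftrightarrow> lt k (map f xs) (map f ys')" if "x = y"
  proof (cases "t (f x)")
    case None
    then show ?thesis using Cons.prems by simp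
  next
    case (Some u)
    then show ?thesis using Cons.IH[of u ys'] Cons.prems ys that by simp
  qed
  moreover have "f x = f y \<longleftrightarrow> x = y" using assms(3) by (auto simp: inj_def)
  ultimately show ?case using R[OF h] unfolding ys by (auto simp: lex_less_Cons)
qed simp

context framed begin

lemma internalI: "e \<in> arcs G \<Longrightarrow> f \<in> arcs G \<Longrightarrow> head G e = tail G f \<Longrightarrow> head G e \<in> internal G"
  unfolding internal_def is_source_def is_sink_def by (auto simp: in_arcs_def out_arcs_def)

lemma sinkI: "e \<in> arcs G \<Longrightarrow> head G e \<notin> internal G \<Longrightarrow> is_sink G (head G e)"
  unfolding internal_def is_source_def by (auto simp: in_arcs_def)

lemma sourceI: "e \<in> arcs G \<Longrightarrow> tail G e \<notin> internal G \<Longrightarrow> is_source G (tail G e)"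
  unfolding internal_def is_sink_def by (auto simp: out_arcs_def)

lemma sink_not_internal: "is_sink G v \<Longrightarrow> v \<notin> internal G"
  unfolding internal_def by blast

lemma source_not_internal: "is_source G v \<Longrightarrow> v \<notin> internal G"
  unfolding internal_def by blast

lemma walk_Cons: "D.awalk u (e # es) w \<longleftrightarrow> e \<in> arcs G \<and> u = tail G e \<and> D.awalk (head G e) es w"
  by (rule D.awalk_Cons_iff)

lemma walk_Nil: "D.awalk u [] w \<longleftrightarrow> u = w \<and> u \<in> verts G"
  by (rule D.awalk_Nil_iff)

lemma walk_append: "D.awalk u (es @ fs) w \<longleftrightarrow> (\<exists>v. D.awalk u es v \<and> D.awalk v fs w)"
proof (induction es arbitrary: u)
  case Nil
  show ?case using D.awalk_hd_in_verts by (auto simp: walk_Nil)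
next
  case (Cons e es)
  then show ?case by (auto simp: walk_Cons)
qed

lemma walk_end: "D.awalk u es w \<Longrightarrow> D.awalk u es w' \<Longrightarrow> w = w'"
  by (induction es arbitrary: u) (auto simp: walk_Cons walk_Nil)

lemma walk_start: "D.awalk u es w \<Longrightarrow> D.awalk u' es w \<Longrightarrow> u = u'"
  by (cases es) (auto simp: walk_Cons walk_Nil)

lemma walk_split:
  assumes "D.awalk u es w" "v \<in> set (D.awalk_verts u es)"
  shows "D.awalk u (takeWhile (\<lambda>e. tail G e \<noteq> v) es) v \<and> D.awalk v (dropWhile (\<lambda>e. tail G e \<noteq> v) es) w"
  using assms
proof (induction es arbitrary: u)
  case Nil
  then show ?case by (auto simp: walk_Nil)
next
  case (Cons e es)
  show ?case
  proof (cases "tail G e = v")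
    case True
    then show ?thesis using Cons.prems by (auto simp: walk_Nil walk_Cons)
  next
    case False
    then show ?thesis using Cons by (auto simp: walk_Cons)
  qed
qed

lemma walk_tails: "D.awalk u es v \<Longrightarrow> (\<forall>e \<in> set es. tail G e < v) \<and> u \<le> v"
proof (induction es arbitrary: u)
  case Nil
  then show ?case by (simp add: walk_Nil)
next
  case (Cons f es)
  have *: "f \<in> arcs G" "u = tail G f" "D.awalk (head G f) es v" using Cons.prems by (auto simp: walk_Cons)
  then show ?case using Cons.IH[OF *(3)] tail_head[OF *(1)] by auto
qed

text \<open>Vertices increase along a walk, so no edge of \<open>es\<close> has tail
  \<open>v\<close>, and the first edge of \<open>fs\<close>, if there is one, does.\<close>

lemma walk_take:
  assumes "D.awalk u es v" "D.awalk v fs w"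
  shows "takeWhile (\<lambda>e. tail G e \<noteq> v) (es @ fs) = es" "dropWhile (\<lambda>e. tail G e \<noteq> v) (es @ fs) = fs"
proof -
  have 1: "\<forall>e \<in> set es. tail G e \<noteq> v" using walk_tails[OF assms(1)] by auto
  have 2: "fs = [] \<or> tail G (hd fs) = v" using assms(2) by (cases fs) (auto simp: walk_Cons)
  show "takeWhile (\<lambda>e. tail G e \<noteq> v) (es @ fs) = es" "dropWhile (\<lambda>e. tail G e \<noteq> v) (es @ fs) = fs"
    using 1 2 by (induction es) (cases fs; auto)+
qed

lemma walk_mem: "D.awalk u es v \<Longrightarrow> D.awalk v fs w \<Longrightarrow> v \<in> set (D.awalk_verts u (es @ fs))"
proof (induction es arbitrary: u)
  case Nil
  then show ?case by (cases fs) (auto simp: walk_Nil walk_Cons)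
next
  case (Cons e es)
  then show ?case by (auto simp: walk_Cons)
qed

lemma XE_in: "e \<in> arcs G \<Longrightarrow> XE e \<in> xE"
  unfolding xE_def by blast

text \<open>A vertex between two edges of a walk is internal, so the half path goes on exactly until
  the walk reaches its sink.\<close>

lemma rhalf_map: "D.awalk v es w \<Longrightarrow> v \<in> internal G \<Longrightarrow> is_sink G w \<Longrightarrow> M.rhalf v (map XE es)"
proof (induction es arbitrary: v)
  case Nil
  then show ?case using sink_not_internal by (auto simp: walk_Nil)
next
  case (Cons e es)
  then have e: "e \<in> arcs G" "tail G e = v" "D.awalk (head G e) es w" by (auto simp: walk_Cons)
  show ?case
  proof (cases "head G e \<in> internal G")
    case True
    then show ?thesis using Cons.IH[OF e(3)] Cons.prems e XE_in by simp
  next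
    case False
    have "es = []"
    proof (cases es)
      case (Cons f fs)
      then show ?thesis using internalI[of e f] e False by (auto simp: walk_Cons)
    qed
    then show ?thesis using e False XE_in Cons.prems by simp
  qed
qed

lemma rhalf_mapR: "D.awalk v es (cvert c) \<Longrightarrow> v \<in> internal G \<Longrightarrow> right_corner \<Gamma> c \<Longrightarrow> M.rhalf v (map XE es @ [XR c])"
proof (induction es arbitrary: v)
  case Nil
  then show ?case unfolding xE_def xRC_def by (auto simp: walk_Nil)
next
  case (Cons e es)
  then have e: "e \<in> arcs G" "tail G e = v" "D.awalk (head G e) es (cvert c)" by (auto simp: walk_Cons)
  have "head G e \<in> internal G"
  proof (cases es)
    case Nil
    then show ?thesis using e right_corner_arcs(1)[OF Cons.prems(3)] by (simp add: walk_Nil)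
  next
    case (Cons f fs)
    then show ?thesis using internalI[of e f] e by (auto simp: walk_Cons)
  qed
  then show ?case using Cons.IH[OF e(3)] Cons.prems e XE_in by simp
qed

lemma lhalf_map: "D.awalk u es v \<Longrightarrow> v \<in> internal G \<Longrightarrow> is_source G u \<Longrightarrow> M.lhalf v (rev (map XE es))"
proof (induction es arbitrary: v rule: rev_induct)
  case Nil
  then show ?case using source_not_internal by (auto simp: walk_Nil)
next
  case (snoc e es)
  then have e: "e \<in> arcs G" "head G e = v" "D.awalk u es (tail G e)" by (auto simp: walk_append walk_Cons walk_Nil)
  show ?case
  proof (cases "tail G e \<in> internal G")
    case True
    then show ?thesis using snoc.IH[OF e(3)] snoc.prems e XE_in by simp
  next
    case False
    have "es = []"
    proof (cases es rule: rev_cases)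
      case (snoc fs f)
      then show ?thesis using internalI[of f e] e False by (auto simp: walk_append walk_Cons walk_Nil)
    qed
    then show ?thesis using e False XE_in snoc.prems by simp
  qed
qed

lemma lhalf_mapL: "D.awalk (cvert c) es v \<Longrightarrow> v \<in> internal G \<Longrightarrow> left_corner \<Gamma> c \<Longrightarrow> M.lhalf v (rev (map XE es) @ [XL c])"
proof (induction es arbitrary: v rule: rev_induct)
  case Nil
  then show ?case unfolding xE_def xLC_def by (auto simp: walk_Nil)
next
  case (snoc e es)
  then have e: "e \<in> arcs G" "head G e = v" "D.awalk (cvert c) es (tail G e)" by (auto simp: walk_append walk_Cons walk_Nil)
  have "tail G e \<in> internal G"
  proof (cases es rule: rev_cases)
    case Nil
    then show ?thesis using e left_corner_arcs(1)[OF snoc.prems(3)] by (simp add: walk_Nil)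
  next
    case (snoc fs f)
    then show ?thesis using internalI[of f e] e by (auto simp: walk_append walk_Cons walk_Nil)
  qed
  then show ?case using snoc.IH[OF e(3)] snoc.prems e XE_in by simp
qed

lemma rhalf_conv:
  "M.rhalf v Y \<Longrightarrow> (\<exists>es w. Y = map XE es \<and> D.awalk v es w \<and> is_sink G w) \<or>
     (\<exists>es c. Y = map XE es @ [XR c] \<and> D.awalk v es (cvert c) \<and> right_corner \<Gamma> c)"
proof (induction Y arbitrary: v)
  case (Cons y Y)
  have y: "y \<in> xE" "xtv y = Some v" using Cons.prems by auto
  then show ?case
  proof (cases rule: xE_tv)
    case (1 e)
    show ?thesis
    proof (cases "head G e \<in> internal G")
      case True
      then have "M.rhalf (head G e) Y" using Cons.prems 1 by simp
      from Cons.IH[OF this] show ?thesis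
      proof (elim disjE exE conjE)
        fix es w assume "Y = map XE es" "D.awalk (head G e) es w" "is_sink G w"
        then show ?thesis using 1 by (intro disjI1 exI[of _ "e # es"] exI[of _ w]) (auto simp: walk_Cons)
      next
        fix es c assume "Y = map XE es @ [XR c]" "D.awalk (head G e) es (cvert c)" "right_corner \<Gamma> c"
        then show ?thesis using 1 by (intro disjI2 exI[of _ "e # es"] exI[of _ c]) (auto simp: walk_Cons)
      qed
    next
      case False
      then have "Y = []" "is_sink G (head G e)" using Cons.prems 1 sinkI by auto
      then show ?thesis using 1 D.head_in_verts[of e]
        by (intro disjI1 exI[of _ "[e]"] exI[of _ "head G e"]) (auto simp: walk_Cons walk_Nil)
    qed
  next
    case (2 c)
    then have "Y = []" using Cons.prems by simp
    then show ?thesis using 2 internal_verts[of v]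
      by (intro disjI2 exI[of _ "[]"] exI[of _ c]) (auto simp: walk_Nil)
  qed
qed simp

lemma lhalf_conv:
  "M.lhalf v X \<Longrightarrow> (\<exists>es u. X = rev (map XE es) \<and> D.awalk u es v \<and> is_source G u) \<or>
     (\<exists>es c. X = rev (map XE es) @ [XL c] \<and> D.awalk (cvert c) es v \<and> left_corner \<Gamma> c)"
proof (induction X arbitrary: v)
  case (Cons x X)
  have x: "x \<in> xE" "xhv x = Some v" using Cons.prems by auto
  then show ?case
  proof (cases rule: xE_hv)
    case (1 e)
    have vv: "v \<in> verts G" using internal_verts 1 by blast
    show ?thesis
    proof (cases "tail G e \<in> internal G")
      case True
      then have "M.lhalf (tail G e) X" using Cons.prems 1 by simp
      from Cons.IH[OF this] show ?thesis
      proof (elim disjE exE conjE)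
        fix es u assume "X = rev (map XE es)" "D.awalk u es (tail G e)" "is_source G u"
        then show ?thesis using 1 vv
          by (intro disjI1 exI[of _ "es @ [e]"] exI[of _ u]) (auto simp: walk_append walk_Cons walk_Nil)
      next
        fix es c assume "X = rev (map XE es) @ [XL c]" "D.awalk (cvert c) es (tail G e)" "left_corner \<Gamma> c"
        then show ?thesis using 1 vv
          by (intro disjI2 exI[of _ "es @ [e]"] exI[of _ c]) (auto simp: walk_append walk_Cons walk_Nil)
      qed
    next
      case False
      then have "X = []" "is_source G (tail G e)" using Cons.prems 1 sourceI by auto
      then show ?thesis using 1 vv
        by (intro disjI1 exI[of _ "[e]"] exI[of _ "tail G e"]) (auto simp: walk_Cons walk_Nil)
    qed
  next
    case (2 c)
    then have "X = []" using Cons.prems by simp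
    then show ?thesis using 2 internal_verts[of v]
      by (intro disjI2 exI[of _ "[]"] exI[of _ c]) (auto simp: walk_Nil)
  qed
qed simp

lemma route_walk: "route G p \<Longrightarrow> D.awalk (start p) (path_arcs p) (end_vertex G p) \<and> is_source G (start p) \<and> is_sink G (end_vertex G p)"
  unfolding route_def is_dpath_def by blast

lemma prefix_suffix: "prefix_to G v p @ suffix_from G v p = path_arcs p"
  unfolding prefix_to_def suffix_from_def by (rule takeWhile_dropWhile_id)

lemma dpath_split:
  assumes "is_dpath G p" "v \<in> pverts G p"
  shows "D.awalk (start p) (prefix_to G v p) v" "D.awalk v (suffix_from G v p) (end_vertex G p)"
  using walk_split[of "start p" "path_arcs p" "end_vertex G p" v] assms
  unfolding is_dpath_def pverts_def prefix_to_def suffix_from_def by blast+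

lemma split_dpath:
  assumes "path_arcs p = es @ fs" "D.awalk (start p) es v" "D.awalk v fs w"
  shows "v \<in> pverts G p" "prefix_to G v p = es" "suffix_from G v p = fs" "end_vertex G p = w"
proof -
  show "v \<in> pverts G p" unfolding pverts_def assms(1) using walk_mem assms(2,3) .
  show "prefix_to G v p = es" "suffix_from G v p = fs"
    unfolding prefix_to_def suffix_from_def assms(1) using walk_take assms(2,3) by blast+
  have "D.awalk (start p) (path_arcs p) w" using assms(2,3) unfolding assms(1) walk_append by blast
  then show "end_vertex G p = w" unfolding end_vertex_def by auto
qed

definition phi :: "'e dpath \<Rightarrow> 'e xstep list" where
  "phi p = (if path_arcs p = [] then [XI (start p)] else map XE (path_arcs p))"

definition psi :: "'e gpath \<Rightarrow> 'e xstep list" where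
  "psi b = XL (the (lend b)) # map XE (path_arcs (spine b)) @ [XR (the (rend b))]"

lemma inj_XE: "inj XE"
  by (simp add: inj_def)

lemma map_XE_eq [simp]: "map XE es = map XE fs \<longleftrightarrow> es = fs"
  using inj_map_eq_map[OF inj_XE] .

text \<open>The encoding of a route contains no corner steps, which excludes the other forms of half
  path in \<open>lhalf_conv\<close> and \<open>rhalf_conv\<close>.\<close>

lemma through_phi:
  assumes p: "route G p"
  shows "M.through (phi p) v X Y \<longleftrightarrow> v \<in> internal G \<and> v \<in> pverts G p \<and>
    X = rev (map XE (prefix_to G v p)) \<and> Y = map XE (suffix_from G v p)"
proof
  assume t: "M.through (phi p) v X Y"
  then have e: "phi p = rev X @ Y" and X: "M.lhalf v X" and Y: "M.rhalf v Y" unfolding M.through_def by blast+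
  have nXL: "XL c \<notin> set (phi p)" "XR c \<notin> set (phi p)" for c unfolding phi_def by auto
  obtain es u where es: "X = rev (map XE es)" "D.awalk u es v" "is_source G u"
    using lhalf_conv[OF X]
  proof (elim disjE exE conjE)
    fix es c assume "X = rev (map XE es) @ [XL c]"
    then have "XL c \<in> set (phi p)" unfolding e by simp
    then show ?thesis using nXL by blast
  qed blast
  obtain fs w where fs: "Y = map XE fs" "D.awalk v fs w" "is_sink G w"
    using rhalf_conv[OF Y]
  proof (elim disjE exE conjE)
    fix es c assume "Y = map XE es @ [XR c]"
    then have "XR c \<in> set (phi p)" unfolding e by simp
    then show ?thesis using nXL by blast
  qed blast
  have ne: "es \<noteq> []" using X es by auto
  have "path_arcs p \<noteq> []"
  proof
    assume "path_arcs p = []"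
    then have "[XI (start p)] = map XE (es @ fs)" using e es fs unfolding phi_def by simp
    then show False by (cases "es @ fs") auto
  qed
  then have "map XE (path_arcs p) = map XE (es @ fs)" using e es(1) fs(1) unfolding phi_def by simp
  then have a: "path_arcs p = es @ fs" unfolding map_XE_eq .
  have "start p = u"
    using route_walk[OF p] es(2) ne unfolding a by (cases es) (auto simp: walk_Cons)
  moreover have "v \<in> internal G" using xE_hv M.through_hv[OF t] by metis
  ultimately show "v \<in> internal G \<and> v \<in> pverts G p \<and>
    X = rev (map XE (prefix_to G v p)) \<and> Y = map XE (suffix_from G v p)"
    using split_dpath[OF a _ fs(2)] es fs by blast
next
  assume a: "v \<in> internal G \<and> v \<in> pverts G p \<and>
    X = rev (map XE (prefix_to G v p)) \<and> Y = map XE (suffix_from G v p)"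
  have w: "is_dpath G p" "is_source G (start p)" "is_sink G (end_vertex G p)" using p unfolding route_def by blast+
  have s: "D.awalk (start p) (prefix_to G v p) v" "D.awalk v (suffix_from G v p) (end_vertex G p)"
    using dpath_split[OF w(1)] a by blast+
  have X: "M.lhalf v X" using lhalf_map[OF s(1) _ w(2)] a by blast
  have Y: "M.rhalf v Y" using rhalf_map[OF s(2) _ w(3)] a by blast
  have "path_arcs p \<noteq> []" using Y a prefix_suffix[of v p] by auto
  then have "phi p = map XE (prefix_to G v p @ suffix_from G v p)" unfolding phi_def prefix_suffix by simp
  then show "M.through (phi p) v X Y" unfolding M.through_def using X Y a by simp
qed

lemma brickE:
  assumes "brick \<Gamma> b"
  obtains c s d where "b = GPath (Some c) s (Some d)" "left_corner \<Gamma> c" "right_corner \<Gamma> d" "is_dpath G s"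
    "cvert c = start s" "cvert d = end_vertex G s" "D.awalk (cvert c) (path_arcs s) (cvert d)"
    "psi b = XL c # map XE (path_arcs s) @ [XR d]"
proof -
  obtain x s y where b: "b = GPath x s y" by (cases b)
  then obtain c d where "x = Some c" "y = Some d" using assms unfolding brick_def by auto
  then show ?thesis using that[of c s d] assms b unfolding brick_def generalized_path_def is_dpath_def psi_def by auto
qed

lemma walk_internal:
  assumes "D.awalk u es w" "u \<in> internal G" "w \<in> internal G" "v \<in> set (D.awalk_verts u es)"
  shows "v \<in> internal G"
proof -
  have *: "D.awalk u (takeWhile (\<lambda>e. tail G e \<noteq> v) es) v" "D.awalk v (dropWhile (\<lambda>e. tail G e \<noteq> v) es) w"
    using walk_split[OF assms(1,4)] by blast+
  show ?thesis
  proof (cases "dropWhile (\<lambda>e. tail G e \<noteq> v) es")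
    case Nil
    have "v = w" using *(2) unfolding Nil walk_Nil by blast
    then show ?thesis using assms(3) by simp
  next
    case c: (Cons f fs)
    then have f: "f \<in> arcs G" "tail G f = v" using *(2) by (auto simp: walk_Cons)
    show ?thesis
    proof (cases "takeWhile (\<lambda>e. tail G e \<noteq> v) es" rule: rev_cases)
      case Nil
      have "u = v" using *(1) unfolding Nil walk_Nil by blast
      then show ?thesis using assms(2) by simp
    next
      case (snoc gs g)
      then have "g \<in> arcs G" "head G g = v" using *(1) by (auto simp: walk_append walk_Cons walk_Nil)
      then show ?thesis using internalI[of g f] f by simp
    qed
  qed
qed

text \<open>The spine joins two internal vertices, so by \<open>walk_internal\<close> the brick can
  be split at each of its vertices.\<close>

lemma through_psi:
  assumes b: "brick \<Gamma> b" "b = GPath (Some c) s (Some d)"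
  shows "M.through (psi b) v X Y \<longleftrightarrow> v \<in> pverts G s \<and>
    X = rev (map XE (prefix_to G v s)) @ [XL c] \<and> Y = map XE (suffix_from G v s) @ [XR d]"
proof -
  have bb: "left_corner \<Gamma> c" "right_corner \<Gamma> d" "is_dpath G s"
    "cvert c = start s" "cvert d = end_vertex G s" "D.awalk (cvert c) (path_arcs s) (cvert d)"
    "psi b = XL c # map XE (path_arcs s) @ [XR d]"
    using brickE[OF b(1)] unfolding b(2) by (metis gpath.inject option.inject)+
  show ?thesis
  proof
    assume t: "M.through (psi b) v X Y"
    then have e: "psi b = rev X @ Y" and X: "M.lhalf v X" and Y: "M.rhalf v Y" unfolding M.through_def by blast+
    have h: "last X = XL c" "last Y = XR d" using M.through_hd[OF t] M.through_last[OF t] bb(7) by auto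
    have XE_no: "last (rev (map XE es)) \<noteq> XL c" if "es \<noteq> []" for es :: "'e list" and c
      using that by (cases es) auto
    have XE_no': "last (map XE es) \<noteq> XR c" if "es \<noteq> []" for es :: "'e list" and c
      using that by (cases es rule: rev_cases) auto
    obtain es where es: "X = rev (map XE es) @ [XL c]" "D.awalk (cvert c) es v"
      using lhalf_conv[OF X]
    proof (elim disjE exE conjE)
      fix es u assume "X = rev (map XE es)"
      then show ?thesis using XE_no h(1) X by (cases "es = []") auto
    next
      fix es c' assume "X = rev (map XE es) @ [XL c']" "D.awalk (cvert c') es v"
      then show ?thesis using that h(1) by simp
    qed
    obtain fs where fs: "Y = map XE fs @ [XR d]" "D.awalk v fs (cvert d)"
      using rhalf_conv[OF Y]
    proof (elim disjE exE conjE)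
      fix es u assume "Y = map XE es"
      then show ?thesis using XE_no' h(2) Y by (cases "es = []") auto
    next
      fix es c' assume "Y = map XE es @ [XR c']" "D.awalk v es (cvert c')"
      then show ?thesis using that h(2) by simp
    qed
    have "map XE (path_arcs s) = map XE (es @ fs)" using e es(1) fs(1) bb(7) by simp
    then have a: "path_arcs s = es @ fs" unfolding map_XE_eq .
    then show "v \<in> pverts G s \<and> X = rev (map XE (prefix_to G v s)) @ [XL c] \<and> Y = map XE (suffix_from G v s) @ [XR d]"
      using split_dpath[OF a _ fs(2)] es fs bb(4) by simp
  next
    assume a: "v \<in> pverts G s \<and> X = rev (map XE (prefix_to G v s)) @ [XL c] \<and> Y = map XE (suffix_from G v s) @ [XR d]"
    have s: "D.awalk (cvert c) (prefix_to G v s) v" "D.awalk v (suffix_from G v s) (cvert d)"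
      using dpath_split[OF bb(3)] a bb(4,5) by auto
    have i: "v \<in> internal G"
      using walk_internal[OF bb(6) left_corner_arcs(1)[OF bb(1)] right_corner_arcs(1)[OF bb(2)]] a
      unfolding pverts_def bb(4) by blast
    have "psi b = XL c # map XE (prefix_to G v s @ suffix_from G v s) @ [XR d]" using bb(7) prefix_suffix by simp
    then show "M.through (psi b) v X Y" unfolding M.through_def
      using lhalf_mapL[OF s(1) i bb(1)] rhalf_mapR[OF s(2) i bb(2)] a by simp
  qed
qed

end

section \<open>Comparison of coherence\<close>

text \<open>Lifts a bijection of elements to families of sets; used for maximal cliques via
  \<open>phi\<close> and for brick cliques via \<open>psi\<close>.\<close>

lemma bij_betw_image_Collect:
  assumes f: "bij_betw f A C" and Q: "\<And>Y. Q Y \<Longrightarrow> Y \<subseteq> C"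
  shows "bij_betw ((`) f) {X. X \<subseteq> A \<and> Q (f ` X)} {Y. Q Y}"
proof (rule bij_betw_imageI)
  have i: "inj_on f A" and fA: "f ` A = C" using f by (auto simp: bij_betw_def)
  show "inj_on ((`) f) {X. X \<subseteq> A \<and> Q (f ` X)}"
    by (rule inj_onI) (use inj_on_image_eq_iff[OF i] in blast)
  show "(`) f ` {X. X \<subseteq> A \<and> Q (f ` X)} = {Y. Q Y}"
  proof
    show "{Y. Q Y} \<subseteq> (`) f ` {X. X \<subseteq> A \<and> Q (f ` X)}"
    proof
      fix Y assume "Y \<in> {Y. Q Y}"
      then have Y: "Q Y" "Y \<subseteq> f ` A" using Q fA by auto
      then obtain X where "X \<subseteq> A" "Y = f ` X" by (auto simp: subset_image_iff)
      then show "Y \<in> (`) f ` {X. X \<subseteq> A \<and> Q (f ` X)}" using Y by blast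
    qed
  qed auto
qed

lemma (in cornered) coherent_set_insert:
  assumes "coherent_set D" "route q" "\<forall>p \<in> D. wcoh q p" shows "coherent_set (insert q D)"
proof -
  have "wcoh p q" if "p \<in> D" for p using assms(3) that wcoh_sym by blast
  then show ?thesis using assms wcoh_refl unfolding coherent_set_def by simp
qed

context framed begin

lemma XE_iff: "XE e \<in> xE \<longleftrightarrow> e \<in> arcs G"
  unfolding xE_def xLC_def xRC_def by auto

lemma XL_iff: "XL c \<in> xE \<longleftrightarrow> left_corner \<Gamma> c" "XL c \<in> xLC \<longleftrightarrow> left_corner \<Gamma> c"
  unfolding xE_def xLC_def xRC_def by auto

lemma XR_iff: "XR c \<in> xE \<longleftrightarrow> right_corner \<Gamma> c" "XR c \<in> xRC \<longleftrightarrow> right_corner \<Gamma> c"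
  unfolding xE_def xLC_def xRC_def by auto

lemma in_order_sub: "w \<in> internal G \<Longrightarrow> (x, y) \<in> in_order \<Gamma> w \<Longrightarrow> x \<in> arcs G \<and> y \<in> arcs G \<and> head G x = w \<and> head G y = w"
  using fin_order.sub[OF in_fin_order] by fastforce

lemma out_order_sub: "w \<in> internal G \<Longrightarrow> (x, y) \<in> out_order \<Gamma> w \<Longrightarrow> x \<in> arcs G \<and> y \<in> arcs G \<and> tail G x = w \<and> tail G y = w"
  using fin_order.sub[OF out_fin_order] by fastforce

text \<open>Arcs with head \<open>w\<close> occur in the order at \<open>w\<close> only, so the
  union selects that order.\<close>

lemma in_rel:
  assumes "XE x \<in> xE" "XE y \<in> xE" "xhv (XE x) = Some w" "xhv (XE y) = Some w"
  shows "(x, y) \<in> (\<Union>w\<in>internal G. in_order \<Gamma> w) \<longleftrightarrow> xki (XE x) < xki (XE y)"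
proof -
  have a: "x \<in> arcs G" "y \<in> arcs G" "head G x = w" "head G y = w" "w \<in> internal G"
    using assms by (auto simp: XE_iff split: if_splits)
  have "w' = w" if "w' \<in> internal G" "(x, y) \<in> in_order \<Gamma> w'" for w'
    using in_order_sub[OF that] a(3) by simp
  then have "(x, y) \<in> (\<Union>w\<in>internal G. in_order \<Gamma> w) \<longleftrightarrow> (x, y) \<in> in_order \<Gamma> w" using a(5) by blast
  then show ?thesis unfolding xki_E(1)[OF a] .
qed

lemma out_rel:
  assumes "XE x \<in> xE" "XE y \<in> xE" "xtv (XE x) = Some w" "xtv (XE y) = Some w"
  shows "(x, y) \<in> (\<Union>w\<in>internal G. out_order \<Gamma> w) \<longleftrightarrow> xko (XE x) < xko (XE y)"
proof -
  have a: "x \<in> arcs G" "y \<in> arcs G" "tail G x = w" "tail G y = w" "w \<in> internal G"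
    using assms by (auto simp: XE_iff split: if_splits)
  have "w' = w" if "w' \<in> internal G" "(x, y) \<in> out_order \<Gamma> w'" for w'
    using out_order_sub[OF that] a(3) by simp
  then have "(x, y) \<in> (\<Union>w\<in>internal G. out_order \<Gamma> w) \<longleftrightarrow> (x, y) \<in> out_order \<Gamma> w" using a(5) by blast
  then show ?thesis unfolding xko_E(1)[OF a] .
qed

lemma route_less_iff:
  assumes p: "route G p" "M.through (phi p) v X Y" and q: "route G q" "M.through (phi q) v X' Y'"
  shows "route_in_less \<Gamma> v p q \<longleftrightarrow> lt xki X X'" "route_out_less \<Gamma> v p q \<longleftrightarrow> lt xko Y Y'"
proof -
  have X: "X = map XE (rev (prefix_to G v p))" "X' = map XE (rev (prefix_to G v q))"
    and Y: "Y = map XE (suffix_from G v p)" "Y' = map XE (suffix_from G v q)"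
    using through_phi[OF p(1), of v X Y] through_phi[OF q(1), of v X' Y'] p(2) q(2) by (auto simp: rev_map)
  show "route_in_less \<Gamma> v p q \<longleftrightarrow> lt xki X X'"
    unfolding route_in_less_def X
    by (rule lex_less_lt[where E = xE and h = xhv and t = xtv and v = v])
      (use M.through_lhalf[OF p(2)] M.through_lhalf[OF q(2)] X inj_XE in_rel in \<open>simp_all del: xhv.simps xki.simps\<close>)
  show "route_out_less \<Gamma> v p q \<longleftrightarrow> lt xko Y Y'"
    unfolding route_out_less_def Y
    by (rule lex_less_lt[where E = xE and h = xtv and t = xhv and v = v])
      (use M.through_rhalf[OF p(2)] M.through_rhalf[OF q(2)] Y inj_XE out_rel in \<open>simp_all del: xtv.simps xko.simps\<close>)
qed

lemma clockwise_iff: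
  assumes "route G p" "M.through (phi p) v X Y" "route G q" "M.through (phi q) v X' Y'"
  shows "route_clockwise \<Gamma> v p q \<longleftrightarrow> lt xki X X' \<and> lt xko Y' Y"
  unfolding route_clockwise_def using route_less_iff[OF assms] route_less_iff[OF assms(3,4,1,2)] by blast

lemma through_phi_ex:
  assumes "route G p" "v \<in> internal G" "v \<in> pverts G p"
  obtains X Y where "M.through (phi p) v X Y"
  using through_phi[OF assms(1)] assms(2,3) by blast

lemma clash_phi:
  assumes "route G p" "route G q"
  shows "M.clash (phi p) (phi q) \<longleftrightarrow>
    (\<exists>v. v \<in> internal G \<and> v \<in> pverts G p \<and> v \<in> pverts G q \<and> route_clockwise \<Gamma> v p q)"
proof
  assume "M.clash (phi p) (phi q)"
  then obtain v X Y X' Y' where t: "M.through (phi p) v X Y" "M.through (phi q) v X' Y'" "lt xki X X'" "lt xko Y' Y"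
    unfolding M.clash_def by blast
  then have "route_clockwise \<Gamma> v p q" using clockwise_iff assms by blast
  then show "\<exists>v. v \<in> internal G \<and> v \<in> pverts G p \<and> v \<in> pverts G q \<and> route_clockwise \<Gamma> v p q"
    using t(1,2) unfolding through_phi[OF assms(1)] through_phi[OF assms(2)] by blast
next
  assume "\<exists>v. v \<in> internal G \<and> v \<in> pverts G p \<and> v \<in> pverts G q \<and> route_clockwise \<Gamma> v p q"
  then obtain v where v: "v \<in> internal G" "v \<in> pverts G p" "v \<in> pverts G q" "route_clockwise \<Gamma> v p q" by blast
  obtain X Y where X: "M.through (phi p) v X Y" using through_phi_ex[OF assms(1) v(1,2)] .
  obtain X' Y' where X': "M.through (phi q) v X' Y'" using through_phi_ex[OF assms(2) v(1,3)] .
  show "M.clash (phi p) (phi q)" unfolding M.clash_def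
    using X X' v(4) clockwise_iff[OF assms(1) X assms(2) X'] by blast
qed

lemma wcoh_phi: "route G p \<Longrightarrow> route G q \<Longrightarrow> M.wcoh (phi p) (phi q) \<longleftrightarrow> routes_coherent \<Gamma> p q"
  unfolding M.wcoh_def clash_phi routes_coherent_def incoherent_at_def by blast

section \<open>Extended orders and coherence of bricks\<close>

fun stepL :: "'e step \<Rightarrow> 'e xstep" where
  "stepL (EdgeStep e) = XE e" | "stepL (CornerStep c) = XL c"

fun stepR :: "'e step \<Rightarrow> 'e xstep" where
  "stepR (EdgeStep e) = XE e" | "stepR (CornerStep c) = XR c"

lemma inj_stepL: "inj stepL"
proof (rule injI)
  fix x y assume "stepL x = stepL y" then show "x = y" by (cases x; cases y) auto
qed

lemma inj_stepR: "inj stepR"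
proof (rule injI)
  fix x y assume "stepR x = stepR y" then show "x = y" by (cases x; cases y) auto
qed

lemma ext_in_less:
  assumes w: "w \<in> internal G" and "(a, b) \<in> ext_in_order \<Gamma> w"
  shows "xhv (stepL a) = Some w \<and> xhv (stepL b) = Some w \<and> xki (stepL a) < xki (stepL b)"
  using assms(2) unfolding ext_in_order_def
proof (induction rule: trancl_induct)
  case (base b)
  then show ?case
  proof (elim UnE CollectE exE conjE)
    fix e f assume *: "(a, b) = (EdgeStep e, EdgeStep f)" "(e, f) \<in> in_order \<Gamma> w"
    then show ?thesis using in_order_sub[OF w *(2)] w xki_E(1)[of e f w] by simp
  next
    fix c assume *: "(a, b) = (EdgeStep (cdown c), CornerStep c)" "left_corner \<Gamma> c" "cvert c = w"
    then show ?thesis using left_corner_arcs[OF *(2)] xki_lr[OF *(2)] w by simp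
  next
    fix c assume *: "(a, b) = (CornerStep c, EdgeStep (cup c))" "left_corner \<Gamma> c" "cvert c = w"
    then show ?thesis using left_corner_arcs[OF *(2)] xki_lr[OF *(2)] w by simp
  qed
next
  case (step b d)
  have "xhv (stepL b) = Some w \<and> xhv (stepL d) = Some w \<and> xki (stepL b) < xki (stepL d)"
    using step.hyps(2)
  proof (elim UnE CollectE exE conjE)
    fix e f assume *: "(b, d) = (EdgeStep e, EdgeStep f)" "(e, f) \<in> in_order \<Gamma> w"
    then show ?thesis using in_order_sub[OF w *(2)] w xki_E(1)[of e f w] by simp
  next
    fix c assume *: "(b, d) = (EdgeStep (cdown c), CornerStep c)" "left_corner \<Gamma> c" "cvert c = w"
    then show ?thesis using left_corner_arcs[OF *(2)] xki_lr[OF *(2)] w by simp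
  next
    fix c assume *: "(b, d) = (CornerStep c, EdgeStep (cup c))" "left_corner \<Gamma> c" "cvert c = w"
    then show ?thesis using left_corner_arcs[OF *(2)] xki_lr[OF *(2)] w by simp
  qed
  then show ?case using step.IH by simp
qed

lemma ext_out_less:
  assumes w: "w \<in> internal G" and "(a, b) \<in> ext_out_order \<Gamma> w"
  shows "xtv (stepR a) = Some w \<and> xtv (stepR b) = Some w \<and> xko (stepR a) < xko (stepR b)"
  using assms(2) unfolding ext_out_order_def
proof (induction rule: trancl_induct)
  case (base b)
  then show ?case
  proof (elim UnE CollectE exE conjE)
    fix e f assume *: "(a, b) = (EdgeStep e, EdgeStep f)" "(e, f) \<in> out_order \<Gamma> w"
    then show ?thesis using out_order_sub[OF w *(2)] w xko_E(1)[of e f w] by simp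
  next
    fix c assume *: "(a, b) = (EdgeStep (cdown c), CornerStep c)" "right_corner \<Gamma> c" "cvert c = w"
    then show ?thesis using right_corner_arcs[OF *(2)] xko_lr[OF *(2)] w by simp
  next
    fix c assume *: "(a, b) = (CornerStep c, EdgeStep (cup c))" "right_corner \<Gamma> c" "cvert c = w"
    then show ?thesis using right_corner_arcs[OF *(2)] xko_lr[OF *(2)] w by simp
  qed
next
  case (step b d)
  have "xtv (stepR b) = Some w \<and> xtv (stepR d) = Some w \<and> xko (stepR b) < xko (stepR d)"
    using step.hyps(2)
  proof (elim UnE CollectE exE conjE)
    fix e f assume *: "(b, d) = (EdgeStep e, EdgeStep f)" "(e, f) \<in> out_order \<Gamma> w"
    then show ?thesis using out_order_sub[OF w *(2)] w xko_E(1)[of e f w] by simp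
  next
    fix c assume *: "(b, d) = (EdgeStep (cdown c), CornerStep c)" "right_corner \<Gamma> c" "cvert c = w"
    then show ?thesis using right_corner_arcs[OF *(2)] xko_lr[OF *(2)] w by simp
  next
    fix c assume *: "(b, d) = (CornerStep c, EdgeStep (cup c))" "right_corner \<Gamma> c" "cvert c = w"
    then show ?thesis using right_corner_arcs[OF *(2)] xko_lr[OF *(2)] w by simp
  qed
  then show ?case using step.IH by simp
qed

lemma ext_in_edge:
  assumes "e \<in> arcs G" "f \<in> arcs G" "head G e = w" "head G f = w" "w \<in> internal G" "xki (XE e) < xki (XE f)"
  shows "(EdgeStep e, EdgeStep f) \<in> ext_in_order \<Gamma> w"
  unfolding ext_in_order_def using xki_E(1)[OF assms(1-5)] assms(6) by (intro r_into_trancl) blast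

lemma ext_in_down: "left_corner \<Gamma> c \<Longrightarrow> (EdgeStep (cdown c), CornerStep c) \<in> ext_in_order \<Gamma> (cvert c)"
  unfolding ext_in_order_def by (intro r_into_trancl) blast

lemma ext_in_up: "left_corner \<Gamma> c \<Longrightarrow> (CornerStep c, EdgeStep (cup c)) \<in> ext_in_order \<Gamma> (cvert c)"
  unfolding ext_in_order_def by (intro r_into_trancl) blast

lemma ext_in_trans: "(a, b) \<in> ext_in_order \<Gamma> w \<Longrightarrow> (b, c) \<in> ext_in_order \<Gamma> w \<Longrightarrow> (a, c) \<in> ext_in_order \<Gamma> w"
  unfolding ext_in_order_def by (rule trancl_trans)

text \<open>The transitive closure reaches a corner through its lower edge and leaves it through its
  upper edge. Conversely, \<open>xki_corner\<close> shows that a larger key lies beyond the upper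
  edge and a smaller one before the lower edge, so every comparison of keys can be realised by such
  a chain.\<close>

lemma ext_in_rel:
  assumes "stepL a \<in> xE" "stepL b \<in> xE" "xhv (stepL a) = Some w" "xhv (stepL b) = Some w"
  shows "(a, b) \<in> (\<Union>w\<in>internal G. ext_in_order \<Gamma> w) \<longleftrightarrow> xki (stepL a) < xki (stepL b)"
proof
  assume "(a, b) \<in> (\<Union>w\<in>internal G. ext_in_order \<Gamma> w)"
  then show "xki (stepL a) < xki (stepL b)" using ext_in_less by blast
next
  assume lt: "xki (stepL a) < xki (stepL b)"
  have w: "w \<in> internal G" using xE_hv[OF assms(1,3)] by blast
  have edge: "(EdgeStep e, EdgeStep f) \<in> ext_in_order \<Gamma> w \<or> e = f"
    if "e \<in> arcs G" "f \<in> arcs G" "head G e = w" "head G f = w" "xki (XE e) \<le> xki (XE f)" for e f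
    using ext_in_edge[OF that(1-4) w] xki_E(2)[OF that(1-4) w] that(5) by linarith
  have down: "(EdgeStep e, CornerStep c) \<in> ext_in_order \<Gamma> w"
    if e: "e \<in> arcs G" "head G e = w" and c: "left_corner \<Gamma> c" "cvert c = w" and lt: "xki (XE e) < xki (XL c)" for e c
  proof -
    note ca = left_corner_arcs[OF c(1)]
    have h: "xhv (XE e) = Some w" using e w by simp
    have "xki (XE e) \<le> xki (XE (cdown c))"
      using xki_corner[OF c, of "XE e"] h e lt xki_lr(2)[OF c(1)] by (auto simp: XE_iff)
    then have "(EdgeStep e, EdgeStep (cdown c)) \<in> ext_in_order \<Gamma> w \<or> e = cdown c"
      using edge[OF e(1) ca(2) e(2)] ca(4) c(2) by simp
    then show ?thesis using ext_in_down[OF c(1)] c(2) ext_in_trans by blast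
  qed
  have up: "(CornerStep c, EdgeStep e) \<in> ext_in_order \<Gamma> w"
    if e: "e \<in> arcs G" "head G e = w" and c: "left_corner \<Gamma> c" "cvert c = w" and lt: "xki (XL c) < xki (XE e)" for e c
  proof -
    note ca = left_corner_arcs[OF c(1)]
    have h: "xhv (XE e) = Some w" using e w by simp
    have "xki (XE (cup c)) \<le> xki (XE e)"
      using xki_corner[OF c, of "XE e"] h e lt xki_lr(1)[OF c(1)] by (auto simp: XE_iff)
    then have "(EdgeStep (cup c), EdgeStep e) \<in> ext_in_order \<Gamma> w \<or> cup c = e"
      using edge[OF ca(3) e(1)] ca(5) c(2) e(2) by simp
    then show ?thesis using ext_in_up[OF c(1)] c(2) ext_in_trans by blast
  qed
  have "(a, b) \<in> ext_in_order \<Gamma> w"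
  proof (cases a)
    case (EdgeStep e)
    have e: "e \<in> arcs G" "head G e = w" using assms(1,3) EdgeStep by (auto simp: XE_iff split: if_splits)
    show ?thesis
    proof (cases b)
      case b: (EdgeStep f)
      have f: "f \<in> arcs G" "head G f = w" using assms(2,4) b by (auto simp: XE_iff split: if_splits)
      have "xki (XE e) < xki (XE f)" using lt unfolding EdgeStep b stepL.simps .
      then show ?thesis using ext_in_edge[OF e(1) f(1) e(2) f(2) w] EdgeStep b by simp
    next
      case b: (CornerStep c)
      have c: "left_corner \<Gamma> c" "cvert c = w" using assms(2,4) b by (auto simp: XL_iff)
      show ?thesis using down[OF e c] lt unfolding EdgeStep b stepL.simps .
    qed
  next
    case (CornerStep c)
    have c: "left_corner \<Gamma> c" "cvert c = w" using assms(1,3) CornerStep by (auto simp: XL_iff)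
    show ?thesis
    proof (cases b)
      case b: (EdgeStep f)
      have f: "f \<in> arcs G" "head G f = w" using assms(2,4) b by (auto simp: XE_iff split: if_splits)
      show ?thesis using up[OF f c] lt unfolding CornerStep b stepL.simps .
    next
      case b: (CornerStep d)
      have d: "left_corner \<Gamma> d" "cvert d = w" using assms(2,4) b by (auto simp: XL_iff)
      note ca = left_corner_arcs[OF c(1)]
      have lt: "xki (XL c) < xki (XL d)" using lt unfolding CornerStep b stepL.simps .
      \<comment> \<open>The upper edge of \<open>c\<close> is at most \<open>d\<close>, and equality
        is excluded by parity.\<close>
      have "xki (XE (cup c)) \<le> xki (XL d)"
        using xki_corner[OF c, of "XL d"] d lt xki_lr(1)[OF c(1)] by (auto simp: XL_iff)
      then have "xki (XE (cup c)) < xki (XL d)" using XE_parity(1)[of "cup c" d] by linarith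
      then have "(EdgeStep (cup c), CornerStep d) \<in> ext_in_order \<Gamma> w" using down[OF ca(3) _ d] ca(5) c(2) by simp
      then show ?thesis using ext_in_up[OF c(1)] c(2) ext_in_trans unfolding CornerStep b by blast
    qed
  qed
  then show "(a, b) \<in> (\<Union>w\<in>internal G. ext_in_order \<Gamma> w)" using w by blast
qed

lemma ext_out_edge:
  assumes "e \<in> arcs G" "f \<in> arcs G" "tail G e = w" "tail G f = w" "w \<in> internal G" "xko (XE e) < xko (XE f)"
  shows "(EdgeStep e, EdgeStep f) \<in> ext_out_order \<Gamma> w"
  unfolding ext_out_order_def using xko_E(1)[OF assms(1-5)] assms(6) by (intro r_into_trancl) blast

lemma ext_out_down: "right_corner \<Gamma> c \<Longrightarrow> (EdgeStep (cdown c), CornerStep c) \<in> ext_out_order \<Gamma> (cvert c)"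
  unfolding ext_out_order_def by (intro r_into_trancl) blast

lemma ext_out_up: "right_corner \<Gamma> c \<Longrightarrow> (CornerStep c, EdgeStep (cup c)) \<in> ext_out_order \<Gamma> (cvert c)"
  unfolding ext_out_order_def by (intro r_into_trancl) blast

lemma ext_out_trans: "(a, b) \<in> ext_out_order \<Gamma> w \<Longrightarrow> (b, c) \<in> ext_out_order \<Gamma> w \<Longrightarrow> (a, c) \<in> ext_out_order \<Gamma> w"
  unfolding ext_out_order_def by (rule trancl_trans)

lemma ext_out_rel:
  assumes "stepR a \<in> xE" "stepR b \<in> xE" "xtv (stepR a) = Some w" "xtv (stepR b) = Some w"
  shows "(a, b) \<in> (\<Union>w\<in>internal G. ext_out_order \<Gamma> w) \<longleftrightarrow> xko (stepR a) < xko (stepR b)"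
proof
  assume "(a, b) \<in> (\<Union>w\<in>internal G. ext_out_order \<Gamma> w)"
  then show "xko (stepR a) < xko (stepR b)" using ext_out_less by blast
next
  assume lt: "xko (stepR a) < xko (stepR b)"
  have w: "w \<in> internal G" using xE_tv[OF assms(1,3)] by blast
  have edge: "(EdgeStep e, EdgeStep f) \<in> ext_out_order \<Gamma> w \<or> e = f"
    if "e \<in> arcs G" "f \<in> arcs G" "tail G e = w" "tail G f = w" "xko (XE e) \<le> xko (XE f)" for e f
    using ext_out_edge[OF that(1-4) w] xko_E(2)[OF that(1-4) w] that(5) by linarith
  have down: "(EdgeStep e, CornerStep c) \<in> ext_out_order \<Gamma> w"
    if e: "e \<in> arcs G" "tail G e = w" and c: "right_corner \<Gamma> c" "cvert c = w" and lt: "xko (XE e) < xko (XR c)" for e c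
  proof -
    note ca = right_corner_arcs[OF c(1)]
    have h: "xtv (XE e) = Some w" using e w by simp
    have "xko (XE e) \<le> xko (XE (cdown c))"
      using xko_corner[OF c, of "XE e"] h e lt xko_lr(2)[OF c(1)] by (auto simp: XE_iff)
    then have "(EdgeStep e, EdgeStep (cdown c)) \<in> ext_out_order \<Gamma> w \<or> e = cdown c"
      using edge[OF e(1) ca(2) e(2)] ca(4) c(2) by simp
    then show ?thesis using ext_out_down[OF c(1)] c(2) ext_out_trans by blast
  qed
  have up: "(CornerStep c, EdgeStep e) \<in> ext_out_order \<Gamma> w"
    if e: "e \<in> arcs G" "tail G e = w" and c: "right_corner \<Gamma> c" "cvert c = w" and lt: "xko (XR c) < xko (XE e)" for e c
  proof -
    note ca = right_corner_arcs[OF c(1)]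
    have h: "xtv (XE e) = Some w" using e w by simp
    have "xko (XE (cup c)) \<le> xko (XE e)"
      using xko_corner[OF c, of "XE e"] h e lt xko_lr(1)[OF c(1)] by (auto simp: XE_iff)
    then have "(EdgeStep (cup c), EdgeStep e) \<in> ext_out_order \<Gamma> w \<or> cup c = e"
      using edge[OF ca(3) e(1)] ca(5) c(2) e(2) by simp
    then show ?thesis using ext_out_up[OF c(1)] c(2) ext_out_trans by blast
  qed
  have "(a, b) \<in> ext_out_order \<Gamma> w"
  proof (cases a)
    case (EdgeStep e)
    have e: "e \<in> arcs G" "tail G e = w" using assms(1,3) EdgeStep by (auto simp: XE_iff split: if_splits)
    show ?thesis
    proof (cases b)
      case b: (EdgeStep f)
      have f: "f \<in> arcs G" "tail G f = w" using assms(2,4) b by (auto simp: XE_iff split: if_splits)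
      have "xko (XE e) < xko (XE f)" using lt unfolding EdgeStep b stepR.simps .
      then show ?thesis using ext_out_edge[OF e(1) f(1) e(2) f(2) w] EdgeStep b by simp
    next
      case b: (CornerStep c)
      have c: "right_corner \<Gamma> c" "cvert c = w" using assms(2,4) b by (auto simp: XR_iff)
      show ?thesis using down[OF e c] lt unfolding EdgeStep b stepR.simps .
    qed
  next
    case (CornerStep c)
    have c: "right_corner \<Gamma> c" "cvert c = w" using assms(1,3) CornerStep by (auto simp: XR_iff)
    show ?thesis
    proof (cases b)
      case b: (EdgeStep f)
      have f: "f \<in> arcs G" "tail G f = w" using assms(2,4) b by (auto simp: XE_iff split: if_splits)
      show ?thesis using up[OF f c] lt unfolding CornerStep b stepR.simps .
    next
      case b: (CornerStep d)
      have d: "right_corner \<Gamma> d" "cvert d = w" using assms(2,4) b by (auto simp: XR_iff)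
      note ca = right_corner_arcs[OF c(1)]
      have lt: "xko (XR c) < xko (XR d)" using lt unfolding CornerStep b stepR.simps .
      have "xko (XE (cup c)) \<le> xko (XR d)"
        using xko_corner[OF c, of "XR d"] d lt xko_lr(1)[OF c(1)] by (auto simp: XR_iff)
      then have "xko (XE (cup c)) < xko (XR d)" using XE_parity(2)[of "cup c" d] by linarith
      then have "(EdgeStep (cup c), CornerStep d) \<in> ext_out_order \<Gamma> w" using down[OF ca(3) _ d] ca(5) c(2) by simp
      then show ?thesis using ext_out_up[OF c(1)] c(2) ext_out_trans unfolding CornerStep b by blast
    qed
  qed
  then show "(a, b) \<in> (\<Union>w\<in>internal G. ext_out_order \<Gamma> w)" using w by blast
qed

lemma steps_psi:
  assumes b: "brick \<Gamma> b" and t: "M.through (psi b) v X Y"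
  shows "X = map stepL (in_steps G v b)" "Y = map stepR (out_steps G v b)" "v \<in> pverts G (spine b)"
proof -
  obtain c s d where e: "b = GPath (Some c) s (Some d)" using brickE[OF b] by metis
  have "v \<in> pverts G s" "X = rev (map XE (prefix_to G v s)) @ [XL c]" "Y = map XE (suffix_from G v s) @ [XR d]"
    using t unfolding through_psi[OF b e] by blast+
  then show "X = map stepL (in_steps G v b)" "Y = map stepR (out_steps G v b)" "v \<in> pverts G (spine b)"
    unfolding e in_steps_def out_steps_def corner_steps_def by (simp_all add: rev_map)
qed

lemma through_psi_ex:
  assumes b: "brick \<Gamma> b" and v: "v \<in> pverts G (spine b)"
  obtains X Y where "M.through (psi b) v X Y"
proof -
  obtain c s d where e: "b = GPath (Some c) s (Some d)" using brickE[OF b] by metis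
  then show ?thesis using that through_psi[OF b e] v by simp
qed

lemma gp_less_iff:
  assumes b: "brick \<Gamma> b" "M.through (psi b) v X Y" and b': "brick \<Gamma> b'" "M.through (psi b') v X' Y'"
  shows "gp_in_less \<Gamma> v b b' \<longleftrightarrow> lt xki X X'" "gp_out_less \<Gamma> v b b' \<longleftrightarrow> lt xko Y Y'"
proof -
  note X = steps_psi(1)[OF b] steps_psi(1)[OF b'] and Y = steps_psi(2)[OF b] steps_psi(2)[OF b']
  show "gp_in_less \<Gamma> v b b' \<longleftrightarrow> lt xki X X'"
    unfolding gp_in_less_def X
    by (rule lex_less_lt[where E = xE and h = xhv and t = xtv and v = v])
      (use M.through_lhalf[OF b(2)] M.through_lhalf[OF b'(2)] X inj_stepL ext_in_rel in \<open>simp_all del: xhv.simps xki.simps\<close>)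
  show "gp_out_less \<Gamma> v b b' \<longleftrightarrow> lt xko Y Y'"
    unfolding gp_out_less_def Y
    by (rule lex_less_lt[where E = xE and h = xtv and t = xhv and v = v])
      (use M.through_rhalf[OF b(2)] M.through_rhalf[OF b'(2)] Y inj_stepR ext_out_rel in \<open>simp_all del: xtv.simps xko.simps\<close>)
qed

lemma clash_psi:
  assumes "brick \<Gamma> b" "brick \<Gamma> b'"
  shows "M.clash (psi b) (psi b') \<longleftrightarrow> (\<exists>v \<in> pverts G (spine b) \<inter> pverts G (spine b'). gp_clockwise \<Gamma> v b b')"
proof
  assume "M.clash (psi b) (psi b')"
  then obtain v X Y X' Y' where t: "M.through (psi b) v X Y" "M.through (psi b') v X' Y'" "lt xki X X'" "lt xko Y' Y"
    unfolding M.clash_def by blast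
  have "gp_clockwise \<Gamma> v b b'" unfolding gp_clockwise_def
    using gp_less_iff[OF assms(1) t(1) assms(2) t(2)] gp_less_iff[OF assms(2) t(2) assms(1) t(1)] t by blast
  then show "\<exists>v \<in> pverts G (spine b) \<inter> pverts G (spine b'). gp_clockwise \<Gamma> v b b'"
    using steps_psi(3)[OF assms(1) t(1)] steps_psi(3)[OF assms(2) t(2)] by blast
next
  assume "\<exists>v \<in> pverts G (spine b) \<inter> pverts G (spine b'). gp_clockwise \<Gamma> v b b'"
  then obtain v where v: "v \<in> pverts G (spine b)" "v \<in> pverts G (spine b')" "gp_clockwise \<Gamma> v b b'" by blast
  obtain X Y where X: "M.through (psi b) v X Y" using through_psi_ex[OF assms(1) v(1)] .
  obtain X' Y' where X': "M.through (psi b') v X' Y'" using through_psi_ex[OF assms(2) v(2)] .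
  have "lt xki X X' \<and> lt xko Y' Y" using v(3) unfolding gp_clockwise_def
    using gp_less_iff[OF assms(1) X assms(2) X'] gp_less_iff[OF assms(2) X' assms(1) X] by blast
  then show "M.clash (psi b) (psi b')" unfolding M.clash_def using X X' by blast
qed

lemma wcoh_psi: "brick \<Gamma> b \<Longrightarrow> brick \<Gamma> b' \<Longrightarrow> M.wcoh (psi b) (psi b') \<longleftrightarrow> weakly_coherent \<Gamma> b b'"
  unfolding M.wcoh_def clash_psi weakly_coherent_def by blast

lemma gp_coherent_psi:
  assumes "brick \<Gamma> b" "brick \<Gamma> b'"
  shows "gp_coherent \<Gamma> b b' \<longleftrightarrow> M.wcoh (psi b) (psi b') \<and> hd (psi b) \<noteq> hd (psi b') \<and> last (psi b) \<noteq> last (psi b')"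
proof -
  obtain c s d where e: "b = GPath (Some c) s (Some d)" using brickE[OF assms(1)] by metis
  obtain c' s' d' where e': "b' = GPath (Some c') s' (Some d')" using brickE[OF assms(2)] by metis
  have "hd (psi b) \<noteq> hd (psi b') \<longleftrightarrow> (\<nexists>c. lend b = Some c \<and> lend b' = Some c)"
    "last (psi b) \<noteq> last (psi b') \<longleftrightarrow> (\<nexists>c. rend b = Some c \<and> rend b' = Some c)"
    unfolding psi_def e e' by auto
  then show ?thesis unfolding gp_coherent_def wcoh_psi[OF assms] by blast
qed

lemma psi_brick: "brick \<Gamma> b \<Longrightarrow> M.brick (psi b)"
proof -
  assume b: "brick \<Gamma> b"
  obtain c s d where e: "b = GPath (Some c) s (Some d)" "left_corner \<Gamma> c" "right_corner \<Gamma> d" "cvert c = start s"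
    "D.awalk (cvert c) (path_arcs s) (cvert d)" "psi b = XL c # map XE (path_arcs s) @ [XR d]"
    using brickE[OF b] by metis
  have "start s \<in> pverts G s" unfolding pverts_def using D.hd_in_awalk_verts(1)[OF e(5)] e(4) by simp
  then obtain X Y where "M.through (psi b) (start s) X Y" using through_psi_ex[OF b] e(1) by auto
  then show ?thesis unfolding M.brick_def using M.through_complete e(2,3,6) by (auto simp: XL_iff XR_iff)
qed

lemma psi_bij: "bij_betw psi {b. brick \<Gamma> b} {x. M.brick x}"
proof (rule bij_betw_imageI)
  show "inj_on psi {b. brick \<Gamma> b}"
  proof (rule inj_onI)
    fix b b' assume b: "b \<in> {b. brick \<Gamma> b}" "b' \<in> {b. brick \<Gamma> b}" "psi b = psi b'"
    obtain c s d where e: "b = GPath (Some c) s (Some d)" "cvert c = start s"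
      "psi b = XL c # map XE (path_arcs s) @ [XR d]" using brickE b(1) by blast
    obtain c' s' d' where e': "b' = GPath (Some c') s' (Some d')" "cvert c' = start s'"
      "psi b' = XL c' # map XE (path_arcs s') @ [XR d']" using brickE b(2) by blast
    \<comment> \<open>The list does not record the start of the spine, but the left corner
      does.\<close>
    have "c = c'" "d = d'" "path_arcs s = path_arcs s'" using b(3) unfolding e(3) e'(3) by auto
    then show "b = b'" using e(1,2) e'(1,2) by (metis dpath.expand)
  qed
  show "psi ` {b. brick \<Gamma> b} = {x. M.brick x}"
  proof
    show "psi ` {b. brick \<Gamma> b} \<subseteq> {x. M.brick x}" using psi_brick by blast
    show "{x. M.brick x} \<subseteq> psi ` {b. brick \<Gamma> b}"
    proof
      fix x assume "x \<in> {x. M.brick x}"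
      then have x: "M.complete x" "hd x \<in> xLC" "last x \<in> xRC" unfolding M.brick_def by blast+
      obtain v C where v: "xhv (hd x) = Some v" "M.through x v [hd x] C" "x = hd x # C" using M.LC_through[OF x(1,2)] .
      obtain c where c: "hd x = XL c" "left_corner \<Gamma> c" using x(2) unfolding xLC_def by blast
      have lC: "last C \<in> xRC" using M.through_last[OF v(2)] x(3) by simp
      have "M.rhalf v C" using M.through_rhalf[OF v(2)] .
      obtain es d where d: "C = map XE es @ [XR d]" "D.awalk v es (cvert d)" "right_corner \<Gamma> d"
        using rhalf_conv[OF \<open>M.rhalf v C\<close>]
      proof (elim disjE exE conjE)
        fix es w assume "C = map XE es"
        then show ?thesis using lC half_ne[OF \<open>M.rhalf v C\<close>] unfolding xRC_def by (cases es rule: rev_cases) auto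
      qed blast
      let ?s = "DPath v es"
      let ?b = "GPath (Some c) ?s (Some d)"
      have cv: "cvert c = v" using v(1) c(1) by simp
      have e: "end_vertex G ?s = cvert d" unfolding end_vertex_def using d(2) by auto
      have "brick \<Gamma> ?b" unfolding brick_def generalized_path_def is_dpath_def using c d cv by (simp add: e)
      moreover have "psi ?b = x" unfolding psi_def using v(3) c(1) d(1) by simp
      ultimately show "x \<in> psi ` {b. brick \<Gamma> b}" by blast
    qed
  qed
qed

lemma phi_route: "route G p \<Longrightarrow> M.route (phi p)"
proof -
  assume p: "route G p"
  have w: "D.awalk (start p) (path_arcs p) (end_vertex G p)" "is_source G (start p)" "is_sink G (end_vertex G p)"
    using route_walk[OF p] by blast+
  show ?thesis
  proof (cases "path_arcs p")
    case Nil
    then have "start p = end_vertex G p" using w(1) by (simp add: walk_Nil)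
    then have "XI (start p) \<in> xE" using w unfolding xE_def by auto
    then show ?thesis unfolding M.route_def M.complete_def phi_def using Nil by (auto simp: xLC_def xRC_def)
  next
    case (Cons e es)
    then have e: "e \<in> arcs G" "start p = tail G e" "D.awalk (head G e) es (end_vertex G p)" using w(1) by (auto simp: walk_Cons)
    have "M.complete (phi p)"
    proof (cases "head G e \<in> internal G")
      case True
      have "D.awalk (start p) [e] (head G e)" using e internal_verts[OF True] by (auto simp: walk_Cons walk_Nil)
      then have "head G e \<in> pverts G p" using split_dpath(1)[of p "[e]" es] Cons e(3) by simp
      then show ?thesis using through_phi_ex[OF p True] M.through_complete by metis
    next
      case False
      have "es = []"
      proof (cases es)
        case c: (Cons f fs)
        then show ?thesis using internalI[of e f] e False by (auto simp: walk_Cons)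
      qed
      moreover have "tail G e \<notin> internal G" using w(2) e(2) source_not_internal by auto
      ultimately show ?thesis unfolding M.complete_def phi_def using Cons False XE_in[OF e(1)] by auto
    qed
    moreover have "hd (phi p) \<notin> xLC" unfolding phi_def xLC_def using Cons by auto
    moreover have "last (phi p) \<notin> xRC" unfolding phi_def xRC_def using Cons by (auto simp: last_map)
    ultimately show ?thesis unfolding M.route_def by blast
  qed
qed

lemma phi_bij: "bij_betw phi {p. route G p} {x. M.route x}"
proof (rule bij_betw_imageI)
  show "inj_on phi {p. route G p}"
  proof (rule inj_onI)
    fix p q assume pq: "p \<in> {p. route G p}" "q \<in> {p. route G p}" "phi p = phi q"
    have w: "D.awalk (start p) (path_arcs p) (end_vertex G p)" "D.awalk (start q) (path_arcs q) (end_vertex G q)"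
      using route_walk pq by blast+
    \<comment> \<open>The start is the tail of the first arc, or it is stored in \<open>XI\<close>
      if there is none.\<close>
    have "path_arcs p = path_arcs q \<and> start p = start q"
    proof (cases "path_arcs p")
      case Nil
      then show ?thesis using pq(3) unfolding phi_def by (cases "path_arcs q") auto
    next
      case (Cons e es)
      then have "path_arcs q = path_arcs p" using pq(3) unfolding phi_def by (cases "path_arcs q") auto
      then show ?thesis using w Cons by (simp add: walk_Cons)
    qed
    then show "p = q" by (intro dpath.expand) simp
  qed
  show "phi ` {p. route G p} = {x. M.route x}"
  proof
    show "phi ` {p. route G p} \<subseteq> {x. M.route x}" using phi_route by blast
    show "{x. M.route x} \<subseteq> phi ` {p. route G p}"
    proof
      fix x assume "x \<in> {x. M.route x}"
      then have x: "M.complete x" "hd x \<notin> xLC" "last x \<notin> xRC" unfolding M.route_def by blast+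
      then consider y where "y \<in> xE" "x = [y]" "xtv y = None" "xhv y = None" | v X Y where "M.through x v X Y"
        unfolding M.complete_def by blast
      then show "x \<in> phi ` {p. route G p}"
      proof cases
        case 1
        show ?thesis
        proof (cases y)
          case (XE e)
          then have e: "e \<in> arcs G" "tail G e \<notin> internal G" "head G e \<notin> internal G"
            using 1 by (auto simp: XE_iff split: if_splits)
          let ?p = "DPath (tail G e) [e]"
          have w: "D.awalk (tail G e) [e] (head G e)" using e D.head_in_verts[OF e(1)] by (simp add: walk_Cons walk_Nil)
          then have "end_vertex G ?p = head G e" unfolding end_vertex_def by auto
          then have "route G ?p" unfolding route_def is_dpath_def using w sourceI[OF e(1,2)] sinkI[OF e(1,3)] by simp
          moreover have "phi ?p = x" unfolding phi_def using 1 XE by simp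
          ultimately show ?thesis by blast
        next
          case (XI u)
          then have u: "is_source G u" "is_sink G u" using 1 unfolding xE_def xLC_def xRC_def by auto
          let ?p = "DPath u []"
          have "u \<in> verts G" using u unfolding is_source_def by blast
          then have "D.awalk u [] u" by (simp add: walk_Nil)
          moreover have "end_vertex G ?p = u" unfolding end_vertex_def by simp
          ultimately have "route G ?p" unfolding route_def is_dpath_def using u by simp
          moreover have "phi ?p = x" unfolding phi_def using 1 XI by simp
          ultimately show ?thesis by blast
        qed (use 1 x in auto)
      next
        case (2 v X Y)
        obtain es u where es: "X = rev (map XE es)" "D.awalk u es v" "is_source G u"
          using lhalf_conv[OF M.through_lhalf[OF 2]]
        proof (elim disjE exE conjE)
          fix es c assume "X = rev (map XE es) @ [XL c]" "left_corner \<Gamma> c"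
          then show ?thesis using M.through_hd[OF 2] x(2) by (simp add: XL_iff)
        qed blast
        obtain fs w where fs: "Y = map XE fs" "D.awalk v fs w" "is_sink G w"
          using rhalf_conv[OF M.through_rhalf[OF 2]]
        proof (elim disjE exE conjE)
          fix es c assume "Y = map XE es @ [XR c]" "right_corner \<Gamma> c"
          then show ?thesis using M.through_last[OF 2] x(3) by (simp add: XR_iff)
        qed blast
        let ?p = "DPath u (es @ fs)"
        have a: "path_arcs ?p = es @ fs" "D.awalk (start ?p) es v" using es by simp_all
        have "end_vertex G ?p = w" using split_dpath(4)[OF a fs(2)] .
        moreover have "D.awalk u (es @ fs) w" using es fs walk_append by blast
        ultimately have "route G ?p" unfolding route_def is_dpath_def using es fs by simp
        moreover have "es \<noteq> []" using M.through_ne[OF 2] es by auto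
        then have "phi ?p = map XE (es @ fs)" unfolding phi_def by simp
        then have "phi ?p = x" using 2 es fs unfolding M.through_def by simp
        ultimately show ?thesis by blast
      qed
    qed
  qed
qed

section \<open>Maximal cliques and brick cliques under the encodings\<close>

lemma phi_eq: "route G p \<Longrightarrow> route G q \<Longrightarrow> phi p = phi q \<longleftrightarrow> p = q"
  using phi_bij unfolding bij_betw_def inj_on_def by blast

text \<open>\<open>pairwise\<close> speaks of distinct routes; \<open>M.wcoh_refl\<close> covers the
  diagonal.\<close>

lemma clique_iff: "clique \<Gamma> \<Delta> \<longleftrightarrow> \<Delta> \<subseteq> {p. route G p} \<and> M.coherent_set (phi ` \<Delta>)"
proof (cases "\<Delta> \<subseteq> {p. route G p}")
  case True
  have "(\<forall>x \<in> \<Delta>. \<forall>y \<in> \<Delta>. x \<noteq> y \<longrightarrow> routes_coherent \<Gamma> x y) \<longleftrightarrow> (\<forall>x \<in> \<Delta>. \<forall>y \<in> \<Delta>. M.wcoh (phi x) (phi y))"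
  proof (intro ball_cong refl)
    fix x y assume xy: "x \<in> \<Delta>" "y \<in> \<Delta>"
    then have r: "route G x" "route G y" using True by blast+
    show "(x \<noteq> y \<longrightarrow> routes_coherent \<Gamma> x y) \<longleftrightarrow> M.wcoh (phi x) (phi y)"
      using wcoh_phi[OF r] M.wcoh_refl by (cases "x = y") auto
  qed
  moreover have "\<forall>p \<in> \<Delta>. route G p" "\<forall>p \<in> phi ` \<Delta>. M.route p" using True phi_route by blast+
  ultimately show ?thesis unfolding clique_def M.coherent_set_def pairwise_def ball_simps using True by blast
next
  case False
  then show ?thesis unfolding clique_def by blast
qed

text \<open>Inclusion-maximality is translated into absorption of coherent routes; every abstract
  route is the image of a route, so there is nothing further to absorb.\<close>

lemma max_cliques_iff: "\<Delta> \<in> max_cliques \<Gamma> \<longleftrightarrow> \<Delta> \<subseteq> {p. route G p} \<and> M.max_clique (phi ` \<Delta>)"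
proof
  assume m: "\<Delta> \<in> max_cliques \<Gamma>"
  then have c: "\<Delta> \<subseteq> {p. route G p}" "M.coherent_set (phi ` \<Delta>)" and mx: "\<And>\<Delta>'. clique \<Gamma> \<Delta>' \<Longrightarrow> \<Delta> \<subseteq> \<Delta>' \<Longrightarrow> \<Delta>' = \<Delta>"
    unfolding max_cliques_def clique_iff by blast+
  have "x \<in> phi ` \<Delta>" if x: "M.route x" "\<forall>p \<in> phi ` \<Delta>. M.wcoh x p" for x
  proof -
    obtain p where p: "route G p" "x = phi p" using phi_bij x(1) unfolding bij_betw_def by blast
    have "M.coherent_set (phi ` insert p \<Delta>)"
      unfolding image_insert p(2)[symmetric] by (rule M.coherent_set_insert[OF c(2) x])
    then have "clique \<Gamma> (insert p \<Delta>)" unfolding clique_iff using c(1) p(1) by blast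
    then have "insert p \<Delta> = \<Delta>" using mx by blast
    then show ?thesis using p(2) by blast
  qed
  then show "\<Delta> \<subseteq> {p. route G p} \<and> M.max_clique (phi ` \<Delta>)" using c unfolding M.max_clique_def by blast
next
  assume m: "\<Delta> \<subseteq> {p. route G p} \<and> M.max_clique (phi ` \<Delta>)"
  then have "clique \<Gamma> \<Delta>" unfolding clique_iff M.max_clique_def by blast
  moreover have "\<Delta>' = \<Delta>" if c: "clique \<Gamma> \<Delta>'" "\<Delta> \<subseteq> \<Delta>'" for \<Delta>'
  proof
    show "\<Delta>' \<subseteq> \<Delta>"
    proof
      fix p assume p: "p \<in> \<Delta>'"
      have r: "route G p" "M.coherent_set (phi ` \<Delta>')" using c(1) p unfolding clique_iff by blast+
      have "\<forall>x \<in> phi ` \<Delta>. M.wcoh (phi p) x" using r(2) p c(2) unfolding M.coherent_set_def by blast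
      then have "phi p \<in> phi ` \<Delta>" using m phi_route[OF r(1)] unfolding M.max_clique_def by blast
      then obtain q where "q \<in> \<Delta>" "phi p = phi q" by blast
      then show "p \<in> \<Delta>" using phi_eq[OF r(1)] m by blast
    qed
  qed (rule c(2))
  ultimately show "\<Delta> \<in> max_cliques \<Gamma>" unfolding max_cliques_def by blast
qed

lemma max_cliques_bij: "bij_betw ((`) phi) (max_cliques \<Gamma>) {D. M.max_clique D}"
proof -
  have "max_cliques \<Gamma> = {\<Delta>. \<Delta> \<subseteq> {p. route G p} \<and> M.max_clique (phi ` \<Delta>)}" using max_cliques_iff by blast
  moreover have "D \<subseteq> {x. M.route x}" if "M.max_clique D" for D using that unfolding M.max_clique_def M.coherent_set_def by blast
  ultimately show ?thesis using bij_betw_image_Collect[OF phi_bij] by simp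
qed

lemma brick_cliques_iff: "B \<in> brick_cliques \<Gamma> \<longleftrightarrow> B \<subseteq> {b. brick \<Gamma> b} \<and> M.brick_clique (psi ` B)"
proof (cases "B \<subseteq> {b. brick \<Gamma> b}")
  case True
  have inj: "psi b = psi b' \<longleftrightarrow> b = b'" if "b \<in> B" "b' \<in> B" for b b'
    using psi_bij True that unfolding bij_betw_def inj_on_def by blast
  have "(\<forall>x \<in> B. \<forall>y \<in> B. x \<noteq> y \<longrightarrow> gp_coherent \<Gamma> x y) \<longleftrightarrow> (\<forall>x \<in> B. \<forall>y \<in> B. psi x \<noteq> psi y \<longrightarrow>
      M.wcoh (psi x) (psi y) \<and> hd (psi x) \<noteq> hd (psi y) \<and> last (psi x) \<noteq> last (psi y))"
  proof (intro ball_cong refl)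
    fix x y assume xy: "x \<in> B" "y \<in> B"
    then have r: "brick \<Gamma> x" "brick \<Gamma> y" using True by blast+
    show "(x \<noteq> y \<longrightarrow> gp_coherent \<Gamma> x y) \<longleftrightarrow> (psi x \<noteq> psi y \<longrightarrow>
      M.wcoh (psi x) (psi y) \<and> hd (psi x) \<noteq> hd (psi y) \<and> last (psi x) \<noteq> last (psi y))"
      unfolding gp_coherent_psi[OF r] inj[OF xy] ..
  qed
  moreover have "\<forall>b \<in> B. brick \<Gamma> b" "\<forall>b \<in> psi ` B. M.brick b" using True psi_brick by blast+
  ultimately show ?thesis unfolding brick_cliques_def M.brick_clique_def pairwise_def ball_simps using True by blast
next
  case False
  then show ?thesis unfolding brick_cliques_def by blast
qed

lemma brick_cliques_bij: "bij_betw ((`) psi) (brick_cliques \<Gamma>) {B. M.brick_clique B}"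
proof -
  have "brick_cliques \<Gamma> = {B. B \<subseteq> {b. brick \<Gamma> b} \<and> M.brick_clique (psi ` B)}" using brick_cliques_iff by blast
  moreover have "B \<subseteq> {x. M.brick x}" if "M.brick_clique B" for B using that unfolding M.brick_clique_def by blast
  ultimately show ?thesis using bij_betw_image_Collect[OF psi_bij] by simp
qed

end

section \<open>Comparison of labels\<close>

text \<open>The common ending \<open>s\<close> cannot reach back to \<open>x\<close> and
  \<open>x'\<close>, because these differ at the same distance from the end.\<close>

lemma common_suffix:
  assumes "p @ s = z @ x # a" "p' @ s = z' @ x' # a" "x \<noteq> x'"
  shows "\<exists>t. a = t @ s \<and> p = z @ x # t \<and> p' = z' @ x' # t"
proof (cases "length s \<le> length a")
  case True
  then obtain t t0 where t: "a = t @ t0" "length t0 = length s"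
    by (metis append_take_drop_id length_drop diff_diff_cancel)
  have "p @ s = (z @ x # t) @ t0" "p' @ s = (z' @ x' # t) @ t0" using assms(1,2) t(1) by simp_all
  then have "p = z @ x # t \<and> s = t0" "p' = z' @ x' # t \<and> s = t0"
    unfolding append_eq_append_conv[OF disjI2[OF t(2)[symmetric]]] .
  then show ?thesis using t(1) by blast
next
  case False
  then obtain s0 s1 where s: "s = s0 @ s1" "length s1 = length (x # a)"
    by (metis append_take_drop_id length_drop diff_diff_cancel not_less_eq_eq length_Cons)
  have l: "length s1 = length (x # a)" "length s1 = length (x' # a)" using s(2) by simp_all
  have "(p @ s0) @ s1 = z @ (x # a)" "(p' @ s0) @ s1 = z' @ (x' # a)" using assms(1,2) s(1) by simp_all
  then have "s1 = x # a" "s1 = x' # a"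
    unfolding append_eq_append_conv[OF disjI2[OF l(1)]] append_eq_append_conv[OF disjI2[OF l(2)]] by blast+
  then show ?thesis using assms(3) by simp
qed

lemma common_prefix:
  assumes "s @ p = a @ y # w" "s @ p' = a @ y' # w'" "y \<noteq> y'"
  shows "\<exists>t. a = s @ t \<and> p = t @ y # w \<and> p' = t @ y' # w'"
proof -
  have "rev p @ rev s = rev w @ y # rev a" "rev p' @ rev s = rev w' @ y' # rev a"
    using arg_cong[OF assms(1), of rev] arg_cong[OF assms(2), of rev] by simp_all
  from common_suffix[OF this assms(3)] obtain t where
    t: "rev a = t @ rev s" "rev p = rev w @ y # t" "rev p' = rev w' @ y' # t" by blast
  have "a = s @ rev t" "p = rev t @ y # w" "p' = rev t @ y' # w'"
    using arg_cong[OF t(1), of rev] arg_cong[OF t(2), of rev] arg_cong[OF t(3), of rev] by simp_all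
  then show ?thesis by blast
qed

context cornered begin

definition Up :: "'x list set \<Rightarrow> 'x list set" where
  "Up D = {b. \<exists>D1 r r'. cover D D1 r r' \<and> labels r r' b}"

text \<open>Negation turns every cover around and swaps the two routes of a label while it leaves
  bricks and brick cliques unchanged. Upward labels are thus downward labels of the negated
  graph.\<close>

lemma Up_bij: "bij_betw Up {D. max_clique D} {B. brick_clique B}"
proof -
  interpret ng: cornered E hv tv "\<lambda>x. - ki x" "\<lambda>x. - ko x" LC RC rk N by (rule negated)
  have max_clique: "ng.max_clique = max_clique" by (rule ext) (rule max_clique_neg)
  have brick_clique: "ng.brick_clique = brick_clique" by (rule ext) (simp only: brick_clique_def ng.brick_clique_def wcoh_neg)
  have cov: "ng.cover D0 D r r' \<longleftrightarrow> cover D D0 r' r" for D0 D r r'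
    unfolding cover_def ng.cover_def max_clique by blast
  have between: "ng.between (\<lambda>x. - k x) X P X' \<longleftrightarrow> between k X' P X" for k :: "'x \<Rightarrow> int" and X P X'
    unfolding between_def ng.between_def neg_less_iff_less by blast
  have labels: "ng.labels r r' b \<longleftrightarrow> labels r' r b" for r r' b
    unfolding labels_def ng.labels_def between by blast
  have "ng.Down = Up" by (rule ext) (unfold Up_def ng.Down_def cov labels, blast)
  then show ?thesis using ng.Down_bij unfolding max_clique brick_clique by simp
qed

end

section \<open>Maximal common subpaths and the corners at their ends\<close>

context framed begin

lemma decomposes_dpath:
  assumes "is_dpath G r" "decomposes G r p1 s p2"
  shows "is_dpath G s" "D.awalk (end_vertex G s) p2 (end_vertex G r)"
proof -
  have a: "path_arcs r = p1 @ path_arcs s @ p2" "D.awalk (start r) p1 (start s)"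
    using assms(2) unfolding decomposes_def by blast+
  have "D.awalk (start r) (p1 @ path_arcs s @ p2) (end_vertex G r)" using assms(1) a(1) unfolding is_dpath_def by simp
  then obtain u w where u: "D.awalk (start r) p1 u" "D.awalk u (path_arcs s) w" "D.awalk w p2 (end_vertex G r)"
    unfolding walk_append by blast
  have "u = start s" using walk_end[OF u(1) a(2)] .
  then have s: "D.awalk (start s) (path_arcs s) w" using u(2) by simp
  then have e: "end_vertex G s = w" unfolding end_vertex_def by auto
  show "is_dpath G s" unfolding is_dpath_def e by (rule s)
  show "D.awalk (end_vertex G s) p2 (end_vertex G r)" unfolding e by (rule u(3))
qed

lemma decomposes_at:
  assumes "is_dpath G r" "decomposes G r p1 s p2" "v \<in> pverts G s"
  shows "v \<in> pverts G r" "prefix_to G v r = p1 @ prefix_to G v s" "suffix_from G v r = suffix_from G v s @ p2"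
proof -
  note d = decomposes_dpath[OF assms(1,2)]
  have a: "path_arcs r = p1 @ path_arcs s @ p2" "D.awalk (start r) p1 (start s)"
    using assms(2) unfolding decomposes_def by blast+
  note s = dpath_split[OF d(1) assms(3)]
  have e: "path_arcs r = (p1 @ prefix_to G v s) @ (suffix_from G v s @ p2)"
    using a(1) prefix_suffix[of v s] by simp
  have w: "D.awalk (start r) (p1 @ prefix_to G v s) v" unfolding walk_append using a(2) s(1) by blast
  have w': "D.awalk v (suffix_from G v s @ p2) (end_vertex G r)" unfolding walk_append using s(2) d(2) by blast
  show "v \<in> pverts G r" "prefix_to G v r = p1 @ prefix_to G v s" "suffix_from G v r = suffix_from G v s @ p2"
    using split_dpath[OF e w w'] by blast+
qed

lemma middle:
  assumes r: "is_dpath G r" and v: "v \<in> pverts G r" and p: "prefix_to G v r = z @ x # a" and q: "suffix_from G v r = b @ y # w"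
  shows "decomposes G r (z @ [x]) (DPath (head G x) (a @ b)) (y # w)" "v \<in> pverts G (DPath (head G x) (a @ b))"
    "prefix_to G v (DPath (head G x) (a @ b)) = a" "suffix_from G v (DPath (head G x) (a @ b)) = b"
    "D.awalk (head G x) a v" "end_vertex G (DPath (head G x) (a @ b)) = tail G y" "x \<in> arcs G" "y \<in> arcs G"
proof -
  note s = dpath_split[OF r v]
  obtain u where u: "D.awalk (start r) z u" "x \<in> arcs G" "u = tail G x" "D.awalk (head G x) a v"
    using s(1) unfolding p walk_append walk_Cons by blast
  obtain u' where u': "D.awalk v b u'" "y \<in> arcs G" "u' = tail G y"
    using s(2) unfolding q walk_append walk_Cons by blast
  show "D.awalk (head G x) a v" "x \<in> arcs G" "y \<in> arcs G" using u u' by blast+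
  have "D.awalk (start r) (z @ [x]) (head G x)" unfolding walk_append walk_Cons walk_Nil
    using u D.head_in_verts[OF u(2)] by blast
  moreover have "path_arcs r = (z @ [x]) @ (a @ b) @ (y # w)" using prefix_suffix[of v r] p q by simp
  ultimately show "decomposes G r (z @ [x]) (DPath (head G x) (a @ b)) (y # w)" unfolding decomposes_def by simp
  have 1: "path_arcs (DPath (head G x) (a @ b)) = a @ b" "D.awalk (start (DPath (head G x) (a @ b))) a v"
    using u(4) by simp_all
  show "v \<in> pverts G (DPath (head G x) (a @ b))" "prefix_to G v (DPath (head G x) (a @ b)) = a"
    "suffix_from G v (DPath (head G x) (a @ b)) = b" "end_vertex G (DPath (head G x) (a @ b)) = tail G y"
    using split_dpath[OF 1 u'(1)] u'(3) by simp_all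
qed

text \<open>A common subpath through \<open>v\<close> cannot extend past the arcs at which the two
  paths differ, so it lies inside the piece between them. That piece is common itself and is
  therefore the only maximal one.\<close>

lemma max_common_iff:
  assumes r: "is_dpath G r" "v \<in> pverts G r" "prefix_to G v r = z @ x # a" "suffix_from G v r = b @ y # w"
    and r': "is_dpath G r'" "v \<in> pverts G r'" "prefix_to G v r' = z' @ x' # a" "suffix_from G v r' = b @ y' # w'"
    and ne: "x \<noteq> x'" "y \<noteq> y'"
  shows "max_common_subpath G v r r' s \<longleftrightarrow> s = DPath (head G x) (a @ b)"
proof -
  let ?s = "DPath (head G x) (a @ b)"
  note m = middle[OF r] and m' = middle[OF r']
  have hx: "head G x' = head G x" using walk_start[OF m(5) m'(5)] by simp
  have sub: "subpath G ?s r" "subpath G ?s r'" using m(1) m'(1) unfolding subpath_def hx by blast+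
  have both: "\<exists>t t' p1 p2. a = t @ prefix_to G v u \<and> b = suffix_from G v u @ t' \<and> p1 = z @ x # t \<and>
      decomposes G r p1 u p2"
    if u: "subpath G u r" "subpath G u r'" "v \<in> pverts G u" for u
  proof -
    obtain p1 p2 where p: "decomposes G r p1 u p2" using u(1) unfolding subpath_def by blast
    obtain p1' p2' where p': "decomposes G r' p1' u p2'" using u(2) unfolding subpath_def by blast
    have e: "p1 @ prefix_to G v u = z @ x # a" "suffix_from G v u @ p2 = b @ y # w"
      using decomposes_at[OF r(1) p u(3)] r(3,4) by simp_all
    have e': "p1' @ prefix_to G v u = z' @ x' # a" "suffix_from G v u @ p2' = b @ y' # w'"
      using decomposes_at[OF r'(1) p' u(3)] r'(3,4) by simp_all
    show ?thesis using common_suffix[OF e(1) e'(1) ne(1)] common_prefix[OF e(2) e'(2) ne(2)] p by blast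
  qed
  show ?thesis
  proof
    assume "max_common_subpath G v r r' s"
    then have s: "subpath G s r" "subpath G s r'" "v \<in> pverts G s"
      and mx: "\<And>t. subpath G t r \<Longrightarrow> subpath G t r' \<Longrightarrow> subpath G s t \<Longrightarrow> t = s"
      unfolding max_common_subpath_def by blast+
    obtain t t' p2 where t: "a = t @ prefix_to G v s" "b = suffix_from G v s @ t'" "decomposes G r (z @ x # t) s p2"
      using both[OF s] by blast
    have "D.awalk (start r) (z @ x # t) (start s)" using t(3) unfolding decomposes_def by blast
    then have "D.awalk (head G x) t (start s)" unfolding walk_append walk_Cons by blast
    moreover have "a @ b = t @ path_arcs s @ t'" using t(1,2) prefix_suffix[of v s] by simp
    ultimately have "decomposes G ?s t s t'" unfolding decomposes_def by simp
    then have "subpath G s ?s" unfolding subpath_def by blast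
    then show "s = ?s" using mx[OF sub] by simp
  next
    assume s: "s = ?s"
    have "t = ?s" if t: "subpath G t r" "subpath G t r'" "subpath G ?s t" for t
    proof -
      obtain q1 q2 where q: "decomposes G r q1 t q2" using t(1) unfolding subpath_def by blast
      have dt: "is_dpath G t" using decomposes_dpath(1)[OF r(1) q] .
      obtain t1 t2 where d: "decomposes G t t1 ?s t2" using t(3) unfolding subpath_def by blast
      note da = decomposes_at[OF dt d m(2), unfolded m(3,4)]
      obtain u u' where u: "a = u @ prefix_to G v t" "b = suffix_from G v t @ u'" using both[OF t(1,2) da(1)] by blast
      \<comment> \<open>\<open>t\<close> contains the middle piece and is contained in it, so
        nothing is left over on either side.\<close>
      have "length a = length u + length (prefix_to G v t)" using arg_cong[OF u(1), of length] by simp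
      moreover have "length (prefix_to G v t) = length t1 + length a" using arg_cong[OF da(2), of length] by simp
      ultimately have "t1 = []" by simp
      then have pa: "prefix_to G v t = a" using da(2) by simp
      have "length b = length u' + length (suffix_from G v t)" using arg_cong[OF u(2), of length] by simp
      moreover have "length (suffix_from G v t) = length t2 + length b" using arg_cong[OF da(3), of length] by simp
      ultimately have "t2 = []" by simp
      then have sb: "suffix_from G v t = b" using da(3) by simp
      have "path_arcs t = a @ b" using prefix_suffix[of v t] pa sb by simp
      moreover have "start t = head G x" using walk_start[OF dpath_split(1)[OF dt da(1)]] m(5) pa by simp
      ultimately show ?thesis by (intro dpath.expand) simp
    qed
    then show "max_common_subpath G v r r' s" unfolding max_common_subpath_def s using sub m(2) by blast
  qed
qed

lemma rev_map_split:
  assumes "rev (map XE p) = A @ x # Z"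
  obtains z e a where "p = z @ e # a" "A = rev (map XE a)" "x = XE e" "Z = rev (map XE z)"
proof -
  have "map XE p = rev Z @ x # rev A" using arg_cong[OF assms, of rev] by simp
  then obtain z e a where *: "p = z @ e # a" "rev Z = map XE z" "x = XE e" "rev A = map XE a"
    by (auto simp: map_eq_append_conv map_eq_Cons_conv)
  have "A = rev (map XE a)" "Z = rev (map XE z)" using *(2,4) by (simp_all add: rev_swap)
  then show ?thesis using that * by blast
qed

lemma map_split:
  assumes "map XE p = A @ x # Z"
  obtains z e a where "p = a @ e # z" "A = map XE a" "x = XE e" "Z = map XE z"
  using assms by (auto simp: map_eq_append_conv map_eq_Cons_conv)

text \<open>\<open>c\<close> stands for the one step known to lie between \<open>e\<close> and
  \<open>f\<close>. It is some corner, not yet known to be the one formed by \<open>e\<close> and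
  \<open>f\<close>; an arc in between would contradict \<open>nb\<close>.\<close>

lemma left_cornerI:
  assumes e: "e \<in> arcs G" "f \<in> arcs G" "head G e = v" "head G f = v" "v \<in> internal G" "xki (XE e) < xki (XE f)"
    and nb: "\<forall>y \<in> xE. xhv y = Some v \<longrightarrow> y = XL c \<or> xki y \<le> xki (XE e) \<or> xki (XE f) \<le> xki y"
  shows "left_corner \<Gamma> (Corner v e f)"
proof -
  have "(e, g) \<notin> in_order \<Gamma> v \<or> (g, f) \<notin> in_order \<Gamma> v" for g
  proof (rule ccontr)
    assume "\<not> ?thesis"
    then have g: "(e, g) \<in> in_order \<Gamma> v" "(g, f) \<in> in_order \<Gamma> v" by blast+
    have ga: "g \<in> arcs G" "head G g = v" using in_order_sub[OF e(5) g(1)] by blast+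
    have "xki (XE e) < xki (XE g)" using xki_E(1)[OF e(1) ga(1) e(3) ga(2) e(5)] g(1) by blast
    moreover have "xki (XE g) < xki (XE f)" using xki_E(1)[OF ga(1) e(2) ga(2) e(4,5)] g(2) by blast
    moreover have "XE g \<in> xE" "xhv (XE g) = Some v" using ga e(5) XE_in by auto
    ultimately show False using nb by (metis linorder_not_less xstep.distinct(1))
  qed
  moreover have "(e, f) \<in> in_order \<Gamma> v" using xki_E(1)[OF e(1-5)] e(6) by blast
  ultimately show ?thesis unfolding left_corner_def consecutive_def using e(5) by auto
qed

lemma right_cornerI:
  assumes e: "e \<in> arcs G" "f \<in> arcs G" "tail G e = v" "tail G f = v" "v \<in> internal G" "xko (XE e) < xko (XE f)"
    and nb: "\<forall>y \<in> xE. xtv y = Some v \<longrightarrow> y = XR c \<or> xko y \<le> xko (XE e) \<or> xko (XE f) \<le> xko y"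
  shows "right_corner \<Gamma> (Corner v e f)"
proof -
  have "(e, g) \<notin> out_order \<Gamma> v \<or> (g, f) \<notin> out_order \<Gamma> v" for g
  proof (rule ccontr)
    assume "\<not> ?thesis"
    then have g: "(e, g) \<in> out_order \<Gamma> v" "(g, f) \<in> out_order \<Gamma> v" by blast+
    have ga: "g \<in> arcs G" "tail G g = v" using out_order_sub[OF e(5) g(1)] by blast+
    have "xko (XE e) < xko (XE g)" using xko_E(1)[OF e(1) ga(1) e(3) ga(2) e(5)] g(1) by blast
    moreover have "xko (XE g) < xko (XE f)" using xko_E(1)[OF ga(1) e(2) ga(2) e(4,5)] g(2) by blast
    moreover have "XE g \<in> xE" "xtv (XE g) = Some v" using ga e(5) XE_in by auto
    ultimately show False using nb by (metis linorder_not_less xstep.distinct(3))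
  qed
  moreover have "(e, f) \<in> out_order \<Gamma> v" using xko_E(1)[OF e(1-5)] e(6) by blast
  ultimately show ?thesis unfolding right_corner_def consecutive_def using e(5) by auto
qed

lemma image_phi_diff:
  assumes "\<Delta> \<in> max_cliques \<Gamma>" "\<Delta>' \<in> max_cliques \<Gamma>"
  shows "phi ` \<Delta> - phi ` \<Delta>' = phi ` (\<Delta> - \<Delta>')"
proof -
  have s: "\<Delta> \<union> \<Delta>' \<subseteq> {p. route G p}" using assms unfolding max_cliques_iff by blast
  have "inj_on phi (\<Delta> \<union> \<Delta>')" using inj_on_subset[OF _ s] phi_bij unfolding bij_betw_def by blast
  then show ?thesis using inj_on_image_set_diff[of phi "\<Delta> \<union> \<Delta>'" \<Delta> \<Delta>'] by blast
qed

text \<open>A conflict by itself only provides two diverging arcs at each end of the common subpath.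
  That they are consecutive, and so form corners, comes from \<open>M.cover_corner\<close> and its
  mirror image, which rely on adjacency of the cliques.\<close>

lemma label_imp:
  assumes l: "cover_label \<Gamma> \<Delta> \<Delta>' b"
  shows "brick \<Gamma> b \<and> (\<exists>x x'. M.cover (phi ` \<Delta>) (phi ` \<Delta>') x x' \<and> M.labels x x' (psi b))"
proof -
  obtain r r' s r1 r2 r1' r2' where cv: "covers_via \<Gamma> \<Delta> \<Delta>' r r' s"
    and d: "decomposes G r r1 s r2" "decomposes G r' r1' s r2'"
    and b: "b = GPath (Some (Corner (start s) (last r1) (last r1'))) s
              (Some (Corner (end_vertex G s) (hd r2') (hd r2)))"
    using l unfolding cover_label_def by blast
  have c: "\<Delta> \<in> max_cliques \<Gamma>" "\<Delta>' \<in> max_cliques \<Gamma>" "\<Delta> - \<Delta>' = {r}" "\<Delta>' - \<Delta> = {r'}"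
    "subroute_of_conflict \<Gamma> r r' s" "\<forall>v\<in>pverts G s. route_clockwise \<Gamma> v r r'"
    using cv unfolding covers_via_def by blast+
  have "r \<in> \<Delta>" "r' \<in> \<Delta>'" using c(3,4) by blast+
  then have rr: "route G r" "route G r'" using c(1,2) unfolding max_cliques_iff by blast+
  have dr: "is_dpath G r" "is_dpath G r'" using rr unfolding route_def by blast+
  have cov: "M.cover (phi ` \<Delta>) (phi ` \<Delta>') (phi r) (phi r')"
    unfolding M.cover_def image_phi_diff[OF c(1,2)] image_phi_diff[OF c(2,1)] c(3,4)
    using c(1,2) unfolding max_cliques_iff by simp
  obtain v where v: "v \<in> internal G" "v \<in> pverts G r" "v \<in> pverts G r'" "max_common_subpath G v r r' s"
    using c(5) unfolding subroute_of_conflict_def incoherent_at_def by blast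
  have vs: "v \<in> pverts G s" using v(4) unfolding max_common_subpath_def by blast
  obtain X Y where X: "M.through (phi r) v X Y" using through_phi_ex[OF rr(1) v(1,2)] .
  obtain X' Y' where X': "M.through (phi r') v X' Y'" using through_phi_ex[OF rr(2) v(1,3)] .
  have lt: "lt xki X X'" "lt xko Y' Y" using clockwise_iff[OF rr(1) X rr(2) X'] c(6) vs by blast+
  have eX: "X = rev (map XE (prefix_to G v r))" "Y = map XE (suffix_from G v r)"
    "X' = rev (map XE (prefix_to G v r'))" "Y' = map XE (suffix_from G v r')"
    using X X' unfolding through_phi[OF rr(1)] through_phi[OF rr(2)] by blast+
  obtain A x Z x' Z' k where k: "X = A @ x # Z" "X' = A @ x' # Z'" "k \<in> xLC" "xhv k = xhv x" "xhv x' = xhv x"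
    "xki x < xki k" "xki k < xki x'" "\<forall>y \<in> xE. xhv y = xhv k \<longrightarrow> y = k \<or> xki y \<le> xki x \<or> xki x' \<le> xki y"
    using M.cover_corner[OF cov X X' lt] by metis
  obtain B y W y' W' h where h: "Y = B @ y # W" "Y' = B @ y' # W'" "h \<in> xRC" "xtv h = xtv y" "xtv y' = xtv y"
    "xko y' < xko h" "xko h < xko y" "\<forall>u \<in> xE. xtv u = xtv h \<longrightarrow> u = h \<or> xko u \<le> xko y' \<or> xko y \<le> xko u"
    using M.cover_corner_R[OF cov X X' lt] by metis
  obtain z e a where e: "prefix_to G v r = z @ e # a" "A = rev (map XE a)" "x = XE e"
    using rev_map_split eX(1) k(1) by metis
  obtain z' e' a' where e': "prefix_to G v r' = z' @ e' # a'" "A = rev (map XE a')" "x' = XE e'"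
    using rev_map_split eX(3) k(2) by metis
  have "a' = a" using e(2) e'(2) by simp
  obtain w f g where f: "suffix_from G v r = g @ f # w" "B = map XE g" "y = XE f"
    using map_split eX(2) h(1) by metis
  obtain w' f' g' where f': "suffix_from G v r' = g' @ f' # w'" "B = map XE g'" "y' = XE f'"
    using map_split eX(4) h(2) by metis
  have "g' = g" using f(2) f'(2) by simp
  have ne: "e \<noteq> e'" "f \<noteq> f'" using k(6,7) h(6,7) e(3) e'(3) f(3) f'(3) by auto
  have s: "s = DPath (head G e) (a @ g)"
    using max_common_iff[OF dr(1) v(2) e(1) f(1) dr(2) v(3) _ _ ne] v(4) e'(1) f'(1) \<open>a' = a\<close> \<open>g' = g\<close> by simp
  note m = middle[OF dr(1) v(2) e(1) f(1), folded s]
  note m' = middle[OF dr(2) v(3) e'(1) f'(1)]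
  have r1: "r1 = z @ [e]" "r2 = f # w" using decomposes_at[OF dr(1) d(1) vs] e(1) f(1) m(3,4) by simp_all
  have r1': "r1' = z' @ [e']" "r2' = f' # w'"
    using decomposes_at[OF dr(2) d(2) vs] e'(1) f'(1) m(3,4) \<open>a' = a\<close> \<open>g' = g\<close> by simp_all
  let ?c = "Corner (head G e) e e'" and ?d = "Corner (end_vertex G s) f' f"
  have b': "b = GPath (Some ?c) s (Some ?d)" unfolding b r1 r1' s by simp
  obtain k' where k': "k = XL k'" "left_corner \<Gamma> k'" using k(3) unfolding xLC_def by blast
  obtain h' where h': "h = XR h'" "right_corner \<Gamma> h'" using h(3) unfolding xRC_def by blast
  have xe: "xhv (XE e) = Some (cvert k')" "xhv (XE e') = Some (cvert k')" using k(4,5) e(3) e'(3) k'(1) by simp_all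
  then have hi: "head G e \<in> internal G" "head G e' = head G e" "cvert k' = head G e" by (auto split: if_splits)
  have "left_corner \<Gamma> ?c"
  proof (rule left_cornerI[where c = k'])
    show "xki (XE e) < xki (XE e')" using k(6,7) e(3) e'(3) by simp
    show "\<forall>y \<in> xE. xhv y = Some (head G e) \<longrightarrow> y = XL k' \<or> xki y \<le> xki (XE e) \<or> xki (XE e') \<le> xki y"
      using k(8) unfolding k'(1) e(3) e'(3) using hi(3) by simp
  qed (use hi m(7) m'(7) in auto)
  have yf: "xtv (XE f) = Some (cvert h')" "xtv (XE f') = Some (cvert h')" using h(4,5) f(3) f'(3) h'(1) by simp_all
  then have ti: "tail G f \<in> internal G" "tail G f' = tail G f" "cvert h' = tail G f" by (auto split: if_splits)
  have "right_corner \<Gamma> ?d"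
  proof (rule right_cornerI[where c = h'])
    show "xko (XE f') < xko (XE f)" using h(6,7) f(3) f'(3) by simp
    show "\<forall>y \<in> xE. xtv y = Some (end_vertex G s) \<longrightarrow> y = XR h' \<or> xko y \<le> xko (XE f') \<or> xko (XE f) \<le> xko y"
      using h(8) unfolding h'(1) f(3) f'(3) m(6) using ti(3) by simp
  qed (use ti m(6,8) m'(8) in auto)
  have "is_dpath G s" using decomposes_dpath(1)[OF dr(1) d(1)] .
  then have br: "brick \<Gamma> b" unfolding b' brick_def generalized_path_def
    using \<open>left_corner \<Gamma> ?c\<close> \<open>right_corner \<Gamma> ?d\<close> s by simp
  have "M.through (psi b) v (rev (map XE a) @ [XL ?c]) (map XE g @ [XR ?d])"
    unfolding through_psi[OF br b'] using vs m(3,4) by simp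
  moreover have "M.between xki X (rev (map XE a) @ [XL ?c]) X'"
    unfolding M.between_def k(1,2) e(2,3) e'(3) using xki_lr[OF \<open>left_corner \<Gamma> ?c\<close>] by auto
  moreover have "M.between xko Y' (map XE g @ [XR ?d]) Y"
    unfolding M.between_def h(1,2) f(2,3) f'(3) using xko_lr[OF \<open>right_corner \<Gamma> ?d\<close>] by auto
  ultimately have "M.labels (phi r) (phi r') (psi b)"
    unfolding M.labels_def using psi_brick[OF br] X X' by blast
  then show ?thesis using br cov by blast
qed

text \<open>The abstract label only says that the corners of \<open>b\<close> separate the diverging
  arcs. By \<open>M.cover_L_between\<close> and \<open>M.cover_R_between\<close> these arcs are the
  neighbours of the corners, so they are the lower and upper arcs that the concrete label
  prescribes.\<close>

lemma label_conv:
  assumes m: "\<Delta> \<in> max_cliques \<Gamma>" "\<Delta>' \<in> max_cliques \<Gamma>" and b: "brick \<Gamma> b"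
    and cov: "M.cover (phi ` \<Delta>) (phi ` \<Delta>') x x'" and l: "M.labels x x' (psi b)"
  shows "cover_label \<Gamma> \<Delta> \<Delta>' b"
proof -
  have rt: "\<And>p. p \<in> \<Delta> \<union> \<Delta>' \<Longrightarrow> route G p" using m unfolding max_cliques_iff by blast
  have sing: "\<exists>r. A = {r} \<and> u = phi r" if w: "phi ` A = {u}" "A \<subseteq> \<Delta> \<union> \<Delta>'" for A u
  proof -
    obtain r where r: "r \<in> A" "phi r = u" using w(1) by blast
    have "q = r" if "q \<in> A" for q
      using phi_eq[OF rt rt, of q r] that r w by blast
    then show ?thesis using r by blast
  qed
  have df: "phi ` (\<Delta> - \<Delta>') = {x}" "phi ` (\<Delta>' - \<Delta>) = {x'}"
    using cov unfolding M.cover_def image_phi_diff[OF m] image_phi_diff[OF m(2,1)] by blast+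
  obtain r where r: "\<Delta> - \<Delta>' = {r}" "x = phi r" using sing[OF df(1)] by blast
  obtain r' where r': "\<Delta>' - \<Delta> = {r'}" "x' = phi r'" using sing[OF df(2)] by blast
  have "r \<in> \<Delta> \<union> \<Delta>'" "r' \<in> \<Delta> \<union> \<Delta>'" using r r' by blast+
  then have rr: "route G r" "route G r'" using rt by blast+
  have dr: "is_dpath G r" "is_dpath G r'" using rr unfolding route_def by blast+
  obtain v X Y X' Y' P Q where t: "M.through (phi r) v X Y" "M.through (phi r') v X' Y'" "M.through (psi b) v P Q"
    and bt: "M.between xki X P X'" "M.between xko Y' Q Y" using l unfolding M.labels_def r(2) r'(2) by blast
  obtain c s d where e: "b = GPath (Some c) s (Some d)" "left_corner \<Gamma> c" "right_corner \<Gamma> d" "is_dpath G s"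
    "cvert c = start s" "cvert d = end_vertex G s" using brickE[OF b] by metis
  have P: "v \<in> pverts G s" "P = rev (map XE (prefix_to G v s)) @ [XL c]" "Q = map XE (suffix_from G v s) @ [XR d]"
    using t(3) unfolding through_psi[OF b e(1)] by blast+
  have v: "v \<in> internal G" "v \<in> pverts G r" "v \<in> pverts G r'"
    and eX: "X = rev (map XE (prefix_to G v r))" "Y = map XE (suffix_from G v r)"
    "X' = rev (map XE (prefix_to G v r'))" "Y' = map XE (suffix_from G v r')"
    using t(1,2) unfolding through_phi[OF rr(1)] through_phi[OF rr(2)] by blast+
  define a where "a = prefix_to G v s"
  define g where "g = suffix_from G v s"
  obtain x0 x0' Z Z' where k: "X = rev (map XE a) @ x0 # Z" "X' = rev (map XE a) @ x0' # Z'"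
    "xki x0 < xki (XL c)" "xki (XL c) < xki x0'" using bt(1) unfolding M.between_def P(2) a_def[symmetric] by auto
  obtain y0 y0' W W' where h: "Y = map XE g @ y0 # W" "Y' = map XE g @ y0' # W'"
    "xko y0' < xko (XR d)" "xko (XR d) < xko y0" using bt(2) unfolding M.between_def P(3) g_def[symmetric] by auto
  obtain z ed a1 where ed: "prefix_to G v r = z @ ed # a1" "rev (map XE a) = rev (map XE a1)" "x0 = XE ed"
    using rev_map_split eX(1) k(1) by metis
  obtain z' eu a2 where eu: "prefix_to G v r' = z' @ eu # a2" "rev (map XE a) = rev (map XE a2)" "x0' = XE eu"
    using rev_map_split eX(3) k(2) by metis
  obtain w fu g1 where fu: "suffix_from G v r = g1 @ fu # w" "map XE g = map XE g1" "y0 = XE fu"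
    using map_split eX(2) h(1) by metis
  obtain w' fd g2 where fd: "suffix_from G v r' = g2 @ fd # w'" "map XE g = map XE g2" "y0' = XE fd"
    using map_split eX(4) h(2) by metis
  have pr: "prefix_to G v r = z @ ed # a" "suffix_from G v r = g @ fu # w"
    and pr': "prefix_to G v r' = z' @ eu # a" "suffix_from G v r' = g @ fd # w'"
    using ed eu fu fd by simp_all
  have kc: "xki (XE ed) < xki (XL c)" "xki (XL c) < xki (XE eu)" "xko (XE fd) < xko (XR d)" "xko (XR d) < xko (XE fu)"
    using k(3,4) h(3,4) ed(3) eu(3) fu(3) fd(3) by simp_all
  have ne: "ed \<noteq> eu" "fu \<noteq> fd" using kc by auto
  note mr = middle[OF dr(1) v(2) pr] and mr' = middle[OF dr(2) v(3) pr']
  have st: "start s = head G ed" using walk_start[OF dpath_split(1)[OF e(4) P(1)]] mr(5) unfolding a_def by simp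
  have st': "start s = head G eu" using walk_start[OF dpath_split(1)[OF e(4) P(1)]] mr'(5) unfolding a_def by simp
  have s: "s = DPath (head G ed) (a @ g)"
    using prefix_suffix[of v s] st unfolding a_def g_def by (intro dpath.expand) simp
  have s': "s = DPath (head G eu) (a @ g)" using s st st' by simp
  have mx: "max_common_subpath G v r r' s"
    using max_common_iff[OF dr(1) v(2) pr dr(2) v(3) pr' ne] s by simp
  have dec: "decomposes G r (z @ [ed]) s (fu # w)" "decomposes G r' (z' @ [eu]) s (fd # w')"
    using mr(1)[folded s] mr'(1)[folded s'] by blast+
  \<comment> \<open>The routes agree along the spine and differ right behind its two ends, so the
    comparison is the same at each of its vertices.\<close>
  have cw: "route_clockwise \<Gamma> u r r'" if u: "u \<in> pverts G s" for u
  proof -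
    obtain Pu Qu where "M.through (psi b) u Pu Qu" using through_psi_ex[OF b] u e(1) by auto
    then have ui: "u \<in> internal G" using M.through_hv xE_hv by metis
    note du = decomposes_at[OF dr(1) dec(1) u] and du' = decomposes_at[OF dr(2) dec(2) u]
    obtain Xu Yu where tu: "M.through (phi r) u Xu Yu" using through_phi_ex[OF rr(1) ui du(1)] .
    obtain Xu' Yu' where tu': "M.through (phi r') u Xu' Yu'" using through_phi_ex[OF rr(2) ui du'(1)] .
    have "Xu = rev (map XE (prefix_to G u r))" "Yu = map XE (suffix_from G u r)"
      "Xu' = rev (map XE (prefix_to G u r'))" "Yu' = map XE (suffix_from G u r')"
      using tu tu' unfolding through_phi[OF rr(1)] through_phi[OF rr(2)] by blast+
    then have "lt xki Xu Xu'" "lt xko Yu' Yu"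
      unfolding du(2,3) du'(2,3) using kc by (simp_all del: xki.simps xko.simps)
    then show ?thesis using clockwise_iff[OF rr(1) tu rr(2) tu'] by blast
  qed
  have "incoherent_at \<Gamma> v r r'" unfolding incoherent_at_def using v cw[OF P(1)] by blast
  then have cv: "covers_via \<Gamma> \<Delta> \<Delta>' r r' s"
    unfolding covers_via_def subroute_of_conflict_def using m r(1) r'(1) mx cw by blast
  have lt: "lt xki X X'" "lt xko Y' Y" using clockwise_iff[OF rr(1) t(1) rr(2) t(2)] cw[OF P(1)] by blast+
  have cov': "M.cover (phi ` \<Delta>) (phi ` \<Delta>') (phi r) (phi r')" using cov r(2) r'(2) by simp
  note ca = left_corner_arcs[OF e(2)] and da = right_corner_arcs[OF e(3)]
  have ci: "cvert c = head G ed" "head G ed \<in> internal G" "cvert c = head G eu" using e(5) st st' ca(1) by simp_all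
  have hvc: "xhv (XL c) = xhv (XE ed)" using ci by simp
  have nb: "\<forall>y \<in> xE. xhv y = xhv (XL c) \<longrightarrow> y = XL c \<or> xki y \<le> xki (XE ed) \<or> xki (XE eu) \<le> xki y"
    using M.cover_L_between[OF cov' t(1,2) lt k(1,2)[unfolded ed(3) eu(3)] _ hvc kc(1,2)] e(2) XL_iff(2) by metis
  have ev: "end_vertex G s = tail G fu" "end_vertex G s = tail G fd" using mr(6)[folded s] mr'(6)[folded s'] by simp_all
  have di: "cvert d = tail G fu" "tail G fu \<in> internal G" "cvert d = tail G fd" using e(6) ev da(1) by simp_all
  have tvd: "xtv (XR d) = xtv (XE fu)" using di by simp
  have nb': "\<forall>y \<in> xE. xtv y = xtv (XR d) \<longrightarrow> y = XR d \<or> xko y \<le> xko (XE fd) \<or> xko (XE fu) \<le> xko y"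
    using M.cover_R_between[OF cov' t(1,2) lt h(1,2)[unfolded fu(3) fd(3)] _ tvd kc(3,4)] e(3) XR_iff(2) by metis
  have mem: "XE (cdown c) \<in> xE" "XE (cup c) \<in> xE" "XE ed \<in> xE" "XE eu \<in> xE"
    "XE (cdown d) \<in> xE" "XE (cup d) \<in> xE" "XE fu \<in> xE" "XE fd \<in> xE"
    using ca da mr(7,8) mr'(7,8) XE_in by blast+
  have hh: "xhv (XE (cdown c)) = xhv (XL c)" "xhv (XE (cup c)) = xhv (XL c)" "xhv (XE ed) = Some (cvert c)" "xhv (XE eu) = Some (cvert c)"
    using ca ci by simp_all
  have tt: "xtv (XE (cdown d)) = xtv (XR d)" "xtv (XE (cup d)) = xtv (XR d)" "xtv (XE fu) = Some (cvert d)" "xtv (XE fd) = Some (cvert d)"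
    using da di by simp_all
  note cl = xki_lr[OF e(2)] and dl = xko_lr[OF e(3)]
  \<comment> \<open>Both arcs lie below the corner with no step in between, so each is at most the
    other. The same argument identifies the other three arcs.\<close>
  have "xki (XE (cdown c)) \<le> xki (XE ed)" using nb mem(1) hh(1) cl kc by fastforce
  moreover have "xki (XE ed) \<le> xki (XE (cdown c))"
    using xki_corner[OF e(2) refl mem(3) hh(3)] cl kc by fastforce
  ultimately have "cdown c = ed"
    using xki_E(2)[OF ca(2) mr(7) ca(4) ci(1)[symmetric] ca(1)] by (meson order.antisym)
  have "xki (XE eu) \<le> xki (XE (cup c))" using nb mem(2) hh(2) cl kc by fastforce
  moreover have "xki (XE (cup c)) \<le> xki (XE eu)"
    using xki_corner[OF e(2) refl mem(4) hh(4)] cl kc by fastforce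
  ultimately have "cup c = eu"
    using xki_E(2)[OF ca(3) mr'(7) ca(5) ci(3)[symmetric] ca(1)] by (meson order.antisym)
  have "xko (XE (cdown d)) \<le> xko (XE fd)" using nb' mem(5) tt(1) dl kc by fastforce
  moreover have "xko (XE fd) \<le> xko (XE (cdown d))"
    using xko_corner[OF e(3) refl mem(8) tt(4)] dl kc by fastforce
  ultimately have "cdown d = fd"
    using xko_E(2)[OF da(2) mr'(8) da(4) di(3)[symmetric] da(1)] by (meson order.antisym)
  have "xko (XE fu) \<le> xko (XE (cup d))" using nb' mem(6) tt(2) dl kc by fastforce
  moreover have "xko (XE (cup d)) \<le> xko (XE fu)"
    using xko_corner[OF e(3) refl mem(7) tt(3)] dl kc by fastforce
  ultimately have "cup d = fu"
    using xko_E(2)[OF da(3) mr(8) da(5) di(1)[symmetric] da(1)] by (meson order.antisym)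
  have "c = Corner (start s) (last (z @ [ed])) (last (z' @ [eu]))"
    using \<open>cdown c = ed\<close> \<open>cup c = eu\<close> e(5) by (cases c) simp
  moreover have "d = Corner (end_vertex G s) (hd (fd # w')) (hd (fu # w))"
    using \<open>cdown d = fd\<close> \<open>cup d = fu\<close> e(6) by (cases d) simp
  ultimately show ?thesis unfolding cover_label_def using cv dec e(1) by blast
qed

section \<open>Transfer of the bijections\<close>

lemma max_clique_preimage:
  assumes "M.max_clique D" obtains \<Delta> where "\<Delta> \<in> max_cliques \<Gamma>" "D = phi ` \<Delta>"
  using assms max_cliques_bij unfolding bij_betw_def by blast

lemma brick_preimage:
  assumes "M.brick x" obtains b where "brick \<Gamma> b" "x = psi b"
  using assms psi_bij unfolding bij_betw_def by blast

lemma psi_DownBricks: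
  assumes "\<Delta> \<in> max_cliques \<Gamma>"
  shows "psi ` DownBricks \<Gamma> \<Delta> = M.Down (phi ` \<Delta>)"
proof
  show "psi ` DownBricks \<Gamma> \<Delta> \<subseteq> M.Down (phi ` \<Delta>)"
    unfolding DownBricks_def M.Down_def using label_imp by blast
  show "M.Down (phi ` \<Delta>) \<subseteq> psi ` DownBricks \<Gamma> \<Delta>"
  proof
    fix y assume "y \<in> M.Down (phi ` \<Delta>)"
    then obtain D0 x x' where c: "M.cover D0 (phi ` \<Delta>) x x'" "M.labels x x' y" unfolding M.Down_def by blast
    then have "M.max_clique D0" "M.brick y" unfolding M.cover_def M.labels_def by blast+
    obtain \<Delta>0 where d: "\<Delta>0 \<in> max_cliques \<Gamma>" "D0 = phi ` \<Delta>0" using max_clique_preimage[OF \<open>M.max_clique D0\<close>] .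
    obtain b where b: "brick \<Gamma> b" "y = psi b" using brick_preimage[OF \<open>M.brick y\<close>] .
    have "cover_label \<Gamma> \<Delta>0 \<Delta> b" using label_conv[OF d(1) assms b(1)] c d(2) b(2) by blast
    then show "y \<in> psi ` DownBricks \<Gamma> \<Delta>" unfolding DownBricks_def using b(2) by blast
  qed
qed

lemma psi_UpBricks:
  assumes "\<Delta> \<in> max_cliques \<Gamma>"
  shows "psi ` UpBricks \<Gamma> \<Delta> = M.Up (phi ` \<Delta>)"
proof
  show "psi ` UpBricks \<Gamma> \<Delta> \<subseteq> M.Up (phi ` \<Delta>)"
    unfolding UpBricks_def M.Up_def using label_imp by blast
  show "M.Up (phi ` \<Delta>) \<subseteq> psi ` UpBricks \<Gamma> \<Delta>"
  proof
    fix y assume "y \<in> M.Up (phi ` \<Delta>)"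
    then obtain D1 x x' where c: "M.cover (phi ` \<Delta>) D1 x x'" "M.labels x x' y" unfolding M.Up_def by blast
    then have "M.max_clique D1" "M.brick y" unfolding M.cover_def M.labels_def by blast+
    obtain \<Delta>1 where d: "\<Delta>1 \<in> max_cliques \<Gamma>" "D1 = phi ` \<Delta>1" using max_clique_preimage[OF \<open>M.max_clique D1\<close>] .
    obtain b where b: "brick \<Gamma> b" "y = psi b" using brick_preimage[OF \<open>M.brick y\<close>] .
    have "cover_label \<Gamma> \<Delta> \<Delta>1 b" using label_conv[OF assms d(1) b(1)] c d(2) b(2) by blast
    then show "y \<in> psi ` UpBricks \<Gamma> \<Delta>" unfolding UpBricks_def using b(2) by blast
  qed
qed

text \<open>The image map of \<open>psi\<close> is a bijection on brick cliques, so it can be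
  cancelled on the left. The hypothesis \<open>br\<close> is what lets membership in
  \<open>brick_cliques\<close> be read off after applying \<open>psi\<close>.\<close>

lemma bij_transfer:
  assumes F: "bij_betw F {D. M.max_clique D} {B. M.brick_clique B}"
    and f: "\<And>\<Delta>. \<Delta> \<in> max_cliques \<Gamma> \<Longrightarrow> psi ` f \<Delta> = F (phi ` \<Delta>)"
    and br: "\<And>\<Delta>. f \<Delta> \<subseteq> {b. brick \<Gamma> b}"
  shows "bij_betw f (max_cliques \<Gamma>) (brick_cliques \<Gamma>)"
proof -
  have "bij_betw (F \<circ> (`) phi) (max_cliques \<Gamma>) {B. M.brick_clique B}"
    using bij_betw_trans[OF max_cliques_bij F] .
  moreover have "bij_betw (F \<circ> (`) phi) (max_cliques \<Gamma>) {B. M.brick_clique B} \<longleftrightarrow>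
      bij_betw ((`) psi \<circ> f) (max_cliques \<Gamma>) {B. M.brick_clique B}"
    by (rule bij_betw_cong) (simp add: f)
  ultimately have *: "bij_betw ((`) psi \<circ> f) (max_cliques \<Gamma>) {B. M.brick_clique B}" by blast
  have "f ` max_cliques \<Gamma> \<subseteq> brick_cliques \<Gamma>"
  proof (rule image_subsetI)
    fix \<Delta> assume "\<Delta> \<in> max_cliques \<Gamma>"
    then have "M.brick_clique (psi ` f \<Delta>)" using * unfolding bij_betw_def by auto
    then show "f \<Delta> \<in> brick_cliques \<Gamma>" unfolding brick_cliques_iff using br by blast
  qed
  then show ?thesis using bij_betw_comp_iff2[OF brick_cliques_bij] * by blast
qed

theorem bij_DownBricks_UpBricks:
  "bij_betw (DownBricks \<Gamma>) (max_cliques \<Gamma>) (brick_cliques \<Gamma>) \<and>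
   bij_betw (UpBricks \<Gamma>) (max_cliques \<Gamma>) (brick_cliques \<Gamma>)"
proof
  show "bij_betw (DownBricks \<Gamma>) (max_cliques \<Gamma>) (brick_cliques \<Gamma>)"
    by (rule bij_transfer[OF M.Down_bij psi_DownBricks]) (use label_imp in \<open>auto simp: DownBricks_def\<close>)
  show "bij_betw (UpBricks \<Gamma>) (max_cliques \<Gamma>) (brick_cliques \<Gamma>)"
    by (rule bij_transfer[OF M.Up_bij psi_UpBricks]) (use label_imp in \<open>auto simp: UpBricks_def\<close>)
qed

end

theorem theorem3p3:
  fixes n :: nat and \<Gamma> :: "'e framed_graph"
  assumes "framed_graph n \<Gamma>"
  shows "bij_betw (DownBricks \<Gamma>) (max_cliques \<Gamma>) (brick_cliques \<Gamma>) \<and>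
         bij_betw (UpBricks \<Gamma>) (max_cliques \<Gamma>) (brick_cliques \<Gamma>)"
proof -
  interpret framed n \<Gamma> by unfold_locales (rule assms)
  show ?thesis by (rule bij_DownBricks_UpBricks)
qed

end
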